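(* Let $\omega\in\mathbb R^d$ be nonresonant, let $\mathcal S:\mathbb T^d\to\mathbb R$ be smooth, put $\Sigma=\{\theta\in\mathbb T^d:\mathcal S(\theta)=0\}$, and assume $\nabla\mathcal S(\theta)\ne0$ for all $\theta\in\Sigma$. Assume that the tangency set $\mathcal C=\{\theta\in\Sigma:D_\omega\mathcal S(\theta)=0\}$ is finite, $\mathcal C=\{\theta^{(1)},\dots,\theta^{(M)}\}$, and that for each $j$ there is an integer $r_j\ge2$ with $$D_\omega^\ell\mathcal S(\theta^{(j)})=0\ \ (1\le\ell<r_j),\qquad D_\omega^{r_j}\mathcal S(\theta^{(j)})\neq0.$$ Let $q(x)=\mathcal S(x\omega)$ and $N_{\mathcal S,\omega}(L)=\#\{x\in[0,L]:q(x)=0\}$ (distinct zeros, without multiplicity). Then $\rho_{\mathcal S,\omega}=\lim_{L\to\infty}N_{\mathcal S,\omega}(L)/L$ exists and $$\rho_{\mathcal S,\omega}=\frac1{(2\pi)^d}\int_{\mathbb T^d}\delta_0(\mathcal S(\theta))|D_\omega\mathcal S(\theta)|\,d\theta=\frac1{(2\pi)^d}\int_\Sigma\frac{|D_\omega\mathcal S(\theta)|}{|\nabla\mathcal S(\theta)|}\,d\sigma(\theta).$$ Moreover, if $\Sigma\neq\varnothing$ and $0<x_1<x_2<\cdots$ denote the positive zeros of $q$, $\Theta_n=x_n\omega\pmod{2\pi}$, then the empirical measures $\mu_N=\frac1N\sum_{n=1}^N\delta_{\Theta_n}$ converge weakly in $\mathcal P(\Sigma)$, as $N\to\infty$, to the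 probability measure $$d\mu_{\mathcal S,\omega}(\theta)=\frac1{(2\pi)^d\rho_{\mathcal S,\omega}}\frac{|D_\omega\mathcal S(\theta)|}{|\nabla\mathcal S(\theta)|}\,d\sigma(\theta).$$
   Context: $\mathbb T^d=\mathbb R^d/(2\pi\mathbb Z)^d$. Nonresonant: $\omega\cdot\ell\neq0$ for all $\ell\in\mathbb Z^d\setminus\{0\}$. $D_\omega=\omega\cdot\nabla_\theta$. $\sigma$ is the surface ($(d-1)$-dimensional Hausdorff) measure on $\Sigma$; $\mathcal P(\Sigma)$ is the set of Borel probability measures on $\Sigma$. The integral with the Dirac mass $\delta_0$ is understood as $\lim_{\eta\to0}\int_{\mathbb T^d}\chi_\eta(\mathcal S(\theta))|D_\omega\mathcal S(\theta)|\,d\theta$, where $\chi_\eta(s)=\eta^{-1}\chi(s/\eta)$, $\chi\in C_c^\infty((-1,1))$, $\chi\ge0$, $\int\chi=1$. *)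

theory Defs
  imports "HOL-Probability.Probability"
begin

section \<open>The torus\<close>

definition torus_rel :: "real ^ 'n \<Rightarrow> real ^ 'n \<Rightarrow> bool" where
  "torus_rel x y \<longleftrightarrow> (\<exists>k :: int ^ 'n. \<forall>i. y $ i = x $ i + 2 * pi * of_int (k $ i))"

lemma equivp_torus_rel: "equivp torus_rel"
proof (rule equivpI)
  show "reflp torus_rel"
    unfolding reflp_def torus_rel_def by (auto intro: exI[of _ 0])
  show "symp torus_rel"
    unfolding symp_def torus_rel_def
  proof (intro allI impI)
    fix x y :: "real ^ 'n"
    assume "\<exists>k :: int ^ 'n. \<forall>i. y $ i = x $ i + 2 * pi * of_int (k $ i)"
    then obtain k :: "int ^ 'n" where "\<forall>i. y $ i = x $ i + 2 * pi * of_int (k $ i)" by blast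
    then show "\<exists>k :: int ^ 'n. \<forall>i. x $ i = y $ i + 2 * pi * of_int (k $ i)"
      by (intro exI[of _ "- k"]) simp
  qed
  show "transp torus_rel"
    unfolding transp_def torus_rel_def
  proof (intro allI impI)
    fix x y z :: "real ^ 'n"
    assume "\<exists>k :: int ^ 'n. \<forall>i. y $ i = x $ i + 2 * pi * of_int (k $ i)"
      and "\<exists>k :: int ^ 'n. \<forall>i. z $ i = y $ i + 2 * pi * of_int (k $ i)"
    then obtain k l :: "int ^ 'n" where "\<forall>i. y $ i = x $ i + 2 * pi * of_int (k $ i)"
      and "\<forall>i. z $ i = y $ i + 2 * pi * of_int (l $ i)" by blast
    then show "\<exists>k :: int ^ 'n. \<forall>i. z $ i = x $ i + 2 * pi * of_int (k $ i)"
      by (intro exI[of _ "k + l"]) (simp add: algebra_simps)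
  qed
qed

quotient_type 'n torus = "real ^ 'n::finite" / torus_rel
  by (rule equivp_torus_rel)

lemma abs_torus_eq_iff:
  "abs_torus x = abs_torus y \<longleftrightarrow> (\<exists>k :: int ^ 'n. y = x + (2 * pi) *\<^sub>R (\<chi> i. of_int (k $ i)))"
  for x y :: "real ^ 'n::finite"
  by (simp add: torus.abs_eq_iff torus_rel_def vec_eq_iff)

lemma abs_rep_torus [simp]: "abs_torus (rep_torus p) = p"
  by (rule Quotient_abs_rep[OF Quotient_torus])

lemma abs_torus_add_cong: "abs_torus x = abs_torus y \<Longrightarrow> abs_torus (x + v) = abs_torus (y + v)"
  by (auto simp: abs_torus_eq_iff algebra_simps)

lemma closed_torus_fibre: "closed {z. abs_torus z = p}" for p :: "'n::finite torus"
proof -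
  have "{z. abs_torus z = p} =
    (\<Inter>i. (\<lambda>z. (z $ i - rep_torus p $ i) / (2 * pi)) -` \<int>)" (is "_ = ?R")
  proof (intro set_eqI iffI)
    fix z assume "z \<in> {z. abs_torus z = p}"
    then have "abs_torus (rep_torus p) = abs_torus z" by simp
    then obtain k :: "int ^ 'n" where "z = rep_torus p + (2 * pi) *\<^sub>R (\<chi> i. of_int (k $ i))"
      unfolding abs_torus_eq_iff by blast
    then show "z \<in> ?R" by simp
  next
    fix z assume "z \<in> ?R"
    then have "\<forall>i. \<exists>k::int. (z $ i - rep_torus p $ i) / (2 * pi) = of_int k"
      by (auto elim!: Ints_cases)
    then obtain k :: "'n \<Rightarrow> int" where k: "\<And>i. (z $ i - rep_torus p $ i) / (2 * pi) = of_int (k i)"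
      by metis
    have "z = rep_torus p + (2 * pi) *\<^sub>R (\<chi> i. of_int ((\<chi> i. k i) $ i))"
      using k by (simp add: vec_eq_iff field_simps)
    then have "abs_torus (rep_torus p) = abs_torus z"
      unfolding abs_torus_eq_iff by blast
    then show "z \<in> {z. abs_torus z = p}" by simp
  qed
  moreover have "closed ?R"
    by (intro closed_INT ballI closed_vimage closed_Ints continuous_intros) auto
  ultimately show ?thesis by simp
qed

text \<open>The flat quotient metric: the Euclidean distance of two cosets of \<open>(2\<pi>\<int>)\<^sup>n\<close>.\<close>

instantiation torus :: (finite) metric_space
begin

definition dist_torus :: "'a torus \<Rightarrow> 'a torus \<Rightarrow> real" where
  "dist_torus p q = setdist {x. abs_torus x = p} {y. abs_torus y = q}"

definition uniformity_torus :: "('a torus \<times> 'a torus) filter" where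
  "uniformity_torus = (INF e\<in>{0 <..}. principal {(x, y). dist x y < e})"

definition open_torus :: "'a torus set \<Rightarrow> bool" where
  "open_torus U \<longleftrightarrow> (\<forall>x\<in>U. \<forall>\<^sub>F (x', y) in uniformity. x' = x \<longrightarrow> y \<in> U)"

lemma dist_abs_torus:
  "dist (abs_torus x) q = setdist {x} {y. abs_torus y = q}" for x :: "real ^ 'a"
proof (rule antisym)
  show "dist (abs_torus x) q \<le> setdist {x} {y. abs_torus y = q}"
    unfolding dist_torus_def by (rule setdist_le_sing) simp
  have ne: "{y. abs_torus y = q} \<noteq> {}"
    using abs_rep_torus[of q] by blast
  show "setdist {x} {y. abs_torus y = q} \<le> dist (abs_torus x) q"
    unfolding dist_torus_def
  proof (rule le_setdistI)
    show "{x'. abs_torus x' = abs_torus x} \<noteq> {}" "{y. abs_torus y = q} \<noteq> {}"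
      using ne by blast+
    fix u v assume u: "u \<in> {x'. abs_torus x' = abs_torus x}" and v: "v \<in> {y. abs_torus y = q}"
    have "abs_torus (v + (x - u)) = abs_torus v"
    proof -
      have "abs_torus (u + (v - u)) = abs_torus (x + (v - u))"
        by (rule abs_torus_add_cong) (use u in simp)
      then show ?thesis by (simp add: algebra_simps)
    qed
    then have "setdist {x} {y. abs_torus y = q} \<le> dist x (v + (x - u))"
      using v by (intro setdist_le_dist) auto
    also have "\<dots> = dist u v" by (simp add: dist_norm norm_minus_commute)
    finally show "setdist {x} {y. abs_torus y = q} \<le> dist u v" .
  qed
qed

instance
proof
  fix p q r :: "'a torus"
  show "dist p q = 0 \<longleftrightarrow> p = q"
  proof -
    have "dist p q = setdist {rep_torus p} {y. abs_torus y = q}"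
      using dist_abs_torus[of "rep_torus p" q] by simp
    also have "\<dots> = 0 \<longleftrightarrow> p = q"
      using setdist_eq_0_closed[OF closed_torus_fibre[of q], of "rep_torus p"] abs_rep_torus[of q]
      by (auto simp del: abs_rep_torus) (auto simp: Collect_empty_eq)
    finally show ?thesis .
  qed
  show "dist p q \<le> dist p r + dist q r"
  proof -
    have "dist p q \<le> dist (rep_torus r) z + setdist {rep_torus r} {y. abs_torus y = q}"
      if "abs_torus z = p" for z
    proof -
      have "dist p q = setdist {z} {y. abs_torus y = q}"
        using dist_abs_torus[of z q] that by simp
      also have "\<dots> \<le> dist z (rep_torus r) + setdist {rep_torus r} {y. abs_torus y = q}"
        using setdist_triangle[of "{z}" "{y. abs_torus y = q}" "rep_torus r"] by simp
      finally show ?thesis by (simp add: dist_commute)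
    qed
    then have "dist p q - setdist {rep_torus r} {y. abs_torus y = q}
        \<le> setdist {rep_torus r} {z. abs_torus z = p}"
      using abs_rep_torus[of p] by (intro le_setdistI) (force simp del: abs_rep_torus)+
    also have "\<dots> = dist p r"
      using dist_abs_torus[of "rep_torus r" p] by (simp add: dist_torus_def setdist_sym)
    finally show ?thesis
      using dist_abs_torus[of "rep_torus r" q] by (simp add: dist_torus_def setdist_sym)
  qed
qed (rule uniformity_torus_def open_torus_def)+

end

lemma continuous_abs_torus: "continuous_on UNIV (abs_torus :: real ^ 'n::finite \<Rightarrow> 'n torus)"
proof -
  have "dist (abs_torus x) (abs_torus y) \<le> dist x y" for x y :: "real ^ 'n"
    unfolding dist_torus_def by (rule setdist_le_dist) auto
  then show ?thesis
    by (auto simp: continuous_on_iff intro: le_less_trans)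
qed

text \<open>Lebesgue measure \<open>d\<theta>\<close> on the torus, of total mass \<open>(2\<pi>)\<^sup>n\<close>.\<close>

definition torus_lebesgue :: "'n::finite torus measure" where
  "torus_lebesgue =
     distr (restrict_space lborel {x :: real ^ 'n. \<forall>i. 0 \<le> x $ i \<and> x $ i < 2 * pi}) borel abs_torus"


section \<open>Smooth functions and derivatives\<close>

definition partial_deriv :: "'a::euclidean_space \<Rightarrow> ('a \<Rightarrow> real) \<Rightarrow> 'a \<Rightarrow> real" where
  "partial_deriv b f x = deriv (\<lambda>t. f (x + t *\<^sub>R b)) 0"

definition grad :: "('a::euclidean_space \<Rightarrow> real) \<Rightarrow> 'a \<Rightarrow> 'a" where
  "grad f x = (\<Sum>b\<in>Basis. partial_deriv b f x *\<^sub>R b)"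

primrec cont_diff :: "nat \<Rightarrow> ('a::euclidean_space \<Rightarrow> real) \<Rightarrow> bool" where
  "cont_diff 0 f \<longleftrightarrow> continuous_on UNIV f"
| "cont_diff (Suc k) f \<longleftrightarrow>
     (\<forall>x. f differentiable (at x)) \<and> (\<forall>b\<in>Basis. cont_diff k (partial_deriv b f))"

definition smooth :: "('a::euclidean_space \<Rightarrow> real) \<Rightarrow> bool" where
  "smooth f \<longleftrightarrow> (\<forall>k. cont_diff k f)"

definition torus_smooth :: "('n::finite torus \<Rightarrow> real) \<Rightarrow> bool" where
  "torus_smooth S \<longleftrightarrow> smooth (S \<circ> abs_torus)"

definition torus_grad :: "('n::finite torus \<Rightarrow> real) \<Rightarrow> 'n torus \<Rightarrow> real ^ 'n" where
  "torus_grad S \<theta> = grad (S \<circ> abs_torus) (rep_torus \<theta>)"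

text \<open>The gradient does not depend on the chosen representative.\<close>

lemma torus_grad_abs: "torus_grad S (abs_torus x) = grad (S \<circ> abs_torus) x"
proof -
  have "abs_torus (rep_torus (abs_torus x) + v) = abs_torus (x + v)" for v
    by (rule abs_torus_add_cong) simp
  then show ?thesis
    by (simp add: torus_grad_def grad_def partial_deriv_def)
qed

definition D_op :: "real ^ 'n \<Rightarrow> ('n::finite torus \<Rightarrow> real) \<Rightarrow> 'n torus \<Rightarrow> real" where
  "D_op \<omega> S \<theta> = \<omega> \<bullet> torus_grad S \<theta>"

definition nonresonant :: "real ^ 'n::finite \<Rightarrow> bool" where
  "nonresonant \<omega> \<longleftrightarrow> (\<forall>l :: int ^ 'n. l \<noteq> 0 \<longrightarrow> \<omega> \<bullet> (\<chi> i. of_int (l $ i)) \<noteq> 0)"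

text \<open>The nonnegative functions in \<open>C\<^sub>c\<^sup>\<infinity>((-1,1))\<close> of integral one.\<close>

definition mollifier :: "(real \<Rightarrow> real) \<Rightarrow> bool" where
  "mollifier \<phi> \<longleftrightarrow> smooth \<phi> \<and> closure {s. \<phi> s \<noteq> 0} \<subseteq> {-1<..<1} \<and> (\<forall>s. 0 \<le> \<phi> s)
     \<and> (LINT s|lborel. \<phi> s) = 1"


section \<open>Hausdorff measure\<close>

text \<open>
  The \<open>k\<close>-dimensional Hausdorff measure for integer \<open>k\<close>, with the usual normalisation (a set of
  diameter \<open>r\<close> is weighted by the volume of the \<open>k\<close>-dimensional ball of diameter \<open>r\<close>) under which it
  coincides with \<open>k\<close>-dimensional surface area; for \<open>k = 0\<close> it is the counting measure.
  Since \<^const>\<open>diameter\<close> is a junk value on unbounded sets, coverings use bounded sets only.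
\<close>

definition hausdorff_weight :: "nat \<Rightarrow> 'a::metric_space set \<Rightarrow> ennreal" where
  "hausdorff_weight k U =
     (if U = {} then 0 else ennreal (unit_ball_vol (real k) * (diameter U / 2) ^ k))"

definition hausdorff_pre :: "nat \<Rightarrow> real \<Rightarrow> 'a::metric_space set \<Rightarrow> ennreal" where
  "hausdorff_pre k \<delta> A =
     (INF U \<in> {U :: nat \<Rightarrow> 'a set. A \<subseteq> (\<Union>i. U i) \<and> (\<forall>i. bounded (U i) \<and> diameter (U i) \<le> \<delta>)}.
        \<Sum>i. hausdorff_weight k (U i))"

definition hausdorff_outer :: "nat \<Rightarrow> 'a::metric_space set \<Rightarrow> ennreal" where
  "hausdorff_outer k A = (SUP \<delta> \<in> {0<..}. hausdorff_pre k \<delta> A)"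

definition hausdorff_measure :: "nat \<Rightarrow> 'a::metric_space measure" where
  "hausdorff_measure k = measure_of UNIV (sets borel) (hausdorff_outer k)"

definition surface_measure :: "'n::finite torus set \<Rightarrow> 'n torus measure" where
  "surface_measure \<Sigma> = restrict_space (hausdorff_measure (CARD('n) - 1)) \<Sigma>"


section \<open>Probability measures on a subset and weak convergence\<close>

definition prob_measures_on :: "'a::topological_space set \<Rightarrow> 'a measure set" where
  "prob_measures_on \<Sigma> = {M. prob_space M \<and> space M = \<Sigma> \<and> sets M = sets (restrict_space borel \<Sigma>)}"

definition weakly_converges_on ::
    "'a::topological_space set \<Rightarrow> (nat \<Rightarrow> 'a measure) \<Rightarrow> 'a measure \<Rightarrow> bool" where
  "weakly_converges_on \<Sigma> M \<mu> \<longleftrightarrow>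
     (\<forall>f :: 'a \<Rightarrow> real. continuous_on \<Sigma> f \<and> bounded (f ` \<Sigma>) \<longrightarrow>
        (\<lambda>N. LINT \<theta>|M N. f \<theta>) \<longlonglongrightarrow> (LINT \<theta>|\<mu>. f \<theta>))"

text \<open>\<open>1/N \<Sum>\<^sub>n \<delta>(\<Theta>\<^sub>n)\<close> for \<open>n = 1, \<dots>, N\<close>, as a Borel measure on \<open>\<Sigma>\<close>; meaningful for \<open>N \<ge> 1\<close>.\<close>

definition empirical_measure :: "'a::topological_space set \<Rightarrow> (nat \<Rightarrow> 'a) \<Rightarrow> nat \<Rightarrow> 'a measure" where
  "empirical_measure \<Sigma> \<Theta> N = distr (uniform_count_measure {1..N}) (restrict_space borel \<Sigma>) \<Theta>"


section \<open>Zeros along the linear flow\<close>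

definition zero_set :: "('n::finite torus \<Rightarrow> real) \<Rightarrow> 'n torus set" where
  "zero_set S = {\<theta>. S \<theta> = 0}"

definition tangency_set :: "real ^ 'n \<Rightarrow> ('n::finite torus \<Rightarrow> real) \<Rightarrow> 'n torus set" where
  "tangency_set \<omega> S = {\<theta> \<in> zero_set S. D_op \<omega> S \<theta> = 0}"

definition orbit_fun :: "real ^ 'n \<Rightarrow> ('n::finite torus \<Rightarrow> real) \<Rightarrow> real \<Rightarrow> real" where
  "orbit_fun \<omega> S x = S (abs_torus (x *\<^sub>R \<omega>))"

definition zero_count :: "real ^ 'n \<Rightarrow> ('n::finite torus \<Rightarrow> real) \<Rightarrow> real \<Rightarrow> nat" where
  "zero_count \<omega> S L = card {x \<in> {0..L}. orbit_fun \<omega> S x = 0}"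

definition enumerates_pos_zeros :: "(real \<Rightarrow> real) \<Rightarrow> (nat \<Rightarrow> real) \<Rightarrow> bool" where
  "enumerates_pos_zeros q x \<longleftrightarrow> strict_mono_on {1..} x \<and> x ` {1..} = {t. 0 < t \<and> q t = 0}"

end

theory Submission
  imports Defs
begin

text \<open>
  Let \<open>N g x\<close> be the sum of \<open>g\<close> over the crossings of \<open>\<Sigma>\<close> by the orbit segment \<open>x + t \<omega>\<close>, \<open>0 \<le> t < h\<close>.
  The finite order of the tangencies bounds the number of crossings uniformly in \<open>x\<close>, and for continuous
  \<open>g\<close> the function \<open>N g\<close> is continuous at every \<open>x\<close> whose segment meets \<open>\<Sigma>\<close> transversally and not at
  its ends, hence almost everywhere. Weyl equidistribution, extended to bounded almost everywhere
  continuous functions, therefore shows that the sum of \<open>g\<close> over the zeros up to time \<open>L\<close>, divided by \<open>L\<close>, tends to the torus average of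
  \<open>N g / h\<close>. This average is a surface integral: \<open>N\<close> applied to the indicator of a small transversal
  patch of \<open>\<Sigma>\<close> integrates to the volume swept by the patch in time \<open>h\<close>, which up to a factor close to 1 is
  \<open>h |\<omega> \<cdot> \<nabla>S| / |\<nabla>S|\<close> times its Hausdorff measure; covering the transversal part of \<open>\<Sigma>\<close> by
  such patches gives equality, and the tangencies are negligible on both sides. The comparison rests
  on the identity of Hausdorff and Lebesgue measure in a hyperplane, hence on the isodiametric inequality.
\<close>

section \<open>Hausdorff measure\<close>

text \<open>Zeros are instants, whereas equidistribution speaks of functions on the torus. The
  window count mediates: integrating \<open>N g\<close> over starting times sees each zero for a
  time exactly h. Two conditions fix the window. It is so short that along it either S stays away
  from 0 or one derivative along the flow does not vanish, which bounds the count by Rolle's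
  theorem; and the flow moves by at most 1 during it, so that lattice translates of a small patch,
  shifted by at least 2 pi, are not met in one window. The same bound dominates the mollified count,
  which yields the formula with the Dirac mass, and it makes the weighted surface integral finite.
  The surface is never parametrised: a patch is compared with a hyperplane by projection along
  \<omega>, for which Lipschitz estimates suffice. Dimension one is treated apart: the zero set is
  discrete and there are no tangencies.\<close>

abbreviation covers :: "real \<Rightarrow> 'a::metric_space set \<Rightarrow> (nat \<Rightarrow> 'a set) set" where
  "covers \<delta> A \<equiv> {U. A \<subseteq> (\<Union>i. U i) \<and> (\<forall>i. bounded (U i) \<and> diameter (U i) \<le> \<delta>)}"

lemma hausdorff_weight_empty [simp]: "hausdorff_weight k {} = 0"
  by (simp add: hausdorff_weight_def)

lemma hausdorff_weight_mono:
  assumes "U \<subseteq> V" "bounded V"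
  shows "hausdorff_weight k U \<le> hausdorff_weight k V"
proof (cases "U = {}")
  case False
  have "diameter U \<le> diameter V" using assms by (rule diameter_subset)
  moreover have "0 \<le> diameter U"
    using assms bounded_subset diameter_ge_0 by blast
  ultimately show ?thesis
    using False assms unfolding hausdorff_weight_def
    by (auto intro!: ennreal_leI mult_left_mono power_mono)
qed simp

lemma hausdorff_pre_antimono: "\<delta> \<le> \<delta>' \<Longrightarrow> hausdorff_pre k \<delta>' A \<le> hausdorff_pre k \<delta> A"
  unfolding hausdorff_pre_def by (rule INF_superset_mono) (auto intro: order_trans)

lemma hausdorff_pre_mono: "A \<subseteq> B \<Longrightarrow> hausdorff_pre k \<delta> A \<le> hausdorff_pre k \<delta> B"
  unfolding hausdorff_pre_def by (rule INF_superset_mono) auto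

lemma hausdorff_outer_mono: "A \<subseteq> B \<Longrightarrow> hausdorff_outer k A \<le> hausdorff_outer k B"
  unfolding hausdorff_outer_def by (intro SUP_mono) (use hausdorff_pre_mono in blast)

lemma hausdorff_pre_le_cover:
  assumes "A \<subseteq> (\<Union>i. U i)" "\<And>i. bounded (U i)" "\<And>i. diameter (U i) \<le> \<delta>"
  shows "hausdorff_pre k \<delta> A \<le> (\<Sum>i. hausdorff_weight k (U i))"
  unfolding hausdorff_pre_def by (rule INF_lower) (use assms in auto)

text \<open>Indices outside the range are padded with the empty set: its weight is 0 even for k = 0,
  and \<open>0 \<le> \<delta>\<close> admits it in a cover of mesh \<delta>.\<close>

lemma hausdorff_pre_le_countable_cover:
  assumes "countable C" "A \<subseteq> (\<Union>i\<in>C. U i)" "\<And>i. i \<in> C \<Longrightarrow> bounded (U i)"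
    "\<And>i. i \<in> C \<Longrightarrow> diameter (U i) \<le> \<delta>" "0 \<le> \<delta>"
  shows "hausdorff_pre k \<delta> A \<le> (\<integral>\<^sup>+i. hausdorff_weight k (U i) \<partial>count_space C)"
proof -
  define V where "V n = (if n \<in> to_nat_on C ` C then U (from_nat_into C n) else {})" for n
  have V: "V (to_nat_on C i) = U i" if "i \<in> C" for i
    using that assms(1) by (simp add: V_def)
  have inj: "inj_on (to_nat_on C) C" using assms(1) by (rule inj_on_to_nat_on)
  have "hausdorff_pre k \<delta> A \<le> (\<Sum>n. hausdorff_weight k (V n))"
  proof (rule hausdorff_pre_le_cover)
    show "A \<subseteq> (\<Union>n. V n)" using assms(2) V by blast
    show "bounded (V n)" "diameter (V n) \<le> \<delta>" for n
      using assms by (auto simp: V_def)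
  qed
  also have "\<dots> = (\<integral>\<^sup>+n. hausdorff_weight k (V n) \<partial>count_space UNIV)"
    by (simp add: nn_integral_count_space_nat)
  also have "\<dots> = (\<integral>\<^sup>+n. hausdorff_weight k (V n) \<partial>count_space (to_nat_on C ` C))"
    by (rule nn_integral_count_space_eq) (auto simp: V_def)
  also have "\<dots> = (\<integral>\<^sup>+i. hausdorff_weight k (V (to_nat_on C i)) \<partial>count_space C)"
    by (rule nn_integral_bij_count_space[symmetric]) (use inj in \<open>auto simp: bij_betw_def\<close>)
  also have "\<dots> = (\<integral>\<^sup>+i. hausdorff_weight k (U i) \<partial>count_space C)"
    by (intro nn_integral_cong) (simp add: V)
  finally show ?thesis .
qed

lemma hausdorff_pre_less_cover:
  assumes "hausdorff_pre k \<delta> A < c"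
  obtains U where "A \<subseteq> (\<Union>i. U i)" "\<And>i. bounded (U i)" "\<And>i. diameter (U i) \<le> \<delta>"
    "(\<Sum>i. hausdorff_weight k (U i)) < c"
  using assms that unfolding hausdorff_pre_def INF_less_iff by blast

lemma hausdorff_pre_le_outer: "0 < \<delta> \<Longrightarrow> hausdorff_pre k \<delta> A \<le> hausdorff_outer k A"
  unfolding hausdorff_outer_def by (rule SUP_upper) simp

lemma hausdorff_outer_empty [simp]: "hausdorff_outer k {} = 0"
proof -
  have "hausdorff_pre k \<delta> {} = 0" if "0 < \<delta>" for \<delta> :: real
    using hausdorff_pre_le_cover[of "{}" "\<lambda>_. {}" \<delta> k] that by simp
  then have "(\<Squnion>\<delta>\<in>{0<..}. hausdorff_pre k \<delta> {}) = (\<Squnion>\<delta>\<in>{0::real<..}. 0)"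
    by (intro SUP_cong) auto
  then show ?thesis by (simp add: hausdorff_outer_def)
qed

lemma hausdorff_pre_subadditive:
  assumes "0 \<le> \<delta>"
  shows "hausdorff_pre k \<delta> (\<Union>n. A n) \<le> (\<Sum>n. hausdorff_pre k \<delta> (A n))"
proof (rule ennreal_le_epsilon)
  fix e :: real assume e: "0 < e" and fin: "(\<Sum>n. hausdorff_pre k \<delta> (A n)) < top"
  have "hausdorff_pre k \<delta> (A n) < hausdorff_pre k \<delta> (A n) + ennreal (e * (1/2) ^ Suc n)" for n
  proof -
    have "hausdorff_pre k \<delta> (A n) < top"
      using fin ennreal_suminf_lessD by blast
    then show ?thesis using e by (simp add: ennreal_less_zero_iff)
  qed
  then have "\<exists>U. A n \<subseteq> (\<Union>i. U i) \<and> (\<forall>i. bounded (U i)) \<and> (\<forall>i. diameter (U i) \<le> \<delta>) \<and>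
     (\<Sum>i. hausdorff_weight k (U i)) < hausdorff_pre k \<delta> (A n) + ennreal (e * (1/2) ^ Suc n)" for n
    by (rule hausdorff_pre_less_cover) blast
  then obtain U where U: "\<And>n. A n \<subseteq> (\<Union>i. U n i)" "\<And>n i. bounded (U n i)"
      "\<And>n i. diameter (U n i) \<le> \<delta>"
      "\<And>n. (\<Sum>i. hausdorff_weight k (U n i)) < hausdorff_pre k \<delta> (A n) + ennreal (e * (1/2) ^ Suc n)"
    by metis
  have "hausdorff_pre k \<delta> (\<Union>n. A n) \<le>
      (\<integral>\<^sup>+p. hausdorff_weight k (case p of (n, i) \<Rightarrow> U n i) \<partial>count_space UNIV)"
    by (rule hausdorff_pre_le_countable_cover) (use U assms in \<open>auto split: prod.splits, blast\<close>)
  also have "\<dots> = (\<integral>\<^sup>+p. (\<lambda>n i. hausdorff_weight k (U n i)) (fst p) (snd p) \<partial>count_space UNIV)"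
    by (intro nn_integral_cong) (auto split: prod.splits)
  also have "\<dots> = (\<integral>\<^sup>+n. \<integral>\<^sup>+i. hausdorff_weight k (U n i) \<partial>count_space UNIV \<partial>count_space UNIV)"
    by (subst nn_integral_fst_count_space[symmetric]) simp
  also have "\<dots> = (\<Sum>n. \<Sum>i. hausdorff_weight k (U n i))"
    by (simp add: nn_integral_count_space_nat)
  also have "\<dots> \<le> (\<Sum>n. hausdorff_pre k \<delta> (A n) + ennreal (e * (1/2) ^ Suc n))"
    using U(4) by (intro suminf_le) (auto intro: less_imp_le)
  also have "\<dots> = (\<Sum>n. hausdorff_pre k \<delta> (A n)) + (\<Sum>n. ennreal (e * (1/2) ^ Suc n))"
    by (rule suminf_add[symmetric]) auto
  also have "(\<Sum>n. ennreal (e * (1/2) ^ Suc n)) = ennreal e"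
    using e sums_mult[OF power_half_series, of e] by (intro suminf_ennreal_eq) auto
  finally show "hausdorff_pre k \<delta> (\<Union>n. A n) \<le> (\<Sum>n. hausdorff_pre k \<delta> (A n)) + ennreal e" .
qed

section \<open>Caratheodory's criterion and the resulting Borel measure\<close>

lemma hausdorff_outer_subadditive:
  "hausdorff_outer k (\<Union>n. A n) \<le> (\<Sum>n. hausdorff_outer k (A n))"
  unfolding hausdorff_outer_def[of k "\<Union>n. A n"]
proof (rule SUP_least)
  fix \<delta> :: real assume "\<delta> \<in> {0<..}"
  then have "hausdorff_pre k \<delta> (\<Union>n. A n) \<le> (\<Sum>n. hausdorff_pre k \<delta> (A n))"
    by (intro hausdorff_pre_subadditive) simp
  also have "\<dots> \<le> (\<Sum>n. hausdorff_outer k (A n))"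
    using \<open>\<delta> \<in> {0<..}\<close> by (intro suminf_le hausdorff_pre_le_outer) auto
  finally show "hausdorff_pre k \<delta> (\<Union>n. A n) \<le> (\<Sum>n. hausdorff_outer k (A n))" .
qed

lemma hausdorff_outer_Un: "hausdorff_outer k (A \<union> B) \<le> hausdorff_outer k A + hausdorff_outer k B"
proof -
  have "hausdorff_outer k (\<Union>n. binaryset A B n) \<le> (\<Sum>n. hausdorff_outer k (binaryset A B n))"
    by (rule hausdorff_outer_subadditive)
  then show ?thesis
    by (simp add: UN_binaryset_eq suminf_binaryset_eq)
qed

text \<open>A covering set of diameter below e meets at most one of A and B, so a fine cover of the
  union splits into a cover of each.\<close>

lemma hausdorff_outer_separated:
  fixes A B :: "'a::metric_space set"
  assumes sep: "\<And>x y. x \<in> A \<Longrightarrow> y \<in> B \<Longrightarrow> e \<le> dist x y" and e: "0 < e"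
  shows "hausdorff_outer k A + hausdorff_outer k B \<le> hausdorff_outer k (A \<union> B)"
proof -
  have *: "hausdorff_pre k \<delta> A + hausdorff_pre k \<delta> B \<le> hausdorff_outer k (A \<union> B)"
    if \<delta>: "0 < \<delta>" "\<delta> < e" for \<delta>
  proof -
    have "hausdorff_pre k \<delta> A + hausdorff_pre k \<delta> B \<le> hausdorff_pre k \<delta> (A \<union> B)"
      unfolding hausdorff_pre_def[of k \<delta> "A \<union> B"]
    proof (rule INF_greatest)
      fix U :: "nat \<Rightarrow> 'a set" assume "U \<in> covers \<delta> (A \<union> B)"
      then have U: "A \<union> B \<subseteq> (\<Union>i. U i)" "\<And>i. bounded (U i)" "\<And>i. diameter (U i) \<le> \<delta>" by auto
      have sm: "diameter (U i \<inter> X) \<le> \<delta>" for i X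
        using diameter_subset[of "U i \<inter> X" "U i"] U(2,3)[of i] by auto
      have "hausdorff_pre k \<delta> A \<le> (\<Sum>i. hausdorff_weight k (U i \<inter> A))"
        by (rule hausdorff_pre_le_cover) (use U sm in \<open>auto intro: bounded_Int\<close>)
      moreover have "hausdorff_pre k \<delta> B \<le> (\<Sum>i. hausdorff_weight k (U i \<inter> B))"
        by (rule hausdorff_pre_le_cover) (use U sm in \<open>auto intro: bounded_Int\<close>)
      ultimately have "hausdorff_pre k \<delta> A + hausdorff_pre k \<delta> B \<le>
          (\<Sum>i. hausdorff_weight k (U i \<inter> A)) + (\<Sum>i. hausdorff_weight k (U i \<inter> B))"
        by (rule add_mono)
      also have "\<dots> = (\<Sum>i. hausdorff_weight k (U i \<inter> A) + hausdorff_weight k (U i \<inter> B))"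
        by (rule suminf_add) auto
      also have "\<dots> \<le> (\<Sum>i. hausdorff_weight k (U i))"
      proof (intro suminf_le)
        fix i
        have "U i \<inter> A = {} \<or> U i \<inter> B = {}"
        proof (rule ccontr)
          assume "\<not> ?thesis"
          then obtain x y where xy: "x \<in> U i" "x \<in> A" "y \<in> U i" "y \<in> B" by auto
          then have "dist x y \<le> diameter (U i)" using U(2) by (intro diameter_bounded_bound) auto
          then show False using sep[OF xy(2,4)] U(3)[of i] \<delta> by linarith
        qed
        then show "hausdorff_weight k (U i \<inter> A) + hausdorff_weight k (U i \<inter> B) \<le> hausdorff_weight k (U i)"
          using U(2) hausdorff_weight_mono[of "U i \<inter> A" "U i" k] hausdorff_weight_mono[of "U i \<inter> B" "U i" k] by auto
      qed auto
      finally show "hausdorff_pre k \<delta> A + hausdorff_pre k \<delta> B \<le> (\<Sum>i. hausdorff_weight k (U i))" .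
    qed
    also have "\<dots> \<le> hausdorff_outer k (A \<union> B)" by (rule hausdorff_pre_le_outer) fact
    finally show ?thesis .
  qed
  \<comment> \<open>The sum of the two suprema runs over two independent meshes; a common smaller
    mesh dominates both.\<close>
  have **: "hausdorff_pre k \<delta> A + hausdorff_pre k \<delta>' B \<le> hausdorff_outer k (A \<union> B)"
    if "0 < \<delta>" "0 < \<delta>'" for \<delta> \<delta>'
  proof -
    define r where "r = min (min \<delta> \<delta>') (e/2)"
    have r: "0 < r" "r < e" "r \<le> \<delta>" "r \<le> \<delta>'" using that e by (auto simp: r_def)
    have "hausdorff_pre k \<delta> A + hausdorff_pre k \<delta>' B \<le> hausdorff_pre k r A + hausdorff_pre k r B"
      by (intro add_mono hausdorff_pre_antimono r)
    also have "\<dots> \<le> hausdorff_outer k (A \<union> B)" by (rule *[OF r(1,2)])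
    finally show ?thesis .
  qed
  have "hausdorff_outer k A + hausdorff_outer k B =
     (SUP \<delta>\<in>{0<..}. SUP \<delta>'\<in>{0<..}. hausdorff_pre k \<delta> A + hausdorff_pre k \<delta>' B)"
    unfolding hausdorff_outer_def
    by (subst ennreal_SUP_add_left[symmetric], simp, subst ennreal_SUP_add_right, simp) (rule refl)
  also have "\<dots> \<le> hausdorff_outer k (A \<union> B)"
    by (intro SUP_least) (use ** in auto)
  finally show ?thesis .
qed

text \<open>Caratheodory's criterion for metric outer measures. A - F is exhausted by sets
  \<open>B n\<close> at positive distance from F, for which additivity holds by separation. What is
  left out lies in the shells \<open>R j\<close> with j at least n; shells of equal parity are
  separated from each other, so their measures have a finite sum and the tail tends to 0.\<close>

lemma hausdorff_outer_closed_split: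
  fixes F A :: "'a::metric_space set"
  assumes F: "closed F"
  shows "hausdorff_outer k (A \<inter> F) + hausdorff_outer k (A - F) \<le> hausdorff_outer k A"
proof (cases "F = {} \<or> hausdorff_outer k A = top")
  case True
  then show ?thesis by auto
next
  case False
  then have ne: "F \<noteq> {}" and fin: "hausdorff_outer k A < top" by (auto simp: top.not_eq_extremum)
  define B where "B n = {x \<in> A. 1 / (real n + 1) \<le> infdist x F}" for n
  define R where "R n = {x \<in> A. 1 / (real n + 2) \<le> infdist x F \<and> infdist x F < 1 / (real n + 1)}" for n
  have sep: "a - b \<le> dist x y" if "a \<le> infdist x F" "infdist y F \<le> b" for x y a b
    using infdist_triangle[of x F y] that by linarith
  have partial: "(\<Sum>i<m. hausdorff_outer k (R (2 * i + p))) \<le> hausdorff_outer k (\<Union>i<m. R (2 * i + p))" for m p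
  proof (induction m)
    case (Suc m)
    have "hausdorff_outer k (\<Union>i<m. R (2 * i + p)) + hausdorff_outer k (R (2 * m + p)) \<le>
        hausdorff_outer k ((\<Union>i<m. R (2 * i + p)) \<union> R (2 * m + p))"
    \<comment> \<open>For m = 0 the union is empty and any positive constant will do; the general
      gap would be negative for m = p = 0.\<close>
    proof (rule hausdorff_outer_separated[where e="if m = 0 then 1 else
          1 / (real (2 * m + p)) - 1 / (real (2 * m + p) + 1)"])
      fix x y assume x: "x \<in> (\<Union>i<m. R (2 * i + p))" and y: "y \<in> R (2 * m + p)"
      then obtain i where i: "i < m" "x \<in> R (2 * i + p)" by auto
      have "1 / (real (2 * m + p)) \<le> 1 / (real (2 * i + p) + 2)"
        using i by (intro divide_left_mono) auto
      also have "\<dots> \<le> infdist x F" using i by (auto simp: R_def)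
      finally have "1 / (real (2 * m + p)) - 1 / (real (2 * m + p) + 1) \<le> dist x y"
        using y by (intro sep) (auto simp: R_def)
      then show "(if m = 0 then 1 else 1 / (real (2 * m + p)) - 1 / (real (2 * m + p) + 1)) \<le> dist x y"
        using i by simp
    qed (simp add: frac_less2)
    note sepm = this
    have un: "(\<Union>i<Suc m. R (2 * i + p)) = (\<Union>i<m. R (2 * i + p)) \<union> R (2 * m + p)"
      by (auto simp: less_Suc_eq)
    have "(\<Sum>i<Suc m. hausdorff_outer k (R (2 * i + p))) \<le>
        hausdorff_outer k (\<Union>i<m. R (2 * i + p)) + hausdorff_outer k (R (2 * m + p))"
      using Suc by (simp add: add_right_mono)
    from order_trans[OF this sepm] show ?case unfolding un .
  qed simp
  have half: "(\<Sum>i. hausdorff_outer k (R (2 * i + p))) < top" for p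
  proof -
    have "(\<Sum>i. hausdorff_outer k (R (2 * i + p))) \<le> hausdorff_outer k A"
    proof (rule suminf_le_const)
      fix m
      have "(\<Union>i<m. R (2 * i + p)) \<subseteq> A" by (auto simp: R_def)
      then show "(\<Sum>i<m. hausdorff_outer k (R (2 * i + p))) \<le> hausdorff_outer k A"
        by (intro order_trans[OF partial hausdorff_outer_mono])
    qed auto
    then show ?thesis using fin by auto
  qed
  have "(\<Sum>n. hausdorff_outer k (R n)) \<le>
      (\<Sum>i. hausdorff_outer k (R (2 * i + 0))) + (\<Sum>i. hausdorff_outer k (R (2 * i + 1)))"
  proof (rule suminf_le_const)
    fix N
    have eq: "(\<Sum>n<2 * N. hausdorff_outer k (R n)) =
        (\<Sum>i<N. hausdorff_outer k (R (2 * i + 0))) + (\<Sum>i<N. hausdorff_outer k (R (2 * i + 1)))"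
      by (induction N) (simp_all add: add_ac)
    have "(\<Sum>n<N. hausdorff_outer k (R n)) \<le> (\<Sum>n<2 * N. hausdorff_outer k (R n))"
      by (rule sum_mono2) auto
    also have "\<dots> \<le> (\<Sum>i. hausdorff_outer k (R (2 * i + 0))) + (\<Sum>i. hausdorff_outer k (R (2 * i + 1)))"
      unfolding eq by (intro add_mono sum_le_suminf) auto
    finally show "(\<Sum>n<N. hausdorff_outer k (R n)) \<le>
        (\<Sum>i. hausdorff_outer k (R (2 * i + 0))) + (\<Sum>i. hausdorff_outer k (R (2 * i + 1)))" .
  qed auto
  also have "\<dots> < top" using half[of 0] half[of 1] by simp
  finally have total: "(\<Sum>n. hausdorff_outer k (R n)) < top" .
  show ?thesis
  proof (rule ennreal_le_epsilon)
    fix e :: real assume e: "0 < e"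
    define a where "a n = enn2real (hausdorff_outer k (R n))" for n
    have a: "hausdorff_outer k (R n) = ennreal (a n)" "0 \<le> a n" for n
      using ennreal_suminf_lessD[OF total, of n] by (auto simp: a_def)
    have "summable a"
      using total a by (intro summable_suminf_not_top) auto
    then obtain n where "norm (\<Sum>j. a (j + n)) < e"
      using suminf_exist_split[OF e] by blast
    then have tail: "(\<Sum>j. hausdorff_outer k (R (j + n))) \<le> ennreal e"
      using \<open>summable a\<close> a by (simp add: suminf_ennreal2 summable_ignore_initial_segment ennreal_leI)
    have "A - F \<subseteq> B n \<union> (\<Union>j. R (j + n))"
    proof
      fix x assume x: "x \<in> A - F"
      then have pos: "0 < infdist x F"
        using F ne infdist_pos_not_in_closed by blast
      show "x \<in> B n \<union> (\<Union>j. R (j + n))"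
      proof (cases "1 / (real n + 1) \<le> infdist x F")
        case False
        \<comment> \<open>With this m the distance is at least 1 / m and less than 1 / (m - 1),
          which is membership in the shell of index m - 2.\<close>
        define m where "m = nat \<lceil>1 / infdist x F\<rceil>"
        have m: "real m - 1 < 1 / infdist x F" "1 / infdist x F \<le> real m"
          using pos ceiling_correct[of "1 / infdist x F"] by (auto simp: m_def)
        have "real n + 1 < 1 / infdist x F" using False pos by (simp add: field_simps)
        then have "n + 2 \<le> m" using m(2) by linarith
        then obtain j where j: "m = j + n + 2" using le_Suc_ex by (metis add.assoc add.commute)
        have "x \<in> R (j + n)" using x pos m by (auto simp: R_def j field_simps)
        then show ?thesis by blast
      qed (use x in \<open>auto simp: B_def\<close>)
    qed
    then have "hausdorff_outer k (A - F) \<le> hausdorff_outer k (B n) + hausdorff_outer k (\<Union>j. R (j + n))"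
      by (rule order_trans[OF hausdorff_outer_mono hausdorff_outer_Un])
    also have "\<dots> \<le> hausdorff_outer k (B n) + ennreal e"
      using order_trans[OF hausdorff_outer_subadditive tail] by (intro add_left_mono)
    finally have "hausdorff_outer k (A \<inter> F) + hausdorff_outer k (A - F) \<le>
        (hausdorff_outer k (A \<inter> F) + hausdorff_outer k (B n)) + ennreal e"
      by (simp add: add_left_mono add.assoc)
    also have "hausdorff_outer k (A \<inter> F) + hausdorff_outer k (B n) \<le> hausdorff_outer k ((A \<inter> F) \<union> B n)"
    proof (rule hausdorff_outer_separated)
      show "1 / (real n + 1) \<le> dist x y" if "x \<in> A \<inter> F" "y \<in> B n" for x y
        using sep[of "1 / (real n + 1)" y x 0] that by (auto simp: B_def dist_commute)
    qed auto
    also have "\<dots> \<le> hausdorff_outer k A" by (rule hausdorff_outer_mono) (auto simp: B_def)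
    finally show "hausdorff_outer k (A \<inter> F) + hausdorff_outer k (A - F) \<le> hausdorff_outer k A + ennreal e"
      by (simp add: add_right_mono)
  qed
qed

lemma outer_measure_space_hausdorff: "outer_measure_space (Pow UNIV) (hausdorff_outer k)"
  unfolding outer_measure_space_def positive_def increasing_def countably_subadditive_def
  using hausdorff_outer_mono hausdorff_outer_subadditive by auto

text \<open>Closed sets lie in the lambda system of the outer measure, hence all Borel sets do. This
  makes \<open>measure_of\<close> return the outer measure on Borel sets; for a set function that is
  not a measure it would return 0 everywhere.\<close>

lemma measure_space_hausdorff:
  "measure_space UNIV (sets (borel :: 'a::metric_space measure)) (hausdorff_outer k)"
proof -
  interpret sigma_algebra UNIV "Pow UNIV :: 'a set set" by (rule sigma_algebra_Pow)
  let ?L = "lambda_system UNIV (Pow UNIV) (hausdorff_outer k) :: 'a set set"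
  have ms: "measure_space UNIV ?L (hausdorff_outer k)"
    by (rule caratheodory_lemma[OF outer_measure_space_hausdorff])
  then have sa: "sigma_algebra UNIV ?L" by (simp add: measure_space_def)
  have "F \<in> ?L" if "closed F" for F
    unfolding lambda_system_eq
  proof (clarsimp, rule antisym)
    fix x
    show "hausdorff_outer k (x \<inter> F) + hausdorff_outer k (x - F) \<le> hausdorff_outer k x"
      by (rule hausdorff_outer_closed_split[OF that])
    show "hausdorff_outer k x \<le> hausdorff_outer k (x \<inter> F) + hausdorff_outer k (x - F)"
      using hausdorff_outer_Un[of k "x \<inter> F" "x - F"] by (simp add: Int_Diff_Un)
  qed
  then have "sigma_sets UNIV {F :: 'a set. closed F} \<subseteq> ?L"
    by (intro sigma_algebra.sigma_sets_subset[OF sa]) auto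
  then have "sets borel \<subseteq> ?L" by (simp add: borel_eq_closed)
  then show ?thesis
    by (intro measure_down[OF ms]) (metis sets.sigma_algebra_axioms space_borel)
qed

lemma sets_hausdorff_measure [simp, measurable_cong]:
  "sets (hausdorff_measure k :: 'a::metric_space measure) = sets borel"
  unfolding hausdorff_measure_def by (metis sets.sets_measure_of_eq space_borel)

lemma space_hausdorff_measure [simp]: "space (hausdorff_measure k) = UNIV"
  unfolding hausdorff_measure_def by (simp add: space_measure_of_conv)

lemma emeasure_hausdorff_measure:
  fixes A :: "'a::metric_space set"
  assumes "A \<in> sets borel"
  shows "emeasure (hausdorff_measure k) A = hausdorff_outer k A"
  using measure_space_hausdorff[where 'a='a, of k] assms
  unfolding hausdorff_measure_def measure_space_def
  by (intro emeasure_measure_of_sigma) auto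

section \<open>The isodiametric inequality\<close>

definition chord :: "'a::euclidean_space \<Rightarrow> 'a set \<Rightarrow> 'a \<Rightarrow> ennreal" where
  "chord b A x = emeasure lborel {s::real. x + s *\<^sub>R b \<in> A}"

text \<open>For a unit vector b this is the Steiner symmetral: on each line parallel to b, A is
  replaced by the open segment of the same length centred at height 0. It can be written pointwise
  because \<open>chord\<close> is constant along the line.\<close>

definition steiner :: "'a::euclidean_space \<Rightarrow> 'a set \<Rightarrow> 'a set" where
  "steiner b A = {x. ennreal (2 * \<bar>x \<bullet> b\<bar>) < chord b A x}"

definition reflect :: "'a::euclidean_space \<Rightarrow> 'a \<Rightarrow> 'a" where
  "reflect c x = x - (2 * (x \<bullet> c)) *\<^sub>R c"

lemma chord_measurable [measurable]:
  assumes [measurable]: "A \<in> sets borel"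
  shows "chord b A \<in> borel_measurable borel"
proof -
  have "(\<lambda>p. fst p + snd p *\<^sub>R b) \<in> borel \<Otimes>\<^sub>M lborel \<rightarrow>\<^sub>M borel"
    by measurable
  from measurable_sets[OF this assms]
  have "{(x, s::real). x + s *\<^sub>R b \<in> A} \<in> sets (borel \<Otimes>\<^sub>M lborel)"
    by (simp add: vimage_def split_def space_pair_measure)
  then have "(\<lambda>x. emeasure lborel (Pair x -` {(x, s::real). x + s *\<^sub>R b \<in> A})) \<in> borel_measurable borel"
    by (rule lborel.measurable_emeasure_Pair)
  then show ?thesis by (simp add: chord_def[abs_def] vimage_def)
qed

lemma nn_integral_lborel_shift:
  fixes f :: "'a::euclidean_space \<Rightarrow> ennreal"
  assumes [measurable]: "f \<in> borel_measurable borel"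
  shows "(\<integral>\<^sup>+x. f (x + c) \<partial>lborel) = (\<integral>\<^sup>+x. f x \<partial>lborel)"
proof -
  have "(\<integral>\<^sup>+x. f x \<partial>lborel) = (\<integral>\<^sup>+x. f x \<partial>distr lborel borel ((+) c))"
    by (simp add: lborel_distr_plus)
  also have "\<dots> = (\<integral>\<^sup>+x. f (c + x) \<partial>lborel)" by (rule nn_integral_distr) auto
  finally show ?thesis by (simp add: add.commute)
qed

lemma chord_eq_nn_integral:
  assumes [measurable]: "A \<in> sets borel"
  shows "chord b A x = (\<integral>\<^sup>+s. indicator A (x + s *\<^sub>R b) \<partial>lborel)"
proof -
  have "{s. x + s *\<^sub>R b \<in> A} \<in> sets lborel" by measurable
  then have "chord b A x = (\<integral>\<^sup>+s. indicator {s. x + s *\<^sub>R b \<in> A} s \<partial>lborel)"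
    by (simp add: chord_def)
  also have "\<dots> = (\<integral>\<^sup>+s. indicator A (x + s *\<^sub>R b) \<partial>lborel)"
    by (intro nn_integral_cong) (simp add: indicator_def)
  finally show ?thesis .
qed

lemma chord_shift:
  assumes [measurable]: "A \<in> sets borel"
  shows "chord b A (x + t *\<^sub>R b) = chord b A x"
proof -
  have "(\<integral>\<^sup>+s. indicator A (x + t *\<^sub>R b + s *\<^sub>R b) \<partial>lborel)
      = (\<integral>\<^sup>+s. (\<lambda>s. indicator A (x + s *\<^sub>R b)) (s + t) \<partial>lborel)"
    by (intro nn_integral_cong) (simp add: algebra_simps)
  also have "\<dots> = (\<integral>\<^sup>+s. indicator A (x + s *\<^sub>R b) \<partial>lborel)"
    by (rule nn_integral_lborel_shift) measurable
  finally show ?thesis by (simp add: chord_eq_nn_integral)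
qed

text \<open>Cavalieri's principle without coordinates: the slab of points of height in [0,1) meets
  every line parallel to b in length 1, so integrating chords over the slab counts each line
  once.\<close>

lemma emeasure_eq_chord:
  fixes A :: "'a::euclidean_space set"
  assumes [measurable]: "A \<in> sets borel" and b: "norm b = 1"
  shows "emeasure lborel A = (\<integral>\<^sup>+x. chord b A x * indicator {x. 0 \<le> x \<bullet> b \<and> x \<bullet> b < 1} x \<partial>lborel)"
proof -
  let ?I = "{x. 0 \<le> x \<bullet> b \<and> x \<bullet> b < 1}"
  have bb: "b \<bullet> b = 1" using b by (simp add: dot_square_norm)
  have [measurable]: "?I \<in> sets borel" by measurable
  have "(\<integral>\<^sup>+x. chord b A x * indicator ?I x \<partial>lborel)
      = (\<integral>\<^sup>+x. \<integral>\<^sup>+s. indicator A (x + s *\<^sub>R b) * indicator ?I x \<partial>lborel \<partial>lborel)"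
    by (simp add: chord_eq_nn_integral nn_integral_multc)
  also have "\<dots> = (\<integral>\<^sup>+s. \<integral>\<^sup>+x. indicator A (x + s *\<^sub>R b) * indicator ?I x \<partial>lborel \<partial>lborel)"
    by (rule lborel_pair.Fubini') measurable
  \<comment> \<open>Translating x by s b turns the slab condition into a half-open interval of
    length 1 for s.\<close>
  also have "\<dots> = (\<integral>\<^sup>+s. \<integral>\<^sup>+x. indicator A x * indicator {x \<bullet> b - 1<..x \<bullet> b} s \<partial>lborel \<partial>lborel)"
  proof (rule nn_integral_cong)
    fix s :: real
    have "(\<integral>\<^sup>+x. indicator A (x + s *\<^sub>R b) * indicator ?I x \<partial>lborel)
        = (\<integral>\<^sup>+x. (\<lambda>x. indicator A x * indicator {x. x \<bullet> b - 1 < s \<and> s \<le> x \<bullet> b} x) (x + s *\<^sub>R b) \<partial>lborel)"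
      by (intro nn_integral_cong) (auto simp: indicator_def inner_add_left bb)
    also have "\<dots> = (\<integral>\<^sup>+x. indicator A x * indicator {x. x \<bullet> b - 1 < s \<and> s \<le> x \<bullet> b} x \<partial>lborel)"
      by (rule nn_integral_lborel_shift) measurable
    finally show "(\<integral>\<^sup>+x. indicator A (x + s *\<^sub>R b) * indicator ?I x \<partial>lborel)
        = (\<integral>\<^sup>+x. indicator A x * indicator {x \<bullet> b - 1<..x \<bullet> b} s \<partial>lborel)"
      by (simp add: indicator_def)
  qed
  also have "\<dots> = (\<integral>\<^sup>+x. \<integral>\<^sup>+s. indicator A x * indicator {x \<bullet> b - 1<..x \<bullet> b} s \<partial>lborel \<partial>lborel)"
    by (rule lborel_pair.Fubini') (unfold greaterThanAtMost_iff indicator_def, measurable)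
  also have "\<dots> = emeasure lborel A"
    by (simp add: nn_integral_cmult)
  finally show ?thesis ..
qed

lemma steiner_measurable [measurable]:
  assumes [measurable]: "A \<in> sets borel"
  shows "steiner b A \<in> sets borel"
  unfolding steiner_def by measurable

lemma chord_steiner:
  fixes A :: "'a::euclidean_space set"
  assumes A: "A \<in> sets borel" and b: "norm b = 1"
  shows "chord b (steiner b A) x = chord b A x"
proof -
  have bb: "b \<bullet> b = 1" using b by (simp add: dot_square_norm)
  have "{s. x + s *\<^sub>R b \<in> steiner b A} = {s. ennreal (2 * \<bar>x \<bullet> b + s\<bar>) < chord b A x}"
    by (simp add: steiner_def chord_shift[OF A] inner_add_left bb)
  also have "emeasure lborel \<dots> = chord b A x"
  proof (cases "chord b A x" rule: ennreal_cases)
    case (real c)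
    then have "{s. ennreal (2 * \<bar>x \<bullet> b + s\<bar>) < chord b A x} = {- c / 2 - x \<bullet> b<..<c / 2 - x \<bullet> b}"
      by (auto simp: ennreal_less_iff abs_if split: if_splits)
    then show ?thesis using real by simp
  qed simp
  finally show ?thesis by (simp add: chord_def)
qed

lemma emeasure_steiner:
  assumes "A \<in> sets borel" "norm b = 1"
  shows "emeasure lborel (steiner b A) = emeasure lborel A"
  using assms by (simp add: emeasure_eq_chord[of _ b] chord_steiner)

text \<open>The chords of A on the lines through x and y contain heights u and v at distance at
  least \<bar>x \<bullet> b\<bar> + \<bar>y \<bullet> b\<bar>; otherwise the two chord lengths would
  add up to at most twice that sum, whereas membership in the symmetral makes them larger. The
  components orthogonal to b are unchanged, so Pythagoras concludes.\<close>

lemma steiner_dist_le: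
  fixes A :: "'a::euclidean_space set"
  assumes A: "A \<in> sets borel" and b: "norm b = 1"
    and d: "\<And>x y. x \<in> A \<Longrightarrow> y \<in> A \<Longrightarrow> dist x y \<le> d"
    and x: "x \<in> steiner b A" and y: "y \<in> steiner b A"
  shows "dist x y \<le> d"
proof -
  have bb: "b \<bullet> b = 1" using b by (simp add: dot_square_norm)
  \<comment> \<open>\<open>U\<close> and \<open>V\<close> list heights above the hyperplane
    orthogonal to b, the common scale on which the two chords are compared.\<close>
  define U where "U = {s. x + (s - x \<bullet> b) *\<^sub>R b \<in> A}"
  define V where "V = {s. y + (s - y \<bullet> b) *\<^sub>R b \<in> A}"
  have shift: "chord b A z = emeasure lborel {s. z + (s - z \<bullet> b) *\<^sub>R b \<in> A}" for z
    using chord_shift[OF A, of b z "- (z \<bullet> b)"] by (simp add: chord_def algebra_simps)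
  have mU: "ennreal (2 * \<bar>x \<bullet> b\<bar>) < emeasure lborel U" and mV: "ennreal (2 * \<bar>y \<bullet> b\<bar>) < emeasure lborel V"
    using x y shift[of x] shift[of y] by (auto simp: steiner_def U_def V_def)
  then have ne: "U \<noteq> {}" "V \<noteq> {}" by auto
  have dd: "\<bar>u - v\<bar> \<le> d" if "x + u *\<^sub>R b \<in> A" "x + v *\<^sub>R b \<in> A" for u v x
    using d[OF that] b by (simp add: dist_norm flip: scaleR_diff_left)
  have bdd: "bounded U" "bounded V"
    unfolding bounded_two_points U_def V_def
    using dd[of x "s - x \<bullet> b" "t - x \<bullet> b" for s t] dd[of y "s - y \<bullet> b" "t - y \<bullet> b" for s t]
    by (auto simp: dist_real_def intro!: exI[of _ d])
  have le: "emeasure lborel W \<le> ennreal (Sup W - Inf W)" if "bounded W" "W \<noteq> {}" for W :: "real set"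
  proof -
    have "W \<subseteq> {Inf W..Sup W}"
      using bounded_imp_bdd_above[OF that(1)] bounded_imp_bdd_below[OF that(1)] by (auto intro: cInf_lower cSup_upper)
    then have "emeasure lborel W \<le> emeasure lborel {Inf W..Sup W}" by (rule emeasure_mono) simp
    moreover have "Inf W \<le> Sup W"
      using that bounded_imp_bdd_above[OF that(1)] bounded_imp_bdd_below[OF that(1)] by (intro cInf_le_cSup) auto
    ultimately show ?thesis by simp
  qed
  have lU: "2 * \<bar>x \<bullet> b\<bar> < Sup U - Inf U" and lV: "2 * \<bar>y \<bullet> b\<bar> < Sup V - Inf V"
    using less_le_trans[OF mU le[OF bdd(1) ne(1)]] less_le_trans[OF mV le[OF bdd(2) ne(2)]]
    by (auto simp: ennreal_less_iff)
  obtain u v where uv: "u \<in> U" "v \<in> V" "\<bar>x \<bullet> b\<bar> + \<bar>y \<bullet> b\<bar> \<le> \<bar>u - v\<bar>"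
  proof (rule ccontr)
    assume "\<not> thesis"
    with that have small: "\<bar>u - v\<bar> \<le> \<bar>x \<bullet> b\<bar> + \<bar>y \<bullet> b\<bar>" if "u \<in> U" "v \<in> V" for u v
      using \<open>u \<in> U\<close> \<open>v \<in> V\<close> by fastforce
    let ?m = "\<bar>x \<bullet> b\<bar> + \<bar>y \<bullet> b\<bar>"
    have "Sup U \<le> Inf V + ?m"
    proof (rule cSup_least[OF ne(1)])
      fix u assume u: "u \<in> U"
      have "u - ?m \<le> Inf V" by (rule cInf_greatest[OF ne(2)]) (use small[OF u] in fastforce)
      then show "u \<le> Inf V + ?m" by simp
    qed
    moreover have "Sup V \<le> Inf U + ?m"
    proof (rule cSup_least[OF ne(2)])
      fix v assume v: "v \<in> V"
      have "v - ?m \<le> Inf U" by (rule cInf_greatest[OF ne(1)]) (use small[OF _ v] in fastforce)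
      then show "v \<le> Inf U + ?m" by simp
    qed
    ultimately show False using lU lV by linarith
  qed
  define x' y' where "x' = x + (u - x \<bullet> b) *\<^sub>R b" and "y' = y + (v - y \<bullet> b) *\<^sub>R b"
  define p where "p = (x - y) - ((x - y) \<bullet> b) *\<^sub>R b"
  have pb: "p \<bullet> b = 0" by (simp add: p_def inner_diff_left bb)
  have sq: "(norm (p + t *\<^sub>R b))\<^sup>2 = (norm p)\<^sup>2 + t\<^sup>2" for t
    unfolding power2_norm_eq_inner
    by (simp add: inner_add_left inner_add_right pb inner_commute[of b p] bb power2_eq_square)
  have "(dist x y)\<^sup>2 = (norm p)\<^sup>2 + (x \<bullet> b - y \<bullet> b)\<^sup>2"
    using sq[of "x \<bullet> b - y \<bullet> b"] by (simp add: dist_norm p_def inner_diff_left algebra_simps)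
  also have "\<dots> \<le> (norm p)\<^sup>2 + (u - v)\<^sup>2"
    using uv(3) abs_triangle_ineq4[of "x \<bullet> b" "y \<bullet> b"] by (intro add_left_mono) (meson abs_le_square_iff order_trans)
  also have "\<dots> = (dist x' y')\<^sup>2"
    using sq[of "u - v"] by (simp add: dist_norm p_def x'_def y'_def inner_diff_left algebra_simps)
  finally have "dist x y \<le> dist x' y'" by (simp add: power2_le_iff_abs_le)
  also have "\<dots> \<le> d" using uv(1,2) by (intro d) (auto simp: U_def V_def x'_def y'_def)
  finally show ?thesis .
qed

lemma reflect_steiner_self:
  assumes A: "A \<in> sets borel" and b: "norm b = 1"
  shows "reflect b x \<in> steiner b A \<longleftrightarrow> x \<in> steiner b A"
proof -
  have bb: "b \<bullet> b = 1" using b by (simp add: dot_square_norm)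
  have "chord b A (reflect b x) = chord b A x"
    using chord_shift[OF A, of b x "- (2 * (x \<bullet> b))"] by (simp add: reflect_def)
  moreover have "reflect b x \<bullet> b = - (x \<bullet> b)"
    by (simp add: reflect_def inner_diff_left bb)
  ultimately show ?thesis by (simp add: steiner_def)
qed

lemma reflect_steiner_orthogonal:
  assumes sym: "\<And>x. reflect c x \<in> A \<longleftrightarrow> x \<in> A" and bc: "b \<bullet> c = 0"
  shows "reflect c x \<in> steiner b A \<longleftrightarrow> x \<in> steiner b A"
proof -
  have "reflect c (x + s *\<^sub>R b) = reflect c x + s *\<^sub>R b" for s
    by (simp add: reflect_def inner_add_left bc)
  then have "reflect c x + s *\<^sub>R b \<in> A \<longleftrightarrow> x + s *\<^sub>R b \<in> A" for s
    using sym by metis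
  then have "chord b A (reflect c x) = chord b A x" by (simp add: chord_def)
  moreover have "reflect c x \<bullet> b = x \<bullet> b"
    using bc by (simp add: reflect_def inner_diff_left inner_commute[of c b])
  ultimately show ?thesis by (simp add: steiner_def)
qed

text \<open>The basis directions are treated one after the other. A reflection in a direction
  orthogonal to the current one preserves heights and chord lengths, so the symmetries already
  gained survive.\<close>

lemma exists_symmetrized:
  fixes A I :: "'a::euclidean_space set"
  assumes "finite I" "I \<subseteq> Basis" "A \<in> sets borel" "\<And>x y. x \<in> A \<Longrightarrow> y \<in> A \<Longrightarrow> dist x y \<le> d"
  shows "\<exists>B. B \<in> sets borel \<and> emeasure lborel B = emeasure lborel A \<and>
    (\<forall>x\<in>B. \<forall>y\<in>B. dist x y \<le> d) \<and> (\<forall>c\<in>I. \<forall>x. reflect c x \<in> B \<longleftrightarrow> x \<in> B)"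
  using assms(1,2)
proof (induction I rule: finite_induct)
  case empty
  show ?case using assms(3,4) by (intro exI[of _ A]) simp
next
  case (insert b I)
  then obtain B where B: "B \<in> sets borel" "emeasure lborel B = emeasure lborel A"
    "\<And>x y. x \<in> B \<Longrightarrow> y \<in> B \<Longrightarrow> dist x y \<le> d" "\<And>c x. c \<in> I \<Longrightarrow> reflect c x \<in> B \<longleftrightarrow> x \<in> B"
    using insert.IH insert.prems by auto
  have b: "norm b = 1" using insert by simp
  have "reflect c x \<in> steiner b B \<longleftrightarrow> x \<in> steiner b B" if "c \<in> insert b I" for c x
  proof (cases "c = b")
    case True then show ?thesis using reflect_steiner_self[OF B(1) b] by simp
  next
    case False
    then have "c \<in> I" using that by simp
    moreover have "b \<bullet> c = 0" using False insert.prems \<open>c \<in> I\<close> by (auto intro: inner_not_same_Basis)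
    ultimately show ?thesis using reflect_steiner_orthogonal B(4) by blast
  qed
  then show ?case
    using B b by (intro exI[of _ "steiner b B"]) (auto simp: emeasure_steiner intro: steiner_dist_le)
qed

text \<open>A set symmetric under \<open>x \<mapsto> -x\<close> lies in the ball around 0 whose diameter is its own.\<close>

theorem isodiametric:
  fixes A :: "'a::euclidean_space set"
  assumes A: "A \<in> sets borel" "bounded A"
  shows "emeasure lborel A \<le> ennreal (unit_ball_vol (real DIM('a)) * (diameter A / 2) ^ DIM('a))"
proof -
  obtain B :: "'a set" where B: "B \<in> sets borel" "emeasure lborel B = emeasure lborel A"
    "\<And>x y. x \<in> B \<Longrightarrow> y \<in> B \<Longrightarrow> dist x y \<le> diameter A" "\<And>c x. c \<in> Basis \<Longrightarrow> reflect c x \<in> B \<longleftrightarrow> x \<in> B"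
    using exists_symmetrized[of Basis A "diameter A"] A(1) diameter_bounded_bound[OF A(2)]
    by (metis finite_Basis subset_refl)
  \<comment> \<open>The reflections in the directions of J compose to this map; for J =
    \<open>Basis\<close> it sends x to - x.\<close>
  have "x - (\<Sum>c\<in>J. (2 * (x \<bullet> c)) *\<^sub>R c) \<in> B" if "finite J" "J \<subseteq> Basis" "x \<in> B" for J x
    using that
  proof (induction J rule: finite_induct)
    case (insert b J)
    let ?y = "x - (\<Sum>c\<in>J. (2 * (x \<bullet> c)) *\<^sub>R c)"
    have "(\<Sum>c\<in>J. (2 * (x \<bullet> c)) *\<^sub>R c) \<bullet> b = 0"
      unfolding inner_sum_left
    proof (rule sum.neutral, rule)
      fix c assume "c \<in> J"
      then have "c \<bullet> b = 0" using insert by (intro inner_not_same_Basis) auto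
      then show "(2 * (x \<bullet> c)) *\<^sub>R c \<bullet> b = 0" by simp
    qed
    then have "reflect b ?y = x - (\<Sum>c\<in>insert b J. (2 * (x \<bullet> c)) *\<^sub>R c)"
      using insert by (simp add: reflect_def inner_diff_left)
    then show ?case using insert B(4)[of b ?y] by auto
  qed auto
  note flip = this
  have neg: "- x \<in> B" if "x \<in> B" for x
  proof -
    have "(\<Sum>c\<in>Basis. (2 * (x \<bullet> c)) *\<^sub>R c) = 2 *\<^sub>R (\<Sum>c\<in>Basis. (x \<bullet> c) *\<^sub>R c)"
      by (simp add: scaleR_sum_right)
    then show ?thesis
      using flip[OF finite_Basis subset_refl that] by (simp add: euclidean_representation scaleR_2)
  qed
  have "B \<subseteq> cball 0 (diameter A / 2)"
  proof
    fix x assume "x \<in> B"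
    then have "dist x (- x) \<le> diameter A" using neg B(3) by blast
    moreover have "dist x (- x) = 2 * norm x" by (simp add: dist_norm flip: scaleR_2)
    ultimately show "x \<in> cball 0 (diameter A / 2)" by simp
  qed
  then have "emeasure lborel B \<le> emeasure lborel (cball 0 (diameter A / 2) :: 'a set)"
    by (intro emeasure_mono) auto
  then have "emeasure lborel A \<le> emeasure lborel (cball 0 (diameter A / 2) :: 'a set)"
    by (simp add: B(2))
  also have "\<dots> = ennreal (unit_ball_vol (real DIM('a)) * (diameter A / 2) ^ DIM('a))"
    using diameter_ge_0[OF A(2)] by (intro emeasure_cball) simp
  finally show ?thesis .
qed

section \<open>Lipschitz images, and agreement of Hausdorff with Lebesgue measure in full
  dimension\<close>

lemma hausdorff_outer_lipschitz:
  fixes f :: "'a::metric_space \<Rightarrow> 'b::metric_space"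
  assumes f: "\<And>x y. x \<in> A \<Longrightarrow> y \<in> A \<Longrightarrow> dist (f x) (f y) \<le> L * dist x y" and L: "0 < L"
  shows "hausdorff_outer k (f ` A) \<le> ennreal (L ^ k) * hausdorff_outer k A"
  unfolding hausdorff_outer_def[of k "f ` A"]
proof (rule SUP_least)
  fix \<delta> :: real assume "\<delta> \<in> {0<..}"
  then have \<delta>: "0 < \<delta>" by simp
  have c: "ennreal (L ^ k) * ennreal (1 / L ^ k) = 1"
    using L by (simp flip: ennreal_mult')
  \<comment> \<open>The constant is moved to the left so that the infimum over the covers of A can
    be estimated cover by cover.\<close>
  have "ennreal (1 / L ^ k) * hausdorff_pre k \<delta> (f ` A) \<le> hausdorff_pre k (\<delta> / L) A"
    unfolding hausdorff_pre_def[of k "\<delta> / L"]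
  proof (rule INF_greatest)
    fix U :: "nat \<Rightarrow> 'a set" assume "U \<in> covers (\<delta> / L) A"
    then have U: "A \<subseteq> (\<Union>i. U i)" "\<And>i. bounded (U i)" "\<And>i. diameter (U i) \<le> \<delta> / L" by auto
    define V where "V i = f ` (U i \<inter> A)" for i
    have dV: "dist x y \<le> L * diameter (U i)" if xy: "x \<in> V i" "y \<in> V i" for x y i
    proof -
      obtain u v where uv: "x = f u" "y = f v" "u \<in> U i" "u \<in> A" "v \<in> U i" "v \<in> A"
        using xy unfolding V_def by blast
      have "dist (f u) (f v) \<le> L * dist u v" using f uv by blast
      also have "\<dots> \<le> L * diameter (U i)"
        using L uv diameter_bounded_bound[OF U(2)] by (intro mult_left_mono) auto
      finally show ?thesis using uv by simp
    qed
    have bV: "bounded (V i)" for i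
      unfolding bounded_two_points using dV by blast
    have diamV: "diameter (V i) \<le> L * diameter (U i)" for i
    proof (cases "V i = {}")
      case True then show ?thesis using L diameter_ge_0[OF U(2)] by (simp add: diameter_def)
    next
      case False then show ?thesis
        unfolding diameter_def[of "V i"] using dV by (auto intro!: cSUP_least)
    qed
    have wV: "hausdorff_weight k (V i) \<le> ennreal (L ^ k) * hausdorff_weight k (U i)" for i
    proof (cases "V i = {}")
      case False
      then have "U i \<noteq> {}" by (auto simp: V_def)
      have "(diameter (V i) / 2) ^ k \<le> (L * diameter (U i) / 2) ^ k"
        using diamV[of i] diameter_ge_0[OF bV] by (intro power_mono) auto
      also have "\<dots> = L ^ k * (diameter (U i) / 2) ^ k" by (simp add: power_mult_distrib power_divide)
      finally have "unit_ball_vol (real k) * (diameter (V i) / 2) ^ k \<le> L ^ k * (unit_ball_vol (real k) * (diameter (U i) / 2) ^ k)"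
        by (simp add: mult.left_commute mult_left_mono)
      then show ?thesis using False \<open>U i \<noteq> {}\<close> L
        by (simp add: hausdorff_weight_def ennreal_leI flip: ennreal_mult')
    qed simp
    have "hausdorff_pre k \<delta> (f ` A) \<le> (\<Sum>i. hausdorff_weight k (V i))"
    proof (rule hausdorff_pre_le_cover)
      show "f ` A \<subseteq> (\<Union>i. V i)" using U(1) by (fastforce simp: V_def)
      show "diameter (V i) \<le> \<delta>" for i
        using diamV[of i] U(3)[of i] L by (simp add: field_simps)
    qed (rule bV)
    also have "\<dots> \<le> (\<Sum>i. ennreal (L ^ k) * hausdorff_weight k (U i))"
      by (intro suminf_le wV) auto
    also have "\<dots> = ennreal (L ^ k) * (\<Sum>i. hausdorff_weight k (U i))" by simp
    finally have "ennreal (1 / L ^ k) * hausdorff_pre k \<delta> (f ` A)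
        \<le> ennreal (1 / L ^ k) * (ennreal (L ^ k) * (\<Sum>i. hausdorff_weight k (U i)))"
      by (rule mult_left_mono) simp
    then show "ennreal (1 / L ^ k) * hausdorff_pre k \<delta> (f ` A) \<le> (\<Sum>i. hausdorff_weight k (U i))"
      using c by (simp add: mult.assoc[symmetric] mult.commute)
  qed
  also have "\<dots> \<le> hausdorff_outer k A" using \<delta> L by (intro hausdorff_pre_le_outer) simp
  finally have "ennreal (L ^ k) * (ennreal (1 / L ^ k) * hausdorff_pre k \<delta> (f ` A)) \<le> ennreal (L ^ k) * hausdorff_outer k A"
    by (rule mult_left_mono) simp
  then show "hausdorff_pre k \<delta> (f ` A) \<le> ennreal (L ^ k) * hausdorff_outer k A"
    using c by (simp add: mult.assoc[symmetric])
qed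

lemma hausdorff_weight_cball:
  fixes c :: "'a::euclidean_space"
  assumes "0 \<le> r"
  shows "hausdorff_weight DIM('a) (cball c r) = emeasure lborel (cball c r)"
  using assms by (simp add: hausdorff_weight_def emeasure_cball)

text \<open>Passing to closures makes a cover measurable without changing diameters; then the
  isodiametric inequality bounds the volume of each piece by its weight.\<close>

lemma lborel_le_hausdorff_outer:
  fixes A :: "'a::euclidean_space set"
  assumes [measurable]: "A \<in> sets borel"
  shows "emeasure lborel A \<le> hausdorff_outer DIM('a) A"
proof -
  have "emeasure lborel A \<le> hausdorff_pre DIM('a) 1 A"
    unfolding hausdorff_pre_def
  proof (rule INF_greatest)
    fix U :: "nat \<Rightarrow> 'a set" assume "U \<in> covers 1 A"
    then have U: "A \<subseteq> (\<Union>i. U i)" "\<And>i. bounded (U i)" by auto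
    have "emeasure lborel A \<le> emeasure lborel (\<Union>i. closure (U i))"
    proof (rule emeasure_mono)
      show "A \<subseteq> (\<Union>i. closure (U i))" using U(1) closure_subset by blast
    qed auto
    also have "\<dots> \<le> (\<Sum>i. emeasure lborel (closure (U i)))"
      by (rule emeasure_subadditive_countably) auto
    also have "\<dots> \<le> (\<Sum>i. hausdorff_weight DIM('a) (U i))"
    proof (intro suminf_le)
      fix i
      show "emeasure lborel (closure (U i)) \<le> hausdorff_weight DIM('a) (U i)"
      proof (cases "U i = {}")
        case False
        have "emeasure lborel (closure (U i))
            \<le> ennreal (unit_ball_vol (real DIM('a)) * (diameter (closure (U i)) / 2) ^ DIM('a))"
          by (rule isodiametric[OF borel_closed[OF closed_closure] bounded_closure[OF U(2)]])
        then show ?thesis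
          using False unfolding hausdorff_weight_def by (simp only: diameter_closure[OF U(2)] if_False)
      qed simp
    qed auto
    finally show "emeasure lborel A \<le> (\<Sum>i. hausdorff_weight DIM('a) (U i))" .
  qed
  also have "\<dots> \<le> hausdorff_outer DIM('a) A" by (rule hausdorff_pre_le_outer) simp
  finally show ?thesis .
qed

lemma nn_integral_disjoint_cballs:
  fixes a :: "'i \<Rightarrow> 'a::euclidean_space"
  assumes "countable C" "pairwise (\<lambda>i j. disjnt (cball (a i) (r i)) (cball (a j) (r j))) C"
    and "\<And>i. i \<in> C \<Longrightarrow> cball (a i) (r i) \<subseteq> S" "S \<in> sets lborel"
  shows "(\<integral>\<^sup>+i. emeasure lborel (cball (a i) (r i)) \<partial>count_space C) \<le> emeasure lborel S"
proof -
  have "disjoint_family_on (\<lambda>i. cball (a i) (r i)) C"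
    using assms(2) by (auto simp: pairwise_def disjnt_def disjoint_family_on_def)
  then have "(\<integral>\<^sup>+i. emeasure lborel (cball (a i) (r i)) \<partial>count_space C) = emeasure lborel (\<Union>i\<in>C. cball (a i) (r i))"
    using assms by (intro emeasure_UN_countable[symmetric]) auto
  also have "\<dots> \<le> emeasure lborel S" using assms by (intro emeasure_mono) auto
  finally show ?thesis .
qed

text \<open>A crude bound that serves to make Lebesgue null sets Hausdorff null: disjoint balls
  inside the open set are enlarged five times to cover A, at the price of the factor 5 to the power
  of the dimension.\<close>

lemma hausdorff_pre_le_open:
  fixes A :: "'a::euclidean_space set"
  assumes O: "open O'" "A \<subseteq> O'" and \<delta>: "0 < \<delta>"
  shows "hausdorff_pre DIM('a) \<delta> A \<le> ennreal (5 ^ DIM('a)) * emeasure lborel O'"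
proof -
  \<comment> \<open>The radius is at most \<delta> / 10 because the enlarged balls of radius 5 r
    must have diameter at most \<delta>.\<close>
  have "\<exists>r. 0 < r \<and> r \<le> \<delta> / 10 \<and> cball x r \<subseteq> O'" if x: "x \<in> A" for x
  proof -
    obtain e where "0 < e" "cball x e \<subseteq> O'" using O x by (meson open_contains_cball subsetD)
    then show ?thesis using \<delta> by (intro exI[of _ "min e (\<delta> / 10)"]) (auto simp: subset_iff)
  qed
  then obtain r where r: "\<And>x. x \<in> A \<Longrightarrow> 0 < r x \<and> r x \<le> \<delta> / 10 \<and> cball x (r x) \<subseteq> O'" by metis
  obtain C where C: "countable C" "C \<subseteq> A" "pairwise (\<lambda>i j. disjnt (cball i (r i)) (cball j (r j))) C"
    "A \<subseteq> (\<Union>i\<in>C. cball i (5 * r i))"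
  proof (rule Vitali_covering_lemma_cballs[where S=A and K=A and a="\<lambda>x. x" and r=r and B="\<delta> / 10"])
    show "A \<subseteq> (\<Union>i\<in>A. cball i (r i))" using r by (fastforce intro: less_imp_le)
    show "0 < r i \<and> r i \<le> \<delta> / 10" if "i \<in> A" for i using r that by blast
  qed (rule that)
  have rC: "0 < r i" "10 * r i \<le> \<delta>" "cball i (r i) \<subseteq> O'" if "i \<in> C" for i
    using r[OF subsetD[OF C(2) that]] by simp_all
  have "hausdorff_pre DIM('a) \<delta> A \<le> (\<integral>\<^sup>+i. hausdorff_weight DIM('a) (cball i (5 * r i)) \<partial>count_space C)"
    using C rC \<delta> by (intro hausdorff_pre_le_countable_cover) (auto simp: not_less)
  also have "\<dots> = (\<integral>\<^sup>+i. ennreal (5 ^ DIM('a)) * emeasure lborel (cball i (r i)) \<partial>count_space C)"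
  proof (rule nn_integral_cong)
    fix i assume "i \<in> space (count_space C)"
    then have "0 < r i" using rC by simp
    then show "hausdorff_weight DIM('a) (cball i (5 * r i)) = ennreal (5 ^ DIM('a)) * emeasure lborel (cball i (r i))"
      by (simp add: hausdorff_weight_cball emeasure_cball power_mult_distrib mult_ac flip: ennreal_mult')
  qed
  also have "\<dots> = ennreal (5 ^ DIM('a)) * (\<integral>\<^sup>+i. emeasure lborel (cball i (r i)) \<partial>count_space C)"
    by (rule nn_integral_cmult) simp
  also have "\<dots> \<le> ennreal (5 ^ DIM('a)) * emeasure lborel O'"
    using C rC O by (intro mult_left_mono nn_integral_disjoint_cballs) auto
  finally show ?thesis .
qed

lemma hausdorff_pre_null:
  fixes N :: "'a::euclidean_space set"
  assumes N: "N \<in> sets borel" "emeasure lborel N = 0" and \<delta>: "0 < \<delta>"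
  shows "hausdorff_pre DIM('a) \<delta> N = 0"
proof -
  have "hausdorff_pre DIM('a) \<delta> N \<le> 0 + ennreal e" if e: "0 < e" for e
  proof -
    obtain U where U: "open U" "N \<subseteq> U" "emeasure lborel (U - N) < ennreal (e / 5 ^ DIM('a))"
      using outer_regular_lborel[OF N(1), of "e / 5 ^ DIM('a)"] e by (metis divide_pos_pos zero_less_numeral zero_less_power)
    have "emeasure lborel U = emeasure lborel N + emeasure lborel (U - N)"
      using U N by (subst plus_emeasure) (auto simp: Un_absorb1)
    then have "emeasure lborel U \<le> ennreal (e / 5 ^ DIM('a))" using U N by simp
    then have "ennreal (5 ^ DIM('a)) * emeasure lborel U \<le> ennreal (5 ^ DIM('a)) * ennreal (e / 5 ^ DIM('a))"
      by (rule mult_left_mono) simp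
    also have "\<dots> = ennreal e" by (simp flip: ennreal_mult')
    finally show ?thesis using hausdorff_pre_le_open[OF U(1,2) \<delta>] by simp
  qed
  then show ?thesis using ennreal_le_epsilon[of 0] by fastforce
qed

text \<open>Vitali's theorem fills A up to a null set by small disjoint balls inside an open set of
  almost the same volume. For balls weight and volume coincide, so the factor of the crude bound
  affects the null remainder alone.\<close>

lemma hausdorff_outer_le_lborel:
  fixes A :: "'a::euclidean_space set"
  assumes A: "A \<in> sets borel"
  shows "hausdorff_outer DIM('a) A \<le> emeasure lborel A"
  unfolding hausdorff_outer_def
proof (rule SUP_least)
  fix \<delta> :: real assume "\<delta> \<in> {0<..}"
  then have \<delta>: "0 < \<delta>" by simp
  show "hausdorff_pre DIM('a) \<delta> A \<le> emeasure lborel A"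
  proof (rule ennreal_le_epsilon)
    fix e :: real assume e: "0 < e"
    obtain U where U: "open U" "A \<subseteq> U" "emeasure lborel (U - A) < ennreal e"
      using outer_regular_lborel[OF A e] by blast
    define K where "K = {(x, r). 0 < r \<and> r \<le> \<delta> / 2 \<and> cball x r \<subseteq> U}"
    obtain C where C: "countable C" "C \<subseteq> K"
      "pairwise (\<lambda>i j. disjnt (cball (fst i) (snd i)) (cball (fst j) (snd j))) C"
      "negligible (A - (\<Union>i\<in>C. cball (fst i) (snd i)))"
    proof (rule Vitali_covering_theorem_cballs[where K=K and r=snd and S=A and a=fst])
      show "\<exists>i. i \<in> K \<and> x \<in> cball (fst i) (snd i) \<and> snd i < d" if x: "x \<in> A" "0 < d" for x d
      proof -
        obtain r where "0 < r" "cball x r \<subseteq> U" using U x by (meson open_contains_cball subsetD)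
        then show ?thesis using \<delta> x
          by (intro exI[of _ "(x, min r (min (\<delta> / 2) (d / 2)))"]) (auto simp: K_def subset_iff)
      qed
      show "0 < snd i" if "i \<in> K" for i using that by (simp add: K_def split_beta)
    qed (rule that)
    let ?B = "\<Union>i\<in>C. cball (fst i) (snd i)"
    have B: "?B \<in> sets borel" using C(1) by (intro sets.countable_UN'') auto
    have KC: "0 < snd i" "2 * snd i \<le> \<delta>" "cball (fst i) (snd i) \<subseteq> U" if "i \<in> C" for i
      using subsetD[OF C(2) that] by (simp_all add: K_def split_beta)
    have "emeasure lborel (A - ?B) = 0"
      using C(4) A B by (simp add: negligible_iff_emeasure0 emeasure_completion)
    then have null: "hausdorff_pre DIM('a) \<delta> (A - ?B) = 0"
      using A B \<delta> by (intro hausdorff_pre_null) auto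
    have "hausdorff_pre DIM('a) \<delta> ?B \<le> (\<integral>\<^sup>+i. hausdorff_weight DIM('a) (cball (fst i) (snd i)) \<partial>count_space C)"
      using C KC \<delta> by (intro hausdorff_pre_le_countable_cover) (auto simp: not_less)
    also have "\<dots> = (\<integral>\<^sup>+i. emeasure lborel (cball (fst i) (snd i)) \<partial>count_space C)"
      using KC by (intro nn_integral_cong hausdorff_weight_cball) (auto intro: less_imp_le)
    also have "\<dots> \<le> emeasure lborel U"
      using C KC U by (intro nn_integral_disjoint_cballs) auto
    also have "\<dots> = emeasure lborel A + emeasure lborel (U - A)"
      using U A by (subst plus_emeasure) (auto simp: Un_absorb1)
    also have "\<dots> \<le> emeasure lborel A + ennreal e"
      using U(3) by (intro add_left_mono) (rule less_imp_le)
    finally have ball: "hausdorff_pre DIM('a) \<delta> ?B \<le> emeasure lborel A + ennreal e" .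
    have "hausdorff_pre DIM('a) \<delta> A \<le> hausdorff_pre DIM('a) \<delta> (\<Union>n. binaryset ?B (A - ?B) n)"
      by (rule hausdorff_pre_mono) (auto simp: UN_binaryset_eq)
    also have "\<dots> \<le> (\<Sum>n. hausdorff_pre DIM('a) \<delta> (binaryset ?B (A - ?B) n))"
      using \<delta> by (intro hausdorff_pre_subadditive) simp
    also have "\<dots> = hausdorff_pre DIM('a) \<delta> ?B + hausdorff_pre DIM('a) \<delta> (A - ?B)"
      using \<delta> by (intro suminf_binaryset_eq hausdorff_pre_null) auto
    finally show "hausdorff_pre DIM('a) \<delta> A \<le> emeasure lborel A + ennreal e"
      using ball null by simp
  qed
qed

theorem hausdorff_outer_eq_lborel:
  fixes A :: "'a::euclidean_space set"
  assumes "A \<in> sets borel"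
  shows "hausdorff_outer DIM('a) A = emeasure lborel A"
  using hausdorff_outer_le_lborel[OF assms] lborel_le_hausdorff_outer[OF assms] by (rule antisym)

text \<open>Serves the one-dimensional torus, where surface measure has dimension 0: a nonempty set
  then has weight 1, whatever its diameter.\<close>

lemma hausdorff_outer_0_singleton: "hausdorff_outer 0 {x :: 'a::metric_space} = 1"
proof -
  have "hausdorff_pre 0 \<delta> {x} = 1" if "0 < \<delta>" for \<delta> :: real
  proof (rule antisym)
    have "hausdorff_pre 0 \<delta> {x} \<le> (\<integral>\<^sup>+i. hausdorff_weight 0 {x} \<partial>count_space {x})"
      using that by (intro hausdorff_pre_le_countable_cover) auto
    then show "hausdorff_pre 0 \<delta> {x} \<le> 1"
      by (simp add: nn_integral_count_space_finite hausdorff_weight_def)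
    show "1 \<le> hausdorff_pre 0 \<delta> {x}"
      unfolding hausdorff_pre_def
    proof (rule INF_greatest)
      fix U :: "nat \<Rightarrow> 'a set" assume "U \<in> covers \<delta> {x}"
      then obtain i where "x \<in> U i" by auto
      then have "1 = hausdorff_weight 0 (U i)" by (auto simp: hausdorff_weight_def)
      also have "\<dots> = (\<Sum>j\<in>{i}. hausdorff_weight 0 (U j))" by simp
      also have "\<dots> \<le> (\<Sum>j. hausdorff_weight 0 (U j))" by (rule sum_le_suminf) auto
      finally show "1 \<le> (\<Sum>j. hausdorff_weight 0 (U j))" .
    qed
  qed
  then have "hausdorff_outer 0 {x} = (\<Squnion>\<delta>\<in>{0::real<..}. 1)"
    unfolding hausdorff_outer_def by (intro SUP_cong) auto
  then show ?thesis by simp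
qed

section \<open>Periodic functions\<close>

definition lattice :: "int ^ 'n \<Rightarrow> real ^ 'n::finite" where
  "lattice k = (2 * pi) *\<^sub>R (\<chi> i. of_int (k $ i))"

definition torus_cell :: "(real ^ 'n::finite) set" where
  "torus_cell = {x. \<forall>i. 0 \<le> x $ i \<and> x $ i < 2 * pi}"

definition periodic :: "(real ^ 'n::finite \<Rightarrow> 'b) \<Rightarrow> bool" where
  "periodic g \<longleftrightarrow> (\<forall>x k. g (x + lattice k) = g x)"

lemma periodicD: "periodic g \<Longrightarrow> g (x + lattice k) = g x"
  by (simp add: periodic_def)

lemma lattice_zero [simp]: "lattice 0 = 0"
  by (simp add: lattice_def vec_eq_iff)

lemma lattice_minus: "lattice (- k) = - lattice k"
  by (simp add: lattice_def vec_eq_iff)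

lemma lattice_add: "lattice (k + l) = lattice k + lattice l"
  by (simp add: lattice_def vec_eq_iff algebra_simps)

lemma abs_torus_eq_lattice: "abs_torus x = abs_torus y \<longleftrightarrow> (\<exists>k. y = x + lattice k)"
  by (simp add: abs_torus_eq_iff lattice_def)

lemma abs_torus_lattice [simp]: "abs_torus (x + lattice k) = abs_torus x"
  using abs_torus_eq_lattice by metis

lemma periodic_abs_torus: "periodic (\<lambda>x. F (abs_torus x))"
  by (simp add: periodic_def)

lemma periodic_eq: "periodic g \<Longrightarrow> abs_torus x = abs_torus y \<Longrightarrow> g x = g y"
  unfolding abs_torus_eq_lattice by (auto simp: periodicD)

lemma norm_lattice:
  assumes "k \<noteq> (0 :: int ^ 'n::finite)"
  shows "2 * pi \<le> norm (lattice k)"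
proof -
  obtain i where i: "k $ i \<noteq> 0" using assms by (auto simp: vec_eq_iff)
  then have "1 \<le> \<bar>real_of_int (k $ i)\<bar>" by linarith
  then have "2 * pi \<le> \<bar>lattice k $ i\<bar>" by (simp add: lattice_def abs_mult)
  also have "\<dots> \<le> norm (lattice k)" by (rule component_le_norm_cart)
  finally show ?thesis .
qed

lemma torus_cell_measurable [measurable]: "torus_cell \<in> sets borel"
proof -
  have "torus_cell = (\<Inter>i. {x :: real ^ 'n. 0 \<le> x $ i \<and> x $ i < 2 * pi})"
    by (auto simp: torus_cell_def)
  also have "\<dots> \<in> sets borel"
    by (intro sets.countable_INT'' ) (auto intro!: borel_measurable_le borel_measurable_less sets.sets_Collect)
  finally show ?thesis .
qed

lemma ex1_lattice_torus_cell: "\<exists>!k. x + lattice k \<in> torus_cell"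
proof
  have "x + lattice (\<chi> i. - \<lfloor>x $ i / (2 * pi)\<rfloor>) \<in> torus_cell"
    unfolding torus_cell_def
  proof (simp add: lattice_def, rule allI)
    fix i
    show "2 * pi * of_int \<lfloor>x $ i / (2 * pi)\<rfloor> \<le> x $ i \<and> x $ i - 2 * pi * of_int \<lfloor>x $ i / (2 * pi)\<rfloor> < 2 * pi"
      using floor_divide_lower[of "2 * pi" "x $ i"] floor_divide_upper[of "2 * pi" "x $ i"]
      by (simp add: algebra_simps)
  qed
  then show "x + lattice (\<chi> i. - \<lfloor>x $ i / (2 * pi)\<rfloor>) \<in> torus_cell" .
  fix k assume k: "x + lattice k \<in> torus_cell"
  show "k = (\<chi> i. - \<lfloor>x $ i / (2 * pi)\<rfloor>)"
  proof (simp add: vec_eq_iff, rule allI)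
    fix i
    have k0: "0 \<le> x $ i + 2 * pi * of_int (k $ i)" "x $ i + 2 * pi * of_int (k $ i) < 2 * pi"
      using k by (auto simp: torus_cell_def lattice_def)
    have "of_int (- k $ i) \<le> x $ i / (2 * pi)"
      using k0 by (subst pos_le_divide_eq) (auto simp: algebra_simps)
    moreover have "x $ i / (2 * pi) < of_int (- k $ i) + 1"
      using k0 by (subst pos_divide_less_eq) (auto simp: algebra_simps)
    ultimately have "\<lfloor>x $ i / (2 * pi)\<rfloor> = - k $ i" by (rule floor_unique)
    then show "k $ i = - \<lfloor>x $ i / (2 * pi)\<rfloor>" by simp
  qed
qed

lemma nn_integral_count_space_ex1:
  assumes "\<exists>!k. P k"
  shows "(\<integral>\<^sup>+k. (if P k then c else 0) \<partial>count_space UNIV) = (c :: ennreal)"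
proof -
  obtain k where k: "P l \<longleftrightarrow> l = k" for l using assms by blast
  have "(\<integral>\<^sup>+k. (if P k then c else 0) \<partial>count_space UNIV) = (\<integral>\<^sup>+l. (if P l then c else 0) \<partial>count_space {k})"
    by (intro nn_integral_count_space_eq) (auto simp: k)
  then show ?thesis by (simp add: nn_integral_count_space_finite k)
qed

text \<open>Exactly one lattice translate of x lies in the cell. Inserting the sum of these
  indicators, exchanging sum and integral, and translating back folds the integral over the whole
  space onto the cell.\<close>

lemma nn_integral_unfold:
  fixes g :: "real ^ 'n::finite \<Rightarrow> ennreal"
  assumes [measurable]: "g \<in> borel_measurable borel"
  shows "(\<integral>\<^sup>+x. g x \<partial>lborel) =
    (\<integral>\<^sup>+x\<in>torus_cell. (\<integral>\<^sup>+k. g (x + lattice k) \<partial>count_space UNIV) \<partial>lborel)"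
proof -
  have "(\<integral>\<^sup>+x. g x \<partial>lborel) =
      (\<integral>\<^sup>+x. (\<integral>\<^sup>+k. g x * indicator torus_cell (x + lattice k) \<partial>count_space UNIV) \<partial>lborel)"
  proof (rule nn_integral_cong)
    fix x
    have "(\<integral>\<^sup>+k. g x * indicator torus_cell (x + lattice k) \<partial>count_space UNIV)
        = (\<integral>\<^sup>+k. (if x + lattice k \<in> torus_cell then g x else 0) \<partial>count_space UNIV)"
      by (intro nn_integral_cong) (simp add: indicator_def)
    then show "g x = (\<integral>\<^sup>+k. g x * indicator torus_cell (x + lattice k) \<partial>count_space UNIV)"
      by (simp add: nn_integral_count_space_ex1[OF ex1_lattice_torus_cell])
  qed
  also have "\<dots> = (\<integral>\<^sup>+k. (\<integral>\<^sup>+x. g x * indicator torus_cell (x + lattice k) \<partial>lborel) \<partial>count_space UNIV)"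
    by (rule nn_integral_count_space_nn_integral) auto
  also have "\<dots> = (\<integral>\<^sup>+k. (\<integral>\<^sup>+x. g (x + lattice (- k)) * indicator torus_cell x \<partial>lborel) \<partial>count_space UNIV)"
  proof (rule nn_integral_cong)
    fix k :: "int ^ 'n"
    have "(\<integral>\<^sup>+x. g x * indicator torus_cell (x + lattice k) \<partial>lborel)
        = (\<integral>\<^sup>+x. (\<lambda>x. g (x + lattice (- k)) * indicator torus_cell x) (x + lattice k) \<partial>lborel)"
      by (intro nn_integral_cong) (simp add: lattice_minus)
    also have "\<dots> = (\<integral>\<^sup>+x. g (x + lattice (- k)) * indicator torus_cell x \<partial>lborel)"
      by (rule nn_integral_lborel_shift) measurable
    finally show "(\<integral>\<^sup>+x. g x * indicator torus_cell (x + lattice k) \<partial>lborel)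
        = (\<integral>\<^sup>+x. g (x + lattice (- k)) * indicator torus_cell x \<partial>lborel)" .
  qed
  also have "\<dots> = (\<integral>\<^sup>+k. (\<integral>\<^sup>+x. g (x + lattice k) * indicator torus_cell x \<partial>lborel) \<partial>count_space UNIV)"
    by (rule nn_integral_bij_count_space) (rule bij_uminus)
  also have "\<dots> = (\<integral>\<^sup>+x. (\<integral>\<^sup>+k. g (x + lattice k) * indicator torus_cell x \<partial>count_space UNIV) \<partial>lborel)"
    by (rule nn_integral_count_space_nn_integral[symmetric]) auto
  also have "\<dots> = (\<integral>\<^sup>+x\<in>torus_cell. (\<integral>\<^sup>+k. g (x + lattice k) \<partial>count_space UNIV) \<partial>lborel)"
    by (intro nn_integral_cong) (simp add: nn_integral_multc)
  finally show ?thesis .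
qed

text \<open>The translated cell is another fundamental domain: unfolding its integral leaves exactly
  one lattice translate over each x.\<close>

lemma nn_integral_torus_cell_shift:
  fixes g :: "real ^ 'n::finite \<Rightarrow> ennreal"
  assumes [measurable]: "g \<in> borel_measurable borel" and per: "periodic g"
  shows "(\<integral>\<^sup>+x\<in>torus_cell. g (x + a) \<partial>lborel) = (\<integral>\<^sup>+x\<in>torus_cell. g x \<partial>lborel)"
proof -
  have "(\<integral>\<^sup>+x\<in>torus_cell. g (x + a) \<partial>lborel) =
      (\<integral>\<^sup>+x. (\<lambda>x. g x * indicator torus_cell (x - a)) (x + a) \<partial>lborel)"
    by simp
  also have "\<dots> = (\<integral>\<^sup>+x. g x * indicator torus_cell (x - a) \<partial>lborel)"
    by (rule nn_integral_lborel_shift) measurable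
  also have "\<dots> = (\<integral>\<^sup>+x\<in>torus_cell. (\<integral>\<^sup>+k. g (x + lattice k) * indicator torus_cell (x + lattice k - a) \<partial>count_space UNIV) \<partial>lborel)"
    by (rule nn_integral_unfold) measurable
  also have "\<dots> = (\<integral>\<^sup>+x\<in>torus_cell. g x \<partial>lborel)"
  proof (intro nn_integral_cong arg_cong2[where f="(*)"] refl)
    fix x
    have "(\<integral>\<^sup>+k. g (x + lattice k) * indicator torus_cell (x + lattice k - a) \<partial>count_space UNIV)
        = (\<integral>\<^sup>+k. (if (x - a) + lattice k \<in> torus_cell then g x else 0) \<partial>count_space UNIV)"
      by (intro nn_integral_cong) (simp add: indicator_def periodicD[OF per] algebra_simps)
    also have "\<dots> = g x" by (rule nn_integral_count_space_ex1[OF ex1_lattice_torus_cell])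
    finally show "(\<integral>\<^sup>+k. g (x + lattice k) * indicator torus_cell (x + lattice k - a) \<partial>count_space UNIV) = g x" .
  qed
  finally show ?thesis .
qed

lemma emeasure_torus_cell:
  "emeasure lborel (torus_cell :: (real ^ 'n::finite) set) = ennreal ((2 * pi) ^ CARD('n))"
proof -
  define c :: "real ^ 'n" where "c = (\<chi> i. 2 * pi)"
  have c: "(\<Prod>b\<in>Basis. (c - 0) \<bullet> b) = (2 * pi) ^ CARD('n)"
  proof -
    have "(\<Prod>b\<in>Basis. (c - 0) \<bullet> b) = (\<Prod>b\<in>(Basis :: (real ^ 'n) set). 2 * pi)"
      by (rule prod.cong) (auto simp: c_def Basis_vec_def inner_axis)
    then show ?thesis by simp
  qed
  have le: "0 \<bullet> b \<le> c \<bullet> b" if "b \<in> Basis" for b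
    using that by (auto simp: c_def Basis_vec_def inner_axis)
  have "box 0 c \<subseteq> torus_cell" "torus_cell \<subseteq> cbox 0 c"
    by (simp_all add: torus_cell_def mem_box_cart c_def subset_iff less_imp_le)
  then have "emeasure lborel (box 0 c) \<le> emeasure lborel (torus_cell :: (real ^ 'n) set)"
    "emeasure lborel (torus_cell :: (real ^ 'n) set) \<le> emeasure lborel (cbox 0 c)"
    by (auto intro: emeasure_mono)
  then show ?thesis
    using le c by (simp add: emeasure_lborel_box emeasure_lborel_cbox)
qed

lemma compact_torus: "compact (UNIV :: 'n::finite torus set)"
proof -
  have "(UNIV :: 'n torus set) = abs_torus ` cbox 0 (\<chi> i. 2 * pi)"
  proof (safe)
    fix p :: "'n torus"
    obtain k where "rep_torus p + lattice k \<in> torus_cell" using ex1_lattice_torus_cell by blast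
    then have "rep_torus p + lattice k \<in> cbox 0 (\<chi> i. 2 * pi)"
      by (simp add: torus_cell_def mem_box_cart less_imp_le)
    moreover have "p = abs_torus (rep_torus p + lattice k)" by simp
    ultimately show "p \<in> abs_torus ` cbox 0 (\<chi> i. 2 * pi)" by blast
  qed auto
  moreover have "compact (abs_torus ` cbox 0 (\<chi> i. 2 * pi) :: 'n torus set)"
    by (rule compact_continuous_image[OF continuous_on_subset[OF continuous_abs_torus subset_UNIV] compact_cbox])
  ultimately show ?thesis by metis
qed

lemma dist_abs_torus_le: "dist (abs_torus x) (abs_torus y) \<le> dist x y"
  unfolding dist_torus_def by (rule setdist_le_dist) auto

lemma dist_torus_attained:
  fixes x :: "real ^ 'n::finite"
  obtains y where "abs_torus y = q" "dist (abs_torus x) q = dist x y"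
proof -
  have "{y. abs_torus y = q} \<noteq> {}" using abs_rep_torus[of q] by blast
  then obtain y where "abs_torus y = q" "dist x y = setdist {x} {y. abs_torus y = q}"
    using setdist_compact_closed[of "{x}" "{y. abs_torus y = q}"] closed_torus_fibre[of q] by auto
  then show thesis using that by (simp add: dist_abs_torus)
qed

text \<open>Any other lift of the second point is at least 2 pi away from y, hence at least pi from
  x, so y itself is a nearest lift.\<close>

lemma dist_abs_torus_eq:
  fixes x y :: "real ^ 'n::finite"
  assumes "dist x y \<le> pi"
  shows "dist (abs_torus x) (abs_torus y) = dist x y"
proof -
  obtain z where z: "abs_torus z = abs_torus y" "dist (abs_torus x) (abs_torus y) = dist x z"
    by (rule dist_torus_attained)
  then obtain k where k: "z = y + lattice k" by (metis abs_torus_eq_lattice)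
  have "dist x y \<le> dist x z"
  proof (cases "k = 0")
    case False
    have "2 * pi \<le> dist y z" using norm_lattice[OF False] by (simp add: k dist_norm)
    also have "\<dots> \<le> dist x y + dist x z" by (metis dist_commute dist_triangle)
    finally show ?thesis using assms by simp
  qed (simp add: k)
  then show ?thesis using z(2) dist_abs_torus_le[of x y] by simp
qed

lemma abs_torus_inj_ball:
  fixes x y :: "real ^ 'n::finite"
  assumes "abs_torus x = abs_torus y" "dist x y < 2 * pi"
  shows "x = y"
proof -
  obtain k where k: "y = x + lattice k" using assms abs_torus_eq_lattice by blast
  then have "k = 0" using norm_lattice[of k] assms(2) by (auto simp: dist_norm)
  then show ?thesis using k by simp
qed

text \<open>From right to left: every q has a lift at the same distance from a chosen lift of p, so
  the radius of continuity transfers unchanged.\<close>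

lemma continuous_on_torus_iff:
  fixes F :: "'n::finite torus \<Rightarrow> 'b::metric_space"
  shows "continuous_on UNIV F \<longleftrightarrow> continuous_on UNIV (\<lambda>x. F (abs_torus x))"
proof
  assume "continuous_on UNIV F"
  then show "continuous_on UNIV (\<lambda>x. F (abs_torus x))"
    by (rule continuous_on_compose2[OF _ continuous_abs_torus]) auto
next
  assume *: "continuous_on UNIV (\<lambda>x. F (abs_torus x))"
  show "continuous_on UNIV F"
    unfolding continuous_on_iff
  proof safe
    fix p :: "'n torus" and e :: real assume e: "0 < e"
    obtain d where d: "0 < d" "\<And>y. dist y (rep_torus p) < d \<Longrightarrow> dist (F (abs_torus y)) (F p) < e"
      using * e unfolding continuous_on_iff by (metis UNIV_I abs_rep_torus)
    have "dist (F q) (F p) < e" if "dist q p < d" for q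
    proof -
      obtain y where "abs_torus y = q" "dist (abs_torus (rep_torus p)) q = dist (rep_torus p) y"
        by (rule dist_torus_attained)
      then show ?thesis using d(2)[of y] that by (simp add: dist_commute)
    qed
    then show "\<exists>d>0. \<forall>x'\<in>UNIV. dist x' p < d \<longrightarrow> dist (F x') (F p) < e" using d(1) by auto
  qed
qed

lemma abs_torus_measurable [measurable]: "abs_torus \<in> borel \<rightarrow>\<^sub>M borel"
  using continuous_abs_torus by (rule borel_measurable_continuous_onI)

lemma periodic_factor:
  assumes "periodic g"
  shows "g (rep_torus (abs_torus x)) = g x"
  by (rule periodic_eq[OF assms]) simp

lemma periodic_continuous_factor:
  fixes g :: "real ^ 'n::finite \<Rightarrow> 'b::metric_space"
  assumes "periodic g" "continuous_on UNIV g"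
  shows "continuous_on UNIV (\<lambda>p. g (rep_torus p))"
  unfolding continuous_on_torus_iff using assms by (simp add: periodic_factor)

lemma periodic_uniformly_continuous:
  fixes g :: "real ^ 'n::finite \<Rightarrow> 'b::metric_space"
  assumes "periodic g" "continuous_on UNIV g" "0 < e"
  obtains d where "0 < d" "\<And>x y. dist x y < d \<Longrightarrow> dist (g x) (g y) < e"
proof -
  have "uniformly_continuous_on UNIV (\<lambda>p. g (rep_torus p))"
    using periodic_continuous_factor[OF assms(1,2)] compact_torus by (rule compact_uniformly_continuous)
  then obtain d where "0 < d" and d: "\<And>p q. dist p q < d \<Longrightarrow> dist (g (rep_torus p)) (g (rep_torus q)) < e"
    using assms(3) unfolding uniformly_continuous_on_def by (metis UNIV_I)
  have "dist (g x) (g y) < e" if "dist x y < d" for x y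
    using d[of "abs_torus x" "abs_torus y"] dist_abs_torus_le[of x y] that
    by (simp add: periodic_factor[OF assms(1)])
  then show thesis using that \<open>0 < d\<close> by blast
qed

lemma periodic_bounded:
  fixes g :: "real ^ 'n::finite \<Rightarrow> real"
  assumes "periodic g" "continuous_on UNIV g"
  obtains B where "\<And>x. \<bar>g x\<bar> \<le> B"
proof -
  have "bounded (range (\<lambda>p. g (rep_torus p)))"
    using periodic_continuous_factor[OF assms] compact_torus
    by (intro compact_imp_bounded compact_continuous_image)
  then obtain B where "\<And>p. \<bar>g (rep_torus p)\<bar> \<le> B" by (auto simp: bounded_iff)
  then have "\<bar>g x\<bar> \<le> B" for x using periodic_factor[OF assms(1), of x] by metis
  then show thesis using that by blast
qed

section \<open>Equidistribution of the linear flow\<close>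

definition time_mean :: "real ^ 'n::finite \<Rightarrow> (real ^ 'n \<Rightarrow> real) \<Rightarrow> real \<Rightarrow> real" where
  "time_mean \<omega> g L = (LINT t:{0..L}|lborel. g (t *\<^sub>R \<omega>)) / L"

definition cell_mean :: "(real ^ 'n::finite \<Rightarrow> real) \<Rightarrow> real" where
  "cell_mean g = (LINT x:torus_cell|lborel. g x) / (2 * pi) ^ CARD('n)"

definition equidistributed :: "real ^ 'n::finite \<Rightarrow> (real ^ 'n \<Rightarrow> real) \<Rightarrow> bool" where
  "equidistributed \<omega> g \<longleftrightarrow> (time_mean \<omega> g \<longlongrightarrow> cell_mean g) at_top"

lemma set_integrable_bounded:
  fixes g :: "'a \<Rightarrow> real"
  assumes A: "A \<in> sets M" "emeasure M A < top" and g: "g \<in> borel_measurable M" "\<And>x. \<bar>g x\<bar> \<le> B"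
  shows "set_integrable M A g"
  unfolding set_integrable_def
proof (rule Bochner_Integration.integrable_bound)
  show "integrable M (\<lambda>x. B * indicator A x)" using A by simp
  show "(\<lambda>x. indicator A x *\<^sub>R g x) \<in> borel_measurable M" using A g by measurable
  show "AE x in M. norm (indicator A x *\<^sub>R g x) \<le> norm (B * indicator A x)"
    using g(2) by (auto simp: indicator_def intro!: AE_I2) (meson abs_ge_self order_trans)
qed

lemma set_integrable_time:
  fixes g :: "real ^ 'n::finite \<Rightarrow> real"
  assumes "g \<in> borel_measurable borel" "\<And>x. \<bar>g x\<bar> \<le> B"
  shows "set_integrable lborel {0..L} (\<lambda>t. g (t *\<^sub>R \<omega>))"
  using assms by (intro set_integrable_bounded[where B=B]) (auto simp: emeasure_lborel_Icc_eq)

lemma set_integrable_cell: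
  fixes g :: "real ^ 'n::finite \<Rightarrow> real"
  assumes "g \<in> borel_measurable borel" "\<And>x. \<bar>g x\<bar> \<le> B"
  shows "set_integrable lborel torus_cell g"
  using assms by (intro set_integrable_bounded[where B=B]) (auto simp: emeasure_torus_cell)

lemma cell_mean_const [simp]: "cell_mean (\<lambda>x :: real ^ 'n::finite. c) = c"
  by (simp add: cell_mean_def set_lebesgue_integral_def measure_def emeasure_torus_cell)

lemma time_mean_const: "0 < L \<Longrightarrow> time_mean \<omega> (\<lambda>x. c) L = c"
  by (simp add: time_mean_def set_lebesgue_integral_def)

lemma cell_mean_add:
  fixes f g :: "real ^ 'n::finite \<Rightarrow> real"
  assumes "f \<in> borel_measurable borel" "\<And>x. \<bar>f x\<bar> \<le> B" "g \<in> borel_measurable borel" "\<And>x. \<bar>g x\<bar> \<le> C"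
  shows "cell_mean (\<lambda>x. f x + g x) = cell_mean f + cell_mean g"
  using set_integrable_cell[OF assms(1,2)] set_integrable_cell[OF assms(3,4)]
  by (simp add: cell_mean_def add_divide_distrib)

lemma time_mean_add:
  assumes "f \<in> borel_measurable borel" "\<And>x. \<bar>f x\<bar> \<le> B" "g \<in> borel_measurable borel" "\<And>x. \<bar>g x\<bar> \<le> C"
  shows "time_mean \<omega> (\<lambda>x. f x + g x) L = time_mean \<omega> f L + time_mean \<omega> g L"
  using set_integrable_time[OF assms(1,2)] set_integrable_time[OF assms(3,4)]
  by (simp add: time_mean_def add_divide_distrib)

lemma cell_mean_mono:
  fixes f g :: "real ^ 'n::finite \<Rightarrow> real"
  assumes "f \<in> borel_measurable borel" "\<And>x. \<bar>f x\<bar> \<le> B" "g \<in> borel_measurable borel" "\<And>x. \<bar>g x\<bar> \<le> C"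
    and "\<And>x. f x \<le> g x"
  shows "cell_mean f \<le> cell_mean g"
  using set_integrable_cell[OF assms(1,2)] set_integrable_cell[OF assms(3,4)] assms(5)
  unfolding cell_mean_def by (intro divide_right_mono set_integral_mono) auto

lemma time_mean_mono:
  assumes "f \<in> borel_measurable borel" "\<And>x. \<bar>f x\<bar> \<le> B" "g \<in> borel_measurable borel" "\<And>x. \<bar>g x\<bar> \<le> C"
    and "\<And>x. f x \<le> g x" "0 < L"
  shows "time_mean \<omega> f L \<le> time_mean \<omega> g L"
  using set_integrable_time[OF assms(1,2)] set_integrable_time[OF assms(3,4)] assms(5,6)
  unfolding time_mean_def by (intro divide_right_mono set_integral_mono) auto

lemma equidistributed_add:
  assumes "f \<in> borel_measurable borel" "\<And>x. \<bar>f x\<bar> \<le> B" "g \<in> borel_measurable borel" "\<And>x. \<bar>g x\<bar> \<le> C"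
    and "equidistributed \<omega> f" "equidistributed \<omega> g"
  shows "equidistributed \<omega> (\<lambda>x. f x + g x)"
proof -
  have "time_mean \<omega> (\<lambda>x. f x + g x) = (\<lambda>L. time_mean \<omega> f L + time_mean \<omega> g L)"
    by (rule ext) (rule time_mean_add[OF assms(1-4)])
  then show ?thesis
    using assms(5,6) unfolding equidistributed_def
    by (simp add: cell_mean_add[OF assms(1-4)] tendsto_add)
qed

lemma equidistributed_const: "equidistributed \<omega> (\<lambda>x. c)"
  unfolding equidistributed_def
  by (rule tendsto_eventually) (auto simp: time_mean_const intro!: eventually_at_top_linorderI[of 1])

text \<open>Both means are monotone, so the time mean of g is caught between two quantities whose
  limits differ by little.\<close>

lemma equidistributed_sandwich:
  fixes g :: "real ^ 'n::finite \<Rightarrow> real"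
  assumes g: "g \<in> borel_measurable borel" "\<And>x. \<bar>g x\<bar> \<le> B"
    and approx: "\<And>e. 0 < e \<Longrightarrow> \<exists>h1 h2 C. h1 \<in> borel_measurable borel \<and> h2 \<in> borel_measurable borel \<and>
      (\<forall>x. \<bar>h1 x\<bar> \<le> C \<and> \<bar>h2 x\<bar> \<le> C \<and> h1 x \<le> g x \<and> g x \<le> h2 x) \<and>
      equidistributed \<omega> h1 \<and> equidistributed \<omega> h2 \<and> cell_mean h2 - cell_mean h1 \<le> e"
  shows "equidistributed \<omega> g"
  unfolding equidistributed_def tendsto_iff
proof safe
  fix e :: real assume e: "0 < e"
  obtain h1 h2 C where h: "h1 \<in> borel_measurable borel" "h2 \<in> borel_measurable borel"
    "\<And>x. \<bar>h1 x\<bar> \<le> C" "\<And>x. \<bar>h2 x\<bar> \<le> C" "\<And>x. h1 x \<le> g x" "\<And>x. g x \<le> h2 x"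
    "equidistributed \<omega> h1" "equidistributed \<omega> h2" "cell_mean h2 - cell_mean h1 \<le> e / 2"
    using approx[of "e / 2"] e by auto
  have m: "cell_mean h1 \<le> cell_mean g" "cell_mean g \<le> cell_mean h2"
    using cell_mean_mono[OF h(1,3) g h(5)] cell_mean_mono[OF g h(2,4) h(6)] by auto
  have "\<forall>\<^sub>F L in at_top. dist (time_mean \<omega> h1 L) (cell_mean h1) < e / 2"
    "\<forall>\<^sub>F L in at_top. dist (time_mean \<omega> h2 L) (cell_mean h2) < e / 2"
    using e by (auto intro!: tendstoD[where e="e / 2"] h(7,8)[unfolded equidistributed_def] simp del: less_divide_eq_numeral1)
  then show "\<forall>\<^sub>F L in at_top. dist (time_mean \<omega> g L) (cell_mean g) < e"
    using eventually_gt_at_top[of 0]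
  proof eventually_elim
    case (elim L)
    then show ?case
      using time_mean_mono[OF h(1,3) g h(5), of L \<omega>] time_mean_mono[OF g h(2,4) h(6), of L \<omega>] m h(9)
      unfolding dist_real_def by linarith
  qed
qed

text \<open>The phase b covers sines together with cosines, so the algebra stays real; the product
  formula for cosines closes it under multiplication.\<close>

inductive_set trig_poly :: "(real ^ 'n::finite \<Rightarrow> real) set" where
  wave: "(\<lambda>x. a * cos ((\<chi> i. of_int (k $ i)) \<bullet> x + b)) \<in> trig_poly"
| add: "f \<in> trig_poly \<Longrightarrow> g \<in> trig_poly \<Longrightarrow> (\<lambda>x. f x + g x) \<in> trig_poly"

lemma trig_poly_const: "(\<lambda>x. c) \<in> trig_poly"
  using trig_poly.wave[of c 0 0] by (simp add: inner_vec_def)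

lemma trig_poly_wave_mult:
  assumes "g \<in> trig_poly"
  shows "(\<lambda>x. a * cos ((\<chi> i. of_int (k $ i)) \<bullet> x + b) * g x) \<in> trig_poly"
  using assms
proof induction
  case (wave a' k' b')
  let ?v = "\<lambda>k :: int ^ 'n. (\<chi> i. of_int (k $ i)) :: real ^ 'n"
  have v: "?v (k - k') = ?v k - ?v k'" "?v (k + k') = ?v k + ?v k'" by (auto simp: vec_eq_iff)
  have "(\<lambda>x. a * a' / 2 * cos (?v (k - k') \<bullet> x + (b - b')) + a * a' / 2 * cos (?v (k + k') \<bullet> x + (b + b'))) \<in> trig_poly"
    by (intro trig_poly.intros)
  moreover have "a * a' / 2 * cos (?v (k - k') \<bullet> x + (b - b')) + a * a' / 2 * cos (?v (k + k') \<bullet> x + (b + b'))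
      = a * cos (?v k \<bullet> x + b) * (a' * cos (?v k' \<bullet> x + b'))" for x
  proof -
    have "cos (?v (k - k') \<bullet> x + (b - b')) = cos ((?v k \<bullet> x + b) - (?v k' \<bullet> x + b'))"
      "cos (?v (k + k') \<bullet> x + (b + b')) = cos ((?v k \<bullet> x + b) + (?v k' \<bullet> x + b'))"
      unfolding v by (simp_all add: inner_diff_left inner_add_left algebra_simps)
    then show ?thesis by (simp only: cos_diff cos_add) (simp add: algebra_simps)
  qed
  ultimately show ?case by simp
next
  case (add f g)
  then show ?case using trig_poly.add[OF add.IH] by (simp add: algebra_simps)
qed

lemma trig_poly_mult:
  assumes "f \<in> trig_poly" "g \<in> trig_poly"
  shows "(\<lambda>x. f x * g x) \<in> trig_poly"
  using assms(1)
proof induction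
  case (wave a k b)
  show ?case by (rule trig_poly_wave_mult[OF assms(2)])
next
  case (add f1 f2)
  then show ?case using trig_poly.add[OF add.IH] by (simp add: algebra_simps)
qed

lemma trig_poly_continuous: "f \<in> trig_poly \<Longrightarrow> continuous_on UNIV f"
  by (induction rule: trig_poly.induct) (auto intro!: continuous_intros)

lemma trig_poly_periodic: "f \<in> trig_poly \<Longrightarrow> periodic f"
proof (induction rule: trig_poly.induct)
  case (wave a k b)
  show ?case
    unfolding periodic_def
  proof safe
    fix x :: "real ^ 'a" and l :: "int ^ 'a"
    define m where "m = (\<Sum>i\<in>UNIV. k $ i * l $ i)"
    have "(\<chi> i. of_int (k $ i)) \<bullet> lattice l = (2 * pi) * of_int m"
      by (simp add: inner_vec_def lattice_def m_def sum_distrib_left mult_ac)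
    then have "cos ((\<chi> i. of_int (k $ i)) \<bullet> (x + lattice l) + b)
        = cos (((\<chi> i. of_int (k $ i)) \<bullet> x + b) + (2 * pi) * of_int m)"
      by (simp add: inner_add_right algebra_simps)
    also have "\<dots> = cos ((\<chi> i. of_int (k $ i)) \<bullet> x + b)"
      unfolding cos_add[of "(\<chi> i. of_int (k $ i)) \<bullet> x + b"] by (simp only: cos_int_2pin sin_int_2pin mult_1_right mult_zero_right diff_zero)
    finally show "a * cos ((\<chi> i. of_int (k $ i)) \<bullet> (x + lattice l) + b) = a * cos ((\<chi> i. of_int (k $ i)) \<bullet> x + b)"
      by simp
  qed
qed (simp add: periodic_def)

lemma cell_mean_shift:
  fixes g :: "real ^ 'n::finite \<Rightarrow> real"
  assumes g: "g \<in> borel_measurable borel" "\<And>x. \<bar>g x\<bar> \<le> B" and per: "periodic g"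
  shows "cell_mean (\<lambda>x. g (x + a)) = cell_mean g"
proof -
  have nn: "cell_mean h = enn2real (\<integral>\<^sup>+x\<in>torus_cell. ennreal (h x) \<partial>lborel) / (2 * pi) ^ CARD('n)"
    if "h \<in> borel_measurable borel" "\<And>x. 0 \<le> h x" for h :: "real ^ 'n \<Rightarrow> real"
  proof -
    have "(LINT x:torus_cell|lborel. h x) = enn2real (\<integral>\<^sup>+x. ennreal (indicator torus_cell x *\<^sub>R h x) \<partial>lborel)"
      unfolding set_lebesgue_integral_def using that by (intro integral_eq_nn_integral) auto
    also have "(\<integral>\<^sup>+x. ennreal (indicator torus_cell x *\<^sub>R h x) \<partial>lborel) = (\<integral>\<^sup>+x\<in>torus_cell. ennreal (h x) \<partial>lborel)"
      by (intro nn_integral_cong) (auto simp: indicator_def)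
    finally show ?thesis by (simp add: cell_mean_def)
  qed
  have [measurable]: "(\<lambda>x. g (x + a)) \<in> borel_measurable borel" using g(1) by measurable
  \<comment> \<open>Adding B makes the function nonnegative, so that the translation invariance of
    the nonnegative integral applies.\<close>
  have pos: "0 \<le> g x + B" for x using g(2)[of x] by linarith
  have "cell_mean (\<lambda>x. g (x + a) + B) = cell_mean (\<lambda>x. g x + B)"
    using pos g(1) nn_integral_torus_cell_shift[of "\<lambda>x. ennreal (g x + B)" a] per
    by (simp add: nn periodic_def)
  moreover have "cell_mean (\<lambda>x. g (x + a) + B) = cell_mean (\<lambda>x. g (x + a)) + B"
    using cell_mean_add[of "\<lambda>x. g (x + a)" B "\<lambda>x. B" "\<bar>B\<bar>"] g by simp
  moreover have "cell_mean (\<lambda>x. g x + B) = cell_mean g + B"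
    using cell_mean_add[of g B "\<lambda>x. B" "\<bar>B\<bar>"] g by simp
  ultimately show ?thesis by simp
qed

text \<open>Translation by pi / (v \<bullet> v) times v changes the sign of a nonconstant wave, so
  its space mean is 0. Along the flow the wave has frequency c = \<omega> \<bullet> v, nonzero by
  nonresonance, so its integral stays bounded and the time mean decays like 1 / L.\<close>

lemma equidistributed_wave:
  fixes \<omega> :: "real ^ 'n::finite"
  assumes \<omega>: "nonresonant \<omega>"
  shows "equidistributed \<omega> (\<lambda>x. a * cos ((\<chi> i. of_int (k $ i)) \<bullet> x + b))"
proof (cases "k = 0")
  case True
  then show ?thesis using equidistributed_const[of \<omega> "a * cos b"] by (simp add: inner_vec_def)
next
  case False
  define v :: "real ^ 'n" where "v = (\<chi> i. of_int (k $ i))"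
  define c where "c = \<omega> \<bullet> v"
  have c: "c \<noteq> 0" using \<omega> False by (simp add: nonresonant_def c_def v_def)
  have v: "v \<noteq> 0" using c by (auto simp: c_def)
  let ?g = "\<lambda>x. a * cos (v \<bullet> x + b)"
  have g: "?g \<in> borel_measurable borel" "\<And>x. \<bar>?g x\<bar> \<le> \<bar>a\<bar>"
    by (auto simp: abs_mult intro!: mult_left_le borel_measurable_continuous_onI continuous_intros)
  have per: "periodic ?g" using trig_poly_periodic[OF trig_poly.wave] by (simp add: v_def)
  have "cell_mean (\<lambda>x. ?g (x + (pi / (v \<bullet> v)) *\<^sub>R v)) = cell_mean ?g"
    by (rule cell_mean_shift[OF g per])
  moreover have "?g (x + (pi / (v \<bullet> v)) *\<^sub>R v) = - ?g x" for x
  proof -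
    have "v \<bullet> (x + (pi / (v \<bullet> v)) *\<^sub>R v) + b = (v \<bullet> x + b) + pi"
      using v by (simp add: inner_add_right)
    then show ?thesis by (simp only: cos_periodic_pi)
  qed
  ultimately have "cell_mean (\<lambda>x. - ?g x) = cell_mean ?g" by simp
  moreover have "cell_mean (\<lambda>x. - ?g x + ?g x) = cell_mean (\<lambda>x. - ?g x) + cell_mean ?g"
    by (rule cell_mean_add[OF _ _ g]) (use g in auto)
  ultimately have zero: "cell_mean ?g = 0" by simp
  have val: "(LINT t:{0..L}|lborel. ?g (t *\<^sub>R \<omega>)) = a * (sin (c * L + b) - sin b) / c" if "0 < L" for L
  proof -
    have "(\<integral>t. indicator {0..L} t *\<^sub>R (a * cos (c * t + b)) \<partial>lborel) = a * sin (c * L + b) / c - a * sin (c * 0 + b) / c"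
    proof (rule integral_FTC_atLeastAtMost)
      show "((\<lambda>t. a * sin (c * t + b) / c) has_vector_derivative a * cos (c * t + b)) (at t within {0..L})" for t
        using c unfolding has_real_derivative_iff_has_vector_derivative[symmetric]
        by (auto intro!: derivative_eq_intros)
    qed (use that in \<open>auto intro!: continuous_intros\<close>)
    note FTC = this
    have vt: "v \<bullet> (t *\<^sub>R \<omega>) = c * t" for t by (simp add: c_def inner_commute)
    show ?thesis
      unfolding set_lebesgue_integral_def vt FTC by (simp add: right_diff_distrib diff_divide_distrib)
  qed
  have "(time_mean \<omega> ?g \<longlongrightarrow> 0) at_top"
  proof (rule tendsto_rabs_zero_cancel, rule tendsto_sandwich[OF _ _ tendsto_const])
    show "((\<lambda>L. (2 * \<bar>a\<bar> / \<bar>c\<bar>) / L) \<longlongrightarrow> 0) at_top"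
      by (rule real_tendsto_divide_at_top[OF tendsto_const filterlim_ident])
    show "\<forall>\<^sub>F L in at_top. \<bar>time_mean \<omega> ?g L\<bar> \<le> (2 * \<bar>a\<bar> / \<bar>c\<bar>) / L"
      using eventually_gt_at_top[of 0]
    proof eventually_elim
      case (elim L)
      have "\<bar>sin (c * L + b) - sin b\<bar> \<le> 2"
        using abs_sin_le_one[of "c * L + b"] abs_sin_le_one[of b] by linarith
      then have "\<bar>a\<bar> * \<bar>sin (c * L + b) - sin b\<bar> \<le> \<bar>a\<bar> * 2" by (rule mult_left_mono) simp
      then have "\<bar>a\<bar> * \<bar>sin (c * L + b) - sin b\<bar> / \<bar>c\<bar> / L \<le> 2 * \<bar>a\<bar> / \<bar>c\<bar> / L"
        using elim by (intro divide_right_mono) auto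
      moreover have "time_mean \<omega> ?g L = a * (sin (c * L + b) - sin b) / c / L"
        by (simp only: time_mean_def val[OF elim])
      ultimately show ?case
        using elim by (simp only: abs_mult abs_divide abs_of_pos)
    qed
  qed auto
  then show ?thesis using zero by (simp add: equidistributed_def v_def)
qed

lemma trig_poly_bounded: "f \<in> trig_poly \<Longrightarrow> \<exists>B. \<forall>x. \<bar>f x\<bar> \<le> B"
  using periodic_bounded[OF trig_poly_periodic trig_poly_continuous] by metis

lemma trig_poly_measurable: "f \<in> trig_poly \<Longrightarrow> f \<in> borel_measurable borel"
  by (intro borel_measurable_continuous_onI trig_poly_continuous)

lemma equidistributed_trig_poly:
  assumes "nonresonant \<omega>" "f \<in> trig_poly"
  shows "equidistributed \<omega> f"
  using assms(2)
proof induction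
  case (wave a k b)
  show ?case by (rule equidistributed_wave[OF assms(1)])
next
  case (add f g)
  show ?case
  proof -
    obtain B where B: "\<And>x. \<bar>f x\<bar> \<le> B" using trig_poly_bounded[OF add.hyps(1)] by blast
    obtain C where C: "\<And>x. \<bar>g x\<bar> \<le> C" using trig_poly_bounded[OF add.hyps(2)] by blast
    show ?thesis
      by (rule equidistributed_add[OF trig_poly_measurable[OF add.hyps(1)] B trig_poly_measurable[OF add.hyps(2)] C add.IH])
  qed
qed

lemma trig_poly_dense:
  fixes g :: "real ^ 'n::finite \<Rightarrow> real"
  assumes "periodic g" "continuous_on UNIV g" "0 < e"
  obtains f where "f \<in> trig_poly" "\<And>x. \<bar>g x - f x\<bar> < e"
proof -
  define R :: "('n torus \<Rightarrow> real) set" where "R = {F. (\<lambda>x. F (abs_torus x)) \<in> trig_poly}"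
  interpret function_ring_on R UNIV
  proof
    show "compact (UNIV :: 'n torus set)" by (rule compact_torus)
    show "continuous_on UNIV F" if "F \<in> R" for F
      using that trig_poly_continuous continuous_on_torus_iff by (auto simp: R_def)
    show "\<exists>f\<in>R. f p \<noteq> f q" if "p \<noteq> q" for p q
    proof (rule ccontr)
      assume neg: "\<not> ?thesis"
      have "\<exists>m::int. rep_torus q $ i = rep_torus p $ i + 2 * pi * of_int m" for i
      proof -
        \<comment> \<open>This cosine equals 1 at p, and it equals 1 at q only if the i-th
          coordinates agree modulo 2 pi.\<close>
        define h where "h = (\<lambda>x :: real ^ 'n. 1 * cos ((\<chi> j. of_int (axis i 1 $ j)) \<bullet> x + (- rep_torus p $ i)))"
        have h: "h \<in> trig_poly" unfolding h_def by (rule trig_poly.wave)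
        have "(\<chi> j. of_int (axis i (1::int) $ j)) = (axis i 1 :: real ^ 'n)"
          by (simp add: axis_def vec_eq_iff)
        then have hv: "h x = cos (x $ i - rep_torus p $ i)" for x
          by (simp add: h_def inner_axis' )
        have "(\<lambda>p. h (rep_torus p)) \<in> R"
          using h periodic_factor[OF trig_poly_periodic[OF h]] by (simp add: R_def)
        moreover have "\<forall>f\<in>R. f p = f q" using neg by blast
        ultimately have "h (rep_torus p) = h (rep_torus q)" by (rule bspec[rotated])
        then have "cos (rep_torus q $ i - rep_torus p $ i) = 1" by (simp add: hv)
        then obtain m :: int where "rep_torus q $ i - rep_torus p $ i = of_int m * 2 * pi"
          by (auto simp: cos_one_2pi_int)
        then show ?thesis by (intro exI[of _ m]) (simp add: algebra_simps)
      qed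
      then obtain m where "\<And>i. rep_torus q $ i = rep_torus p $ i + 2 * pi * of_int (m i)" by metis
      then have "rep_torus q = rep_torus p + lattice (\<chi> i. m i)" by (simp add: lattice_def vec_eq_iff)
      then have "abs_torus (rep_torus p) = abs_torus (rep_torus q)" using abs_torus_eq_lattice by blast
      then show False using that by simp
    qed
  qed (auto simp: R_def trig_poly.add trig_poly_mult trig_poly_const)
  obtain F where F: "F \<in> R" "\<And>p. \<bar>g (rep_torus p) - F p\<bar> < e"
    using Stone_Weierstrass_basic[OF periodic_continuous_factor[OF assms(1,2)] assms(3)] by auto
  have "\<bar>g x - F (abs_torus x)\<bar> < e" for x
    using F(2)[of "abs_torus x"] by (simp add: periodic_factor[OF assms(1)])
  then show thesis using that F(1) by (auto simp: R_def)
qed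

lemma equidistributed_continuous:
  fixes g :: "real ^ 'n::finite \<Rightarrow> real"
  assumes \<omega>: "nonresonant \<omega>" and g: "periodic g" "continuous_on UNIV g"
  shows "equidistributed \<omega> g"
proof -
  obtain B where B: "\<And>x. \<bar>g x\<bar> \<le> B" using periodic_bounded[OF g] by blast
  show ?thesis
  proof (rule equidistributed_sandwich[OF _ B])
    show "g \<in> borel_measurable borel" using g(2) by (rule borel_measurable_continuous_onI)
    fix e :: real assume e: "0 < e"
    obtain f where f: "f \<in> trig_poly" "\<And>x. \<bar>g x - f x\<bar> < e / 2"
      using trig_poly_dense[OF g, of "e / 2"] e by auto
    obtain C where C: "\<And>x. \<bar>f x\<bar> \<le> C" using trig_poly_bounded[OF f(1)] by blast
    have shift: "(\<lambda>x. f x + c) \<in> trig_poly" for c using trig_poly.add[OF f(1) trig_poly_const] .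
    have mean: "cell_mean (\<lambda>x. f x + c) = cell_mean f + c" for c
      using cell_mean_add[of f C "\<lambda>x. c" "\<bar>c\<bar>"] trig_poly_measurable[OF f(1)] C by simp
    have bnd: "\<bar>f x + e / 2\<bar> \<le> C + e" "\<bar>f x + - e / 2\<bar> \<le> C + e" "f x + - e / 2 \<le> g x" "g x \<le> f x + e / 2" for x
      using C[of x] f(2)[of x] e by linarith+
    show "\<exists>h1 h2 C. h1 \<in> borel_measurable borel \<and> h2 \<in> borel_measurable borel \<and>
      (\<forall>x. \<bar>h1 x\<bar> \<le> C \<and> \<bar>h2 x\<bar> \<le> C \<and> h1 x \<le> g x \<and> g x \<le> h2 x) \<and>
      equidistributed \<omega> h1 \<and> equidistributed \<omega> h2 \<and> cell_mean h2 - cell_mean h1 \<le> e"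
      by (rule exI[of _ "\<lambda>x. f x + - e / 2"], rule exI[of _ "\<lambda>x. f x + e / 2"], rule exI[of _ "C + e"],
          insert bnd mean[of "- e / 2"] mean[of "e / 2"] e)
        (use trig_poly_measurable[OF shift, of "- e / 2"] trig_poly_measurable[OF shift, of "e / 2"]
          equidistributed_trig_poly[OF \<omega> shift, of "- e / 2"] equidistributed_trig_poly[OF \<omega> shift, of "e / 2"] in simp)
  qed
qed

text \<open>The Lipschitz envelopes decrease to \<open>G\<close> at its continuity points, so a bounded, almost everywhere
  continuous function is squeezed between continuous functions of almost the same mean.\<close>

definition upper_envelope :: "('a::metric_space \<Rightarrow> real) \<Rightarrow> nat \<Rightarrow> 'a \<Rightarrow> real" where
  "upper_envelope G k x = (SUP y. G y - real k * dist x y)"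

context
  fixes G :: "'a::metric_space \<Rightarrow> real" and B :: real
  assumes G: "\<And>x. \<bar>G x\<bar> \<le> B"
begin

lemma upper_envelope_bdd: "bdd_above (range (\<lambda>y. G y - real k * dist x y))"
proof (rule bdd_aboveI2)
  fix y
  have "G y \<le> B" using G[of y] by simp
  moreover have "0 \<le> real k * dist x y" by simp
  ultimately show "G y - real k * dist x y \<le> B" by linarith
qed

lemma upper_envelope_ge: "G y - real k * dist x y \<le> upper_envelope G k x"
  unfolding upper_envelope_def by (rule cSUP_upper[OF UNIV_I upper_envelope_bdd])

lemma upper_envelope_le:
  assumes "\<And>y. G y - real k * dist x y \<le> c"
  shows "upper_envelope G k x \<le> c"
  unfolding upper_envelope_def by (rule cSUP_least) (use assms in auto)

lemma upper_envelope_ge_self: "G x \<le> upper_envelope G k x"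
  using upper_envelope_ge[of x k x] by simp

lemma upper_envelope_abs_le: "\<bar>upper_envelope G k x\<bar> \<le> B"
proof -
  have "upper_envelope G k x \<le> B"
  proof (rule upper_envelope_le)
    fix y
    have "G y \<le> B" using G[of y] by simp
    moreover have "0 \<le> real k * dist x y" by simp
    ultimately show "G y - real k * dist x y \<le> B" by linarith
  qed
  then show ?thesis using upper_envelope_ge_self[of x k] G[of x] by linarith
qed

lemma upper_envelope_lipschitz: "upper_envelope G k x \<le> upper_envelope G k z + real k * dist x z"
proof (rule upper_envelope_le)
  fix y
  have "real k * dist z y \<le> real k * (dist x z + dist x y)"
    by (intro mult_left_mono dist_triangle3) simp
  then have "real k * dist z y \<le> real k * dist x z + real k * dist x y"
    by (simp add: distrib_left)
  then show "G y - real k * dist x y \<le> upper_envelope G k z + real k * dist x z"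
    using upper_envelope_ge[of y k z] by linarith
qed

lemma continuous_upper_envelope: "continuous_on UNIV (upper_envelope G k)"
proof (cases "k = 0")
  case True
  then have "upper_envelope G k = (\<lambda>x. SUP y. G y)" by (simp add: upper_envelope_def fun_eq_iff)
  then show ?thesis by simp
next
  case False
  show ?thesis
    unfolding continuous_on_iff
  proof safe
    fix x :: 'a and e :: real assume e: "0 < e"
    have "dist (upper_envelope G k x') (upper_envelope G k x) < e" if "dist x' x < e / real k" for x'
    proof -
      have "real k * dist x' x < e" using that False by (simp add: pos_less_divide_eq mult.commute)
      then show ?thesis
        using upper_envelope_lipschitz[of k x x'] upper_envelope_lipschitz[of k x' x]
        by (simp add: dist_real_def dist_commute abs_less_iff)
    qed
    then show "\<exists>d>0. \<forall>x'\<in>UNIV. dist x' x < d \<longrightarrow> dist (upper_envelope G k x') (upper_envelope G k x) < e"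
      using e False by (intro exI[of _ "e / real k"]) auto
  qed
qed

lemma upper_envelope_tendsto:
  assumes "isCont G x"
  shows "(\<lambda>k. upper_envelope G k x) \<longlonglongrightarrow> G x"
proof (rule LIMSEQ_I)
  fix e :: real assume e: "0 < e"
  obtain d where d: "0 < d" "\<And>y. dist y x < d \<Longrightarrow> \<bar>G y - G x\<bar> < e / 2"
    using assms e unfolding continuous_at_eps_delta dist_real_def by (metis half_gt_zero)
  have B: "0 \<le> B" using G[of x] by linarith
  obtain n :: nat where n: "2 * B / d < real n" using reals_Archimedean2 by blast
  have "norm (upper_envelope G k x - G x) < e" if k: "n \<le> k" for k
  proof -
    have "upper_envelope G k x \<le> G x + e / 2"
    proof (rule upper_envelope_le)
      fix y
      show "G y - real k * dist x y \<le> G x + e / 2"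
      proof (cases "dist y x < d")
        case True
        have "0 \<le> real k * dist x y" by simp
        then show ?thesis using d(2)[OF True] by linarith
      next
        case False
        have "2 * B \<le> real n * d" using n d(1) by (simp add: field_simps)
        also have "\<dots> \<le> real k * dist x y"
          using k False d(1) by (intro mult_mono) (auto simp: dist_commute)
        finally show ?thesis using G[of x] G[of y] e by linarith
      qed
    qed
    then show ?thesis using upper_envelope_ge_self[of x k] e by simp
  qed
  then show "\<exists>no. \<forall>n\<ge>no. norm (upper_envelope G n x - G x) < e" by blast
qed

end

lemma periodic_upper_envelope:
  assumes "periodic G"
  shows "periodic (upper_envelope G k)"
  unfolding periodic_def
proof safe
  fix x l
  have "range (\<lambda>y. G y - real k * dist (x + lattice l) y) = range (\<lambda>y. G y - real k * dist x y)"
  proof (intro subset_antisym subsetI; safe)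
    fix y
    have "G (y + lattice (- l)) - real k * dist x (y + lattice (- l)) = G y - real k * dist (x + lattice l) y"
      by (simp add: periodicD[OF assms]) (simp add: dist_norm lattice_minus algebra_simps)
    from this[symmetric] show "G y - real k * dist (x + lattice l) y \<in> range (\<lambda>y. G y - real k * dist x y)"
      by (rule range_eqI)
    have "G (y + lattice l) - real k * dist (x + lattice l) (y + lattice l) = G y - real k * dist x y"
      by (simp add: periodicD[OF assms])
    from this[symmetric] show "G y - real k * dist x y \<in> range (\<lambda>y. G y - real k * dist (x + lattice l) y)"
      by (rule range_eqI)
  qed
  then show "upper_envelope G k (x + lattice l) = upper_envelope G k x"
    by (simp add: upper_envelope_def)
qed

lemma cell_mean_upper_envelope_tendsto:
  fixes G :: "real ^ 'n::finite \<Rightarrow> real"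
  assumes G: "\<And>x. \<bar>G x\<bar> \<le> B" "G \<in> borel_measurable borel" and cont: "AE x in lborel. isCont G x"
  shows "(\<lambda>k. cell_mean (upper_envelope G k)) \<longlonglongrightarrow> cell_mean G"
  unfolding cell_mean_def set_lebesgue_integral_def
proof (intro tendsto_divide tendsto_const)
  have [measurable]: "upper_envelope G k \<in> borel_measurable borel" for k
    by (intro borel_measurable_continuous_onI continuous_upper_envelope[OF G(1)])
  show "(\<lambda>k. LINT x|lborel. indicator torus_cell x *\<^sub>R upper_envelope G k x)
      \<longlonglongrightarrow> (LINT x|lborel. indicator torus_cell x *\<^sub>R G x)"
  proof (rule integral_dominated_convergence[where w="\<lambda>x. B * indicator torus_cell x"])
    show "integrable lborel (\<lambda>x :: real ^ 'n. B * indicator torus_cell x)"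
      by (auto simp: emeasure_torus_cell)
    show "AE x in lborel. (\<lambda>k. indicator torus_cell x *\<^sub>R upper_envelope G k x) \<longlonglongrightarrow> indicator torus_cell x *\<^sub>R G x"
      using cont by eventually_elim (intro tendsto_scaleR tendsto_const upper_envelope_tendsto[OF G(1)])
    show "AE x in lborel. norm (indicator torus_cell x *\<^sub>R upper_envelope G k x) \<le> B * indicator torus_cell x" for k
      using upper_envelope_abs_le[of G B, OF G(1)] by (auto simp: indicator_def)
  qed (use G(2) in measurable)
qed auto

theorem equidistributed_AE_continuous:
  fixes G :: "real ^ 'n::finite \<Rightarrow> real"
  assumes \<omega>: "nonresonant \<omega>" and per: "periodic G"
    and G: "G \<in> borel_measurable borel" "\<And>x. \<bar>G x\<bar> \<le> B" and cont: "AE x in lborel. isCont G x"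
  shows "equidistributed \<omega> G"
proof (rule equidistributed_sandwich[OF G])
  fix e :: real assume e: "0 < e"
  \<comment> \<open>The lower envelope of G is minus the upper envelope of - G.\<close>
  let ?U = "upper_envelope G" and ?N = "upper_envelope (\<lambda>x. - G x)"
  have G': "\<And>x. \<bar>- G x\<bar> \<le> B" using G(2) by simp
  have meas: "?U k \<in> borel_measurable borel" "(\<lambda>x. - ?N k x) \<in> borel_measurable borel" for k
    by (intro borel_measurable_continuous_onI borel_measurable_uminus continuous_upper_envelope[OF G(2)]
        continuous_upper_envelope[OF G'])+
  have "equidistributed \<omega> (?U k)" for k
    by (intro equidistributed_continuous \<omega> periodic_upper_envelope per continuous_upper_envelope[OF G(2)])
  moreover have "equidistributed \<omega> (\<lambda>x. - ?N k x)" for k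
    using periodic_upper_envelope[of "\<lambda>x. - G x"] per
    by (intro equidistributed_continuous \<omega> continuous_on_minus continuous_upper_envelope[OF G'])
      (auto simp: periodic_def)
  moreover have neg: "cell_mean (\<lambda>x. - h x) = - cell_mean h" for h :: "real ^ 'n \<Rightarrow> real"
    by (simp add: cell_mean_def set_lebesgue_integral_def)
  have "(\<lambda>k. cell_mean (?N k)) \<longlonglongrightarrow> cell_mean (\<lambda>x. - G x)"
  proof (rule cell_mean_upper_envelope_tendsto[OF G'])
    show "AE x in lborel. isCont (\<lambda>x. - G x) x" using cont by eventually_elim (rule isCont_minus)
  qed (use G(1) in measurable)
  from tendsto_diff[OF cell_mean_upper_envelope_tendsto[OF G(2,1) cont] tendsto_minus[OF this]]
  have "(\<lambda>k. cell_mean (?U k) - cell_mean (\<lambda>x. - ?N k x)) \<longlonglongrightarrow> cell_mean G - - cell_mean (\<lambda>x. - G x)"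
    unfolding neg .
  then have "(\<lambda>k. cell_mean (?U k) - cell_mean (\<lambda>x. - ?N k x)) \<longlonglongrightarrow> 0" by (simp add: neg)
  then have "\<forall>\<^sub>F k in sequentially. cell_mean (?U k) - cell_mean (\<lambda>x. - ?N k x) < e"
    using e by (rule order_tendstoD)
  then obtain k where "cell_mean (?U k) - cell_mean (\<lambda>x. - ?N k x) < e"
    using eventually_happens'[OF sequentially_bot] by blast
  moreover have "\<bar>- ?N k x\<bar> \<le> B \<and> \<bar>?U k x\<bar> \<le> B \<and> - ?N k x \<le> G x \<and> G x \<le> ?U k x" for x
    using upper_envelope_abs_le[of G B, OF G(2)] upper_envelope_abs_le[of "\<lambda>x. - G x" B, OF G']
      upper_envelope_ge_self[of G B, OF G(2)] upper_envelope_ge_self[of "\<lambda>x. - G x" B, OF G'] by (simp add: minus_le_iff)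
  ultimately show "\<exists>h1 h2 C. h1 \<in> borel_measurable borel \<and> h2 \<in> borel_measurable borel \<and>
      (\<forall>x. \<bar>h1 x\<bar> \<le> C \<and> \<bar>h2 x\<bar> \<le> C \<and> h1 x \<le> G x \<and> G x \<le> h2 x) \<and>
      equidistributed \<omega> h1 \<and> equidistributed \<omega> h2 \<and> cell_mean h2 - cell_mean h1 \<le> e"
    using meas less_imp_le by blast
qed

section \<open>Derivatives along the flow\<close>

lemma has_derivative_grad:
  fixes f :: "'a::euclidean_space \<Rightarrow> real"
  assumes "f differentiable (at x)"
  shows "(f has_derivative (\<lambda>h. grad f x \<bullet> h)) (at x)"
proof -
  obtain f' where f': "(f has_derivative f') (at x)" using assms by (auto simp: differentiable_def)
  interpret bounded_linear f' using f' by (rule has_derivative_bounded_linear)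
  have pd: "partial_deriv b f x = f' b" for b
  proof -
    have "((\<lambda>t. x + t *\<^sub>R b) has_derivative (\<lambda>t. t *\<^sub>R b)) (at 0)"
      by (auto intro!: derivative_eq_intros)
    then have "((\<lambda>t. f (x + t *\<^sub>R b)) has_derivative (\<lambda>t. f' (t *\<^sub>R b))) (at 0)"
      by (rule has_derivative_compose) (use f' in simp)
    moreover have "(\<lambda>t. f' (t *\<^sub>R b)) = (*) (f' b)" by (auto simp: scaleR mult.commute)
    ultimately have "((\<lambda>t. f (x + t *\<^sub>R b)) has_field_derivative f' b) (at 0)"
      by (simp add: has_field_derivative_def)
    then show ?thesis by (simp add: partial_deriv_def DERIV_imp_deriv)
  qed
  have "f' h = grad f x \<bullet> h" for h
  proof -
    have "f' h = f' (\<Sum>b\<in>Basis. (h \<bullet> b) *\<^sub>R b)" by (simp add: euclidean_representation)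
    also have "\<dots> = (\<Sum>b\<in>Basis. (h \<bullet> b) * f' b)" by (simp add: sum scaleR)
    also have "\<dots> = grad f x \<bullet> h"
      by (simp add: grad_def inner_sum_left pd inner_commute[of h] mult.commute)
    finally show ?thesis .
  qed
  then have "f' = (\<lambda>h. grad f x \<bullet> h)" by auto
  then show ?thesis using f' by simp
qed

lemma partial_deriv_eq:
  assumes "(f has_derivative (\<lambda>h. v \<bullet> h)) (at x)"
  shows "partial_deriv b f x = v \<bullet> b"
proof -
  have "((\<lambda>t. x + t *\<^sub>R b) has_derivative (\<lambda>t. t *\<^sub>R b)) (at 0)"
    by (auto intro!: derivative_eq_intros)
  then have "((\<lambda>t. f (x + t *\<^sub>R b)) has_derivative (\<lambda>t. v \<bullet> (t *\<^sub>R b))) (at 0)"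
    by (rule has_derivative_compose) (use assms in simp)
  moreover have "(\<lambda>t. v \<bullet> (t *\<^sub>R b)) = (*) (v \<bullet> b)" by auto
  ultimately have "((\<lambda>t. f (x + t *\<^sub>R b)) has_field_derivative v \<bullet> b) (at 0)"
    by (simp add: has_field_derivative_def)
  then show ?thesis by (simp add: partial_deriv_def DERIV_imp_deriv)
qed

lemma cont_diff_lincomb:
  assumes "cont_diff k f" "cont_diff k g"
  shows "cont_diff k (\<lambda>x. a * f x + b * g x)"
  using assms
proof (induction k arbitrary: f g)
  case 0
  then show ?case by (auto intro!: continuous_intros)
next
  case (Suc k)
  have "partial_deriv c (\<lambda>x. a * f x + b * g x) = (\<lambda>x. a * partial_deriv c f x + b * partial_deriv c g x)" for c
  proof
    fix x
    have f: "(f has_derivative (\<lambda>h. grad f x \<bullet> h)) (at x)" and g: "(g has_derivative (\<lambda>h. grad g x \<bullet> h)) (at x)"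
      using Suc.prems by (auto intro: has_derivative_grad)
    have "((\<lambda>x. a * f x + b * g x) has_derivative (\<lambda>h. (a *\<^sub>R grad f x + b *\<^sub>R grad g x) \<bullet> h)) (at x)"
      by (auto intro!: derivative_eq_intros f g simp: inner_add_left)
    from partial_deriv_eq[OF this]
    show "partial_deriv c (\<lambda>x. a * f x + b * g x) x = a * partial_deriv c f x + b * partial_deriv c g x"
      by (simp add: partial_deriv_eq[OF f] partial_deriv_eq[OF g] inner_add_left)
  qed
  then show ?case using Suc by (auto intro!: derivative_intros)
qed

lemma smooth_lincomb: "smooth f \<Longrightarrow> smooth g \<Longrightarrow> smooth (\<lambda>x. a * f x + b * g x)"
  by (simp add: smooth_def cont_diff_lincomb)

lemma smooth_partial_deriv: "smooth f \<Longrightarrow> b \<in> Basis \<Longrightarrow> smooth (partial_deriv b f)"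
  unfolding smooth_def using cont_diff.simps(2) by blast

lemma smooth_differentiable: "smooth f \<Longrightarrow> f differentiable (at x)"
  unfolding smooth_def using cont_diff.simps(2) by blast

lemma smooth_continuous: "smooth f \<Longrightarrow> continuous_on A f"
  unfolding smooth_def using cont_diff.simps(1) continuous_on_subset by blast

lemma smooth_zero: "smooth (\<lambda>x. 0)"
proof -
  have "cont_diff k (\<lambda>x :: 'a. 0 :: real)" for k
    by (induction k) (simp_all add: partial_deriv_def[abs_def])
  then show ?thesis by (simp add: smooth_def)
qed

lemma smooth_inner_grad:
  assumes "smooth f"
  shows "smooth (\<lambda>x. v \<bullet> grad f x)"
proof -
  have "smooth (\<lambda>x. \<Sum>b\<in>J. (v \<bullet> b) * partial_deriv b f x)" if "finite J" "J \<subseteq> Basis" for J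
    using that
  proof (induction J rule: finite_induct)
    case (insert b J)
    then show ?case
      using smooth_lincomb[OF smooth_partial_deriv[OF assms, of b], of "\<lambda>x. \<Sum>b\<in>J. (v \<bullet> b) * partial_deriv b f x" "v \<bullet> b" 1]
      by simp
  qed (simp add: smooth_zero)
  from this[OF finite_Basis subset_refl] show ?thesis
    by (simp add: grad_def inner_sum_right mult.commute)
qed

lemma continuous_grad:
  assumes "smooth f"
  shows "continuous_on A (grad f)"
  unfolding grad_def
  by (intro continuous_intros smooth_continuous smooth_partial_deriv assms)

lemma D_op_abs_torus: "D_op \<omega> S (abs_torus x) = \<omega> \<bullet> grad (\<lambda>x. S (abs_torus x)) x"
  by (simp add: D_op_def torus_grad_abs comp_def)

lemma torus_smooth_D_op: "torus_smooth S \<Longrightarrow> torus_smooth (D_op \<omega> S)"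
  by (simp add: torus_smooth_def comp_def D_op_abs_torus smooth_inner_grad)

lemma torus_smooth_D_op_power: "torus_smooth S \<Longrightarrow> torus_smooth ((D_op \<omega> ^^ j) S)"
  by (induction j) (auto simp: torus_smooth_D_op)

lemma has_derivative_along:
  assumes "smooth f"
  shows "((\<lambda>t. f (x + t *\<^sub>R \<omega>)) has_real_derivative \<omega> \<bullet> grad f (x + t *\<^sub>R \<omega>)) (at t)"
proof -
  have "((\<lambda>t. x + t *\<^sub>R \<omega>) has_derivative (\<lambda>t. t *\<^sub>R \<omega>)) (at t)"
    by (auto intro!: derivative_eq_intros)
  then have "((\<lambda>t. f (x + t *\<^sub>R \<omega>)) has_derivative (\<lambda>s. grad f (x + t *\<^sub>R \<omega>) \<bullet> (s *\<^sub>R \<omega>))) (at t)"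
    by (rule has_derivative_compose) (intro has_derivative_grad smooth_differentiable assms)
  moreover have "(\<lambda>s. grad f (x + t *\<^sub>R \<omega>) \<bullet> (s *\<^sub>R \<omega>)) = (*) (\<omega> \<bullet> grad f (x + t *\<^sub>R \<omega>))"
    by (auto simp: inner_commute)
  ultimately show ?thesis by (simp add: has_field_derivative_def)
qed

section \<open>Zeros and monotone pieces\<close>

text \<open>Each zero of f except the last is sent to a critical point before the next zero; these
  points increase strictly. The bound is proved first for finite sets of zeros, since finiteness of
  the whole set is part of the conclusion.\<close>

lemma rolle_card:
  fixes f f' :: "real \<Rightarrow> real"
  assumes f: "\<And>t. (f has_real_derivative f' t) (at t)"
    and fin: "finite {t \<in> {a..b}. f' t = 0}"
  shows "finite {t \<in> {a..b}. f t = 0} \<and> card {t \<in> {a..b}. f t = 0} \<le> card {t \<in> {a..b}. f' t = 0} + 1"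
proof -
  have bound: "card A \<le> card {t \<in> {a..b}. f' t = 0} + 1" if A: "finite A" "A \<subseteq> {t \<in> {a..b}. f t = 0}" for A
  proof (cases "A = {}")
    case False
    define A' where "A' = A - {Max A}"
    define nx where "nx z = Min {y \<in> A. z < y}" for z
    have nx: "nx z \<in> A \<and> z < nx z \<and> (\<forall>y\<in>A. z < y \<longrightarrow> nx z \<le> y)" if "z \<in> A'" for z
    proof -
      have "z < Max A" using that A(1) by (metis A'_def Diff_iff Max_ge insertI1 less_eq_real_def)
      then have ne: "{y \<in> A. z < y} \<noteq> {}" using Max_in[OF A(1) False] by blast
      have fin': "finite {y \<in> A. z < y}" using A(1) by simp
      show ?thesis using Min_in[OF fin' ne] Min_le[OF fin'] by (auto simp: nx_def)
    qed
    have "\<exists>\<xi>. z < \<xi> \<and> \<xi> < nx z \<and> f' \<xi> = 0" if z: "z \<in> A'" for z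
    proof -
      have zA: "z \<in> A" using z by (simp add: A'_def)
      have "\<exists>\<xi>. z < \<xi> \<and> \<xi> < nx z \<and> f (nx z) - f z = (nx z - z) * f' \<xi>"
        using nx[OF z] f by (intro MVT2) auto
      moreover have "f (nx z) = 0" "f z = 0" using A(2) nx[OF z] zA by auto
      ultimately show ?thesis using nx[OF z] by auto
    qed
    then obtain \<xi> where \<xi>: "\<And>z. z \<in> A' \<Longrightarrow> z < \<xi> z \<and> \<xi> z < nx z \<and> f' (\<xi> z) = 0" by metis
    have lt: "\<xi> z < \<xi> y" if "z \<in> A'" "y \<in> A'" "z < y" for z y
    proof -
      have "\<xi> z < nx z" using \<xi>[OF that(1)] by simp
      also have "nx z \<le> y" using nx[OF that(1)] that by (auto simp: A'_def)
      also have "y < \<xi> y" using \<xi>[OF that(2)] by simp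
      finally show ?thesis .
    qed
    have "inj_on \<xi> A'"
      using lt by (intro inj_onI) (metis less_irrefl linorder_less_linear)
    moreover have "\<xi> ` A' \<subseteq> {t \<in> {a..b}. f' t = 0}"
    proof safe
      fix z assume z: "z \<in> A'"
      then have "a \<le> z" "nx z \<le> b" using A(2) nx[OF z] by (auto simp: A'_def)
      then show "\<xi> z \<in> {a..b}" "f' (\<xi> z) = 0" using \<xi>[OF z] by auto
    qed
    ultimately have "card A' \<le> card {t \<in> {a..b}. f' t = 0}" using fin by (rule card_inj_on_le)
    then show ?thesis using A(1) False by (simp add: A'_def)
  qed simp
  have "finite {t \<in> {a..b}. f t = 0}"
    using bound by (rule finite_if_finite_subsets_card_bdd[THEN conjunct1]) auto
  then show ?thesis using bound by blast
qed

text \<open>Rolle's theorem k times: each step down in the order of differentiation adds at most one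
  zero.\<close>

lemma zeros_card_le:
  fixes F :: "nat \<Rightarrow> real \<Rightarrow> real"
  assumes "\<And>j t. (F j has_real_derivative F (Suc j) t) (at t)"
    and "\<And>t. t \<in> {a..b} \<Longrightarrow> F k t \<noteq> 0"
  shows "finite {t \<in> {a..b}. F 0 t = 0} \<and> card {t \<in> {a..b}. F 0 t = 0} \<le> k"
  using assms
proof (induction k arbitrary: F)
  case 0
  then have "{t \<in> {a..b}. F 0 t = 0} = {}" by auto
  then show ?case by (simp only: finite.emptyI card.empty) simp
next
  case (Suc k)
  have "finite {t \<in> {a..b}. F (Suc 0) t = 0} \<and> card {t \<in> {a..b}. F (Suc 0) t = 0} \<le> k"
    using Suc.IH[of "\<lambda>j. F (Suc j)"] Suc.prems by auto
  then show ?case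
    using rolle_card[of "F 0" "F (Suc 0)" a b] Suc.prems(1) by fastforce
qed

lemma nn_integral_increasing_piece:
  fixes \<phi> q q' :: "real \<Rightarrow> real"
  assumes \<phi>: "continuous_on UNIV \<phi>" and q: "\<And>t. (q has_real_derivative q' t) (at t)"
    and q': "continuous_on UNIV q'" "\<And>t. t \<in> {a..b} \<Longrightarrow> 0 \<le> q' t" and ab: "a \<le> b"
  shows "(\<integral>\<^sup>+t\<in>{a..b}. ennreal (\<phi> (q t) * \<bar>q' t\<bar>) \<partial>lborel) = (\<integral>\<^sup>+x\<in>{q a..q b}. ennreal (\<phi> x) \<partial>lborel)"
proof -
  have [measurable]: "\<phi> \<in> borel_measurable borel" using \<phi> by (rule borel_measurable_continuous_onI)
  have "(\<integral>\<^sup>+x. ennreal (\<phi> x * indicator {q a..q b} x) \<partial>lborel) =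
      (\<integral>\<^sup>+t. ennreal (\<phi> (q t) * q' t * indicator {a..b} t) \<partial>lborel)"
    by (rule nn_integral_substitution[OF _ q continuous_on_subset[OF q'(1)] q'(2) ab])
      (auto simp: set_borel_measurable_def)
  moreover have "(\<integral>\<^sup>+t\<in>{a..b}. ennreal (\<phi> (q t) * \<bar>q' t\<bar>) \<partial>lborel) = (\<integral>\<^sup>+t. ennreal (\<phi> (q t) * q' t * indicator {a..b} t) \<partial>lborel)"
    using q'(2) by (intro nn_integral_cong) (auto simp: indicator_def)
  moreover have "(\<integral>\<^sup>+x\<in>{q a..q b}. ennreal (\<phi> x) \<partial>lborel) = (\<integral>\<^sup>+x. ennreal (\<phi> x * indicator {q a..q b} x) \<partial>lborel)"
    by (intro nn_integral_cong) (auto simp: indicator_def)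
  ultimately show ?thesis by simp
qed

lemma nn_integral_decreasing_piece:
  fixes \<phi> q q' :: "real \<Rightarrow> real"
  assumes \<phi>: "continuous_on UNIV \<phi>" and q: "\<And>t. (q has_real_derivative q' t) (at t)"
    and q': "continuous_on UNIV q'" "\<And>t. t \<in> {a..b} \<Longrightarrow> q' t \<le> 0" and ab: "a \<le> b"
  shows "(\<integral>\<^sup>+t\<in>{a..b}. ennreal (\<phi> (q t) * \<bar>q' t\<bar>) \<partial>lborel) = (\<integral>\<^sup>+x\<in>{q b..q a}. ennreal (\<phi> x) \<partial>lborel)"
proof -
  have [measurable]: "\<phi> \<in> borel_measurable borel" using \<phi> by (rule borel_measurable_continuous_onI)
  have "(\<integral>\<^sup>+t\<in>{a..b}. ennreal (\<phi> (- (- q t)) * \<bar>- q' t\<bar>) \<partial>lborel) = (\<integral>\<^sup>+x\<in>{- q a..- q b}. ennreal (\<phi> (- x)) \<partial>lborel)"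
  proof (rule nn_integral_increasing_piece[where \<phi>="\<lambda>x. \<phi> (- x)" and q="\<lambda>t. - q t" and q'="\<lambda>t. - q' t"])
    show "continuous_on UNIV (\<lambda>x. \<phi> (- x))"
      by (rule continuous_on_compose2[OF \<phi>]) (auto intro: continuous_intros)
  qed (use q q' ab in \<open>auto intro!: derivative_intros continuous_intros\<close>)
  also have "\<dots> = (\<integral>\<^sup>+x\<in>{- q a..- q b}. ennreal (\<phi> (- x)) \<partial>distr lborel borel uminus)"
    by (simp add: lborel_distr_uminus)
  also have "\<dots> = (\<integral>\<^sup>+x\<in>{q b..q a}. ennreal (\<phi> x) \<partial>lborel)"
    by (subst nn_integral_distr) (auto simp: indicator_def intro!: nn_integral_cong)
  finally show ?thesis by simp
qed

lemma constant_sign: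
  fixes g :: "real \<Rightarrow> real"
  assumes "continuous_on {a..b} g" "\<And>t. a < t \<Longrightarrow> t < b \<Longrightarrow> g t \<noteq> 0" "a < b"
  shows "(\<forall>t\<in>{a..b}. 0 \<le> g t) \<or> (\<forall>t\<in>{a..b}. g t \<le> 0)"
proof -
  have conn: "connected (g ` {a<..<b})"
    using assms(1) by (intro connected_continuous_image) (auto intro: continuous_on_subset)
  have cl: "{a..b} = closure {a<..<b}" using assms(3) by simp
  have "(\<forall>t\<in>{a<..<b}. 0 \<le> g t) \<or> (\<forall>t\<in>{a<..<b}. g t \<le> 0)"
  proof (rule ccontr)
    assume "\<not> ?thesis"
    then obtain s t where st: "s \<in> {a<..<b}" "g s < 0" "t \<in> {a<..<b}" "0 < g t" by (auto simp: not_le)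
    then have "0 \<in> g ` {a<..<b}"
      using connectedD_interval[OF conn, of "g s" "g t" 0] by auto
    then show False using assms(2) by auto
  qed
  then show ?thesis
  proof
    assume p: "\<forall>t\<in>{a<..<b}. 0 \<le> g t"
    have "0 \<le> g t" if "t \<in> {a..b}" for t
    proof (rule continuous_ge_on_closure[of "{a<..<b}" g])
      show "continuous_on (closure {a<..<b}) g" unfolding cl[symmetric] by (rule assms(1))
      show "t \<in> closure {a<..<b}" unfolding cl[symmetric] by (rule that)
    qed (use p in auto)
    then show ?thesis by blast
  next
    assume p: "\<forall>t\<in>{a<..<b}. g t \<le> 0"
    have "g t \<le> 0" if "t \<in> {a..b}" for t
    proof (rule continuous_le_on_closure[of "{a<..<b}" g])
      show "continuous_on (closure {a<..<b}) g" unfolding cl[symmetric] by (rule assms(1))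
      show "t \<in> closure {a<..<b}" unfolding cl[symmetric] by (rule that)
    qed (use p in auto)
    then show ?thesis by blast
  qed
qed

text \<open>Cutting at the critical points leaves monotone pieces; on each of them q is a change of
  variables, and the integral becomes that of \<phi> over an interval, hence at most 1.\<close>

lemma nn_integral_pieces_le:
  fixes \<phi> q q' :: "real \<Rightarrow> real"
  assumes \<phi>: "continuous_on UNIV \<phi>" "(\<integral>\<^sup>+x. ennreal (\<phi> x) \<partial>lborel) \<le> 1"
    and q: "\<And>t. (q has_real_derivative q' t) (at t)" "continuous_on UNIV q'"
    and fin: "finite {t \<in> {a<..<b}. q' t = 0}"
  shows "(\<integral>\<^sup>+t\<in>{a..b}. ennreal (\<phi> (q t) * \<bar>q' t\<bar>) \<partial>lborel) \<le> of_nat (card {t \<in> {a<..<b}. q' t = 0} + 1)"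
  using fin
proof (induction "card {t \<in> {a<..<b}. q' t = 0}" arbitrary: a b rule: less_induct)
  case less
  have cont: "continuous_on UNIV q" using q(1) by (meson DERIV_continuous_on has_field_derivative_at_within)
  have [measurable]: "(\<lambda>t. \<phi> (q t) * \<bar>q' t\<bar>) \<in> borel_measurable borel"
    by (intro borel_measurable_continuous_onI continuous_intros q(2) continuous_on_compose2[OF \<phi>(1) cont]) auto
  have le1: "(\<integral>\<^sup>+x\<in>A. ennreal (\<phi> x) \<partial>lborel) \<le> 1" for A
    using \<phi>(2) by (rule order_trans[rotated]) (auto intro!: nn_integral_mono simp: indicator_def)
  show ?case
  proof (cases "\<exists>p. a < p \<and> p < b \<and> q' p = 0")
    case True
    then obtain p where p: "a < p" "p < b" "q' p = 0" by blast
    let ?Z = "\<lambda>a b. {t \<in> {a<..<b}. q' t = 0}"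
    have Z: "?Z a b = insert p (?Z a p \<union> ?Z p b)" using p by auto
    have fin: "finite (?Z a p)" "finite (?Z p b)" using p by (auto intro: finite_subset[OF _ less.prems])
    have card: "card (?Z a b) = card (?Z a p) + card (?Z p b) + 1"
    proof -
      have "card (?Z a p \<union> ?Z p b) = card (?Z a p) + card (?Z p b)"
        by (rule card_Un_disjoint[OF fin]) auto
      moreover have "card (insert p (?Z a p \<union> ?Z p b)) = Suc (card (?Z a p \<union> ?Z p b))"
        by (rule card_insert_disjoint) (use fin in auto)
      ultimately show ?thesis unfolding Z by simp
    qed
    have "(\<integral>\<^sup>+t\<in>{a..b}. ennreal (\<phi> (q t) * \<bar>q' t\<bar>) \<partial>lborel)
        \<le> (\<integral>\<^sup>+t. ennreal (\<phi> (q t) * \<bar>q' t\<bar>) * indicator {a..p} t + ennreal (\<phi> (q t) * \<bar>q' t\<bar>) * indicator {p..b} t \<partial>lborel)"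
      by (intro nn_integral_mono) (auto simp: indicator_def)
    also have "\<dots> = (\<integral>\<^sup>+t\<in>{a..p}. ennreal (\<phi> (q t) * \<bar>q' t\<bar>) \<partial>lborel) + (\<integral>\<^sup>+t\<in>{p..b}. ennreal (\<phi> (q t) * \<bar>q' t\<bar>) \<partial>lborel)"
      by (rule nn_integral_add) auto
    also have "\<dots> \<le> of_nat (card (?Z a p) + 1) + of_nat (card (?Z p b) + 1)"
      using fin card by (intro add_mono less.hyps) auto
    also have "\<dots> = of_nat (card (?Z a b) + 1)" unfolding card by simp
    finally show ?thesis .
  next
    case False
    then have "{t \<in> {a<..<b}. q' t = 0} = {}" by auto
    then have card: "of_nat (card {t \<in> {a<..<b}. q' t = 0} + 1) = (1 :: ennreal)"
      by (simp only: card.empty) simp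
    show ?thesis
    proof (cases "a < b")
      case True
      have "(\<forall>t\<in>{a..b}. 0 \<le> q' t) \<or> (\<forall>t\<in>{a..b}. q' t \<le> 0)"
        using False True by (intro constant_sign continuous_on_subset[OF q(2)]) auto
      then show ?thesis
        unfolding card
        using nn_integral_increasing_piece[OF \<phi>(1) q, of a b] nn_integral_decreasing_piece[OF \<phi>(1) q, of a b] le1 True
        by auto
    next
      case False
      \<comment> \<open>Here the interval from a to b has at most one point.\<close>
      have "AE t in lborel. ennreal (\<phi> (q t) * \<bar>q' t\<bar>) * indicator {a..b} t = 0"
        using AE_lborel_singleton[of a] by eventually_elim (use False in \<open>auto simp: indicator_def\<close>)
      then have "(\<integral>\<^sup>+t\<in>{a..b}. ennreal (\<phi> (q t) * \<bar>q' t\<bar>) \<partial>lborel) = (\<integral>\<^sup>+t. 0 \<partial>(lborel :: real measure))"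
        by (rule nn_integral_cong_AE)
      then show ?thesis by simp
    qed
  qed
qed

section \<open>Counting zeros in a short window\<close>

locale torus_flow =
  fixes \<omega> :: "real ^ 'd" and S :: "'d::finite torus \<Rightarrow> real"
  assumes nonres: "nonresonant \<omega>"
    and smooth: "torus_smooth S"
    and regular: "\<forall>\<theta> \<in> zero_set S. torus_grad S \<theta> \<noteq> 0"
    and fin: "finite (tangency_set \<omega> S)"
    and order: "\<forall>\<theta> \<in> tangency_set \<omega> S. \<exists>r\<ge>2.
        (\<forall>l. 1 \<le> l \<and> l < r \<longrightarrow> (D_op \<omega> ^^ l) S \<theta> = 0) \<and> (D_op \<omega> ^^ r) S \<theta> \<noteq> 0"
begin

definition q :: "nat \<Rightarrow> real ^ 'd \<Rightarrow> real" where
  "q j x = (D_op \<omega> ^^ j) S (abs_torus x)"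

lemma q_smooth: "smooth (q j)"
  using torus_smooth_D_op_power[OF smooth, of j \<omega>] by (simp add: torus_smooth_def comp_def q_def[abs_def])

lemma q_0: "q 0 x = S (abs_torus x)"
  by (simp add: q_def)

lemma q_Suc: "q (Suc j) x = \<omega> \<bullet> grad (q j) x"
  by (simp add: q_def[abs_def] D_op_abs_torus)

lemma q_1: "q 1 x = D_op \<omega> S (abs_torus x)" "q (Suc 0) x = D_op \<omega> S (abs_torus x)"
  by (simp_all add: q_def)

lemma q_periodic: "periodic (q j)"
  unfolding q_def[abs_def] by (rule periodic_abs_torus)

lemma q_continuous: "continuous_on A (q j)"
  using q_smooth by (rule smooth_continuous)

lemma q_measurable [measurable]: "q j \<in> borel_measurable borel"
  by (rule borel_measurable_continuous_onI[OF q_continuous])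

lemma D_op_continuous: "continuous_on A ((D_op \<omega> ^^ j) S)"
proof -
  have "continuous_on UNIV ((D_op \<omega> ^^ j) S)"
    unfolding continuous_on_torus_iff using q_continuous[of UNIV j] by (simp add: q_def[abs_def])
  then show ?thesis by (rule continuous_on_subset) simp
qed

lemma q_deriv: "((\<lambda>t. q j (x + t *\<^sub>R \<omega>)) has_real_derivative q (Suc j) (x + t *\<^sub>R \<omega>)) (at t)"
  unfolding q_Suc by (rule has_derivative_along[OF q_smooth])

lemma q_line_continuous: "continuous_on A (\<lambda>t. q j (x + t *\<^sub>R \<omega>))"
  by (rule continuous_on_compose2[OF q_continuous]) (auto intro!: continuous_intros)

lemma ex_nonzero_derivative: "\<exists>j. (D_op \<omega> ^^ j) S \<theta> \<noteq> 0"
proof (cases "S \<theta> = 0 \<and> D_op \<omega> S \<theta> = 0")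
  case True
  then have "\<theta> \<in> tangency_set \<omega> S" by (simp add: tangency_set_def zero_set_def)
  then show ?thesis using order by blast
next
  case False
  then have "(D_op \<omega> ^^ 0) S \<theta> \<noteq> 0 \<or> (D_op \<omega> ^^ 1) S \<theta> \<noteq> 0" by simp
  then show ?thesis by blast
qed

text \<open>Compactness turns the finite order of the tangencies into a bound for the number of zeros in
  a short time window that is uniform in the starting point.\<close>

lemma uniform_nondegeneracy:
  "\<exists>n\<ge>1. \<forall>\<theta>. (\<forall>\<phi>\<in>ball \<theta> (1 / real n). 1 / real n < \<bar>S \<phi>\<bar>) \<or>
     (\<exists>j\<in>{1..n}. \<forall>\<phi>\<in>ball \<theta> (1 / real n). (D_op \<omega> ^^ j) S \<phi> \<noteq> 0)"
proof (rule ccontr)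
  assume neg: "\<not> ?thesis"
  have "\<exists>\<theta>. \<not> (\<forall>\<phi>\<in>ball \<theta> (1 / real (Suc m)). 1 / real (Suc m) < \<bar>S \<phi>\<bar>) \<and>
     \<not> (\<exists>j\<in>{1..Suc m}. \<forall>\<phi>\<in>ball \<theta> (1 / real (Suc m)). (D_op \<omega> ^^ j) S \<phi> \<noteq> 0)" for m
    using neg by (metis One_nat_def Suc_le_mono le0)
  then obtain \<theta> where \<theta>: "\<And>m. \<not> (\<forall>\<phi>\<in>ball (\<theta> m) (1 / real (Suc m)). 1 / real (Suc m) < \<bar>S \<phi>\<bar>)"
     "\<And>m. \<not> (\<exists>j\<in>{1..Suc m}. \<forall>\<phi>\<in>ball (\<theta> m) (1 / real (Suc m)). (D_op \<omega> ^^ j) S \<phi> \<noteq> 0)" by metis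
  \<comment> \<open>The centres of the failing balls accumulate at some l. A derivative that is
    nonzero at l stays away from 0 near l, in particular on the late balls, which are small and
    close to l.\<close>
  obtain l r where r: "strict_mono r" "(\<theta> \<circ> r) \<longlonglongrightarrow> l"
    using compact_torus[unfolded compact_eq_seq_compact_metric seq_compact_def] by blast
  obtain j where j: "(D_op \<omega> ^^ j) S l \<noteq> 0" using ex_nonzero_derivative by blast
  define c where "c = \<bar>(D_op \<omega> ^^ j) S l\<bar> / 2"
  have c: "0 < c" using j by (simp add: c_def)
  obtain d where d: "0 < d" "\<And>\<phi>. dist \<phi> l < d \<Longrightarrow> dist ((D_op \<omega> ^^ j) S \<phi>) ((D_op \<omega> ^^ j) S l) < c"
    using D_op_continuous[of UNIV j, unfolded continuous_on_iff, rule_format, OF UNIV_I c] by auto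
  have big: "c < \<bar>(D_op \<omega> ^^ j) S \<phi>\<bar>" if "dist \<phi> l < d" for \<phi>
    using d(2)[OF that] abs_triangle_ineq2_sym[of "(D_op \<omega> ^^ j) S l" "(D_op \<omega> ^^ j) S \<phi>"]
    unfolding c_def dist_real_def by linarith
  define e where "e = min (d / 2) c"
  have e: "0 < e" using c d by (simp add: e_def)
  have "(\<lambda>m. 1 / real (Suc m)) \<longlonglongrightarrow> 0" by (rule LIMSEQ_Suc[OF lim_1_over_n])
  then have "\<forall>\<^sub>F m in sequentially. 1 / real (Suc m) < e" using e by (rule order_tendstoD)
  then have "\<forall>\<^sub>F m in sequentially. 1 / real (Suc (r m)) < e"
    using filterlim_subseq[OF r(1)] by (auto simp: filterlim_iff)
  moreover have "\<forall>\<^sub>F m in sequentially. dist ((\<theta> \<circ> r) m) l < d / 2"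
    by (rule tendstoD[OF r(2)]) (use d(1) in simp)
  moreover have "\<forall>\<^sub>F m in sequentially. j \<le> r m"
    using eventually_ge_at_top[of j] by eventually_elim (use seq_suble[OF r(1)] le_trans in blast)
  ultimately have "\<forall>\<^sub>F m in sequentially. 1 / real (Suc (r m)) < e \<and> dist (\<theta> (r m)) l < d / 2 \<and> j \<le> r m"
    by eventually_elim simp
  then obtain m where m: "1 / real (Suc (r m)) < e" "dist (\<theta> (r m)) l < d / 2" "j \<le> r m"
    using eventually_happens'[OF sequentially_bot] by blast
  have near: "c < \<bar>(D_op \<omega> ^^ j) S \<phi>\<bar>" if "\<phi> \<in> ball (\<theta> (r m)) (1 / real (Suc (r m)))" for \<phi>
  proof (rule big)
    have "dist \<phi> l \<le> dist (\<theta> (r m)) \<phi> + dist (\<theta> (r m)) l" by (rule dist_triangle3)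
    then show "dist \<phi> l < d" using m that by (simp add: e_def)
  qed
  show False
  proof (cases "j = 0")
    case True
    have "\<forall>\<phi>\<in>ball (\<theta> (r m)) (1 / real (Suc (r m))). 1 / real (Suc (r m)) < \<bar>S \<phi>\<bar>"
    proof
      fix \<phi> assume "\<phi> \<in> ball (\<theta> (r m)) (1 / real (Suc (r m)))"
      from near[OF this] show "1 / real (Suc (r m)) < \<bar>S \<phi>\<bar>"
        using m(1) True by (simp add: e_def)
    qed
    then show False using \<theta>(1) by blast
  next
    case False
    then have "\<forall>\<phi>\<in>ball (\<theta> (r m)) (1 / real (Suc (r m))). (D_op \<omega> ^^ j) S \<phi> \<noteq> 0" "j \<in> {1..Suc (r m)}"
      using near c m(3) by fastforce+
    then show False using \<theta>(2) by blast
  qed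
qed

text \<open>h is so small that the segment stays in a ball on which one alternative holds. The first
  alternative keeps the bound 1 / n so that a mollifier of width below 1 / n vanishes along the
  whole segment. The condition \<open>h * norm \<omega> \<le> 1\<close> later prevents two lattice
  translates of a small patch from being met within one window.\<close>

lemma ex_window:
  "\<exists>h n. 0 < h \<and> h * norm \<omega> \<le> 1 \<and> 0 < n \<and> (\<forall>x. (\<forall>t\<in>{0..h}. 1 / real n < \<bar>q 0 (x + t *\<^sub>R \<omega>)\<bar>) \<or>
     (\<exists>j\<in>{1..n}. \<forall>t\<in>{0..h}. q j (x + t *\<^sub>R \<omega>) \<noteq> 0))"
proof -
  obtain n where n: "1 \<le> n" "\<And>\<theta>. (\<forall>\<phi>\<in>ball \<theta> (1 / real n). 1 / real n < \<bar>S \<phi>\<bar>) \<or>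
     (\<exists>j\<in>{1..n}. \<forall>\<phi>\<in>ball \<theta> (1 / real n). (D_op \<omega> ^^ j) S \<phi> \<noteq> 0)"
    using uniform_nondegeneracy by blast
  define h where "h = 1 / (real n * (1 + norm \<omega>))"
  have pos: "0 < 1 + norm \<omega>" by (simp add: add_pos_nonneg)
  have h: "0 < h" using n(1) pos by (simp add: h_def)
  have "h * norm \<omega> < h * (1 + norm \<omega>)" using h by simp
  also have "\<dots> = 1 / real n" using pos by (simp add: h_def)
  finally have small: "h * norm \<omega> < 1 / real n" .
  have "1 / real n \<le> 1" using n(1) by simp
  then have "h * norm \<omega> \<le> 1" using small by linarith
  moreover have ball: "abs_torus (x + t *\<^sub>R \<omega>) \<in> ball (abs_torus x) (1 / real n)" if "t \<in> {0..h}" for x t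
  proof -
    have "dist (abs_torus x) (abs_torus (x + t *\<^sub>R \<omega>)) \<le> dist x (x + t *\<^sub>R \<omega>)" by (rule dist_abs_torus_le)
    also have "\<dots> = t * norm \<omega>" using that by (simp add: dist_norm)
    also have "\<dots> \<le> h * norm \<omega>" using that by (intro mult_right_mono) auto
    finally show ?thesis using small by simp
  qed
  ultimately show ?thesis
    using h n unfolding q_def by (intro exI[of _ h] exI[of _ n]) (fastforce dest: ball)
qed

end

locale torus_flow_window = torus_flow \<omega> S
  for \<omega> :: "real ^ 'd::finite" and S :: "'d torus \<Rightarrow> real" +
  fixes h :: real and n :: nat
  assumes h_pos: "0 < h" and h_small: "h * norm \<omega> \<le> 1" and n_pos: "0 < n"
    and window: "\<And>x. (\<forall>t\<in>{0..h}. 1 / real n < \<bar>q 0 (x + t *\<^sub>R \<omega>)\<bar>) \<or>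
      (\<exists>j\<in>{1..n}. \<forall>t\<in>{0..h}. q j (x + t *\<^sub>R \<omega>) \<noteq> 0)"
begin

lemma closed_window_zeros:
  "finite {t \<in> {0..h}. q 0 (x + t *\<^sub>R \<omega>) = 0} \<and> card {t \<in> {0..h}. q 0 (x + t *\<^sub>R \<omega>) = 0} \<le> n"
  using window[of x]
proof
  assume *: "\<forall>t\<in>{0..h}. 1 / real n < \<bar>q 0 (x + t *\<^sub>R \<omega>)\<bar>"
  have "q 0 (x + t *\<^sub>R \<omega>) \<noteq> 0" if "t \<in> {0..h}" for t
  proof -
    have "0 \<le> 1 / real n" by simp
    also have "\<dots> < \<bar>q 0 (x + t *\<^sub>R \<omega>)\<bar>" using * that by blast
    finally show ?thesis by simp
  qed
  then have "{t \<in> {0..h}. q 0 (x + t *\<^sub>R \<omega>) = 0} = {}" by blast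
  then show ?thesis by (simp only: finite.emptyI card.empty) simp
next
  assume "\<exists>j\<in>{1..n}. \<forall>t\<in>{0..h}. q j (x + t *\<^sub>R \<omega>) \<noteq> 0"
  then obtain j where j: "j \<in> {1..n}" "\<And>t. t \<in> {0..h} \<Longrightarrow> q j (x + t *\<^sub>R \<omega>) \<noteq> 0" by blast
  have "finite {t \<in> {0..h}. q 0 (x + t *\<^sub>R \<omega>) = 0} \<and> card {t \<in> {0..h}. q 0 (x + t *\<^sub>R \<omega>) = 0} \<le> j"
    by (rule zeros_card_le[where F="\<lambda>j t. q j (x + t *\<^sub>R \<omega>)"]) (use q_deriv j(2) in auto)
  then show ?thesis using j(1) by auto
qed

definition Z :: "real ^ 'd \<Rightarrow> real set" where
  "Z x = {t \<in> {0..<h}. q 0 (x + t *\<^sub>R \<omega>) = 0}"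

lemma finite_Z [simp]: "finite (Z x)"
  by (rule finite_subset[OF _ conjunct1[OF closed_window_zeros[of x]]]) (auto simp: Z_def)

lemma card_Z: "card (Z x) \<le> n"
proof -
  have "card (Z x) \<le> card {t \<in> {0..h}. q 0 (x + t *\<^sub>R \<omega>) = 0}"
    using closed_window_zeros[of x] by (intro card_mono) (auto simp: Z_def)
  then show ?thesis using closed_window_zeros[of x] by linarith
qed

text \<open>Polymorphic in the value type because real values enter the equidistribution theorem and
  \<open>ennreal\<close> values the measure theory.\<close>

definition N :: "('d torus \<Rightarrow> 'b::comm_monoid_add) \<Rightarrow> real ^ 'd \<Rightarrow> 'b" where
  "N g x = (\<Sum>t\<in>Z x. g (abs_torus (x + t *\<^sub>R \<omega>)))"

lemma periodic_N: "periodic (N g)"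
  unfolding periodic_def
proof safe
  fix x k
  have eq: "x + lattice k + t *\<^sub>R \<omega> = (x + t *\<^sub>R \<omega>) + lattice k" for t by simp
  have "Z (x + lattice k) = Z x" unfolding Z_def eq periodicD[OF q_periodic] ..
  then show "N g (x + lattice k) = N g x" unfolding N_def eq abs_torus_lattice by simp
qed

lemma N_add: "N (\<lambda>\<theta>. f \<theta> + g \<theta>) x = N f x + N g x"
  by (simp add: N_def sum.distrib)

lemma N_cmult: "N (\<lambda>\<theta>. c * g \<theta>) x = (c :: 'b::semiring_0) * N g x"
  by (simp add: N_def sum_distrib_left)

lemma N_mono: "(\<And>\<theta>. f \<theta> \<le> g \<theta>) \<Longrightarrow> N f x \<le> (N g x :: 'b::ordered_comm_monoid_add)"
  unfolding N_def by (rule sum_mono)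

lemma N_ennreal: "(\<And>\<theta>. 0 \<le> f \<theta>) \<Longrightarrow> N (\<lambda>\<theta>. ennreal (f \<theta>)) x = ennreal (N f x)"
  by (simp add: N_def)

section \<open>Measurability of the crossing count\<close>

lemma closed_hitting_set:
  assumes "closed K"
  shows "closed {x. \<exists>t\<in>{a..b}. x + t *\<^sub>R \<omega> \<in> K}"
proof -
  have "compact ((\<lambda>t. t *\<^sub>R \<omega>) ` {a..b})"
    by (intro compact_continuous_image continuous_intros) auto
  then have "closed (\<Union>x\<in>K. \<Union>y\<in>(\<lambda>t. t *\<^sub>R \<omega>) ` {a..b}. {x - y})"
    by (rule closed_compact_differences[OF assms])
  also have "(\<Union>x\<in>K. \<Union>y\<in>(\<lambda>t. t *\<^sub>R \<omega>) ` {a..b}. {x - y}) = {x. \<exists>t\<in>{a..b}. x + t *\<^sub>R \<omega> \<in> K}"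
  proof safe
    fix x k t assume "k \<in> K" "t \<in> {a..b}"
    then show "\<exists>s\<in>{a..b}. k - t *\<^sub>R \<omega> + s *\<^sub>R \<omega> \<in> K" by (intro bexI[of _ t]) auto
  next
    fix x t assume "t \<in> {a..b}" "x + t *\<^sub>R \<omega> \<in> K"
    moreover have "x = (x + t *\<^sub>R \<omega>) - t *\<^sub>R \<omega>" by simp
    ultimately show "x \<in> (\<Union>x\<in>K. \<Union>y\<in>(\<lambda>t. t *\<^sub>R \<omega>) ` {a..b}. {x - y})" by blast
  qed
  finally show ?thesis .
qed

lemma hitting_set_measurable:
  assumes "closed K"
  shows "{x. \<exists>t\<in>{a..<b}. x + t *\<^sub>R \<omega> \<in> K} \<in> sets borel"
proof -
  have "{x. \<exists>t\<in>{a..<b}. x + t *\<^sub>R \<omega> \<in> K} = (\<Union>m. {x. \<exists>t\<in>{a..b - 1 / real (Suc m)}. x + t *\<^sub>R \<omega> \<in> K})"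
  proof safe
    fix x t assume t: "t \<in> {a..<b}" "x + t *\<^sub>R \<omega> \<in> K"
    then obtain m where "inverse (real (Suc m)) < b - t" using reals_Archimedean[of "b - t"] by auto
    then have "t \<in> {a..b - 1 / real (Suc m)}" using t by (simp add: inverse_eq_divide)
    then show "x \<in> (\<Union>m. {x. \<exists>t\<in>{a..b - 1 / real (Suc m)}. x + t *\<^sub>R \<omega> \<in> K})" using t(2) by blast
  next
    fix x m t assume t: "t \<in> {a..b - 1 / real (Suc m)}" "x + t *\<^sub>R \<omega> \<in> K"
    have "0 < 1 / real (Suc m)" by simp
    moreover have "a \<le> t" "t \<le> b - 1 / real (Suc m)" using t(1) by auto
    ultimately have "t \<in> {a..<b}" unfolding atLeastLessThan_iff by linarith
    then show "\<exists>t\<in>{a..<b}. x + t *\<^sub>R \<omega> \<in> K" using t(2) by blast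
  qed
  also have "\<dots> \<in> sets borel" by (intro sets.countable_UN) (auto intro: borel_closed closed_hitting_set[OF assms])
  finally show ?thesis .
qed

lemma finite_gap:
  assumes "finite (A :: real set)"
  obtains d where "0 < d" "\<And>s t. s \<in> A \<Longrightarrow> t \<in> A \<Longrightarrow> s \<noteq> t \<Longrightarrow> d \<le> \<bar>s - t\<bar>"
proof -
  define D where "D = insert 1 ((\<lambda>(s, t). \<bar>s - t\<bar>) ` {p \<in> A \<times> A. fst p \<noteq> snd p})"
  have D: "finite D" using assms by (auto simp: D_def)
  have "0 < Min D" using D by (subst Min_gr_iff) (auto simp: D_def)
  moreover have "Min D \<le> \<bar>s - t\<bar>" if "s \<in> A" "t \<in> A" "s \<noteq> t" for s t
    using D that by (intro Min_le) (auto simp: D_def image_iff)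
  ultimately show thesis using that by blast
qed

text \<open>The window is cut into M half-open pieces. Once they are shorter than the gaps between
  the finitely many hits, the count is the number of pieces that are hit, and hitting a closed set
  during a piece is a Borel condition on the starting point.\<close>

lemma N_closed_measurable:
  assumes A: "closed A"
  shows "N (indicator A :: 'd torus \<Rightarrow> real) \<in> borel_measurable borel"
proof (rule borel_measurable_LIMSEQ_metric)
  define K where "K = {y. q 0 y = 0 \<and> abs_torus y \<in> A}"
  have K: "closed K"
  proof -
    have "K = q 0 -` {0} \<inter> abs_torus -` A" by (auto simp: K_def)
    also have "closed \<dots>"
      by (intro closed_Int closed_vimage A closed_singleton q_continuous continuous_abs_torus)
    finally show ?thesis .
  qed
  define I where "I M j = {real j * h / real M..<real (Suc j) * h / real M}" for M j :: nat
  define H where "H M j = {x. \<exists>t\<in>I M j. x + t *\<^sub>R \<omega> \<in> K}" for M j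
  have [measurable]: "H M j \<in> sets borel" for M j
    unfolding H_def I_def by (rule hitting_set_measurable[OF K])
  show "(\<lambda>x. \<Sum>j<M. indicator (H M j) x :: real) \<in> borel_measurable borel" for M
    by measurable
  fix x :: "real ^ 'd"
  define W where "W = {t \<in> {0..<h}. x + t *\<^sub>R \<omega> \<in> K}"
  have W: "W = {t \<in> Z x. abs_torus (x + t *\<^sub>R \<omega>) \<in> A}" by (auto simp: W_def Z_def K_def)
  then have finW: "finite W" by simp
  have NW: "N (indicator A :: 'd torus \<Rightarrow> real) x = real (card W)"
  proof -
    have "N (indicator A :: 'd torus \<Rightarrow> real) x = (\<Sum>t\<in>Z x. if abs_torus (x + t *\<^sub>R \<omega>) \<in> A then 1 else 0)"
      unfolding N_def by (rule sum.cong) (auto simp: indicator_def)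
    also have "\<dots> = (\<Sum>t\<in>W. 1)"
      unfolding W by (rule sum.inter_filter[symmetric]) simp
    finally show ?thesis by simp
  qed
  obtain d where d: "0 < d" "\<And>s t. s \<in> W \<Longrightarrow> t \<in> W \<Longrightarrow> s \<noteq> t \<Longrightarrow> d \<le> \<bar>s - t\<bar>"
    using finite_gap[OF finW] by blast
  \<comment> \<open>Beyond this M a piece has length below the smallest gap d, so it contains at
    most one hit.\<close>
  obtain M0 :: nat where M0: "h / d < real M0" using reals_Archimedean2 by blast
  have "(\<Sum>j<M. indicator (H M j) x) = N (indicator A :: 'd torus \<Rightarrow> real) x" if M: "M0 + 1 \<le> M" for M
  proof -
    have Mpos: "0 < real M" using M by simp
    have len: "h / real M < d"
    proof -
      have "h / d < real M" using M0 M by linarith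
      then show ?thesis using d(1) Mpos by (simp add: field_simps)
    qed
    have one: "card (W \<inter> I M j) = (if x \<in> H M j then 1 else 0)" if "j < M" for j
    proof -
      have sub: "s = t" if "s \<in> W \<inter> I M j" "t \<in> W \<inter> I M j" for s t
      proof (rule ccontr)
        assume "s \<noteq> t"
        then have "d \<le> \<bar>s - t\<bar>" using d(2) that by blast
        moreover have "\<bar>s - t\<bar> < h / real M"
          using that unfolding I_def by (auto simp: add_divide_distrib distrib_right abs_less_iff)
        ultimately show False using len by linarith
      qed
      have sub01: "I M j \<subseteq> {0..<h}"
      proof
        fix t assume t: "t \<in> I M j"
        have "0 \<le> real j * h / real M" using h_pos by simp
        moreover have "real (Suc j) * h / real M \<le> real M * h / real M"
          using that h_pos Mpos by (intro divide_right_mono mult_right_mono) auto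
        ultimately show "t \<in> {0..<h}" using t Mpos by (auto simp: I_def)
      qed
      show ?thesis
      proof (cases "x \<in> H M j")
        case True
        then obtain t where "t \<in> I M j" "x + t *\<^sub>R \<omega> \<in> K" by (auto simp: H_def)
        then have "t \<in> W \<inter> I M j" using subsetD[OF sub01] by (simp add: W_def)
        then have "W \<inter> I M j = {t}" using sub by blast
        then show ?thesis using True by simp
      next
        case False
        then have "W \<inter> I M j = {}" unfolding H_def W_def by blast
        then show ?thesis using False by simp
      qed
    qed
    have "W = (\<Union>j<M. W \<inter> I M j)"
    proof safe
      fix t assume t: "t \<in> W"
      define j where "j = nat \<lfloor>t * real M / h\<rfloor>"
      have t0: "0 \<le> t" "t < h" using t by (auto simp: W_def)
      have nn: "0 \<le> t * real M / h" using t0 Mpos h_pos by simp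
      have "real j \<le> t * real M / h" "t * real M / h < real j + 1"
        unfolding j_def using nn by linarith+
      then have I: "t \<in> I M j" using Mpos h_pos by (simp add: I_def field_simps)
      have "t * real M / h < real M" using t0 Mpos h_pos by (simp add: field_simps)
      then have "j < M" using \<open>real j \<le> t * real M / h\<close> by linarith
      then show "t \<in> (\<Union>j<M. W \<inter> I M j)" using I t by blast
    qed
    moreover have "card (\<Union>j<M. W \<inter> I M j) = (\<Sum>j<M. card (W \<inter> I M j))"
    proof (rule card_UN_disjoint)
      show "\<forall>i\<in>{..<M}. \<forall>j\<in>{..<M}. i \<noteq> j \<longrightarrow> (W \<inter> I M i) \<inter> (W \<inter> I M j) = {}"
      proof (intro ballI impI)
        fix i j :: nat assume "i \<noteq> j"
        have disj: "I M i \<inter> I M j = {}" if "i < j" for i j :: nat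
        proof -
          have "real (Suc i) * h / real M \<le> real j * h / real M"
            using that h_pos Mpos by (intro divide_right_mono mult_right_mono) auto
          then show ?thesis by (auto simp: I_def)
        qed
        then show "(W \<inter> I M i) \<inter> (W \<inter> I M j) = {}" using disj[of i j] disj[of j i] \<open>i \<noteq> j\<close> by (cases i j rule: linorder_cases) blast+
      qed
    qed (use finW in auto)
    ultimately have "card W = (\<Sum>j<M. card (W \<inter> I M j))" by simp
    also have "\<dots> = (\<Sum>j<M. if x \<in> H M j then 1 else 0)" using one by (intro sum.cong) auto
    finally have "N (indicator A :: 'd torus \<Rightarrow> real) x = (\<Sum>j<M. real (if x \<in> H M j then 1 else 0))"
      unfolding NW by (simp only: of_nat_sum)
    also have "\<dots> = (\<Sum>j<M. indicator (H M j) x)"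
      by (rule sum.cong) (auto simp: indicator_def)
    finally show ?thesis ..
  qed
  then have "\<forall>\<^sub>F M in sequentially. (\<Sum>j<M. indicator (H M j) x) = N (indicator A :: 'd torus \<Rightarrow> real) x"
    by (intro eventually_sequentiallyI[of "M0 + 1"])
  then show "(\<lambda>M. \<Sum>j<M. indicator (H M j) x) \<longlonglongrightarrow> N (indicator A :: 'd torus \<Rightarrow> real) x"
    by (rule tendsto_eventually)
qed

text \<open>Dynkin's argument starting from closed sets. Complements are allowed because the counts
  are finite at every point, so that subtraction in \<open>ennreal\<close> inverts addition.\<close>

lemma N_indicator_measurable:
  assumes "A \<in> sets borel"
  shows "N (indicator A :: 'd torus \<Rightarrow> ennreal) \<in> borel_measurable borel"
proof -
  let ?N = "\<lambda>A. N (indicator A :: 'd torus \<Rightarrow> ennreal)"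
  have closed: "?N A \<in> borel_measurable borel" if "closed A" for A
  proof -
    have "?N A x = ennreal (N (indicator A :: 'd torus \<Rightarrow> real) x)" for x
      using N_ennreal[of "indicator A" x] by (simp add: ennreal_indicator)
    then have "?N A = (\<lambda>x. ennreal (N (indicator A :: 'd torus \<Rightarrow> real) x))" by auto
    then show ?thesis using N_closed_measurable[OF that] by simp
  qed
  have "Int_stable {A :: 'd torus set. closed A}" "{A :: 'd torus set. closed A} \<subseteq> Pow UNIV"
    "A \<in> sigma_sets UNIV {A. closed A}"
    using assms by (auto simp: borel_eq_closed Int_stable_def)
  then show ?thesis
  proof (induction A rule: sigma_sets_induct_disjoint)
    case empty
    then show ?case by (simp add: N_def[abs_def])
  next
    case (compl A)
    have "?N (UNIV - A) x = ?N UNIV x - ?N A x" for x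
    proof -
      have "?N UNIV x = ?N (UNIV - A) x + ?N A x"
        unfolding N_add[symmetric] by (intro arg_cong2[where f=N]) (auto simp: indicator_def)
      moreover have "?N A x \<noteq> top" by (simp add: N_def indicator_def)
      ultimately show ?thesis by (simp add: ennreal_add_diff_cancel_right)
    qed
    then have "?N (UNIV - A) = (\<lambda>x. ?N UNIV x - ?N A x)" by auto
    then show ?case using compl closed[of UNIV] by simp
  next
    case (union A)
    have "?N (\<Union>i. A i) x = (\<Sum>i. ?N (A i) x)" for x
    proof -
      have "?N (\<Union>i. A i) x = (\<Sum>t\<in>Z x. \<Sum>i. indicator (A i) (abs_torus (x + t *\<^sub>R \<omega>)))"
        unfolding N_def using union(1) by (simp add: suminf_indicator)
      also have "\<dots> = (\<Sum>i. ?N (A i) x)" unfolding N_def by (rule suminf_sum[symmetric]) auto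
      finally show ?thesis .
    qed
    then have "?N (\<Union>i. A i) = (\<lambda>x. \<Sum>i. ?N (A i) x)" by auto
    then show ?case using union(3) by simp
  qed (auto simp: closed)
qed

lemma N_SUP:
  fixes U :: "nat \<Rightarrow> 'd torus \<Rightarrow> ennreal"
  assumes "incseq U"
  shows "N (\<lambda>\<theta>. SUP i. U i \<theta>) x = (SUP i. N (U i) x)"
proof -
  have inc: "incseq (\<lambda>i. U i \<theta>)" for \<theta> using assms by (auto simp: incseq_def le_fun_def)
  show ?thesis
    unfolding N_def by (rule ennreal_SUP_sum[symmetric]) (rule inc)
qed

end

section \<open>Starting points whose orbit meets a tangency\<close>

lemma inner_eq_0_card_1:
  fixes v w :: "real ^ 'n::finite"
  assumes "CARD('n) = 1" "v \<bullet> w = 0"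
  shows "v = 0 \<or> w = 0"
proof -
  obtain i :: 'n where i: "UNIV = {i}" using assms(1) card_1_singletonE by blast
  have "v $ i * w $ i = 0" using assms(2) unfolding inner_vec_def i by simp
  moreover have "j = i" for j using i by blast
  ultimately show ?thesis by (metis mult_eq_0_iff vec_eq_iff zero_index)
qed

lemma negligible_line:
  fixes a v :: "'a::euclidean_space"
  assumes "2 \<le> DIM('a)"
  shows "negligible (range (\<lambda>t. a + t *\<^sub>R v))"
proof -
  have "dim (span {v}) \<le> 1" using dim_le_card'[of "{v}"] by (simp add: dim_span)
  then have "negligible (span {v})" using assms by (intro negligible_lowdim) simp
  then have "negligible ((+) a ` span {v})" by (rule negligible_translation)
  moreover have "range (\<lambda>t. a + t *\<^sub>R v) \<subseteq> (+) a ` span {v}" by (auto simp: span_singleton)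
  ultimately show ?thesis by (rule negligible_subset)
qed

lemma compact_bounded_away:
  fixes f :: "'a::topological_space \<Rightarrow> real"
  assumes "compact K" "continuous_on K f" "\<And>x. x \<in> K \<Longrightarrow> f x \<noteq> 0"
  obtains c where "0 < c" "\<And>x. x \<in> K \<Longrightarrow> c \<le> \<bar>f x\<bar>"
proof (cases "K = {}")
  case False
  have "continuous_on K (\<lambda>x. \<bar>f x\<bar>)" using assms(2) by (intro continuous_intros)
  from continuous_attains_inf[OF assms(1) False this]
  obtain y where "y \<in> K" "\<And>x. x \<in> K \<Longrightarrow> \<bar>f y\<bar> \<le> \<bar>f x\<bar>" by auto
  then show thesis using that[of "\<bar>f y\<bar>"] assms(3) by auto
qed (use that[of 1] in auto)

context torus_flow
begin

lemma \<omega>_nonzero: "\<omega> \<noteq> 0"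
proof
  assume "\<omega> = 0"
  moreover have "(1 :: int ^ 'd) \<noteq> 0" by (simp add: vec_eq_iff)
  ultimately show False using nonres[unfolded nonresonant_def, rule_format, of 1] by simp
qed

lemma tangency_empty_card_1:
  assumes "CARD('d) = 1"
  shows "tangency_set \<omega> S = {}"
proof -
  have False if "\<theta> \<in> tangency_set \<omega> S" for \<theta>
  proof -
    have "\<omega> \<bullet> torus_grad S \<theta> = 0" "\<theta> \<in> zero_set S" using that by (auto simp: tangency_set_def D_op_def)
    then show False using inner_eq_0_card_1[OF assms] \<omega>_nonzero regular by blast
  qed
  then show ?thesis by blast
qed

lemma tangency_iff: "abs_torus y \<in> tangency_set \<omega> S \<longleftrightarrow> q 0 y = 0 \<and> q 1 y = 0"
  by (simp add: tangency_set_def zero_set_def q_0 q_1)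

text \<open>These points lie on countably many lines, one through each lattice translate of each of
  the finitely many tangencies. Lines are null from dimension 2 on; in dimension 1 a vanishing
  derivative along \<omega> forces a vanishing gradient, so there are no tangencies.\<close>

lemma negligible_tangency_orbits: "negligible {x. \<exists>t. abs_torus (x + t *\<^sub>R \<omega>) \<in> tangency_set \<omega> S}"
proof (cases "CARD('d) = 1")
  case True
  then show ?thesis by (simp add: tangency_empty_card_1)
next
  case False
  then have dim: "2 \<le> DIM(real ^ 'd)"
    using zero_less_card_finite[where 'a='d] by (simp; linarith)
  let ?L = "\<lambda>(c, k). range (\<lambda>t. (rep_torus c + lattice k) + t *\<^sub>R \<omega>)"
  have "countable (tangency_set \<omega> S \<times> (UNIV :: (int ^ 'd) set))"
    by (intro countable_SIGMA countable_finite[OF fin] countableI_type)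
  then have "negligible (\<Union>p\<in>tangency_set \<omega> S \<times> UNIV. ?L p)"
    by (intro negligible_countable_Union) (auto intro!: negligible_line dim)
  moreover have "{x. \<exists>t. abs_torus (x + t *\<^sub>R \<omega>) \<in> tangency_set \<omega> S} \<subseteq> (\<Union>p\<in>tangency_set \<omega> S \<times> UNIV. ?L p)"
  proof safe
    fix x t assume c: "abs_torus (x + t *\<^sub>R \<omega>) \<in> tangency_set \<omega> S"
    let ?c = "abs_torus (x + t *\<^sub>R \<omega>)"
    have "abs_torus (rep_torus ?c) = ?c" by simp
    then obtain k where k: "x + t *\<^sub>R \<omega> = rep_torus ?c + lattice k" by (metis abs_torus_eq_lattice)
    then have "x = (rep_torus ?c + lattice k) + (- t) *\<^sub>R \<omega>" by (simp add: algebra_simps)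
    then have "x \<in> ?L (?c, k)" unfolding prod.case by (rule range_eqI)
    then show "x \<in> (\<Union>p\<in>tangency_set \<omega> S \<times> UNIV. ?L p)" using c by blast
  qed
  ultimately show ?thesis by (rule negligible_subset)
qed

end

context torus_flow_window
begin

lemma N_measurable [measurable]:
  assumes "g \<in> borel_measurable borel"
  shows "N (g :: 'd torus \<Rightarrow> ennreal) \<in> borel_measurable borel"
  using assms
proof (induction rule: borel_measurable_induct)
  case (cong f g)
  then show ?case by (simp add: fun_eq_iff[symmetric] flip: ext)
next
  case (set A)
  then show ?case by (rule N_indicator_measurable)
next
  case (mult u c)
  then show ?case by (simp add: N_cmult[abs_def] N_def[abs_def] sum_distrib_left[symmetric])
next
  case (add u v)
  then show ?case by (simp add: N_def[abs_def] sum.distrib)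
next
  case (seq U)
  have "N (\<lambda>\<theta>. SUP i. U i \<theta>) = (\<lambda>x. SUP i. N (U i) x)" using N_SUP[OF \<open>incseq U\<close>] by auto
  moreover have "(SUP i. U i) = (\<lambda>\<theta>. SUP i. U i \<theta>)" by (auto simp: fun_eq_iff image_comp)
  ultimately show ?case using seq.IH \<open>g = _\<close> by simp
qed

lemma N_measurable_real:
  assumes "f \<in> borel_measurable borel" "\<And>\<theta>. 0 \<le> f \<theta>"
  shows "N (f :: 'd torus \<Rightarrow> real) \<in> borel_measurable borel"
proof -
  have "N f x = enn2real (N (\<lambda>\<theta>. ennreal (f \<theta>)) x)" for x
    using assms(2) by (simp add: N_ennreal) (simp add: N_def sum_nonneg)
  then have "N f = (\<lambda>x. enn2real (N (\<lambda>\<theta>. ennreal (f \<theta>)) x))" by auto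
  then show ?thesis using assms(1) by simp
qed

lemma N_abs_le:
  assumes "\<And>\<theta>. \<bar>f \<theta>\<bar> \<le> B"
  shows "\<bar>N f x\<bar> \<le> real n * (B :: real)"
proof -
  have B: "0 \<le> B" using assms[of undefined] by linarith
  have "\<bar>N f x\<bar> \<le> (\<Sum>t\<in>Z x. \<bar>f (abs_torus (x + t *\<^sub>R \<omega>))\<bar>)" unfolding N_def by (rule sum_abs)
  also have "\<dots> \<le> (\<Sum>t\<in>Z x. B)" by (intro sum_mono assms)
  also have "\<dots> \<le> real n * B" using card_Z[of x] B by (simp add: mult_right_mono)
  finally show ?thesis .
qed

text \<open>Every orbit segment of length h meets the zero set finitely often, so Fubini along the
  flow shows that h times the volume of the lifted zero set is 0.\<close>

lemma AE_not_zero: "AE x in lborel. q 0 x \<noteq> 0"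
proof -
  let ?A = "{x. q 0 x = 0}"
  have [measurable]: "?A \<in> sets borel" by measurable
  have "(\<integral>\<^sup>+x. (\<integral>\<^sup>+t. indicator {0..<h} t * indicator ?A (x + t *\<^sub>R \<omega>) \<partial>lborel) \<partial>lborel) = (\<integral>\<^sup>+x. 0 \<partial>(lborel :: (real ^ 'd) measure))"
  proof (rule nn_integral_cong)
    fix x
    have "(\<integral>\<^sup>+t. indicator {0..<h} t * indicator ?A (x + t *\<^sub>R \<omega>) \<partial>lborel) = (\<integral>\<^sup>+t. indicator (Z x) t \<partial>lborel)"
      by (intro nn_integral_cong) (auto simp: Z_def indicator_def)
    also have "\<dots> = emeasure lborel (Z x)" by (rule nn_integral_indicator) (simp add: finite_imp_closed borel_closed)
    also have "\<dots> = 0" by (intro emeasure_lborel_countable countable_finite) simp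
    finally show "(\<integral>\<^sup>+t. indicator {0..<h} t * indicator ?A (x + t *\<^sub>R \<omega>) \<partial>lborel) = 0" .
  qed
  then have "0 = (\<integral>\<^sup>+x. (\<integral>\<^sup>+t. indicator {0..<h} t * indicator ?A (x + t *\<^sub>R \<omega>) \<partial>lborel) \<partial>lborel)" by simp
  also have "\<dots> = (\<integral>\<^sup>+t. (\<integral>\<^sup>+x. indicator {0..<h} t * indicator ?A (x + t *\<^sub>R \<omega>) \<partial>lborel) \<partial>lborel)"
    by (rule lborel_pair.Fubini'[symmetric]) measurable
  also have "\<dots> = (\<integral>\<^sup>+t. indicator {0..<h} t * emeasure lborel ?A \<partial>lborel)"
  proof (rule nn_integral_cong)
    fix t
    have "(\<integral>\<^sup>+x. indicator ?A (x + t *\<^sub>R \<omega>) \<partial>lborel) = (\<integral>\<^sup>+x. indicator ?A x \<partial>lborel)"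
      by (rule nn_integral_lborel_shift) measurable
    then show "(\<integral>\<^sup>+x. indicator {0..<h} t * indicator ?A (x + t *\<^sub>R \<omega>) \<partial>lborel) = indicator {0..<h} t * emeasure lborel ?A"
      by (subst nn_integral_cmult) auto
  qed
  also have "\<dots> = ennreal h * emeasure lborel ?A"
    using h_pos by (simp add: nn_integral_multc)
  finally have "emeasure lborel ?A = 0" using h_pos by simp
  then show ?thesis by (intro AE_I[of _ _ ?A]) auto
qed

section \<open>Good starting points and their isolated transversal zeros\<close>

definition good :: "real ^ 'd \<Rightarrow> bool" where
  "good x \<longleftrightarrow> q 0 x \<noteq> 0 \<and> q 0 (x + h *\<^sub>R \<omega>) \<noteq> 0 \<and>
     (\<forall>t\<in>{0..h}. q 0 (x + t *\<^sub>R \<omega>) = 0 \<longrightarrow> q 1 (x + t *\<^sub>R \<omega>) \<noteq> 0)"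

lemma AE_good: "AE x in lborel. good x"
proof -
  have "(\<integral>\<^sup>+x. indicator {x. q 0 x = 0} (x + h *\<^sub>R \<omega>) \<partial>lborel) = (\<integral>\<^sup>+x. indicator {x. q 0 x = 0} x \<partial>lborel)"
    by (rule nn_integral_lborel_shift) measurable
  also have "\<dots> = (\<integral>\<^sup>+x. 0 \<partial>(lborel :: (real ^ 'd) measure))"
    using AE_not_zero by (intro nn_integral_cong_AE) (auto simp: indicator_def)
  finally have "(\<integral>\<^sup>+x. indicator {x. q 0 x = 0} (x + h *\<^sub>R \<omega>) \<partial>lborel) = 0" by simp
  then have "AE x in lborel. (indicator {x. q 0 x = 0} (x + h *\<^sub>R \<omega>) :: ennreal) = 0"
    by (subst nn_integral_0_iff_AE[symmetric]) auto
  then have "AE x in lborel. q 0 (x + h *\<^sub>R \<omega>) \<noteq> 0"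
    by eventually_elim (auto simp: indicator_def split: if_splits)
  moreover have "AE x in lborel. x \<notin> {x. \<exists>t. abs_torus (x + t *\<^sub>R \<omega>) \<in> tangency_set \<omega> S}"
  proof -
    have "AE x in lebesgue. x \<notin> {x. \<exists>t. abs_torus (x + t *\<^sub>R \<omega>) \<in> tangency_set \<omega> S}"
      by (rule AE_not_in) (use negligible_tangency_orbits in \<open>simp only: negligible_iff_null_sets\<close>)
    then show ?thesis by (simp only: AE_completion_iff)
  qed
  ultimately show ?thesis
    using AE_not_zero by eventually_elim (auto simp: good_def tangency_iff)
qed

text \<open>The transversal zeros in quantitative form: disjoint intervals of radius \<rho> around
  them, the sign \<sigma> of the derivative there, and a margin c by which the derivative on the
  intervals, the end values and the values outside avoid 0. The zeros survive a perturbation below c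
  in value and derivative, and a mollifier of width c sees the intervals alone.\<close>

definition isolating :: "real ^ 'd \<Rightarrow> real \<Rightarrow> real \<Rightarrow> (real \<Rightarrow> real) \<Rightarrow> bool" where
  "isolating x \<rho> c \<sigma> \<longleftrightarrow> 0 < \<rho> \<and> 0 < c \<and>
    (\<forall>z\<in>Z x. \<forall>z'\<in>Z x. z \<noteq> z' \<longrightarrow> 2 * \<rho> < \<bar>z - z'\<bar>) \<and>
    (\<forall>z\<in>Z x. \<rho> < z \<and> z + \<rho> < h \<and> (\<sigma> z = 1 \<or> \<sigma> z = - 1) \<and>
      (\<forall>t. \<bar>t - z\<bar> \<le> \<rho> \<longrightarrow> c \<le> \<sigma> z * q 1 (x + t *\<^sub>R \<omega>)) \<and>
      c \<le> \<sigma> z * q 0 (x + (z + \<rho>) *\<^sub>R \<omega>) \<and> \<sigma> z * q 0 (x + (z - \<rho>) *\<^sub>R \<omega>) \<le> - c) \<and>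
    (\<forall>t\<in>{0..h}. (\<forall>z\<in>Z x. \<rho> \<le> \<bar>t - z\<bar>) \<longrightarrow> c \<le> \<bar>q 0 (x + t *\<^sub>R \<omega>)\<bar>)"

lemma isolatingD:
  assumes "isolating x \<rho> c \<sigma>"
  shows "0 < \<rho>" "0 < c"
    "\<And>z z'. z \<in> Z x \<Longrightarrow> z' \<in> Z x \<Longrightarrow> z \<noteq> z' \<Longrightarrow> 2 * \<rho> < \<bar>z - z'\<bar>"
    "\<And>z. z \<in> Z x \<Longrightarrow> \<rho> < z \<and> z + \<rho> < h"
    "\<And>z. z \<in> Z x \<Longrightarrow> \<sigma> z = 1 \<or> \<sigma> z = - 1"
    "\<And>z t. z \<in> Z x \<Longrightarrow> \<bar>t - z\<bar> \<le> \<rho> \<Longrightarrow> c \<le> \<sigma> z * q 1 (x + t *\<^sub>R \<omega>)"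
    "\<And>t. t \<in> {0..h} \<Longrightarrow> (\<And>z. z \<in> Z x \<Longrightarrow> \<rho> \<le> \<bar>t - z\<bar>) \<Longrightarrow> c \<le> \<bar>q 0 (x + t *\<^sub>R \<omega>)\<bar>"
    "\<And>z. z \<in> Z x \<Longrightarrow> c \<le> \<sigma> z * q 0 (x + (z + \<rho>) *\<^sub>R \<omega>)"
    "\<And>z. z \<in> Z x \<Longrightarrow> \<sigma> z * q 0 (x + (z - \<rho>) *\<^sub>R \<omega>) \<le> - c"
  using assms unfolding isolating_def by blast+

lemma ex_isolating:
  assumes "good x" "0 < \<rho>0"
  obtains \<rho> c \<sigma> where "\<rho> < \<rho>0" "isolating x \<rho> c \<sigma>"
proof -
  let ?f = "\<lambda>t. q 0 (x + t *\<^sub>R \<omega>)" and ?f' = "\<lambda>t. q 1 (x + t *\<^sub>R \<omega>)"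
  have Zx: "0 < z \<and> z < h \<and> ?f z = 0 \<and> ?f' z \<noteq> 0" if "z \<in> Z x" for z
    using that assms(1) by (cases "z = 0") (auto simp: Z_def good_def)
  obtain d where d: "0 < d" "\<And>s t. s \<in> Z x \<Longrightarrow> t \<in> Z x \<Longrightarrow> s \<noteq> t \<Longrightarrow> d \<le> \<bar>s - t\<bar>"
    using finite_gap[OF finite_Z] by blast
  define P where "P z \<rho> \<longleftrightarrow> \<rho> < z \<and> z + \<rho> < h \<and> 2 * \<rho> < d \<and> (\<forall>t. \<bar>t - z\<bar> \<le> \<rho> \<longrightarrow> 0 < sgn (?f' z) * ?f' t)" for z \<rho>
  have "\<forall>\<^sub>F \<rho> in at_right 0. P z \<rho>" if z: "z \<in> Z x" for z
  proof -
    have "isCont (\<lambda>t. sgn (?f' z) * ?f' t) z"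
      using q_line_continuous[of UNIV 1 x] by (auto intro!: continuous_intros simp: continuous_on_eq_continuous_at)
    then have "(\<lambda>t. sgn (?f' z) * ?f' t) \<midarrow>z\<rightarrow> sgn (?f' z) * ?f' z" by (simp only: isCont_def)
    moreover have pos: "0 < sgn (?f' z) * ?f' z" using Zx[OF z] by (auto simp: sgn_if)
    ultimately have "\<forall>\<^sub>F t in at z. 0 < sgn (?f' z) * ?f' t" by (rule order_tendstoD)
    then have "\<forall>\<^sub>F t in nhds z. 0 < sgn (?f' z) * ?f' t"
      using pos by (simp only: eventually_nhds_conv_at)
    then obtain e where e: "0 < e" "\<And>t. dist t z < e \<Longrightarrow> 0 < sgn (?f' z) * ?f' t"
      unfolding eventually_nhds_metric by blast
    have "\<forall>\<^sub>F \<rho> in at_right 0. \<rho> < Min {z, h - z, d / 2, e}"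
      using Zx[OF z] d(1) e(1) by (intro eventually_at_right_less eventually_at_rightI[of 0 "Min {z, h - z, d / 2, e}"]) auto
    then show ?thesis
      by eventually_elim (use e(2) in \<open>auto simp: P_def dist_real_def\<close>)
  qed
  then have "\<forall>\<^sub>F \<rho> in at_right 0. \<forall>z\<in>Z x. P z \<rho>" by (simp add: eventually_ball_finite)
  moreover have "\<forall>\<^sub>F \<rho> in at_right 0. \<rho> < \<rho>0" using assms(2) by (intro eventually_at_rightI[of 0 \<rho>0]) auto
  moreover have "\<forall>\<^sub>F \<rho> in at_right (0::real). 0 < \<rho>" by (rule eventually_at_right_less)
  ultimately have "\<forall>\<^sub>F \<rho> in at_right 0. (\<forall>z\<in>Z x. P z \<rho>) \<and> \<rho> < \<rho>0 \<and> 0 < \<rho>" by eventually_elim simp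
  then obtain \<rho> where \<rho>: "\<And>z. z \<in> Z x \<Longrightarrow> P z \<rho>" "\<rho> < \<rho>0" "0 < \<rho>"
    using eventually_happens'[OF trivial_limit_at_right_real] by blast
  define \<sigma> where "\<sigma> z = sgn (?f' z)" for z
  have \<sigma>: "\<sigma> z = 1 \<or> \<sigma> z = - 1" if "z \<in> Z x" for z
    using Zx[OF that] by (auto simp: \<sigma>_def sgn_if)
  have Pz: "\<rho> < z" "z + \<rho> < h" "2 * \<rho> < d" "\<And>t. \<bar>t - z\<bar> \<le> \<rho> \<Longrightarrow> 0 < \<sigma> z * ?f' t" if "z \<in> Z x" for z
    using \<rho>(1)[OF that] by (auto simp: P_def \<sigma>_def)
  have sep: "2 * \<rho> < \<bar>z - z'\<bar>" if "z \<in> Z x" "z' \<in> Z x" "z \<noteq> z'" for z z'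
    using Pz(3)[OF that(1)] d(2)[OF that] by linarith
  \<comment> \<open>The margin comes from two compact sets: near the zeros the derivative does not
    vanish, away from them the function does not.\<close>
  let ?K1 = "\<Union>z\<in>Z x. {z - \<rho>..z + \<rho>}"
  obtain c1 where c1: "0 < c1" "\<And>t. t \<in> ?K1 \<Longrightarrow> c1 \<le> \<bar>?f' t\<bar>"
  proof (rule compact_bounded_away[of ?K1 ?f'])
    show "?f' t \<noteq> 0" if "t \<in> ?K1" for t
    proof -
      obtain z where z: "z \<in> Z x" "\<bar>t - z\<bar> \<le> \<rho>" using \<open>t \<in> ?K1\<close> by (auto simp: abs_le_iff)
      then show ?thesis using Pz(4)[OF z] by auto
    qed
  qed (auto intro: q_line_continuous)
  let ?K2 = "{0..h} - (\<Union>z\<in>Z x. {z - \<rho><..<z + \<rho>})"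
  obtain c2 where c2: "0 < c2" "\<And>t. t \<in> ?K2 \<Longrightarrow> c2 \<le> \<bar>?f t\<bar>"
  proof (rule compact_bounded_away[of ?K2 ?f])
    show "compact ?K2" by (intro compact_diff compact_Icc open_UN) auto
    show "?f t \<noteq> 0" if t: "t \<in> ?K2" for t
    proof
      assume "?f t = 0"
      then have "t \<in> Z x" using t assms(1) by (cases "t = h") (auto simp: Z_def good_def)
      then show False using t \<rho>(3) by auto
    qed
  qed (auto intro: q_line_continuous)
  define c where "c = min c1 c2"
  have D: "c \<le> \<bar>?f t\<bar>" if "t \<in> {0..h}" "\<And>z. z \<in> Z x \<Longrightarrow> \<rho> \<le> \<bar>t - z\<bar>" for t
  proof -
    have "t \<in> ?K2" using that(1) that(2) by (fastforce simp: abs_if split: if_splits)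
    then show ?thesis using c2(2) by (force simp: c_def)
  qed
  have C: "c \<le> \<sigma> z * ?f' t" if "z \<in> Z x" "\<bar>t - z\<bar> \<le> \<rho>" for z t
  proof -
    have "t \<in> ?K1" using that by (auto simp: abs_le_iff intro!: bexI[of _ z])
    then have "c \<le> \<bar>?f' t\<bar>" using c1(2) by (force simp: c_def)
    then show ?thesis using Pz(4)[OF that] \<sigma>[OF that(1)] by auto
  qed
  \<comment> \<open>The ends of the intervals lie in the second set, which gives the size of the end
    values; the mean value theorem, started at z, gives their sign.\<close>
  have E: "c \<le> \<sigma> z * ?f (z + \<rho>)" "\<sigma> z * ?f (z - \<rho>) \<le> - c" if z: "z \<in> Z x" for z
  proof -
    have far: "\<rho> \<le> \<bar>z + \<rho> - z'\<bar>" "\<rho> \<le> \<bar>z - \<rho> - z'\<bar>" if "z' \<in> Z x" for z'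
      using sep[OF z that] \<rho>(3) by (cases "z = z'"; linarith)+
    have abs: "c \<le> \<bar>?f (z + \<rho>)\<bar>" "c \<le> \<bar>?f (z - \<rho>)\<bar>"
      using D[of "z + \<rho>"] D[of "z - \<rho>"] far Pz[OF z] \<rho>(3) Zx[OF z] by auto
    have fz: "?f z = 0" using Zx[OF z] by simp
    obtain s where s: "z < s" "s < z + \<rho>" "?f (z + \<rho>) - ?f z = (z + \<rho> - z) * ?f' s"
      using MVT2[of z "z + \<rho>" ?f ?f'] q_deriv[of 0 x] \<rho>(3) by auto
    obtain r where r: "z - \<rho> < r" "r < z" "?f z - ?f (z - \<rho>) = (z - (z - \<rho>)) * ?f' r"
      using MVT2[of "z - \<rho>" z ?f ?f'] q_deriv[of 0 x] \<rho>(3) by auto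
    have pos: "0 < \<rho> * (\<sigma> z * ?f' s)" "0 < \<rho> * (\<sigma> z * ?f' r)"
      using Pz(4)[OF z, of s] Pz(4)[OF z, of r] s r \<rho>(3) by auto
    have "?f (z + \<rho>) = \<rho> * ?f' s" "?f (z - \<rho>) = - (\<rho> * ?f' r)"
      using s(3) r(3) fz by simp_all
    then have "\<sigma> z * ?f (z + \<rho>) = \<rho> * (\<sigma> z * ?f' s)" "\<sigma> z * ?f (z - \<rho>) = - (\<rho> * (\<sigma> z * ?f' r))"
      by (simp_all only: mult.left_commute mult_minus_right)
    with pos have "0 < \<sigma> z * ?f (z + \<rho>)" "\<sigma> z * ?f (z - \<rho>) < 0" by linarith+
    then show "c \<le> \<sigma> z * ?f (z + \<rho>)" "\<sigma> z * ?f (z - \<rho>) \<le> - c"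
      using abs \<sigma>[OF z] by auto
  qed
  have "0 < c" using c1(1) c2(1) by (simp add: c_def)
  then have "isolating x \<rho> c \<sigma>"
    unfolding isolating_def using \<rho>(3) sep Pz(1,2) \<sigma> C D E by blast
  then show thesis by (rule that[OF \<rho>(2)])
qed

end

section \<open>Mollified Dirac masses\<close>

lemma mollifierD:
  assumes "mollifier \<phi>"
  shows "continuous_on UNIV \<phi>" "\<And>s. 0 \<le> \<phi> s" "\<And>s. 1 \<le> \<bar>s\<bar> \<Longrightarrow> \<phi> s = 0"
    "(\<integral>\<^sup>+s. ennreal (\<phi> s) \<partial>lborel) = 1"
proof -
  show "continuous_on UNIV \<phi>" using assms by (auto simp: mollifier_def intro: smooth_continuous)
  show nonneg: "0 \<le> \<phi> s" for s using assms by (auto simp: mollifier_def)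
  show "\<phi> s = 0" if "1 \<le> \<bar>s\<bar>" for s
  proof (rule ccontr)
    assume "\<phi> s \<noteq> 0"
    then have "s \<in> closure {s. \<phi> s \<noteq> 0}" using closure_subset[of "{s. \<phi> s \<noteq> 0}"] by blast
    then have "s \<in> {-1<..<1}" using assms unfolding mollifier_def by blast
    then show False using that by auto
  qed
  have one: "(LINT s|lborel. \<phi> s) = 1" using assms by (auto simp: mollifier_def)
  \<comment> \<open>A function that is not integrable has integral 0 by convention.\<close>
  then have "integrable lborel \<phi>" using not_integrable_integral_eq by force
  then show "(\<integral>\<^sup>+s. ennreal (\<phi> s) \<partial>lborel) = 1"
    using nn_integral_eq_integral[of lborel \<phi>] nonneg one by simp
qed

lemma scaled_mollifier:
  assumes \<phi>: "mollifier \<phi>" and \<eta>: "0 < \<eta>"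
  defines "\<psi> \<equiv> \<lambda>s. 1 / \<eta> * \<phi> (s / \<eta>)"
  shows "continuous_on UNIV \<psi>" "\<And>s. 0 \<le> \<psi> s" "\<And>s. \<eta> \<le> \<bar>s\<bar> \<Longrightarrow> \<psi> s = 0"
    "(\<integral>\<^sup>+s. ennreal (\<psi> s) \<partial>lborel) = 1"
proof -
  note \<phi>' = mollifierD[OF \<phi>]
  have comp: "continuous_on UNIV (\<lambda>s. \<phi> (s / \<eta>))"
    by (rule continuous_on_compose2[OF \<phi>'(1)]) (use \<eta> in \<open>auto intro!: continuous_intros\<close>)
  then show "continuous_on UNIV \<psi>" unfolding \<psi>_def by (intro continuous_intros)
  show "0 \<le> \<psi> s" for s using \<phi>'(2) \<eta> by (simp add: \<psi>_def)
  show "\<psi> s = 0" if "\<eta> \<le> \<bar>s\<bar>" for s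
  proof -
    have "1 \<le> \<bar>s / \<eta>\<bar>" using that \<eta> by simp
    then show ?thesis using \<phi>'(3) by (simp add: \<psi>_def)
  qed
  have [measurable]: "\<phi> \<in> borel_measurable borel" using \<phi>'(1) by (rule borel_measurable_continuous_onI)
  have [measurable]: "\<psi> \<in> borel_measurable borel"
    using \<open>continuous_on UNIV \<psi>\<close> by (rule borel_measurable_continuous_onI)
  have "(\<integral>\<^sup>+s. ennreal (\<psi> s) \<partial>lborel) = ennreal \<bar>\<eta>\<bar> * (\<integral>\<^sup>+s. ennreal (\<psi> (0 + \<eta> * s)) \<partial>lborel)"
    using \<eta> by (intro nn_integral_real_affine) auto
  also have "\<dots> = ennreal \<eta> * (\<integral>\<^sup>+s. ennreal (1 / \<eta>) * ennreal (\<phi> s) \<partial>lborel)"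
    using \<eta> \<phi>'(2) by (simp add: \<psi>_def ennreal_mult' flip: ennreal_mult)
  also have "\<dots> = ennreal \<eta> * (ennreal (1 / \<eta>) * (\<integral>\<^sup>+s. ennreal (\<phi> s) \<partial>lborel))"
    by (subst nn_integral_cmult) auto
  also have "\<dots> = 1" using \<eta> \<phi>'(4) by (simp flip: ennreal_mult')
  finally show "(\<integral>\<^sup>+s. ennreal (\<psi> s) \<partial>lborel) = 1" .
qed

context torus_flow_window
begin

text \<open>On each isolating interval the end values of the perturbed function keep opposite signs
  and its derivative keeps its sign, so there is exactly one zero; elsewhere the margin c excludes
  zeros.\<close>

lemma perturbed_zeros:
  assumes iso: "isolating x \<rho> c \<sigma>"
    and near: "\<And>t. \<bar>q 0 (x' + t *\<^sub>R \<omega>) - q 0 (x + t *\<^sub>R \<omega>)\<bar> < c"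
      "\<And>t. \<bar>q 1 (x' + t *\<^sub>R \<omega>) - q 1 (x + t *\<^sub>R \<omega>)\<bar> < c"
  obtains \<tau> where "bij_betw \<tau> (Z x) (Z x')" "\<And>z. z \<in> Z x \<Longrightarrow> \<bar>\<tau> z - z\<bar> < \<rho>"
proof -
  let ?f = "\<lambda>t. q 0 (x' + t *\<^sub>R \<omega>)" and ?f' = "\<lambda>t. q 1 (x' + t *\<^sub>R \<omega>)"
  note \<rho> = isolatingD(1)[OF iso] and sep = isolatingD(3)[OF iso] and inside = isolatingD(4)[OF iso]
    and \<sigma> = isolatingD(5)[OF iso] and C = isolatingD(6)[OF iso] and D = isolatingD(7)[OF iso]
    and E = isolatingD(8,9)[OF iso]
  have f': "0 < \<sigma> z * ?f' t" if "z \<in> Z x" "\<bar>t - z\<bar> \<le> \<rho>" for z t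
    using C[OF that] near(2)[of t] \<sigma>[OF that(1)] by auto
  have ends: "0 < \<sigma> z * ?f (z + \<rho>)" "\<sigma> z * ?f (z - \<rho>) < 0" if "z \<in> Z x" for z
    using E(1)[OF that] E(2)[OF that] near(1)[of "z + \<rho>"] near(1)[of "z - \<rho>"] \<sigma>[OF that] by auto
  have ex: "\<exists>t. \<bar>t - z\<bar> < \<rho> \<and> ?f t = 0" if z: "z \<in> Z x" for z
  proof -
    have "\<exists>t\<ge>z - \<rho>. t \<le> z + \<rho> \<and> \<sigma> z * ?f t = 0"
      using ends[OF z] \<rho> by (intro IVT') (auto intro!: continuous_intros q_line_continuous)
    then obtain t where t: "z - \<rho> \<le> t" "t \<le> z + \<rho>" "\<sigma> z * ?f t = 0" by blast
    have "t \<noteq> z - \<rho>" "t \<noteq> z + \<rho>" using t(3) ends[OF z] by auto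
    moreover have "?f t = 0" using t(3) \<sigma>[OF z] by auto
    ultimately show ?thesis using t by (intro exI[of _ t]) auto
  qed
  then obtain \<tau> where \<tau>: "\<And>z. z \<in> Z x \<Longrightarrow> \<bar>\<tau> z - z\<bar> < \<rho> \<and> ?f (\<tau> z) = 0" by metis
  have uniq: "s = t" if z: "z \<in> Z x" and "\<bar>s - z\<bar> < \<rho>" "\<bar>t - z\<bar> < \<rho>" "?f s = 0" "?f t = 0" for z s t
  proof -
    have False if "s < t" "\<bar>s - z\<bar> < \<rho>" "\<bar>t - z\<bar> < \<rho>" "?f s = 0" "?f t = 0" for s t
    proof -
      obtain r where r: "s < r" "r < t" "?f t - ?f s = (t - s) * ?f' r"
        using MVT2[of s t ?f ?f'] q_deriv[of 0 x'] \<open>s < t\<close> by auto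
      then have "?f' r = 0" using that by auto
      moreover have "\<bar>r - z\<bar> \<le> \<rho>" using r that by linarith
      ultimately show False using f'[OF z, of r] by simp
    qed
    then show ?thesis using that by (cases s t rule: linorder_cases) blast+
  qed
  have "bij_betw \<tau> (Z x) (Z x')"
    unfolding bij_betw_def
  proof
    show "inj_on \<tau> (Z x)"
    proof (rule inj_onI, rule ccontr)
      fix z z' assume zz: "z \<in> Z x" "z' \<in> Z x" "\<tau> z = \<tau> z'" "z \<noteq> z'"
      then show False using sep[OF zz(1,2,4)] \<tau>[OF zz(1)] \<tau>[OF zz(2)] by auto
    qed
    show "\<tau> ` Z x = Z x'"
    proof safe
      fix z assume z: "z \<in> Z x"
      then show "\<tau> z \<in> Z x'" using \<tau>[OF z] inside[OF z] by (auto simp: Z_def)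
    next
      fix t assume t: "t \<in> Z x'"
      have t0: "t \<in> {0..h}" "?f t = 0" using t by (auto simp: Z_def)
      have "\<not> c \<le> \<bar>q 0 (x + t *\<^sub>R \<omega>)\<bar>" using near(1)[of t] t0(2) by auto
      then obtain z where z: "z \<in> Z x" "\<bar>t - z\<bar> < \<rho>" using D[OF t0(1)] by (metis not_le)
      then have "t = \<tau> z" using uniq[OF z(1)] \<tau>[OF z(1)] t0(2) by blast
      then show "t \<in> \<tau> ` Z x" using z(1) by blast
    qed
  qed
  then show thesis using that \<tau> by blast
qed

lemma isCont_N:
  fixes f :: "'d torus \<Rightarrow> real"
  assumes f: "continuous_on (zero_set S) f" and x: "good x"
  shows "isCont (N f) x"
  unfolding continuous_at_eps_delta
proof safe
  fix e :: real assume e: "0 < e"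
  \<comment> \<open>There are at most n summands, and each will change by at most this
    amount.\<close>
  define e' where "e' = e / (real n + 1)"
  have e': "0 < e'" using e by (simp add: e'_def add_pos_nonneg)
  have "\<exists>d>0. \<forall>\<theta>\<in>zero_set S. dist \<theta> (abs_torus (x + z *\<^sub>R \<omega>)) < d \<longrightarrow> dist (f \<theta>) (f (abs_torus (x + z *\<^sub>R \<omega>))) < e'"
    if "z \<in> Z x" for z
  proof -
    have "abs_torus (x + z *\<^sub>R \<omega>) \<in> zero_set S" using that by (simp add: Z_def zero_set_def q_0)
    then show ?thesis using f e' unfolding continuous_on_iff by blast
  qed
  then obtain d where d: "\<And>z. z \<in> Z x \<Longrightarrow> 0 < d z"
    "\<And>z \<theta>. z \<in> Z x \<Longrightarrow> \<theta> \<in> zero_set S \<Longrightarrow> dist \<theta> (abs_torus (x + z *\<^sub>R \<omega>)) < d z \<Longrightarrow>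
      dist (f \<theta>) (f (abs_torus (x + z *\<^sub>R \<omega>))) < e'"
    by metis
  define d0 where "d0 = Min (insert 1 (d ` Z x))"
  have d0: "0 < d0" "\<And>z. z \<in> Z x \<Longrightarrow> d0 \<le> d z"
    unfolding d0_def using d(1) by (subst Min_gr_iff) (auto intro: Min_le)
  have \<omega>: "0 < norm \<omega>" using \<omega>_nonzero by simp
  obtain \<rho> c \<sigma> where \<rho>: "\<rho> < d0 / (2 * norm \<omega>)" and iso: "isolating x \<rho> c \<sigma>"
    using ex_isolating[OF x, of "d0 / (2 * norm \<omega>)"] d0(1) \<omega> by (metis divide_pos_pos mult_pos_pos zero_less_numeral)
  note c = isolatingD(2)[OF iso]
  obtain d1 where d1: "0 < d1" "\<And>y y'. dist y y' < d1 \<Longrightarrow> dist (q 0 y) (q 0 y') < c"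
    using periodic_uniformly_continuous[OF q_periodic q_continuous c] by blast
  obtain d2 where d2: "0 < d2" "\<And>y y'. dist y y' < d2 \<Longrightarrow> dist (q 1 y) (q 1 y') < c"
    using periodic_uniformly_continuous[OF q_periodic q_continuous c] by blast
  have "dist (N f x') (N f x) < e" if x': "dist x' x < Min {d1, d2, d0 / 2}" for x'
  proof -
    have shift: "dist (x' + t *\<^sub>R \<omega>) (x + t *\<^sub>R \<omega>) = dist x' x" for t by (simp add: dist_norm)
    obtain \<tau> where \<tau>: "bij_betw \<tau> (Z x) (Z x')" "\<And>z. z \<in> Z x \<Longrightarrow> \<bar>\<tau> z - z\<bar> < \<rho>"
    proof (rule perturbed_zeros[OF iso])
      show "\<bar>q 0 (x' + t *\<^sub>R \<omega>) - q 0 (x + t *\<^sub>R \<omega>)\<bar> < c" for t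
        using d1(2)[of "x' + t *\<^sub>R \<omega>" "x + t *\<^sub>R \<omega>"] x' shift by (simp add: dist_real_def)
      show "\<bar>q 1 (x' + t *\<^sub>R \<omega>) - q 1 (x + t *\<^sub>R \<omega>)\<bar> < c" for t
        using d2(2)[of "x' + t *\<^sub>R \<omega>" "x + t *\<^sub>R \<omega>"] x' shift by (simp add: dist_real_def)
    qed (rule that)
    have close: "\<bar>f (abs_torus (x' + \<tau> z *\<^sub>R \<omega>)) - f (abs_torus (x + z *\<^sub>R \<omega>))\<bar> \<le> e'" if z: "z \<in> Z x" for z
    proof -
      have "\<tau> z \<in> Z x'" using \<tau>(1) z by (auto simp: bij_betw_def)
      then have mem: "abs_torus (x' + \<tau> z *\<^sub>R \<omega>) \<in> zero_set S" by (simp add: Z_def zero_set_def q_0)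
      have "dist (abs_torus (x' + \<tau> z *\<^sub>R \<omega>)) (abs_torus (x + z *\<^sub>R \<omega>)) \<le> dist (x' + \<tau> z *\<^sub>R \<omega>) (x + z *\<^sub>R \<omega>)"
        by (rule dist_abs_torus_le)
      also have "\<dots> = norm ((x' - x) + (\<tau> z - z) *\<^sub>R \<omega>)" by (simp add: dist_norm algebra_simps)
      also have "\<dots> \<le> dist x' x + \<bar>\<tau> z - z\<bar> * norm \<omega>"
        using norm_triangle_ineq[of "x' - x" "(\<tau> z - z) *\<^sub>R \<omega>"] by (simp add: dist_norm)
      \<comment> \<open>Half of \<open>d0\<close> pays for the displacement of the starting point,
        half for the shift of the crossing time.\<close>
      also have "\<dots> < d0 / 2 + d0 / 2"
      proof (rule add_strict_mono)
        show "dist x' x < d0 / 2" using x' by simp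
        have "\<bar>\<tau> z - z\<bar> * norm \<omega> < d0 / (2 * norm \<omega>) * norm \<omega>"
          using \<tau>(2)[OF z] \<rho> \<omega> by (intro mult_strict_right_mono) auto
        then show "\<bar>\<tau> z - z\<bar> * norm \<omega> < d0 / 2" using \<omega> by simp
      qed
      also have "\<dots> \<le> d z" using d0(2)[OF z] by simp
      finally show ?thesis using d(2)[OF z mem] by (simp add: dist_real_def)
    qed
    have "N f x' = (\<Sum>z\<in>Z x. f (abs_torus (x' + \<tau> z *\<^sub>R \<omega>)))"
      unfolding N_def by (rule sum.reindex_bij_betw[OF \<tau>(1), symmetric])
    then have "N f x' - N f x = (\<Sum>z\<in>Z x. f (abs_torus (x' + \<tau> z *\<^sub>R \<omega>)) - f (abs_torus (x + z *\<^sub>R \<omega>)))"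
      by (simp add: N_def sum_subtractf)
    then have "\<bar>N f x' - N f x\<bar> \<le> (\<Sum>z\<in>Z x. \<bar>f (abs_torus (x' + \<tau> z *\<^sub>R \<omega>)) - f (abs_torus (x + z *\<^sub>R \<omega>))\<bar>)"
      by (simp only: sum_abs)
    also have "\<dots> \<le> (\<Sum>z\<in>Z x. e')" by (intro sum_mono close)
    also have "\<dots> \<le> real n * e'" using card_Z[of x] e' by (simp add: mult_right_mono)
    also have "\<dots> < (real n + 1) * e'" using e' by simp
    also have "\<dots> = e" by (simp add: e'_def)
    finally show ?thesis by (simp add: dist_real_def)
  qed
  moreover have "0 < Min {d1, d2, d0 / 2}" using d1 d2 d0 by simp
  ultimately show "\<exists>d>0. \<forall>x'. dist x' x < d \<longrightarrow> dist (N f x') (N f x) < e" by blast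
qed

text \<open>A smoothed number of crossings in the window: by change of variables, every monotone
  passage through the whole support of \<psi> contributes the integral of \<psi>.\<close>

definition mass :: "(real \<Rightarrow> real) \<Rightarrow> real ^ 'd \<Rightarrow> ennreal" where
  "mass \<psi> x = (\<integral>\<^sup>+t\<in>{0..h}. ennreal (\<psi> (q 0 (x + t *\<^sub>R \<omega>)) * \<bar>q 1 (x + t *\<^sub>R \<omega>)\<bar>) \<partial>lborel)"

text \<open>Either the segment avoids the support of \<psi>, or the derivative of some order j \<ge>
  1 has no zero; then \<open>q 1\<close> has at most j - 1 zeros, which leaves at most j monotone
  pieces, each contributing at most 1.\<close>

lemma mass_le:
  assumes \<psi>: "continuous_on UNIV \<psi>" "(\<integral>\<^sup>+s. ennreal (\<psi> s) \<partial>lborel) = 1"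
    and supp: "\<And>s. 1 / real n \<le> \<bar>s\<bar> \<Longrightarrow> \<psi> s = 0"
  shows "mass \<psi> x \<le> of_nat n"
  using window[of x]
proof
  assume *: "\<forall>t\<in>{0..h}. 1 / real n < \<bar>q 0 (x + t *\<^sub>R \<omega>)\<bar>"
  have "mass \<psi> x = (\<integral>\<^sup>+t. 0 \<partial>(lborel :: real measure))"
    unfolding mass_def using * supp by (intro nn_integral_cong) (force simp: indicator_def less_imp_le)
  then show ?thesis by simp
next
  assume "\<exists>j\<in>{1..n}. \<forall>t\<in>{0..h}. q j (x + t *\<^sub>R \<omega>) \<noteq> 0"
  then obtain j where j: "j \<in> {1..n}" "\<And>t. t \<in> {0..h} \<Longrightarrow> q j (x + t *\<^sub>R \<omega>) \<noteq> 0" by blast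
  then obtain k where k: "j = Suc k" by (cases j) auto
  let ?Z1 = "{t \<in> {0..h}. q 1 (x + t *\<^sub>R \<omega>) = 0}"
  have "finite {t \<in> {0..h}. q (Suc 0) (x + t *\<^sub>R \<omega>) = 0} \<and> card {t \<in> {0..h}. q (Suc 0) (x + t *\<^sub>R \<omega>) = 0} \<le> k"
    by (rule zeros_card_le[where F="\<lambda>j t. q (Suc j) (x + t *\<^sub>R \<omega>)"]) (use q_deriv j(2) k in auto)
  then have fin: "finite ?Z1" "card ?Z1 \<le> k" by auto
  have sub: "{t \<in> {0<..<h}. q 1 (x + t *\<^sub>R \<omega>) = 0} \<subseteq> ?Z1" by auto
  have "mass \<psi> x \<le> of_nat (card {t \<in> {0<..<h}. q 1 (x + t *\<^sub>R \<omega>) = 0} + 1)"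
    unfolding mass_def
    by (rule nn_integral_pieces_le[OF \<psi>(1) _ _ q_line_continuous])
      (use \<psi>(2) q_deriv[of 0 x] finite_subset[OF sub fin(1)] in auto)
  also have "\<dots> \<le> of_nat n"
    using card_mono[OF fin(1) sub] fin(2) j(1) k by (intro of_nat_mono) auto
  finally show ?thesis .
qed

text \<open>If \<psi> vanishes for \<bar>s\<bar> \<ge> c, the isolating intervals alone contribute;
  across each of them the function is monotone and runs through all of [-c, c], so the contribution
  is 1.\<close>

lemma mass_eq:
  assumes x: "good x"
  obtains c where "0 < c" "\<And>\<psi>. continuous_on UNIV \<psi> \<Longrightarrow> (\<integral>\<^sup>+s. ennreal (\<psi> s) \<partial>lborel) = 1 \<Longrightarrow>
    (\<And>s. c \<le> \<bar>s\<bar> \<Longrightarrow> \<psi> s = 0) \<Longrightarrow> mass \<psi> x = of_nat (card (Z x))"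
proof -
  obtain \<rho> c \<sigma> where iso: "isolating x \<rho> c \<sigma>"
    using ex_isolating[OF x zero_less_one] by blast
  note st = isolatingD[OF iso]
  have "mass \<psi> x = of_nat (card (Z x))"
    if \<psi>: "continuous_on UNIV \<psi>" "(\<integral>\<^sup>+s. ennreal (\<psi> s) \<partial>lborel) = 1" "\<And>s. c \<le> \<bar>s\<bar> \<Longrightarrow> \<psi> s = 0" for \<psi>
  proof -
    let ?F = "\<lambda>t. ennreal (\<psi> (q 0 (x + t *\<^sub>R \<omega>)) * \<bar>q 1 (x + t *\<^sub>R \<omega>)\<bar>)"
    have meas: "?F \<in> borel_measurable borel"
      by (intro measurable_compose[OF _ measurable_ennreal] borel_measurable_continuous_onI continuous_intros
          q_line_continuous continuous_on_compose2[OF \<psi>(1) q_line_continuous]) auto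
    have "?F t * indicator {0..h} t = (\<Sum>z\<in>Z x. ?F t * indicator {z - \<rho>..z + \<rho>} t)" for t
    proof (cases "\<exists>z\<in>Z x. \<bar>t - z\<bar> \<le> \<rho>")
      case True
      then obtain z where z: "z \<in> Z x" "\<bar>t - z\<bar> \<le> \<rho>" by blast
      have ind: "indicator {z' - \<rho>..z' + \<rho>} t = (if z' = z then 1 else 0 :: ennreal)" if "z' \<in> Z x" for z'
        using st(3)[OF that z(1)] z(2) by (auto simp: indicator_def abs_le_iff)
      have "(\<Sum>z\<in>Z x. ?F t * indicator {z - \<rho>..z + \<rho>} t) = (\<Sum>z'\<in>Z x. if z' = z then ?F t else 0)"
        using ind by (intro sum.cong) auto
      also have "\<dots> = ?F t" using z(1) by simp
      also have "\<dots> = ?F t * indicator {0..h} t"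
      proof -
        have "t \<in> {0..h}" using st(4)[OF z(1)] z(2) by (auto simp: abs_le_iff)
        then show ?thesis by simp
      qed
      finally show ?thesis ..
    next
      case False
      have "(\<Sum>z\<in>Z x. ?F t * indicator {z - \<rho>..z + \<rho>} t) = 0"
        using False by (intro sum.neutral) (auto simp: indicator_def abs_le_iff)
      moreover have "?F t * indicator {0..h} t = 0"
      proof (cases "t \<in> {0..h}")
        case True
        then have "c \<le> \<bar>q 0 (x + t *\<^sub>R \<omega>)\<bar>" using st(7) False by (meson less_imp_le not_le)
        then show ?thesis using \<psi>(3) by simp
      qed simp
      ultimately show ?thesis by (simp only:)
    qed
    then have "mass \<psi> x = (\<integral>\<^sup>+t. (\<Sum>z\<in>Z x. ?F t * indicator {z - \<rho>..z + \<rho>} t) \<partial>lborel)"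
      unfolding mass_def by (simp only:)
    also have "\<dots> = (\<Sum>z\<in>Z x. (\<integral>\<^sup>+t\<in>{z - \<rho>..z + \<rho>}. ?F t \<partial>lborel))"
      using meas by (intro nn_integral_sum) auto
    also have "\<dots> = (\<Sum>z\<in>Z x. 1)"
    proof (rule sum.cong[OF refl])
      fix z assume z: "z \<in> Z x"
      have full: "(\<integral>\<^sup>+s\<in>{a..b}. ennreal (\<psi> s) \<partial>lborel) = 1" if "a \<le> - c" "c \<le> b" for a b
      proof -
        have "(\<integral>\<^sup>+s\<in>{a..b}. ennreal (\<psi> s) \<partial>lborel) = (\<integral>\<^sup>+s. ennreal (\<psi> s) \<partial>lborel)"
        proof (rule nn_integral_cong)
          fix s
          show "ennreal (\<psi> s) * indicator {a..b} s = ennreal (\<psi> s)"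
            using \<psi>(3)[of s] that by (cases "c \<le> \<bar>s\<bar>") (auto simp: indicator_def)
        qed
        then show ?thesis using \<psi>(2) by simp
      qed
      have near: "\<bar>t - z\<bar> \<le> \<rho>" if "t \<in> {z - \<rho>..z + \<rho>}" for t using that by (auto simp: abs_le_iff)
      have deriv: "((\<lambda>t. q 0 (x + t *\<^sub>R \<omega>)) has_real_derivative q 1 (x + t *\<^sub>R \<omega>)) (at t)" for t
        using q_deriv[of 0 x t] by simp
      show "(\<integral>\<^sup>+t\<in>{z - \<rho>..z + \<rho>}. ?F t \<partial>lborel) = 1"
        using st(5)[OF z]
      proof
        assume \<sigma>: "\<sigma> z = 1"
        have "(\<integral>\<^sup>+t\<in>{z - \<rho>..z + \<rho>}. ?F t \<partial>lborel) =
            (\<integral>\<^sup>+s\<in>{q 0 (x + (z - \<rho>) *\<^sub>R \<omega>)..q 0 (x + (z + \<rho>) *\<^sub>R \<omega>)}. ennreal (\<psi> s) \<partial>lborel)"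
        proof (rule nn_integral_increasing_piece[OF \<psi>(1) deriv q_line_continuous])
          show "0 \<le> q 1 (x + t *\<^sub>R \<omega>)" if "t \<in> {z - \<rho>..z + \<rho>}" for t
            using st(6)[OF z near[OF that]] st(2) \<sigma> by simp
        qed (use st(1) in auto)
        also have "\<dots> = 1" using st(8,9)[OF z] \<sigma> by (intro full) auto
        finally show ?thesis .
      next
        assume \<sigma>: "\<sigma> z = - 1"
        have "(\<integral>\<^sup>+t\<in>{z - \<rho>..z + \<rho>}. ?F t \<partial>lborel) =
            (\<integral>\<^sup>+s\<in>{q 0 (x + (z + \<rho>) *\<^sub>R \<omega>)..q 0 (x + (z - \<rho>) *\<^sub>R \<omega>)}. ennreal (\<psi> s) \<partial>lborel)"
        proof (rule nn_integral_decreasing_piece[OF \<psi>(1) deriv q_line_continuous])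
          show "q 1 (x + t *\<^sub>R \<omega>) \<le> 0" if "t \<in> {z - \<rho>..z + \<rho>}" for t
            using st(6)[OF z near[OF that]] st(2) \<sigma> by simp
        qed (use st(1) in auto)
        also have "\<dots> = 1" using st(8,9)[OF z] \<sigma> by (intro full) auto
        finally show ?thesis .
      qed
    qed
    also have "\<dots> = of_nat (card (Z x))" by simp
    finally show ?thesis .
  qed
  then show thesis using that st(2) by blast
qed

end

section \<open>Long time averages\<close>

context torus_flow
begin

lemma closed_zero_set: "closed (zero_set S)"
proof -
  have "zero_set S = S -` {0}" by (auto simp: zero_set_def)
  moreover have "continuous_on UNIV S" using D_op_continuous[of UNIV 0] by simp
  ultimately show ?thesis by (simp add: closed_vimage)
qed

lemma zero_set_measurable [measurable]: "zero_set S \<in> sets borel"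
  using closed_zero_set by simp

end

context torus_flow_window
begin

definition zeros :: "real \<Rightarrow> real \<Rightarrow> real set" where
  "zeros a b = {t \<in> {a..b}. q 0 (t *\<^sub>R \<omega>) = 0}"

lemma zeros_window: "finite (zeros a (a + h)) \<and> card (zeros a (a + h)) \<le> n"
proof -
  have "zeros a (a + h) = (+) a ` {t \<in> {0..h}. q 0 (a *\<^sub>R \<omega> + t *\<^sub>R \<omega>) = 0}"
  proof safe
    fix t assume "t \<in> zeros a (a + h)"
    then show "t \<in> (+) a ` {t \<in> {0..h}. q 0 (a *\<^sub>R \<omega> + t *\<^sub>R \<omega>) = 0}"
      by (intro image_eqI[of _ _ "t - a"]) (auto simp: zeros_def simp flip: scaleR_left_distrib)
  qed (auto simp: zeros_def scaleR_left_distrib)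
  then show ?thesis
    using closed_window_zeros[of "a *\<^sub>R \<omega>"] by (simp add: card_image)
qed

lemma finite_zeros: "finite (zeros a b)"
proof -
  have fin: "finite (zeros a (a + real m * h))" for m
  proof (induction m)
    case 0
    then show ?case by (rule finite_subset[rotated, of "{a}"]) (auto simp: zeros_def)
  next
    case (Suc m)
    have "zeros a (a + real (Suc m) * h) \<subseteq> zeros a (a + real m * h) \<union> zeros (a + real m * h) (a + real m * h + h)"
      by (auto simp: zeros_def algebra_simps)
    then show ?case using Suc zeros_window finite_subset by blast
  qed
  obtain m :: nat where "(b - a) / h < real m" using reals_Archimedean2 by blast
  then have "b \<le> a + real m * h" using h_pos by (simp add: field_simps)
  then have "zeros a b \<subseteq> zeros a (a + real m * h)" by (auto simp: zeros_def)
  then show ?thesis using fin finite_subset by blast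
qed

text \<open>A zero u is seen exactly from the starting times in (u - h, u]. This interval has length
  h and lies in [0, L] unless u < h or u > L, and each exceptional range holds at most n zeros. The
  loss at the left end and the gain at the right end have opposite signs, so the bound for one of
  them suffices.\<close>

lemma time_integral_N:
  fixes f :: "'d torus \<Rightarrow> real"
  assumes f: "\<And>\<theta>. 0 \<le> f \<theta>" "\<And>\<theta>. f \<theta> \<le> B" and L: "h \<le> L"
  shows "\<bar>(LINT s:{0..L}|lborel. N f (s *\<^sub>R \<omega>)) - h * (\<Sum>t\<in>zeros 0 L. f (abs_torus (t *\<^sub>R \<omega>)))\<bar> \<le> h * (real n * B)"
proof -
  define g where "g t = f (abs_torus (t *\<^sub>R \<omega>))" for t
  have g: "0 \<le> g t" "g t \<le> B" for t using f by (auto simp: g_def)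
  have B: "0 \<le> B" using g order_trans by blast
  \<comment> \<open>Starting times up to L see zeros up to L + h.\<close>
  let ?W = "zeros 0 (L + h)"
  define w where "w u = measure lborel ({0..L} \<inter> {u - h<..u})" for u
  have N: "N f (s *\<^sub>R \<omega>) = (\<Sum>u\<in>?W. g u * indicator {u - h<..u} s)" if "s \<in> {0..L}" for s
  proof -
    have "bij_betw ((+) s) (Z (s *\<^sub>R \<omega>)) {u \<in> ?W. s \<in> {u - h<..u}}"
    proof (rule bij_betw_byWitness[of _ "\<lambda>u. u - s"])
      show "(+) s ` Z (s *\<^sub>R \<omega>) \<subseteq> {u \<in> ?W. s \<in> {u - h<..u}}"
        using that by (auto simp: Z_def zeros_def scaleR_left_distrib)
      show "(\<lambda>u. u - s) ` {u \<in> ?W. s \<in> {u - h<..u}} \<subseteq> Z (s *\<^sub>R \<omega>)"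
        by (auto simp: Z_def zeros_def simp flip: scaleR_left_distrib)
    qed auto
    then have "(\<Sum>t\<in>Z (s *\<^sub>R \<omega>). g (s + t)) = (\<Sum>u\<in>{u \<in> ?W. s \<in> {u - h<..u}}. g u)"
      by (rule sum.reindex_bij_betw)
    also have "\<dots> = (\<Sum>u\<in>?W. if s \<in> {u - h<..u} then g u else 0)"
      by (rule sum.inter_filter[OF finite_zeros])
    also have "\<dots> = (\<Sum>u\<in>?W. g u * indicator {u - h<..u} s)"
      by (rule sum.cong) (auto simp: indicator_def)
    finally show ?thesis by (simp add: N_def g_def scaleR_left_distrib)
  qed
  have "(LINT s:{0..L}|lborel. N f (s *\<^sub>R \<omega>)) = (LINT s|lborel. (\<Sum>u\<in>?W. g u * indicator ({0..L} \<inter> {u - h<..u}) s))"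
    unfolding set_lebesgue_integral_def
    by (intro Bochner_Integration.integral_cong) (auto simp: N indicator_def intro!: sum.cong)
  also have "\<dots> = (\<Sum>u\<in>?W. g u * w u)"
  proof -
    have "emeasure lborel ({0..L} \<inter> {u - h<..u}) < \<infinity>" for u
    proof -
      have "emeasure lborel ({0..L} \<inter> {u - h<..u}) \<le> emeasure lborel {0..L}" by (rule emeasure_mono) auto
      also have "\<dots> < \<infinity>" by (simp add: emeasure_lborel_Icc_eq)
      finally show ?thesis .
    qed
    then have "integrable lborel (\<lambda>s. g u * indicator ({0..L} \<inter> {u - h<..u}) s)" for u
      by (intro integrable_mult_right integrable_real_indicator) auto
    then have "(LINT s|lborel. (\<Sum>u\<in>?W. g u * indicator ({0..L} \<inter> {u - h<..u}) s))
        = (\<Sum>u\<in>?W. LINT s|lborel. g u * indicator ({0..L} \<inter> {u - h<..u}) s)"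
      by (rule Bochner_Integration.integral_sum)
    then show ?thesis unfolding w_def by simp
  qed
  finally have eq: "(LINT s:{0..L}|lborel. N f (s *\<^sub>R \<omega>)) = (\<Sum>u\<in>?W. g u * w u)" .
  have w: "0 \<le> w u" "w u \<le> h" for u
  proof -
    have "w u \<le> measure lborel {u - h<..u}" unfolding w_def by (rule measure_mono_fmeasurable) (use h_pos in \<open>auto simp: fmeasurable_def\<close>)
    then show "w u \<le> h" using h_pos by simp
  qed (simp add: w_def)
  have w_mid: "w u = h" if "h \<le> u" "u \<le> L" for u
  proof -
    have "{0..L} \<inter> {u - h<..u} = {u - h<..u}" using that h_pos by auto
    then show ?thesis using h_pos by (simp add: w_def)
  qed
  have few: "(\<Sum>u\<in>A. g u) \<le> real n * B" if A: "A \<subseteq> zeros a (a + h)" for A a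
  proof -
    have "(\<Sum>u\<in>A. g u) \<le> (\<Sum>u\<in>A. B)" by (intro sum_mono g)
    also have "\<dots> = real (card A) * B" by simp
    also have "\<dots> \<le> real n * B"
      using card_mono[OF conjunct1[OF zeros_window] A] zeros_window[of a] B by (intro mult_right_mono) auto
    finally show ?thesis .
  qed
  have split: "?W = zeros 0 L \<union> (?W - zeros 0 L)" using h_pos by (auto simp: zeros_def)
  have "(\<Sum>u\<in>?W. g u * w u) = (\<Sum>u\<in>zeros 0 L. g u * w u) + (\<Sum>u\<in>?W - zeros 0 L. g u * w u)"
    by (subst split, rule sum.union_disjoint) (auto simp: finite_zeros)
  moreover have "(\<Sum>u\<in>zeros 0 L. g u * w u) \<le> (\<Sum>u\<in>zeros 0 L. g u * h)"
    by (intro sum_mono mult_left_mono w g)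
  moreover have "(\<Sum>u\<in>?W - zeros 0 L. g u * w u) \<le> h * (real n * B)"
  proof -
    have "(\<Sum>u\<in>?W - zeros 0 L. g u * w u) \<le> (\<Sum>u\<in>?W - zeros 0 L. g u * h)"
      by (intro sum_mono mult_left_mono w g)
    also have "\<dots> = h * (\<Sum>u\<in>?W - zeros 0 L. g u)" by (simp add: sum_distrib_left mult.commute)
    also have "\<dots> \<le> h * (real n * B)"
      using h_pos by (intro mult_left_mono few[of _ L]) (auto simp: zeros_def)
    finally show ?thesis .
  qed
  moreover have "0 \<le> (\<Sum>u\<in>?W - zeros 0 L. g u * w u)" by (intro sum_nonneg mult_nonneg_nonneg w g)
  moreover have "(\<Sum>u\<in>zeros 0 L. g u * h) - (\<Sum>u\<in>zeros 0 L. g u * w u) \<le> h * (real n * B)"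
  proof -
    let ?E = "{u \<in> zeros 0 L. u < h}"
    have "(\<Sum>u\<in>zeros 0 L. g u * h) - (\<Sum>u\<in>zeros 0 L. g u * w u) = (\<Sum>u\<in>zeros 0 L. g u * (h - w u))"
      by (simp add: right_diff_distrib sum_subtractf)
    also have "\<dots> = (\<Sum>u\<in>?E. g u * (h - w u))"
    proof (rule sum.mono_neutral_right[OF finite_zeros])
      show "\<forall>u\<in>zeros 0 L - ?E. g u * (h - w u) = 0"
      proof
        fix u assume "u \<in> zeros 0 L - ?E"
        then have "h \<le> u" "u \<le> L" by (auto simp: zeros_def)
        then show "g u * (h - w u) = 0" using w_mid by simp
      qed
    qed auto
    also have "\<dots> \<le> (\<Sum>u\<in>?E. g u * h)" using w by (intro sum_mono mult_left_mono g) auto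
    also have "\<dots> = h * (\<Sum>u\<in>?E. g u)" by (simp add: sum_distrib_left mult.commute)
    also have "\<dots> \<le> h * (real n * B)"
      using h_pos by (intro mult_left_mono few[of _ 0]) (auto simp: zeros_def)
    finally show ?thesis .
  qed
  moreover have "(\<Sum>u\<in>zeros 0 L. g u * h) = h * (\<Sum>t\<in>zeros 0 L. f (abs_torus (t *\<^sub>R \<omega>)))"
    by (simp add: g_def sum_distrib_left mult.commute)
  ultimately show ?thesis unfolding eq by linarith
qed

text \<open>Crossing sums evaluate f on the zero set alone, so extension by 0 gives a Borel function
  on the torus with the same sums.\<close>

lemma restrict_to_zero_set:
  fixes f :: "'d torus \<Rightarrow> real"
  assumes "continuous_on (zero_set S) f"
  defines "g \<equiv> \<lambda>\<theta>. if \<theta> \<in> zero_set S then f \<theta> else 0"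
  shows "g \<in> borel_measurable borel" "continuous_on (zero_set S) g" "N g = N f"
proof -
  have "(\<lambda>\<theta>. indicator (zero_set S) \<theta> *\<^sub>R f \<theta>) \<in> borel_measurable borel"
    by (rule borel_measurable_continuous_on_indicator) (use assms in auto)
  moreover have "g = (\<lambda>\<theta>. indicator (zero_set S) \<theta> *\<^sub>R f \<theta>)" by (auto simp: g_def)
  ultimately show "g \<in> borel_measurable borel" by simp
  show "continuous_on (zero_set S) g" using assms(1) by (simp add: g_def cong: continuous_on_cong)
  show "N g = N f" by (rule ext) (auto simp: N_def Z_def zero_set_def q_0 g_def intro!: sum.cong)
qed

theorem zero_sum_limit:
  fixes f :: "'d torus \<Rightarrow> real"
  assumes f: "continuous_on (zero_set S) f" "\<And>\<theta>. \<theta> \<in> zero_set S \<Longrightarrow> 0 \<le> f \<theta>" "\<And>\<theta>. \<theta> \<in> zero_set S \<Longrightarrow> f \<theta> \<le> B"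
  shows "((\<lambda>L. (\<Sum>t\<in>zeros 0 L. f (abs_torus (t *\<^sub>R \<omega>))) / L) \<longlongrightarrow> cell_mean (N f) / h) at_top"
proof -
  define g where "g = (\<lambda>\<theta>. if \<theta> \<in> zero_set S then f \<theta> else 0)"
  note r = restrict_to_zero_set[OF f(1), folded g_def]
  define C where "C = max B 0"
  have g: "0 \<le> g \<theta>" "g \<theta> \<le> C" for \<theta> using f by (auto simp: g_def C_def le_max_iff_disj)
  have "equidistributed \<omega> (N g)"
  proof (rule equidistributed_AE_continuous[OF nonres periodic_N])
    show "N g \<in> borel_measurable borel" using r(1) g(1) by (rule N_measurable_real)
    show "\<bar>N g x\<bar> \<le> real n * C" for x using g by (intro N_abs_le) auto
    show "AE x in lborel. isCont (N g) x" using AE_good by eventually_elim (rule isCont_N[OF r(2)])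
  qed
  then have lim: "((\<lambda>L. time_mean \<omega> (N g) L / h) \<longlongrightarrow> cell_mean (N f) / h) at_top"
    unfolding equidistributed_def r(3) using h_pos by (intro tendsto_divide tendsto_const) auto
  have err: "((\<lambda>L. (\<Sum>t\<in>zeros 0 L. f (abs_torus (t *\<^sub>R \<omega>))) / L - time_mean \<omega> (N g) L / h) \<longlongrightarrow> 0) at_top"
  proof (rule tendsto_rabs_zero_cancel, rule tendsto_sandwich[OF _ _ tendsto_const])
    show "((\<lambda>L. real n * C / L) \<longlongrightarrow> 0) at_top"
      by (rule real_tendsto_divide_at_top[OF tendsto_const filterlim_ident])
    show "\<forall>\<^sub>F L in at_top. \<bar>(\<Sum>t\<in>zeros 0 L. f (abs_torus (t *\<^sub>R \<omega>))) / L - time_mean \<omega> (N g) L / h\<bar> \<le> real n * C / L"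
      using eventually_ge_at_top[of h]
    proof eventually_elim
      case (elim L)
      have L: "0 < L" using elim h_pos by simp
      let ?I = "LINT s:{0..L}|lborel. N g (s *\<^sub>R \<omega>)" and ?\<Sigma> = "\<Sum>t\<in>zeros 0 L. f (abs_torus (t *\<^sub>R \<omega>))"
      have "?\<Sigma> = (\<Sum>t\<in>zeros 0 L. g (abs_torus (t *\<^sub>R \<omega>)))"
        by (rule sum.cong) (auto simp: g_def zeros_def zero_set_def q_0)
      then have "\<bar>?I - h * ?\<Sigma>\<bar> \<le> h * (real n * C)" using time_integral_N[of g C L] g elim by simp
      then have "\<bar>h * ?\<Sigma> - ?I\<bar> / (h * L) \<le> h * (real n * C) / (h * L)"
        using L h_pos by (intro divide_right_mono) (auto simp: abs_minus_commute)
      moreover have "?\<Sigma> / L - ?I / L / h = (h * ?\<Sigma> - ?I) / (h * L)"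
        using L h_pos by (simp add: field_simps)
      ultimately show ?case using L h_pos by (simp add: time_mean_def abs_divide abs_mult)
    qed
  qed auto
  from tendsto_add[OF err lim] show ?thesis by simp
qed

text \<open>Fubini in space and time, together with the invariance of the cell integral under
  translation.\<close>

lemma nn_integral_flow_average:
  fixes g :: "real ^ 'd \<Rightarrow> ennreal"
  assumes [measurable]: "g \<in> borel_measurable borel" and per: "periodic g"
  shows "(\<integral>\<^sup>+x\<in>torus_cell. (\<integral>\<^sup>+t\<in>{0..h}. g (x + t *\<^sub>R \<omega>) \<partial>lborel) \<partial>lborel) = ennreal h * (\<integral>\<^sup>+x\<in>torus_cell. g x \<partial>lborel)"
proof -
  have "(\<integral>\<^sup>+x\<in>torus_cell. (\<integral>\<^sup>+t\<in>{0..h}. g (x + t *\<^sub>R \<omega>) \<partial>lborel) \<partial>lborel)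
      = (\<integral>\<^sup>+x. (\<integral>\<^sup>+t. g (x + t *\<^sub>R \<omega>) * indicator {0..h} t * indicator torus_cell x \<partial>lborel) \<partial>lborel)"
    by (intro nn_integral_cong nn_integral_multc[symmetric]) measurable
  also have "\<dots> = (\<integral>\<^sup>+t. (\<integral>\<^sup>+x. g (x + t *\<^sub>R \<omega>) * indicator {0..h} t * indicator torus_cell x \<partial>lborel) \<partial>lborel)"
    by (rule lborel_pair.Fubini') measurable
  also have "\<dots> = (\<integral>\<^sup>+t. (\<integral>\<^sup>+x\<in>torus_cell. g x \<partial>lborel) * indicator {0..h} t \<partial>lborel)"
  proof (rule nn_integral_cong)
    fix t
    have "(\<integral>\<^sup>+x. g (x + t *\<^sub>R \<omega>) * indicator {0..h} t * indicator torus_cell x \<partial>lborel)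
        = (\<integral>\<^sup>+x. (g (x + t *\<^sub>R \<omega>) * indicator torus_cell x) * indicator {0..h} t \<partial>lborel)"
      by (simp add: mult_ac)
    also have "\<dots> = (\<integral>\<^sup>+x\<in>torus_cell. g (x + t *\<^sub>R \<omega>) \<partial>lborel) * indicator {0..h} t"
      by (rule nn_integral_multc) measurable
    finally show "(\<integral>\<^sup>+x. g (x + t *\<^sub>R \<omega>) * indicator {0..h} t * indicator torus_cell x \<partial>lborel)
        = (\<integral>\<^sup>+x\<in>torus_cell. g x \<partial>lborel) * indicator {0..h} t"
      by (simp add: nn_integral_torus_cell_shift[OF assms])
  qed
  also have "\<dots> = ennreal h * (\<integral>\<^sup>+x\<in>torus_cell. g x \<partial>lborel)"
    using h_pos by (subst nn_integral_cmult_indicator) (auto simp: mult.commute)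
  finally show ?thesis .
qed

lemma nn_integral_torus_lebesgue:
  fixes F :: "'d torus \<Rightarrow> ennreal"
  assumes [measurable]: "F \<in> borel_measurable borel"
  shows "(\<integral>\<^sup>+\<theta>. F \<theta> \<partial>torus_lebesgue) = (\<integral>\<^sup>+x\<in>torus_cell. F (abs_torus x) \<partial>lborel)"
proof -
  have [measurable]: "abs_torus \<in> restrict_space lborel torus_cell \<rightarrow>\<^sub>M borel"
    by (intro measurable_restrict_space1) measurable
  have "(\<integral>\<^sup>+\<theta>. F \<theta> \<partial>torus_lebesgue) = (\<integral>\<^sup>+x. F (abs_torus x) \<partial>restrict_space lborel torus_cell)"
    unfolding torus_lebesgue_def torus_cell_def[symmetric] by (rule nn_integral_distr) measurable
  also have "\<dots> = (\<integral>\<^sup>+x\<in>torus_cell. F (abs_torus x) \<partial>lborel)"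
    by (rule nn_integral_restrict_space) simp
  finally show ?thesis .
qed

text \<open>The cell integral of \<open>mass\<close> is h times the mollified integral. For widths
  below 1 / n it is dominated by the constant n, and at every good point \<open>mass\<close> equals
  the number of crossings once the width is small enough.\<close>

theorem mollified_limit:
  assumes \<phi>: "mollifier \<phi>"
  shows "((\<lambda>\<eta>. LINT \<theta>|torus_lebesgue. 1 / \<eta> * \<phi> (S \<theta> / \<eta>) * \<bar>D_op \<omega> S \<theta>\<bar>) \<longlongrightarrow>
    enn2real (\<integral>\<^sup>+x\<in>torus_cell. N (\<lambda>_. 1) x \<partial>lborel) / h) (at_right 0)"
proof (rule tendsto_at_right_sequentially[of 0 "1 / real n"])
  show "(0::real) < 1 / real n" using n_pos by simp
  fix \<eta> :: "nat \<Rightarrow> real" assume \<eta>: "\<And>k. 0 < \<eta> k" "\<And>k. \<eta> k < 1 / real n" "\<eta> \<longlonglongrightarrow> 0"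
  define \<psi> where "\<psi> k s = 1 / \<eta> k * \<phi> (s / \<eta> k)" for k s
  note \<psi> = scaled_mollifier[OF \<phi> \<eta>(1), folded \<psi>_def]
  have [measurable]: "\<psi> k \<in> borel_measurable borel" for k using \<psi>(1) by (rule borel_measurable_continuous_onI)
  have N1: "N (\<lambda>_. 1 :: ennreal) x = of_nat (card (Z x))" for x by (simp add: N_def)
  have [measurable]: "N (\<lambda>_. 1 :: ennreal) \<in> borel_measurable borel" by (rule N_measurable) simp
  have mass_meas [measurable]: "mass (\<psi> k) \<in> borel_measurable borel" for k
    unfolding mass_def[abs_def] by measurable
  have lim: "(\<lambda>k. \<integral>\<^sup>+x\<in>torus_cell. mass (\<psi> k) x \<partial>lborel) \<longlonglongrightarrow> (\<integral>\<^sup>+x\<in>torus_cell. N (\<lambda>_. 1) x \<partial>lborel)"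
  proof (rule nn_integral_dominated_convergence[where w="\<lambda>x. of_nat n * indicator torus_cell x"])
    have "mass (\<psi> k) x \<le> of_nat n" for k x
    proof (rule mass_le[OF \<psi>(1,4)])
      show "\<psi> k s = 0" if "1 / real n \<le> \<bar>s\<bar>" for s
        by (rule \<psi>(3)) (use \<eta>(2)[of k] that in linarith)
    qed
    then show "AE x in lborel. mass (\<psi> k) x * indicator torus_cell x \<le> of_nat n * indicator torus_cell x" for k
      by (intro AE_I2 mult_right_mono) auto
    show "(\<integral>\<^sup>+x. of_nat n * indicator torus_cell x \<partial>(lborel :: (real ^ 'd) measure)) < \<infinity>"
      by (simp add: nn_integral_cmult emeasure_torus_cell ennreal_mult_less_top of_nat_less_top)
    show "AE x in lborel. (\<lambda>k. mass (\<psi> k) x * indicator torus_cell x) \<longlonglongrightarrow> N (\<lambda>_. 1) x * indicator torus_cell x"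
      using AE_good
    proof eventually_elim
      case (elim x)
      then obtain c where c: "0 < c" "\<And>\<psi>. continuous_on UNIV \<psi> \<Longrightarrow> (\<integral>\<^sup>+s. ennreal (\<psi> s) \<partial>lborel) = 1 \<Longrightarrow>
        (\<And>s. c \<le> \<bar>s\<bar> \<Longrightarrow> \<psi> s = 0) \<Longrightarrow> mass \<psi> x = of_nat (card (Z x))" using mass_eq by blast
      have "\<forall>\<^sub>F k in sequentially. \<eta> k < c" using \<eta>(3) c(1) by (rule order_tendstoD)
      then have "\<forall>\<^sub>F k in sequentially. mass (\<psi> k) x * indicator torus_cell x = N (\<lambda>_. 1) x * indicator torus_cell x"
      proof eventually_elim
        case (elim k)
        have "mass (\<psi> k) x = of_nat (card (Z x))"
          using \<psi> elim by (intro c(2)) auto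
        then show ?case by (simp add: N1)
      qed
      then show ?case by (rule tendsto_eventually)
    qed
  qed measurable
  have fin: "(\<integral>\<^sup>+x\<in>torus_cell. N (\<lambda>_. 1) x \<partial>lborel) \<noteq> top"
  proof -
    have "(\<integral>\<^sup>+x\<in>torus_cell. N (\<lambda>_. 1) x \<partial>lborel) \<le> (\<integral>\<^sup>+x. of_nat n * indicator torus_cell x \<partial>(lborel :: (real ^ 'd) measure))"
      using card_Z by (intro nn_integral_mono mult_right_mono) (auto simp: N1)
    also have "\<dots> < top"
      by (simp add: nn_integral_cmult emeasure_torus_cell ennreal_mult_less_top of_nat_less_top)
    finally show ?thesis by simp
  qed
  have LINT: "(LINT \<theta>|torus_lebesgue. 1 / \<eta> k * \<phi> (S \<theta> / \<eta> k) * \<bar>D_op \<omega> S \<theta>\<bar>)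
      = enn2real (\<integral>\<^sup>+x\<in>torus_cell. mass (\<psi> k) x \<partial>lborel) / h" for k
  proof -
    have cS: "continuous_on UNIV S" "continuous_on UNIV (D_op \<omega> S)"
      using D_op_continuous[of UNIV 0] D_op_continuous[of UNIV 1] by simp_all
    have [measurable]: "S \<in> borel_measurable borel" "D_op \<omega> S \<in> borel_measurable borel"
      using cS by (auto intro: borel_measurable_continuous_onI)
    let ?F = "\<lambda>\<theta>. \<psi> k (S \<theta>) * \<bar>D_op \<omega> S \<theta>\<bar>" and ?g = "\<lambda>x. ennreal (\<psi> k (q 0 x) * \<bar>q 1 x\<bar>)"
    have "(LINT \<theta>|torus_lebesgue. ?F \<theta>) = enn2real (\<integral>\<^sup>+\<theta>. ennreal (?F \<theta>) \<partial>torus_lebesgue)"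
      using \<psi>(2) by (intro integral_eq_nn_integral) (auto simp: torus_lebesgue_def)
    also have "(\<integral>\<^sup>+\<theta>. ennreal (?F \<theta>) \<partial>torus_lebesgue) = (\<integral>\<^sup>+x\<in>torus_cell. ?g x \<partial>lborel)"
      by (subst nn_integral_torus_lebesgue) (auto simp: q_0 q_1)
    finally have 1: "(LINT \<theta>|torus_lebesgue. ?F \<theta>) = enn2real (\<integral>\<^sup>+x\<in>torus_cell. ?g x \<partial>lborel)" .
    have "(\<integral>\<^sup>+x\<in>torus_cell. mass (\<psi> k) x \<partial>lborel) = ennreal h * (\<integral>\<^sup>+x\<in>torus_cell. ?g x \<partial>lborel)"
      unfolding mass_def
    proof (rule nn_integral_flow_average)
      show "periodic ?g" using q_periodic[of 0] q_periodic[of 1] by (simp add: periodic_def)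
    qed measurable
    then show ?thesis using 1 h_pos by (simp add: enn2real_mult \<psi>_def)
  qed
  show "(\<lambda>k. LINT \<theta>|torus_lebesgue. 1 / \<eta> k * \<phi> (S \<theta> / \<eta> k) * \<bar>D_op \<omega> S \<theta>\<bar>)
      \<longlonglongrightarrow> enn2real (\<integral>\<^sup>+x\<in>torus_cell. N (\<lambda>_. 1) x \<partial>lborel) / h"
    unfolding LINT
  proof (intro tendsto_divide tendsto_const tendsto_enn2real)
    show "(\<lambda>k. \<integral>\<^sup>+x\<in>torus_cell. mass (\<psi> k) x \<partial>lborel)
        \<longlonglongrightarrow> ennreal (enn2real (\<integral>\<^sup>+x\<in>torus_cell. N (\<lambda>_. 1) x \<partial>lborel))"
      using lim fin by (simp add: less_top)
  qed (use h_pos in auto)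
qed

end

section \<open>Slicing space by a direction transversal to a hyperplane\<close>

text \<open>An index type with one element fewer than \<open>'n\<close>, so that \<open>real ^ 'n hyper\<close> models a hyperplane
  of \<open>real ^ 'n\<close>; types being non-empty, it degenerates to one element if \<open>'n\<close> has only one.\<close>

typedef ('n::finite) hyper = "{i :: 'n. i \<noteq> undefined \<or> CARD('n) = 1}"
proof (cases "CARD('n) = 1")
  case False
  have "\<exists>i :: 'n. i \<noteq> undefined"
  proof (rule ccontr)
    assume "\<not> ?thesis"
    then have "(UNIV :: 'n set) = {undefined}" by auto
    then have "CARD('n) = card {undefined :: 'n}" by (rule arg_cong)
    then show False using False by simp
  qed
  then show ?thesis by blast
qed auto

instance hyper :: (finite) finite
proof
  have "(UNIV :: 'a hyper set) = Abs_hyper ` {i :: 'a. i \<noteq> undefined \<or> CARD('a) = 1}"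
    by (rule type_definition.Abs_image[OF type_definition_hyper, symmetric])
  then show "finite (UNIV :: 'a hyper set)" by (rule ssubst) simp
qed

lemma CARD_hyper:
  assumes "2 \<le> CARD('n::finite)"
  shows "CARD('n hyper) = CARD('n) - 1"
proof -
  have "CARD('n hyper) = card {i :: 'n. i \<noteq> undefined \<or> CARD('n) = 1}"
    by (rule type_definition.card[OF type_definition_hyper])
  also have "{i :: 'n. i \<noteq> undefined \<or> CARD('n) = 1} = UNIV - {undefined}" using assms by auto
  also have "card (UNIV - {undefined :: 'n}) = CARD('n) - 1" by (rule card_Diff_singleton) simp
  finally show ?thesis .
qed

lemma ex_hyperplane_isometry:
  fixes u :: "real ^ 'n::finite"
  assumes "2 \<le> CARD('n)" "u \<noteq> 0"
  obtains J :: "real ^ 'n hyper \<Rightarrow> real ^ 'n" where "linear J" "\<And>y. norm (J y) = norm y"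
    "range J = {x. u \<bullet> x = 0}"
proof -
  have "dim (UNIV :: (real ^ 'n hyper) set) = dim {x. u \<bullet> x = 0}"
    using assms by (simp add: dim_hyperplane CARD_hyper)
  then obtain f :: "real ^ 'n hyper \<Rightarrow> real ^ 'n" and g where "linear f" "f ` UNIV = {x. u \<bullet> x = 0}" "\<And>x. x \<in> UNIV \<Longrightarrow> norm (f x) = norm x"
    using isometries_subspaces[OF subspace_UNIV subspace_hyperplane[of u]] by metis
  then show thesis using that by blast
qed

text \<open>Lebesgue measure is Hausdorff measure of full dimension, which a distance preserving
  bijection leaves unchanged; this argument also covers maps between different Euclidean
  types.\<close>

lemma lborel_isometry:
  fixes \<Phi> :: "'a::euclidean_space \<Rightarrow> 'b::euclidean_space"
  assumes dim: "DIM('a) = DIM('b)" and iso: "\<And>x y. dist (\<Phi> x) (\<Phi> y) = dist x y" and surj: "surj \<Phi>"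
  shows "distr lborel borel \<Phi> = lborel"
proof (rule measure_eqI)
  have "continuous_on UNIV \<Phi>" unfolding continuous_on_iff using iso by auto
  then have [measurable]: "\<Phi> \<in> borel_measurable borel" by (rule borel_measurable_continuous_onI)
  fix B assume "B \<in> sets (distr lborel borel \<Phi>)"
  then have B: "B \<in> sets borel" by simp
  then have A: "\<Phi> -` B \<in> sets borel" using measurable_sets[of \<Phi> borel borel B] by simp
  have img: "\<Phi> ` (\<Phi> -` B) = B" using surj by auto
  have inv: "inv \<Phi> (\<Phi> x) = x" for x
    using iso by (metis dist_eq_0_iff surj surj_f_inv_f)
  have 1: "hausdorff_outer DIM('b) B \<le> hausdorff_outer DIM('b) (\<Phi> -` B)"
    using hausdorff_outer_lipschitz[of "\<Phi> -` B" \<Phi> 1 "DIM('b)", unfolded img] iso by simp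
  have 2: "hausdorff_outer DIM('b) (\<Phi> -` B) \<le> hausdorff_outer DIM('b) B"
  proof -
    have "dist (inv \<Phi> x) (inv \<Phi> y) = dist x y" for x y
      using iso[of "inv \<Phi> x" "inv \<Phi> y"] surj by (simp add: surj_f_inv_f)
    moreover have "inv \<Phi> ` B = \<Phi> -` B"
      using surj inv by (auto simp: surj_f_inv_f image_iff) (metis inv)
    ultimately show ?thesis using hausdorff_outer_lipschitz[of B "inv \<Phi>" 1 "DIM('b)"] by simp
  qed
  have "emeasure (distr lborel borel \<Phi>) B = emeasure lborel (\<Phi> -` B)"
    using B by (subst emeasure_distr) auto
  also have "\<dots> = emeasure lborel B"
    using 1 2 hausdorff_outer_eq_lborel[OF A] hausdorff_outer_eq_lborel[OF B] dim by simp
  finally show "emeasure (distr lborel borel \<Phi>) B = emeasure lborel B" .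
qed simp

lemma nn_integral_isometry:
  fixes \<Phi> :: "'a::euclidean_space \<Rightarrow> 'b::euclidean_space"
  assumes dim: "DIM('a) = DIM('b)" and iso: "\<And>x y. dist (\<Phi> x) (\<Phi> y) = dist x y" and surj: "surj \<Phi>"
    and [measurable]: "g \<in> borel_measurable borel"
  shows "(\<integral>\<^sup>+x. g x \<partial>lborel) = (\<integral>\<^sup>+x. g (\<Phi> x) \<partial>lborel)"
proof -
  have "continuous_on UNIV \<Phi>" unfolding continuous_on_iff using iso by auto
  then have [measurable]: "\<Phi> \<in> borel_measurable borel" by (rule borel_measurable_continuous_onI)
  have "(\<integral>\<^sup>+x. g x \<partial>lborel) = (\<integral>\<^sup>+x. g x \<partial>distr lborel borel \<Phi>)"
    by (simp add: lborel_isometry[OF dim iso surj])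
  also have "\<dots> = (\<integral>\<^sup>+x. g (\<Phi> x) \<partial>lborel)" by (rule nn_integral_distr) auto
  finally show ?thesis .
qed

text \<open>In the orthonormal coordinates J y + z u write \<omega> = J b + k u with k = \<omega>
  \<bullet> u. Substituting z = k t gives the factor \<bar>k\<bar>, and translating y by t b turns
  the direction u into \<omega>.\<close>

lemma nn_integral_hyperplane_slices:
  fixes u \<omega> :: "real ^ 'n::finite" and J :: "real ^ 'n hyper \<Rightarrow> real ^ 'n"
  assumes n: "2 \<le> CARD('n)" and u: "norm u = 1" and c: "\<omega> \<bullet> u \<noteq> 0"
    and J: "linear J" "\<And>y. norm (J y) = norm y" "range J = {x. u \<bullet> x = 0}"
    and [measurable]: "g \<in> borel_measurable borel"
  shows "(\<integral>\<^sup>+x. g x \<partial>lborel) = ennreal \<bar>\<omega> \<bullet> u\<bar> * (\<integral>\<^sup>+y. (\<integral>\<^sup>+t. g (J y + t *\<^sub>R \<omega>) \<partial>lborel) \<partial>lborel)"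
proof -
  interpret J: linear J by (rule J(1))
  have uu: "u \<bullet> u = 1" using u by (simp add: dot_square_norm)
  have uJ: "u \<bullet> J y = 0" for y using J(3) by blast
  have "continuous_on UNIV J" using J(1) by (simp add: linear_continuous_on linear_linear)
  then have [measurable]: "J \<in> borel_measurable borel" by (rule borel_measurable_continuous_onI)
  define \<Phi> where "\<Phi> p = J (fst p) + snd p *\<^sub>R u" for p
  have norm\<Phi>: "norm (\<Phi> p) = norm p" for p
  proof -
    have "(norm (\<Phi> p))\<^sup>2 = (norm (J (fst p)))\<^sup>2 + (snd p)\<^sup>2"
      unfolding \<Phi>_def power2_norm_eq_inner
      by (simp add: inner_add_left inner_add_right uJ inner_commute[of "J _" u] uu power2_eq_square)
    then have "(norm (\<Phi> p))\<^sup>2 = (norm p)\<^sup>2" by (simp add: J(2) norm_prod_def)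
    then show ?thesis by simp
  qed
  have iso: "dist (\<Phi> p) (\<Phi> r) = dist p r" for p r
  proof -
    have "\<Phi> p - \<Phi> r = \<Phi> (p - r)" by (simp add: \<Phi>_def J.diff algebra_simps)
    then show ?thesis using norm\<Phi>[of "p - r"] by (simp add: dist_norm)
  qed
  have surj: "surj \<Phi>"
  proof -
    have "\<exists>p. x = \<Phi> p" for x
    proof -
      have "u \<bullet> (x - (x \<bullet> u) *\<^sub>R u) = 0" by (simp add: inner_diff_right uu inner_commute)
      then obtain y where y: "J y = x - (x \<bullet> u) *\<^sub>R u" using J(3) by (metis (mono_tags) mem_Collect_eq rangeE)
      then have "x = \<Phi> (y, x \<bullet> u)" by (simp add: \<Phi>_def)
      then show ?thesis by blast
    qed
    then show ?thesis by (auto simp: surj_def)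
  qed
  have dim: "DIM((real ^ 'n hyper) \<times> real) = DIM(real ^ 'n)"
    using n by (simp add: CARD_hyper)
  define k where "k = \<omega> \<bullet> u"
  have "u \<bullet> (\<omega> - k *\<^sub>R u) = 0" by (simp add: inner_diff_right uu k_def inner_commute)
  then obtain b where b: "J b = \<omega> - k *\<^sub>R u" using J(3) by (metis (mono_tags) mem_Collect_eq rangeE)
  have "(\<integral>\<^sup>+x. g x \<partial>lborel) = (\<integral>\<^sup>+p. g (\<Phi> p) \<partial>lborel)"
    by (rule nn_integral_isometry[OF dim iso surj]) measurable
  also have "\<dots> = (\<integral>\<^sup>+p. g (J (fst p) + snd p *\<^sub>R u) \<partial>(lborel \<Otimes>\<^sub>M lborel))"
    by (simp add: lborel_prod \<Phi>_def)
  also have "\<dots> = (\<integral>\<^sup>+z. (\<integral>\<^sup>+y. g (J y + z *\<^sub>R u) \<partial>lborel) \<partial>lborel)"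
    by (subst lborel_pair.nn_integral_snd[symmetric]) auto
  also have "\<dots> = ennreal \<bar>k\<bar> * (\<integral>\<^sup>+t. (\<integral>\<^sup>+y. g (J y + (0 + k * t) *\<^sub>R u) \<partial>lborel) \<partial>lborel)"
    using c by (intro nn_integral_real_affine) (auto simp: k_def)
  also have "(\<integral>\<^sup>+t. (\<integral>\<^sup>+y. g (J y + (0 + k * t) *\<^sub>R u) \<partial>lborel) \<partial>lborel) = (\<integral>\<^sup>+t. (\<integral>\<^sup>+y. g (J y + t *\<^sub>R \<omega>) \<partial>lborel) \<partial>lborel)"
  proof (rule nn_integral_cong)
    fix t :: real
    have eq: "J (y + t *\<^sub>R b) + (0 + k * t) *\<^sub>R u = J y + t *\<^sub>R \<omega>" for y
      by (simp add: J.add J.scaleR b algebra_simps)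
    have "(\<integral>\<^sup>+y. (\<lambda>y. g (J y + (0 + k * t) *\<^sub>R u)) (y + t *\<^sub>R b) \<partial>lborel) = (\<integral>\<^sup>+y. g (J y + (0 + k * t) *\<^sub>R u) \<partial>lborel)"
      by (rule nn_integral_lborel_shift) measurable
    then show "(\<integral>\<^sup>+y. g (J y + (0 + k * t) *\<^sub>R u) \<partial>lborel) = (\<integral>\<^sup>+y. g (J y + t *\<^sub>R \<omega>) \<partial>lborel)"
      unfolding eq by simp
  qed
  also have "(\<integral>\<^sup>+t. (\<integral>\<^sup>+y. g (J y + t *\<^sub>R \<omega>) \<partial>lborel) \<partial>lborel) = (\<integral>\<^sup>+y. (\<integral>\<^sup>+t. g (J y + t *\<^sub>R \<omega>) \<partial>lborel) \<partial>lborel)"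
    by (rule lborel_pair.Fubini') measurable
  finally show ?thesis by (simp add: k_def)
qed

lemma nn_integral_line:
  fixes \<omega> :: "real ^ 'n::finite"
  assumes n: "CARD('n) = 1" and \<omega>: "\<omega> \<noteq> 0" and [measurable]: "g \<in> borel_measurable borel"
  shows "(\<integral>\<^sup>+x. g x \<partial>lborel) = ennreal (norm \<omega>) * (\<integral>\<^sup>+t. g (a + t *\<^sub>R \<omega>) \<partial>lborel)"
proof -
  obtain i :: 'n where i: "UNIV = {i}" using n card_1_singletonE by blast
  have all_i: "j = i" for j using i by blast
  have \<omega>i: "\<omega> $ i \<noteq> 0" using \<omega> all_i by (metis vec_eq_iff zero_index)
  define \<Phi> :: "real \<Rightarrow> real ^ 'n" where "\<Phi> t = (\<chi> j. t)" for t
  have norm: "norm x = \<bar>x $ i\<bar>" for x :: "real ^ 'n" unfolding norm_vec_def L2_set_def i by simp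
  have "(\<integral>\<^sup>+x. g x \<partial>lborel) = (\<integral>\<^sup>+t. g (\<Phi> t) \<partial>lborel)"
  proof (rule nn_integral_isometry)
    show "DIM(real) = DIM(real ^ 'n)" using n by simp
    show "dist (\<Phi> x) (\<Phi> y) = dist x y" for x y by (simp add: dist_norm norm \<Phi>_def)
    have "x = \<Phi> (x $ i)" for x using all_i by (simp add: \<Phi>_def vec_eq_iff) metis
    then show "surj \<Phi>" unfolding surj_def by blast
  qed measurable
  also have "\<dots> = ennreal \<bar>\<omega> $ i\<bar> * (\<integral>\<^sup>+t. g (\<Phi> (a $ i + \<omega> $ i * t)) \<partial>lborel)"
  proof (rule nn_integral_real_affine[OF _ \<omega>i])
    have "continuous_on UNIV \<Phi>" unfolding \<Phi>_def by (intro continuous_intros)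
    then have "\<Phi> \<in> borel_measurable borel" by (rule borel_measurable_continuous_onI)
    then show "(\<lambda>t. g (\<Phi> t)) \<in> borel_measurable borel" by measurable
  qed
  also have "(\<lambda>t. g (\<Phi> (a $ i + \<omega> $ i * t))) = (\<lambda>t. g (a + t *\<^sub>R \<omega>))"
  proof -
    have "\<Phi> (a $ i + \<omega> $ i * t) = a + t *\<^sub>R \<omega>" for t
      unfolding \<Phi>_def vec_eq_iff using all_i by (simp add: mult.commute) metis
    then show ?thesis by simp
  qed
  finally show ?thesis by (simp add: norm)
qed

section \<open>Flux through the zero set and surface measure\<close>

lemma hausdorff_outer_bilipschitz:
  fixes f :: "'a::metric_space \<Rightarrow> 'b::metric_space"
  assumes a: "0 < a" and b: "0 < b"
    and lower: "\<And>x y. x \<in> A \<Longrightarrow> y \<in> A \<Longrightarrow> a * dist x y \<le> dist (f x) (f y)"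
    and upper: "\<And>x y. x \<in> A \<Longrightarrow> y \<in> A \<Longrightarrow> dist (f x) (f y) \<le> b * dist x y"
  shows "hausdorff_outer k (f ` A) \<le> ennreal (b ^ k) * hausdorff_outer k A"
    "ennreal (a ^ k) * hausdorff_outer k A \<le> hausdorff_outer k (f ` A)"
proof -
  show "hausdorff_outer k (f ` A) \<le> ennreal (b ^ k) * hausdorff_outer k A"
    using upper b by (rule hausdorff_outer_lipschitz)
  have inj: "inj_on f A"
  proof (rule inj_onI)
    fix x y assume "x \<in> A" "y \<in> A" "f x = f y"
    then have "a * dist x y \<le> 0" using lower[of x y] by simp
    then show "x = y" using a by (simp add: mult_le_0_iff not_le)
  qed
  have "hausdorff_outer k (inv_into A f ` f ` A) \<le> ennreal ((1 / a) ^ k) * hausdorff_outer k (f ` A)"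
  proof (rule hausdorff_outer_lipschitz)
    fix x y assume "x \<in> f ` A" "y \<in> f ` A"
    then obtain u v where "x = f u" "y = f v" "u \<in> A" "v \<in> A" by auto
    then show "dist (inv_into A f x) (inv_into A f y) \<le> 1 / a * dist x y"
      using lower[of u v] inj a by (simp add: field_simps)
  qed (use a in simp)
  then have "hausdorff_outer k A \<le> ennreal ((1 / a) ^ k) * hausdorff_outer k (f ` A)"
    using inj by (simp add: image_image)
  then have "ennreal (a ^ k) * hausdorff_outer k A \<le> ennreal (a ^ k) * (ennreal ((1 / a) ^ k) * hausdorff_outer k (f ` A))"
    by (rule mult_left_mono) simp
  also have "\<dots> = hausdorff_outer k (f ` A)"
    using a by (simp add: mult.assoc[symmetric] power_divide flip: ennreal_mult)
  finally show "ennreal (a ^ k) * hausdorff_outer k A \<le> hausdorff_outer k (f ` A)" .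
qed

context torus_flow_window
begin

definition crossing_integral :: "('d torus \<Rightarrow> ennreal) \<Rightarrow> ennreal" where
  "crossing_integral g = (\<integral>\<^sup>+x\<in>torus_cell. N g x \<partial>lborel)"

definition flux :: "'d torus set \<Rightarrow> ennreal" where
  "flux A = crossing_integral (indicator A)"

definition patch :: "real ^ 'd \<Rightarrow> real \<Rightarrow> 'd torus set \<Rightarrow> (real ^ 'd) set" where
  "patch x0 r A = {z \<in> ball x0 r. abs_torus z \<in> A}"

definition swept :: "(real ^ 'd) set \<Rightarrow> (real ^ 'd) set" where
  "swept X = {x. \<exists>t\<in>{0..<h}. x + t *\<^sub>R \<omega> \<in> X}"

text \<open>\<open>q 1\<close> does not vanish on the ball, so the mean value theorem rules out two
  zeros of \<open>q 0\<close> on one flow line there; by convexity the segment between two hits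
  stays in the ball.\<close>

lemma patch_line_unique:
  assumes q1: "\<And>z. z \<in> ball x0 r \<Longrightarrow> q 1 z \<noteq> 0" and A: "A \<subseteq> zero_set S"
    and z: "z + s *\<^sub>R \<omega> \<in> patch x0 r A" "z + s' *\<^sub>R \<omega> \<in> patch x0 r A"
  shows "s = s'"
proof -
  have False if "s < s'" "z + s *\<^sub>R \<omega> \<in> patch x0 r A" "z + s' *\<^sub>R \<omega> \<in> patch x0 r A" for s s'
  proof -
    have zero: "q 0 (z + s *\<^sub>R \<omega>) = 0" "q 0 (z + s' *\<^sub>R \<omega>) = 0"
      using that A by (auto simp: patch_def zero_set_def q_0)
    obtain t where t: "s < t" "t < s'" "q 0 (z + s' *\<^sub>R \<omega>) - q 0 (z + s *\<^sub>R \<omega>) = (s' - s) * q 1 (z + t *\<^sub>R \<omega>)"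
      using MVT2[of s s' "\<lambda>t. q 0 (z + t *\<^sub>R \<omega>)" "\<lambda>t. q 1 (z + t *\<^sub>R \<omega>)"] q_deriv[of 0 z] \<open>s < s'\<close> by auto
    then have "q 1 (z + t *\<^sub>R \<omega>) = 0" using zero by auto
    moreover have "z + t *\<^sub>R \<omega> \<in> ball x0 r"
    proof -
      define l where "l = (t - s) / (s' - s)"
      have l: "0 \<le> l" "l \<le> 1" using t by (auto simp: l_def)
      have ls: "l * (s' - s) = t - s" using t by (simp add: l_def)
      have "z + t *\<^sub>R \<omega> = (z + s *\<^sub>R \<omega>) + (l * (s' - s)) *\<^sub>R \<omega>" unfolding ls by (simp add: algebra_simps)
      also have "\<dots> = (1 - l) *\<^sub>R (z + s *\<^sub>R \<omega>) + l *\<^sub>R (z + s' *\<^sub>R \<omega>)" by (simp add: algebra_simps)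
      also have "\<dots> \<in> ball x0 r"
        using that l by (intro convexD[OF convex_ball]) (auto simp: patch_def)
      finally show ?thesis .
    qed
    ultimately show False using q1 by blast
  qed
  then show ?thesis using z by (cases s s' rule: linorder_cases) blast+
qed

lemma patch_lift:
  assumes A: "A \<subseteq> ball (abs_torus x0) r" and y: "abs_torus y \<in> A"
  obtains k where "y + lattice k \<in> patch x0 r A"
proof -
  obtain z where z: "abs_torus z = abs_torus y" "dist (abs_torus x0) (abs_torus y) = dist x0 z"
    by (rule dist_torus_attained)
  then obtain k where "z = y + lattice k" by (metis abs_torus_eq_lattice)
  moreover have "z \<in> patch x0 r A" using z y A by (auto simp: patch_def)
  ultimately show thesis using that by blast
qed

text \<open>Two points of the patch are at most 2 apart and the difference of the times moves a
  point by at most 1, whereas distinct lattice vectors differ by at least 2 pi > 3.\<close>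

lemma patch_translate_unique:
  assumes q1: "\<And>z. z \<in> ball x0 r \<Longrightarrow> q 1 z \<noteq> 0" and A: "A \<subseteq> zero_set S" and r: "r \<le> 1"
    and z: "x + lattice k + t *\<^sub>R \<omega> \<in> patch x0 r A" "x + lattice k' + t' *\<^sub>R \<omega> \<in> patch x0 r A"
    and t: "t \<in> {0..<h}" "t' \<in> {0..<h}"
  shows "k = k' \<and> t = t'"
proof -
  have "k = k'"
  proof (rule ccontr)
    assume "k \<noteq> k'"
    then have "2 * pi \<le> norm (lattice (k - k'))" by (intro norm_lattice) simp
    moreover have "lattice (k - k') = lattice k - lattice k'"
      using lattice_add[of k "- k'"] by (simp add: lattice_minus)
    moreover have "norm (lattice k - lattice k') \<le> 3"
    proof -
      let ?a = "x + lattice k + t *\<^sub>R \<omega>" and ?b = "x + lattice k' + t' *\<^sub>R \<omega>"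
      have "dist ?a ?b \<le> dist x0 ?a + dist x0 ?b" by (rule dist_triangle3)
      also have "\<dots> \<le> 2" using z r by (auto simp: patch_def)
      finally have ab: "norm (?a - ?b) \<le> 2" by (simp add: dist_norm)
      have "\<bar>t' - t\<bar> \<le> h" using t by auto
      then have "norm ((t' - t) *\<^sub>R \<omega>) \<le> h * norm \<omega>" by (simp add: mult_right_mono)
      then have tt: "norm ((t' - t) *\<^sub>R \<omega>) \<le> 1" using h_small by linarith
      have "lattice k - lattice k' = (?a - ?b) + (t' - t) *\<^sub>R \<omega>" by (simp add: algebra_simps)
      then have "norm (lattice k - lattice k') \<le> norm (?a - ?b) + norm ((t' - t) *\<^sub>R \<omega>)"
        by (simp only: norm_triangle_ineq)
      then show ?thesis using ab tt by linarith
    qed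
    ultimately show False using pi_gt3 by simp
  qed
  moreover have "t = t'"
    using patch_line_unique[OF q1 A, where z="x + lattice k" and s=t and s'=t'] z \<open>k = k'\<close> by auto
  ultimately show ?thesis by simp
qed

text \<open>The crossing count of A at x equals the number of lattice translates of x in the swept
  set, which is 0 or 1; unfolding turns the integral over the cell into the volume of that
  set.\<close>

lemma flux_eq_swept:
  assumes q1: "\<And>z. z \<in> ball x0 r \<Longrightarrow> q 1 z \<noteq> 0" and r: "r \<le> 1"
    and A [measurable]: "A \<in> sets borel" and sub: "A \<subseteq> zero_set S" "A \<subseteq> ball (abs_torus x0) r"
  shows "swept (patch x0 r A) \<in> sets borel" "flux A = emeasure lborel (swept (patch x0 r A))"
proof -
  let ?E = "swept (patch x0 r A)"
  have [measurable]: "N (indicator A :: 'd torus \<Rightarrow> ennreal) \<in> borel_measurable borel"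
    by (rule N_measurable) simp
  have N: "N (indicator A :: 'd torus \<Rightarrow> ennreal) x = (\<integral>\<^sup>+k. indicator ?E (x + lattice k) \<partial>count_space UNIV)
      \<and> (N (indicator A :: 'd torus \<Rightarrow> ennreal) x \<noteq> 0 \<longleftrightarrow> (\<exists>k. x + lattice k \<in> ?E))" for x
  proof (cases "\<exists>t\<in>{0..<h}. abs_torus (x + t *\<^sub>R \<omega>) \<in> A")
    case True
    then obtain t where t: "t \<in> {0..<h}" "abs_torus (x + t *\<^sub>R \<omega>) \<in> A" by blast
    then obtain k where "x + t *\<^sub>R \<omega> + lattice k \<in> patch x0 r A" using patch_lift[OF sub(2)] by blast
    then have k: "x + lattice k + t *\<^sub>R \<omega> \<in> patch x0 r A" by (simp add: add_ac)
    have inE: "x + lattice k \<in> ?E" using k t(1) by (auto simp: swept_def)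
    have "\<exists>!k. x + lattice k \<in> ?E"
    proof (rule ex1I[of _ k])
      show "x + lattice k \<in> ?E" by (rule inE)
      fix k' assume "x + lattice k' \<in> ?E"
      then obtain t' where "t' \<in> {0..<h}" "x + lattice k' + t' *\<^sub>R \<omega> \<in> patch x0 r A" by (auto simp: swept_def)
      then show "k' = k" using patch_translate_unique[OF q1 sub(1) r k _ t(1)] by blast
    qed
    then have "(\<integral>\<^sup>+k. (if x + lattice k \<in> ?E then 1 else 0) \<partial>count_space UNIV) = (1 :: ennreal)"
      by (rule nn_integral_count_space_ex1)
    moreover have "(\<lambda>k. indicator ?E (x + lattice k) :: ennreal) = (\<lambda>k. if x + lattice k \<in> ?E then 1 else 0)"
      by (auto simp: indicator_def)
    ultimately have rhs: "(\<integral>\<^sup>+k. indicator ?E (x + lattice k) \<partial>count_space UNIV) = (1 :: ennreal)"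
      by (simp only:)
    have tZ: "t \<in> Z x" using t sub(1) by (auto simp: Z_def zero_set_def q_0)
    have "N (indicator A :: 'd torus \<Rightarrow> ennreal) x = (\<Sum>s\<in>Z x. if s = t then 1 else 0)"
      unfolding N_def
    proof (rule sum.cong[OF refl])
      fix s assume s: "s \<in> Z x"
      have "s = t" if sA: "abs_torus (x + s *\<^sub>R \<omega>) \<in> A"
      proof -
        obtain k' where "x + s *\<^sub>R \<omega> + lattice k' \<in> patch x0 r A" using patch_lift[OF sub(2) sA] by blast
        then have "x + lattice k' + s *\<^sub>R \<omega> \<in> patch x0 r A" by (simp add: add_ac)
        moreover have "s \<in> {0..<h}" using s by (simp add: Z_def)
        ultimately show ?thesis using patch_translate_unique[OF q1 sub(1) r _ k _ t(1)] by blast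
      qed
      then have "abs_torus (x + s *\<^sub>R \<omega>) \<in> A \<longleftrightarrow> s = t" using t(2) by blast
      then show "indicator A (abs_torus (x + s *\<^sub>R \<omega>)) = (if s = t then 1 else 0 :: ennreal)"
        by (simp only: indicator_def of_bool_def)
    qed
    also have "\<dots> = 1" using tZ by simp
    finally show ?thesis using rhs inE by auto
  next
    case False
    have no: "x + lattice k \<notin> ?E" for k
    proof
      assume "x + lattice k \<in> ?E"
      then obtain t where "t \<in> {0..<h}" "abs_torus (x + lattice k + t *\<^sub>R \<omega>) \<in> A" by (auto simp: swept_def patch_def)
      moreover have "x + lattice k + t *\<^sub>R \<omega> = (x + t *\<^sub>R \<omega>) + lattice k" by simp
      ultimately show False using False abs_torus_lattice by metis
    qed
    moreover have "N (indicator A :: 'd torus \<Rightarrow> ennreal) x = 0"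
      unfolding N_def using False by (intro sum.neutral) (auto simp: Z_def)
    ultimately show ?thesis by simp
  qed
  \<comment> \<open>The swept set is a projection, so its measurability is read off from that of N.
    The ball of radius 3 selects the right translate: a nonzero lattice vector in the way would have
    length at most 1 + 3 + 1 = 5 < 2 pi.\<close>
  have "?E = ball x0 3 \<inter> {x. N (indicator A :: 'd torus \<Rightarrow> ennreal) x \<noteq> 0}"
  proof (intro set_eqI iffI)
    fix x assume x: "x \<in> ?E"
    then obtain t where t: "t \<in> {0..<h}" "x + t *\<^sub>R \<omega> \<in> ball x0 r" by (auto simp: swept_def patch_def)
    have "dist x0 x \<le> dist x0 (x + t *\<^sub>R \<omega>) + dist x (x + t *\<^sub>R \<omega>)" by (metis dist_commute dist_triangle)
    moreover have "dist x (x + t *\<^sub>R \<omega>) \<le> h * norm \<omega>" using t by (simp add: dist_norm mult_right_mono)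
    ultimately have "dist x0 x < 3" using t(2) r h_small by simp
    moreover have "\<exists>k. x + lattice k \<in> ?E" using x by (intro exI[of _ 0]) simp
    ultimately show "x \<in> ball x0 3 \<inter> {x. N (indicator A :: 'd torus \<Rightarrow> ennreal) x \<noteq> 0}"
      using N by (metis IntI mem_Collect_eq mem_ball)
  next
    fix x assume x: "x \<in> ball x0 3 \<inter> {x. N (indicator A :: 'd torus \<Rightarrow> ennreal) x \<noteq> 0}"
    then obtain k where k: "x + lattice k \<in> ?E" using N by blast
    then obtain t where t: "t \<in> {0..<h}" "x + lattice k + t *\<^sub>R \<omega> \<in> ball x0 r" by (auto simp: swept_def patch_def)
    have "k = 0"
    proof (rule ccontr)
      assume "k \<noteq> 0"
      then have "2 * pi \<le> norm (lattice k)" by (rule norm_lattice)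
      moreover have "norm (lattice k) \<le> 5"
      proof -
        let ?a = "x + lattice k + t *\<^sub>R \<omega>"
        have "lattice k = (?a - x0) + (x0 - x) + (- t) *\<^sub>R \<omega>" by (simp add: algebra_simps)
        then have "norm (lattice k) \<le> norm (?a - x0) + norm (x0 - x) + norm ((- t) *\<^sub>R \<omega>)"
          by (metis norm_triangle_mono norm_triangle_ineq order_refl)
        moreover have "norm ((- t) *\<^sub>R \<omega>) \<le> h * norm \<omega>" using t by (simp add: mult_right_mono)
        moreover have "norm (?a - x0) \<le> 1" using t(2) r by (simp add: dist_norm norm_minus_commute)
        moreover have "norm (x0 - x) \<le> 3" using x by (simp add: dist_norm)
        ultimately show ?thesis using h_small by linarith
      qed
      ultimately show False using pi_gt3 by simp
    qed
    then show "x \<in> ?E" using k by simp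
  qed
  also have "\<dots> \<in> sets borel" by measurable
  finally show E [measurable]: "?E \<in> sets borel" .
  have "flux A = (\<integral>\<^sup>+x\<in>torus_cell. (\<integral>\<^sup>+k. indicator ?E (x + lattice k) \<partial>count_space UNIV) \<partial>lborel)"
    unfolding flux_def crossing_integral_def by (intro nn_integral_cong) (simp only: N)
  also have "\<dots> = (\<integral>\<^sup>+x. indicator ?E x \<partial>lborel)"
    by (rule nn_integral_unfold[symmetric]) measurable
  finally show "flux A = emeasure lborel ?E" by simp
qed

lemma swept_line_length:
  assumes "z + s *\<^sub>R \<omega> \<in> X" "\<And>s'. z + s' *\<^sub>R \<omega> \<in> X \<Longrightarrow> s' = s"
  shows "(\<integral>\<^sup>+t. indicator (swept X) (z + t *\<^sub>R \<omega>) \<partial>lborel) = ennreal h"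
proof -
  have "z + t *\<^sub>R \<omega> \<in> swept X \<longleftrightarrow> t \<in> {s - h<..s}" for t
  proof
    assume "z + t *\<^sub>R \<omega> \<in> swept X"
    then obtain s' where s': "s' \<in> {0..<h}" "z + (t + s') *\<^sub>R \<omega> \<in> X" by (auto simp: swept_def algebra_simps)
    then show "t \<in> {s - h<..s}" using assms(2)[OF s'(2)] by auto
  next
    assume "t \<in> {s - h<..s}"
    then show "z + t *\<^sub>R \<omega> \<in> swept X"
      unfolding swept_def using assms(1) by (auto intro!: bexI[of _ "s - t"] simp: algebra_simps)
  qed
  then have "(\<integral>\<^sup>+t. indicator (swept X) (z + t *\<^sub>R \<omega>) \<partial>lborel) = (\<integral>\<^sup>+t. indicator {s - h<..s} t \<partial>lborel)"
    by (intro nn_integral_cong) (auto simp: indicator_def)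
  also have "\<dots> = ennreal h" using h_pos by simp
  finally show ?thesis .
qed

end

context torus_flow
begin

section \<open>Surface measure weighted by the normal component of the flow\<close>

definition weight :: "'d torus \<Rightarrow> real" where
  "weight \<theta> = \<bar>D_op \<omega> S \<theta>\<bar> / norm (torus_grad S \<theta>)"

definition area :: "'d torus set \<Rightarrow> ennreal" where
  "area A = (\<integral>\<^sup>+\<theta>\<in>A. ennreal (weight \<theta>) \<partial>hausdorff_measure (CARD('d) - 1))"

lemma torus_grad_q: "torus_grad S (abs_torus x) = grad (q 0) x"
  by (simp add: torus_grad_abs comp_def q_0[abs_def])

lemma weight_abs_torus: "weight (abs_torus x) = \<bar>q 1 x\<bar> / norm (grad (q 0) x)"
  by (simp add: weight_def torus_grad_q q_1)

lemma area_bounds: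
  assumes A: "A \<in> sets borel"
  shows "(\<And>\<theta>. \<theta> \<in> A \<Longrightarrow> weight \<theta> \<le> b) \<Longrightarrow> area A \<le> ennreal b * hausdorff_outer (CARD('d) - 1) A"
    and "(\<And>\<theta>. \<theta> \<in> A \<Longrightarrow> a \<le> weight \<theta>) \<Longrightarrow> ennreal a * hausdorff_outer (CARD('d) - 1) A \<le> area A"
proof -
  have const: "(\<integral>\<^sup>+\<theta>\<in>A. ennreal c \<partial>hausdorff_measure (CARD('d) - 1)) = ennreal c * hausdorff_outer (CARD('d) - 1) A" for c
    using A by (simp add: nn_integral_cmult_indicator emeasure_hausdorff_measure)
  show "area A \<le> ennreal b * hausdorff_outer (CARD('d) - 1) A" if "\<And>\<theta>. \<theta> \<in> A \<Longrightarrow> weight \<theta> \<le> b"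
    unfolding const[symmetric] area_def using that
    by (intro nn_integral_mono) (auto simp: indicator_def intro: ennreal_leI)
  show "ennreal a * hausdorff_outer (CARD('d) - 1) A \<le> area A" if "\<And>\<theta>. \<theta> \<in> A \<Longrightarrow> a \<le> weight \<theta>"
    unfolding const[symmetric] area_def using that
    by (intro nn_integral_mono) (auto simp: indicator_def intro: ennreal_leI)
qed

end

context torus_flow_window
begin

text \<open>Projecting a nearly flat patch along \<open>\<omega>\<close> onto the hyperplane orthogonal to \<open>u\<close> distorts distances by the
  factor \<open>1 \<plusminus> \<epsilon>\<close>, and the set swept by the flow is fibred over the projection by segments of length \<open>h\<close>.\<close>

lemma flux_projection:
  fixes x0 :: "real ^ 'd"
  assumes dim: "2 \<le> CARD('d)" and \<epsilon>: "0 < \<epsilon>" "\<epsilon> < 1" and r: "r \<le> 1"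
    and u: "norm u = 1" and c: "\<omega> \<bullet> u \<noteq> 0"
    and q1: "\<And>z. z \<in> ball x0 r \<Longrightarrow> q 1 z \<noteq> 0"
    and flat: "\<And>z z'. z \<in> ball x0 r \<Longrightarrow> z' \<in> ball x0 r \<Longrightarrow> q 0 z = 0 \<Longrightarrow> q 0 z' = 0 \<Longrightarrow>
      \<bar>(z - z') \<bullet> u\<bar> * norm \<omega> \<le> \<epsilon> * \<bar>\<omega> \<bullet> u\<bar> * norm (z - z')"
    and A: "A \<in> sets borel" and sub: "A \<subseteq> zero_set S" "A \<subseteq> ball (abs_torus x0) r"
  shows "flux A \<le> ennreal (h * \<bar>\<omega> \<bullet> u\<bar> * (1 + \<epsilon>) ^ (CARD('d) - 1)) * hausdorff_outer (CARD('d) - 1) A"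
    and "ennreal (h * \<bar>\<omega> \<bullet> u\<bar> * (1 - \<epsilon>) ^ (CARD('d) - 1)) * hausdorff_outer (CARD('d) - 1) A \<le> flux A"
proof -
  obtain J :: "real ^ 'd hyper \<Rightarrow> real ^ 'd" where J: "linear J" "\<And>y. norm (J y) = norm y" "range J = {x. u \<bullet> x = 0}"
    using ex_hyperplane_isometry[OF dim, of u] u by (metis norm_zero zero_neq_one)
  interpret J: linear J by (rule J(1))
  have uu: "u \<bullet> u = 1" using u by (simp add: dot_square_norm)
  have Jinj: "y = y'" if "J y = J y'" for y y'
    using J(2)[of "y - y'"] that by (simp add: J.diff)
  let ?X = "patch x0 r A"
  note E = flux_eq_swept[OF q1 r A sub]
  \<comment> \<open>Projection along \<omega> onto the hyperplane orthogonal to u, in the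
    coordinates given by J.\<close>
  define P where "P z = inv J (z - ((z \<bullet> u) / (\<omega> \<bullet> u)) *\<^sub>R \<omega>)" for z
  have JP: "J (P z) = z - ((z \<bullet> u) / (\<omega> \<bullet> u)) *\<^sub>R \<omega>" for z
  proof -
    have "u \<bullet> (z - ((z \<bullet> u) / (\<omega> \<bullet> u)) *\<^sub>R \<omega>) = 0"
      using c by (simp add: inner_diff_right inner_commute)
    then have "z - ((z \<bullet> u) / (\<omega> \<bullet> u)) *\<^sub>R \<omega> \<in> range J" using J(3) by blast
    then show ?thesis unfolding P_def by (rule f_inv_into_f)
  qed
  have bilip: "(1 - \<epsilon>) * dist z z' \<le> dist (P z) (P z') \<and> dist (P z) (P z') \<le> (1 + \<epsilon>) * dist z z'"
    if "z \<in> ?X" "z' \<in> ?X" for z z'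
  proof -
    let ?w = "z - z'"
    have "q 0 z = 0" "q 0 z' = 0" "z \<in> ball x0 r" "z' \<in> ball x0 r"
      using that sub(1) by (auto simp: patch_def zero_set_def q_0)
    then have "\<bar>?w \<bullet> u\<bar> * norm \<omega> \<le> \<epsilon> * \<bar>\<omega> \<bullet> u\<bar> * norm ?w" using flat by blast
    then have small: "norm (((?w \<bullet> u) / (\<omega> \<bullet> u)) *\<^sub>R \<omega>) \<le> \<epsilon> * norm ?w"
      using c by (simp add: pos_divide_le_eq mult_ac)
    have "norm (P z - P z') = norm (J (P z - P z'))" by (simp only: J(2))
    also have "J (P z - P z') = ?w - ((?w \<bullet> u) / (\<omega> \<bullet> u)) *\<^sub>R \<omega>"
      by (simp add: J.diff JP inner_diff_left diff_divide_distrib algebra_simps)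
    finally have "norm (P z - P z') = norm (?w - ((?w \<bullet> u) / (\<omega> \<bullet> u)) *\<^sub>R \<omega>)" .
    then show ?thesis
      using small norm_triangle_ineq4[of ?w "((?w \<bullet> u) / (\<omega> \<bullet> u)) *\<^sub>R \<omega>"]
        norm_triangle_ineq2[of ?w "((?w \<bullet> u) / (\<omega> \<bullet> u)) *\<^sub>R \<omega>"]
      by (simp add: dist_norm algebra_simps)
  qed
  have iso: "dist (abs_torus z) (abs_torus z') = dist z z'" if "z \<in> ?X" "z' \<in> ?X" for z z'
  proof (rule dist_abs_torus_eq)
    have "dist z z' \<le> dist x0 z + dist x0 z'" by (rule dist_triangle3)
    also have "\<dots> \<le> 2" using that r by (auto simp: patch_def)
    finally show "dist z z' \<le> pi" using pi_gt3 by simp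
  qed
  have "\<exists>z. z \<in> ?X \<and> abs_torus z = a" if "a \<in> A" for a
    using patch_lift[OF sub(2), of "rep_torus a"] that by (metis abs_rep_torus abs_torus_lattice)
  then obtain l where l: "\<And>a. a \<in> A \<Longrightarrow> l a \<in> ?X" "\<And>a. a \<in> A \<Longrightarrow> abs_torus (l a) = a" by metis
  have l_abs: "l (abs_torus z) = z" if "z \<in> ?X" for z
  proof -
    have "abs_torus z \<in> A" using that by (simp add: patch_def)
    then have "dist (l (abs_torus z)) z = dist (abs_torus z) (abs_torus z)"
      using iso[OF l(1) that] l(2) by metis
    then show ?thesis by simp
  qed
  \<comment> \<open>A is identified isometrically with its lifted patch, which is then
    projected.\<close>
  define F where "F a = P (l a)" for a
  define Y where "Y = F ` A"
  have Y: "Y = P ` ?X"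
  proof
    show "Y \<subseteq> P ` ?X" using l(1) by (auto simp: Y_def F_def)
    show "P ` ?X \<subseteq> Y" using l_abs by (force simp: Y_def F_def patch_def)
  qed
  have Fbilip: "(1 - \<epsilon>) * dist a b \<le> dist (F a) (F b)" "dist (F a) (F b) \<le> (1 + \<epsilon>) * dist a b"
    if "a \<in> A" "b \<in> A" for a b
    using bilip[OF l(1)[OF that(1)] l(1)[OF that(2)]] iso[OF l(1)[OF that(1)] l(1)[OF that(2)]] l(2) that
    by (auto simp: F_def)
  have hit: "(\<exists>s. J y + s *\<^sub>R \<omega> \<in> ?X) \<longleftrightarrow> y \<in> Y" for y
  proof
    assume "\<exists>s. J y + s *\<^sub>R \<omega> \<in> ?X"
    then obtain s where s: "J y + s *\<^sub>R \<omega> \<in> ?X" by blast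
    have "J y \<bullet> u = 0" using J(3) by (metis (mono_tags) inner_commute mem_Collect_eq rangeI)
    then have "J (P (J y + s *\<^sub>R \<omega>)) = J y" using c by (simp add: JP inner_add_left)
    then have "P (J y + s *\<^sub>R \<omega>) = y" by (rule Jinj)
    then show "y \<in> Y" unfolding Y using s by (metis image_eqI)
  next
    assume "y \<in> Y"
    then obtain z where z: "z \<in> ?X" "y = P z" unfolding Y by blast
    then have "J y + ((z \<bullet> u) / (\<omega> \<bullet> u)) *\<^sub>R \<omega> = z" by (simp add: JP)
    then show "\<exists>s. J y + s *\<^sub>R \<omega> \<in> ?X" using z(1) by metis
  qed
  have line: "(\<integral>\<^sup>+t. indicator (swept ?X) (J y + t *\<^sub>R \<omega>) \<partial>lborel) = ennreal h * indicator Y y" for y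
  proof (cases "y \<in> Y")
    case True
    then obtain s where s: "J y + s *\<^sub>R \<omega> \<in> ?X" using hit by blast
    have "s' = s" if "J y + s' *\<^sub>R \<omega> \<in> ?X" for s'
      using patch_line_unique[OF q1 sub(1) that s] .
    then show ?thesis using swept_line_length[OF s] True by simp
  next
    case False
    have "J y + t *\<^sub>R \<omega> \<notin> swept ?X" for t
    proof
      assume "J y + t *\<^sub>R \<omega> \<in> swept ?X"
      then obtain s where "J y + t *\<^sub>R \<omega> + s *\<^sub>R \<omega> \<in> ?X" by (auto simp: swept_def)
      then have "J y + (t + s) *\<^sub>R \<omega> \<in> ?X" by (simp add: scaleR_left_distrib add.assoc)
      then show False using False hit by blast
    qed
    then show ?thesis using False by simp
  qed
  have [measurable]: "swept ?X \<in> sets borel" by (rule E(1))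
  have "continuous_on UNIV J" using J(1) by (simp add: linear_continuous_on linear_linear)
  then have [measurable]: "J \<in> borel_measurable borel" by (rule borel_measurable_continuous_onI)
  \<comment> \<open>\<open>Y\<close> is an image of a Borel set; its measurability is read off from
    the lengths of the fibres of the swept set.\<close>
  have "Y = {y. (\<integral>\<^sup>+t. indicator (swept ?X) (J y + t *\<^sub>R \<omega>) \<partial>lborel) \<noteq> 0}"
    unfolding line using h_pos by (auto simp: indicator_def)
  also have "\<dots> \<in> sets borel" by measurable
  finally have [measurable]: "Y \<in> sets borel" .
  have "flux A = (\<integral>\<^sup>+x. indicator (swept ?X) x \<partial>lborel)" using E by simp
  also have "\<dots> = ennreal \<bar>\<omega> \<bullet> u\<bar> * (\<integral>\<^sup>+y. ennreal h * indicator Y y \<partial>lborel)"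
    unfolding line[symmetric] by (rule nn_integral_hyperplane_slices[OF dim u c J]) measurable
  also have "\<dots> = ennreal \<bar>\<omega> \<bullet> u\<bar> * (ennreal h * emeasure lborel Y)"
    by (simp add: nn_integral_cmult_indicator)
  also have "emeasure lborel Y = hausdorff_outer (CARD('d) - 1) Y"
    using hausdorff_outer_eq_lborel[of Y] dim by (simp add: CARD_hyper)
  also have "ennreal \<bar>\<omega> \<bullet> u\<bar> * (ennreal h * hausdorff_outer (CARD('d) - 1) Y) = ennreal (h * \<bar>\<omega> \<bullet> u\<bar>) * hausdorff_outer (CARD('d) - 1) Y"
    using h_pos by (simp add: ennreal_mult mult_ac)
  finally have flux: "flux A = ennreal (h * \<bar>\<omega> \<bullet> u\<bar>) * hausdorff_outer (CARD('d) - 1) Y" .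
  note bl = hausdorff_outer_bilipschitz[where f=F and A=A and a="1 - \<epsilon>" and b="1 + \<epsilon>" and k="CARD('d) - 1", folded Y_def]
  have pos: "0 \<le> h * \<bar>\<omega> \<bullet> u\<bar>" using h_pos by simp
  have "flux A \<le> ennreal (h * \<bar>\<omega> \<bullet> u\<bar>) * (ennreal ((1 + \<epsilon>) ^ (CARD('d) - 1)) * hausdorff_outer (CARD('d) - 1) A)"
    unfolding flux using bl(1) Fbilip \<epsilon> by (intro mult_left_mono) auto
  then show "flux A \<le> ennreal (h * \<bar>\<omega> \<bullet> u\<bar> * (1 + \<epsilon>) ^ (CARD('d) - 1)) * hausdorff_outer (CARD('d) - 1) A"
    using pos \<epsilon> by (simp add: ennreal_mult'' mult.assoc ennreal_mult)
  have "ennreal (h * \<bar>\<omega> \<bullet> u\<bar>) * (ennreal ((1 - \<epsilon>) ^ (CARD('d) - 1)) * hausdorff_outer (CARD('d) - 1) A) \<le> flux A"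
    unfolding flux using bl(2) Fbilip \<epsilon> by (intro mult_left_mono) auto
  then show "ennreal (h * \<bar>\<omega> \<bullet> u\<bar> * (1 - \<epsilon>) ^ (CARD('d) - 1)) * hausdorff_outer (CARD('d) - 1) A \<le> flux A"
    using pos \<epsilon> by (simp add: ennreal_mult'' mult.assoc ennreal_mult)
qed

text \<open>In dimension 1 all points lie on one flow line, so a nonempty patch is a single point.
  The swept set is a segment of length h times the norm of \<omega>, and the weight at the point is
  the norm of \<omega>.\<close>

lemma flux_area_local_card_1:
  assumes dim: "CARD('d) = 1" and r: "r \<le> 1"
    and q1: "\<And>z. z \<in> ball x0 r \<Longrightarrow> q 1 z \<noteq> 0"
    and A: "A \<in> sets borel" and sub: "A \<subseteq> zero_set S" "A \<subseteq> ball (abs_torus x0) r"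
  shows "flux A = ennreal h * area A"
proof (cases "A = {}")
  case True
  then show ?thesis by (simp add: flux_def crossing_integral_def area_def N_def)
next
  case False
  let ?X = "patch x0 r A"
  note E = flux_eq_swept[OF q1 r A sub]
  obtain a where "a \<in> A" using False by blast
  then obtain k where "rep_torus a + lattice k \<in> ?X" using patch_lift[OF sub(2), of "rep_torus a"] by auto
  then obtain z0 where z0: "z0 \<in> ?X" by blast
  obtain i :: 'd where i: "UNIV = {i}" using dim card_1_singletonE by blast
  have all_i: "j = i" for j using i by blast
  have \<omega>i: "\<omega> $ i \<noteq> 0" using \<omega>_nonzero all_i by (metis vec_eq_iff zero_index)
  have single: "z = z0" if "z \<in> ?X" for z
  proof -
    define s where "s = (z $ i - z0 $ i) / \<omega> $ i"
    have "z = z0 + s *\<^sub>R \<omega>"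
      unfolding vec_eq_iff
    proof
      fix j show "z $ j = (z0 + s *\<^sub>R \<omega>) $ j" using \<omega>i all_i[of j] by (simp add: s_def)
    qed
    then have "s = 0" using patch_line_unique[OF q1 sub(1), where z=z0 and s=s and s'=0] that z0 by simp
    then show ?thesis using \<open>z = z0 + s *\<^sub>R \<omega>\<close> by simp
  qed
  have A_eq: "A = {abs_torus z0}"
  proof
    show "A \<subseteq> {abs_torus z0}"
    proof
      fix b assume "b \<in> A"
      then obtain k where "rep_torus b + lattice k \<in> ?X" using patch_lift[OF sub(2), of "rep_torus b"] by auto
      then have "rep_torus b + lattice k = z0" by (rule single)
      then have "abs_torus z0 = b" by auto
      then show "b \<in> {abs_torus z0}" by simp
    qed
    show "{abs_torus z0} \<subseteq> A" using z0 by (simp add: patch_def)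
  qed
  have [measurable]: "swept ?X \<in> sets borel" by (rule E(1))
  have "flux A = (\<integral>\<^sup>+x. indicator (swept ?X) x \<partial>lborel)" using E by simp
  also have "\<dots> = ennreal (norm \<omega>) * (\<integral>\<^sup>+t. indicator (swept ?X) (z0 + t *\<^sub>R \<omega>) \<partial>lborel)"
    by (rule nn_integral_line[OF dim \<omega>_nonzero]) measurable
  also have "(\<integral>\<^sup>+t. indicator (swept ?X) (z0 + t *\<^sub>R \<omega>) \<partial>lborel) = ennreal h"
  proof (rule swept_line_length)
    show "z0 + 0 *\<^sub>R \<omega> \<in> ?X" using z0 by simp
    show "s' = 0" if "z0 + s' *\<^sub>R \<omega> \<in> ?X" for s'
      using patch_line_unique[OF q1 sub(1), where z=z0 and s=s' and s'=0] that z0 by simp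
  qed
  finally have flux: "flux A = ennreal (norm \<omega>) * ennreal h" .
  have w: "weight (abs_torus z0) = norm \<omega>"
  proof -
    let ?g = "torus_grad S (abs_torus z0)"
    have "abs_torus z0 \<in> zero_set S" using A_eq sub(1) by blast
    then have g: "?g \<noteq> 0" using regular by blast
    have n: "norm x = \<bar>x $ i\<bar>" for x :: "real ^ 'd" unfolding norm_vec_def L2_set_def i by simp
    have "\<omega> \<bullet> ?g = \<omega> $ i * ?g $ i" unfolding inner_vec_def i by simp
    moreover have "?g $ i \<noteq> 0" using g n[of ?g] by auto
    ultimately show ?thesis using n[of ?g] n[of \<omega>] by (simp add: weight_def D_op_def abs_mult)
  qed
  have "area A = ennreal (norm \<omega>) * hausdorff_outer 0 A"
    using area_bounds[OF A, of "norm \<omega>" ] area_bounds(2)[OF A, of "norm \<omega>"] w dim A_eq by (intro antisym) auto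
  then have "area A = ennreal (norm \<omega>)" by (simp add: A_eq hausdorff_outer_0_singleton)
  then show ?thesis using flux by (simp add: mult.commute)
qed

text \<open>Take for u the unit vector along the gradient at x0. On a small ball the weight is
  within a factor 1 \<plusminus> \<epsilon> of \<bar>\<omega> \<bullet> u\<bar>, and the projection
  distorts distances by at most 1 \<plusminus> \<epsilon>; \<epsilon> is chosen so that both errors
  together stay within \<kappa>.\<close>

lemma flux_area_local:
  assumes x0: "q 1 x0 \<noteq> 0" and \<kappa>: "1 < \<kappa>"
  shows "\<exists>r>0. \<forall>A. A \<in> sets borel \<longrightarrow> A \<subseteq> zero_set S \<longrightarrow> A \<subseteq> ball (abs_torus x0) r \<longrightarrow>
    flux A \<le> ennreal (\<kappa> * h) * area A \<and> ennreal h * area A \<le> ennreal \<kappa> * flux A"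
proof -
  define g0 where "g0 = grad (q 0) x0"
  have q10: "q 1 x0 = \<omega> \<bullet> g0" by (simp add: g0_def q_Suc)
  have g0: "g0 \<noteq> 0" using x0 q10 by auto
  define u where "u = g0 /\<^sub>R norm g0"
  have u: "norm u = 1" using g0 by (simp add: u_def)
  define w where "w = \<bar>\<omega> \<bullet> u\<bar>"
  have w_eq: "w = \<bar>q 1 x0\<bar> / norm g0" by (simp add: w_def u_def q10 abs_mult divide_inverse mult.commute del: One_nat_def)
  have w: "0 < w" using x0 g0 by (simp add: w_eq)
  have \<omega>: "0 < norm \<omega>" using \<omega>_nonzero by simp
  define k where "k = CARD('d) - 1"
  have lim: "((\<lambda>\<epsilon>. \<kappa> * (1 - \<epsilon>) - (1 + \<epsilon>) ^ k) \<longlongrightarrow> \<kappa> * (1 - 0) - (1 + 0) ^ k) (at_right (0::real))"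
    "((\<lambda>\<epsilon>. \<kappa> * (1 - \<epsilon>) ^ k - (1 + \<epsilon>)) \<longlongrightarrow> \<kappa> * (1 - 0) ^ k - (1 + 0)) (at_right (0::real))"
    by (intro tendsto_intros)+
  have "0 < \<kappa> * (1 - 0) - (1 + 0) ^ k" "0 < \<kappa> * (1 - 0) ^ k - (1 + 0)" using \<kappa> by simp_all
  then have "\<forall>\<^sub>F \<epsilon> in at_right (0::real). 0 < \<kappa> * (1 - \<epsilon>) - (1 + \<epsilon>) ^ k"
    "\<forall>\<^sub>F \<epsilon> in at_right (0::real). 0 < \<kappa> * (1 - \<epsilon>) ^ k - (1 + \<epsilon>)"
    using order_tendstoD(1)[OF lim(1)] order_tendstoD(1)[OF lim(2)] by blast+
  moreover have "\<forall>\<^sub>F \<epsilon> in at_right (0::real). \<epsilon> < 1" by (rule eventually_at_rightI[of 0 1]) auto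
  moreover have "\<forall>\<^sub>F \<epsilon> in at_right (0::real). 0 < \<epsilon>" by (rule eventually_at_right_less)
  ultimately have "\<forall>\<^sub>F \<epsilon> in at_right (0::real). 0 < \<epsilon> \<and> \<epsilon> < 1 \<and> (1 + \<epsilon>) ^ k \<le> \<kappa> * (1 - \<epsilon>) \<and> 1 + \<epsilon> \<le> \<kappa> * (1 - \<epsilon>) ^ k"
    by eventually_elim auto
  \<comment> \<open>The third condition serves the upper bound of the flux, where the projection may
    expand while the weight is small; the fourth serves the lower bound.\<close>
  then obtain \<epsilon> where \<epsilon>: "0 < \<epsilon>" "\<epsilon> < 1" "(1 + \<epsilon>) ^ k \<le> \<kappa> * (1 - \<epsilon>)" "1 + \<epsilon> \<le> \<kappa> * (1 - \<epsilon>) ^ k"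
    using eventually_happens'[OF trivial_limit_at_right_real] by blast
  have cont: "isCont (grad (q 0)) x0" "isCont (q 1) x0"
    using continuous_grad[OF q_smooth[of 0], of UNIV] q_continuous[of UNIV 1] by (auto simp: continuous_on_eq_continuous_at)
  \<comment> \<open>With this relative tolerance for the gradient, chords of the zero set satisfy
    exactly the flatness hypothesis of \<open>flux_projection\<close>.\<close>
  define d where "d = \<epsilon> * w / norm \<omega>"
  have d: "0 < d" using \<epsilon>(1) w \<omega> by (simp add: d_def)
  have "isCont (\<lambda>z. \<bar>q 1 z\<bar> / norm (grad (q 0) z)) x0"
    using cont g0 by (intro continuous_intros) (auto simp: g0_def)
  then obtain r1 where r1: "0 < r1" "\<And>z. dist z x0 < r1 \<Longrightarrow> \<bar>\<bar>q 1 z\<bar> / norm (grad (q 0) z) - w\<bar> < \<epsilon> * w"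
    using \<epsilon>(1) w unfolding continuous_at_eps_delta w_eq g0_def dist_real_def by (metis mult_pos_pos)
  obtain r2 where r2: "0 < r2" "\<And>z. dist z x0 < r2 \<Longrightarrow> dist (grad (q 0) z) g0 < d * norm g0"
    using cont(1) d g0 unfolding continuous_at_eps_delta g0_def by (metis mult_pos_pos zero_less_norm_iff)
  obtain r3 where r3: "0 < r3" "\<And>z. dist z x0 < r3 \<Longrightarrow> dist (q 1 z) (q 1 x0) < \<bar>q 1 x0\<bar>"
    using cont(2) x0 unfolding continuous_at_eps_delta by (metis zero_less_abs_iff)
  define r where "r = Min {1, r1, r2, r3}"
  have r: "0 < r" "r \<le> 1" "r \<le> r1" "r \<le> r2" "r \<le> r3" using r1(1) r2(1) r3(1) by (auto simp: r_def)
  have q1: "q 1 z \<noteq> 0" if "z \<in> ball x0 r" for z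
    using r3(2)[of z] that r by (auto simp: dist_commute dist_real_def)
  have wt: "(1 - \<epsilon>) * w \<le> weight \<theta> \<and> weight \<theta> \<le> (1 + \<epsilon>) * w" if "A \<subseteq> ball (abs_torus x0) r" "\<theta> \<in> A" for A \<theta>
  proof -
    obtain y where y: "abs_torus y = \<theta>" "dist (abs_torus x0) \<theta> = dist x0 y" by (rule dist_torus_attained)
    then have "dist y x0 < r1" using that r by (auto simp: dist_commute)
    from r1(2)[OF this] show ?thesis
      using weight_abs_torus[of y] y(1) by (simp add: abs_less_iff algebra_simps)
  qed
  have flat: "\<bar>(z - z') \<bullet> u\<bar> * norm \<omega> \<le> \<epsilon> * \<bar>\<omega> \<bullet> u\<bar> * norm (z - z')"
    if zz: "z \<in> ball x0 r" "z' \<in> ball x0 r" "q 0 z = 0" "q 0 z' = 0" for z z'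
  proof -
    let ?v = "z - z'"
    \<comment> \<open>The chord between two zeros is orthogonal to the gradient at an intermediate
      point, and that gradient is close to \<open>g0\<close>.\<close>
    obtain t where t: "0 < t" "t < 1" "q 0 (z' + 1 *\<^sub>R ?v) - q 0 (z' + 0 *\<^sub>R ?v) = (1 - 0) * (?v \<bullet> grad (q 0) (z' + t *\<^sub>R ?v))"
      using MVT2[of 0 1 "\<lambda>t. q 0 (z' + t *\<^sub>R ?v)" "\<lambda>t. ?v \<bullet> grad (q 0) (z' + t *\<^sub>R ?v)"]
        has_derivative_along[OF q_smooth] by fastforce
    let ?y = "z' + t *\<^sub>R ?v"
    have 0: "?v \<bullet> grad (q 0) ?y = 0" using t(3) zz by simp
    have "?y = (1 - t) *\<^sub>R z' + t *\<^sub>R z" by (simp add: algebra_simps)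
    also have "\<dots> \<in> ball x0 r" using zz t by (intro convexD[OF convex_ball]) auto
    finally have near: "dist (grad (q 0) ?y) g0 < d * norm g0" using r2(2)[of ?y] r by (simp add: dist_commute)
    have "?v \<bullet> g0 = - (?v \<bullet> (grad (q 0) ?y - g0))" using 0 by (simp add: inner_diff_right)
    then have "\<bar>?v \<bullet> g0\<bar> \<le> norm ?v * norm (grad (q 0) ?y - g0)"
      using Cauchy_Schwarz_ineq2[of ?v "grad (q 0) ?y - g0"] by simp
    also have "\<dots> \<le> norm ?v * (d * norm g0)" using near by (intro mult_left_mono) (auto simp: dist_norm)
    finally have "\<bar>?v \<bullet> g0\<bar> / norm g0 \<le> norm ?v * d" using g0 by (simp add: pos_divide_le_eq mult_ac)
    then have "\<bar>?v \<bullet> u\<bar> \<le> norm ?v * d" by (simp add: u_def abs_mult divide_inverse mult.commute)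
    then have "\<bar>?v \<bullet> u\<bar> * norm \<omega> \<le> norm ?v * d * norm \<omega>" using \<omega> by (intro mult_right_mono) auto
    also have "\<dots> = \<epsilon> * \<bar>\<omega> \<bullet> u\<bar> * norm ?v" using \<omega> by (simp add: d_def w_def)
    finally show ?thesis .
  qed
  have "flux A \<le> ennreal (\<kappa> * h) * area A \<and> ennreal h * area A \<le> ennreal \<kappa> * flux A"
    if A: "A \<in> sets borel" "A \<subseteq> zero_set S" "A \<subseteq> ball (abs_torus x0) r" for A
  proof (cases "CARD('d) = 1")
    case True
    have eq: "flux A = ennreal h * area A" by (rule flux_area_local_card_1[OF True r(2) q1 A])
    have "1 * (ennreal h * area A) \<le> ennreal \<kappa> * (ennreal h * area A)"
      using \<kappa> by (intro mult_right_mono) auto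
    then show ?thesis using h_pos \<kappa> by (simp add: eq ennreal_mult mult.assoc)
  next
    case False
    then have dim: "2 \<le> CARD('d)" using zero_less_card_finite[where 'a='d] by linarith
    have c: "\<omega> \<bullet> u \<noteq> 0" using w by (simp add: w_def)
    note fp = flux_projection[OF dim \<epsilon>(1,2) r(2) u c q1 flat A, folded w_def k_def]
    note ab = area_bounds[OF A(1), folded k_def]
    let ?H = "hausdorff_outer k A"
    have a1: "area A \<le> ennreal ((1 + \<epsilon>) * w) * ?H" and a2: "ennreal ((1 - \<epsilon>) * w) * ?H \<le> area A"
      using wt[OF A(3)] by (auto intro: ab)
    have "flux A \<le> ennreal (h * w * (1 + \<epsilon>) ^ k) * ?H" by (rule fp(1))
    also have "\<dots> \<le> ennreal (\<kappa> * h * ((1 - \<epsilon>) * w)) * ?H"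
    proof (intro mult_right_mono ennreal_leI)
      have "h * w * (1 + \<epsilon>) ^ k \<le> h * w * (\<kappa> * (1 - \<epsilon>))" using \<epsilon>(3) h_pos w by (intro mult_left_mono) auto
      then show "h * w * (1 + \<epsilon>) ^ k \<le> \<kappa> * h * ((1 - \<epsilon>) * w)" by (simp add: mult_ac)
    qed simp
    also have "\<dots> = ennreal (\<kappa> * h) * (ennreal ((1 - \<epsilon>) * w) * ?H)"
      using \<kappa> h_pos w \<epsilon> by (simp add: ennreal_mult mult.assoc)
    also have "\<dots> \<le> ennreal (\<kappa> * h) * area A" by (intro mult_left_mono a2) simp
    finally have 1: "flux A \<le> ennreal (\<kappa> * h) * area A" .
    have "ennreal h * area A \<le> ennreal h * (ennreal ((1 + \<epsilon>) * w) * ?H)" by (intro mult_left_mono a1) simp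
    also have "\<dots> = ennreal (h * ((1 + \<epsilon>) * w)) * ?H" using h_pos w \<epsilon> by (simp add: ennreal_mult mult.assoc)
    also have "\<dots> \<le> ennreal (\<kappa> * (h * w * (1 - \<epsilon>) ^ k)) * ?H"
    proof (intro mult_right_mono ennreal_leI)
      have "h * w * (1 + \<epsilon>) \<le> h * w * (\<kappa> * (1 - \<epsilon>) ^ k)" using \<epsilon>(4) h_pos w by (intro mult_left_mono) auto
      then show "h * ((1 + \<epsilon>) * w) \<le> \<kappa> * (h * w * (1 - \<epsilon>) ^ k)" by (simp add: mult_ac)
    qed simp
    also have "\<dots> = ennreal \<kappa> * (ennreal (h * w * (1 - \<epsilon>) ^ k) * ?H)"
      using \<kappa> h_pos w \<epsilon> by (simp add: ennreal_mult mult.assoc)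
    also have "\<dots> \<le> ennreal \<kappa> * flux A" by (rule mult_left_mono[OF fp(2) zero_le])
    finally show ?thesis using 1 by blast
  qed
  then show ?thesis using r(1) by blast
qed

end

context torus_flow
begin

lemma continuous_torus_grad: "continuous_on A (torus_grad S)"
proof -
  have "continuous_on UNIV (torus_grad S)"
    unfolding continuous_on_torus_iff torus_grad_q using q_smooth by (rule continuous_grad)
  then show ?thesis by (rule continuous_on_subset) simp
qed

lemma weight_measurable [measurable]: "weight \<in> borel_measurable borel"
proof -
  have [measurable]: "torus_grad S \<in> borel_measurable borel" "D_op \<omega> S \<in> borel_measurable borel"
    using continuous_torus_grad D_op_continuous[of UNIV 1] by (auto intro: borel_measurable_continuous_onI)
  show ?thesis unfolding weight_def[abs_def] by measurable
qed

lemma area_Un: "A \<in> sets borel \<Longrightarrow> B \<in> sets borel \<Longrightarrow> A \<inter> B = {} \<Longrightarrow> area (A \<union> B) = area A + area B"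
  unfolding area_def by (rule nn_integral_disjoint_pair) auto

end

section \<open>From small patches to all Borel subsets of the zero set\<close>

lemma ennreal_le_of_le_mult:
  fixes a b :: ennreal
  assumes "\<And>\<kappa>. 1 < \<kappa> \<Longrightarrow> a \<le> ennreal \<kappa> * b"
  shows "a \<le> b"
proof (cases "b = \<top>")
  case False
  \<comment> \<open>The instance \<kappa> = 2 already shows that a is finite, so the rest happens in
    the reals.\<close>
  then have "ennreal 2 * b < \<top>" by (simp add: ennreal_mult_less_top less_top)
  moreover have "a \<le> ennreal 2 * b" using assms[of 2] by simp
  ultimately have "a < \<top>" by (rule le_less_trans[rotated])
  then obtain x y where a: "a = ennreal x" "0 \<le> x" and b: "b = ennreal y" "0 \<le> y"
    using False by (cases a; cases b) auto
  have "z * x \<le> y" if z: "0 < z" "z < 1" for z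
  proof -
    have "ennreal (1 / z * y) = ennreal (1 / z) * ennreal y" using z b(2) by (intro ennreal_mult) auto
    moreover have "a \<le> ennreal (1 / z) * b" using z by (intro assms) simp
    ultimately have "ennreal x \<le> ennreal (1 / z * y)" by (simp only: a(1) b(1))
    then have "x \<le> 1 / z * y" by (rule iffD1[OF ennreal_le_iff, rotated]) (use z b in simp)
    then show ?thesis using z by (simp add: field_simps)
  qed
  then have "x \<le> y" by (rule field_le_mult_one_interval)
  then show ?thesis using a b by (simp add: ennreal_leI)
qed simp

context torus_flow_window
begin

lemma crossing_integral_add:
  assumes [measurable]: "f \<in> borel_measurable borel" "g \<in> borel_measurable borel"
  shows "crossing_integral (\<lambda>\<theta>. f \<theta> + g \<theta>) = crossing_integral f + crossing_integral g"
  unfolding crossing_integral_def N_add distrib_right by (rule nn_integral_add) measurable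

lemma crossing_integral_cmult:
  assumes [measurable]: "g \<in> borel_measurable borel"
  shows "crossing_integral (\<lambda>\<theta>. c * g \<theta>) = c * crossing_integral g"
  unfolding crossing_integral_def N_cmult mult.assoc by (rule nn_integral_cmult) measurable

lemma crossing_integral_SUP:
  assumes U: "incseq U" and [measurable]: "\<And>i. U i \<in> borel_measurable borel"
  shows "crossing_integral (\<lambda>\<theta>. SUP i. U i \<theta>) = (SUP i. crossing_integral (U i))"
proof -
  have "incseq (\<lambda>i. N (U i))"
    using U by (auto simp: incseq_def le_fun_def intro!: N_mono)
  then have "incseq (\<lambda>i x. N (U i) x * indicator torus_cell x)"
    by (auto simp: incseq_def le_fun_def intro!: mult_right_mono)
  then show ?thesis
    unfolding crossing_integral_def N_SUP[OF U] SUP_mult_right_ennreal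
    by (intro nn_integral_monotone_convergence_SUP) measurable
qed

lemma flux_Un:
  assumes "A \<in> sets borel" "B \<in> sets borel" "A \<inter> B = {}"
  shows "flux (A \<union> B) = flux A + flux B"
proof -
  have "indicator (A \<union> B) = (\<lambda>\<theta>. indicator A \<theta> + indicator B \<theta> :: ennreal)"
    using assms(3) by (auto simp: indicator_def fun_eq_iff)
  then show ?thesis unfolding flux_def using assms by (simp add: crossing_integral_add)
qed

lemma flux_tangency: "flux (A \<inter> tangency_set \<omega> S) = 0"
proof -
  have "AE x in lebesgue. x \<notin> {x. \<exists>t. abs_torus (x + t *\<^sub>R \<omega>) \<in> tangency_set \<omega> S}"
    by (rule AE_not_in) (use negligible_tangency_orbits in \<open>simp only: negligible_iff_null_sets\<close>)
  then have "AE x in lborel. x \<notin> {x. \<exists>t. abs_torus (x + t *\<^sub>R \<omega>) \<in> tangency_set \<omega> S}"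
    by (simp only: AE_completion_iff)
  then have "AE x in lborel. N (indicator (A \<inter> tangency_set \<omega> S)) x * indicator torus_cell x = (0 :: ennreal)"
    by eventually_elim (auto simp: N_def)
  then have "flux (A \<inter> tangency_set \<omega> S) = (\<integral>\<^sup>+x. 0 \<partial>(lborel :: (real ^ 'd) measure))"
    unfolding flux_def crossing_integral_def by (rule nn_integral_cong_AE)
  then show ?thesis by simp
qed

text \<open>Removing one ball at a time cuts A into finitely many disjoint pieces, over which both
  inequalities add up.\<close>

lemma flux_area_cover:
  assumes "finite C" and \<kappa>: "0 < \<kappa>"
    and C: "\<And>c A. c \<in> C \<Longrightarrow> A \<in> sets borel \<Longrightarrow> A \<subseteq> zero_set S \<Longrightarrow> A \<subseteq> ball c (r c) \<Longrightarrow>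
      flux A \<le> ennreal (\<kappa> * h) * area A \<and> ennreal h * area A \<le> ennreal \<kappa> * flux A"
    and A: "A \<in> sets borel" "A \<subseteq> zero_set S" "A \<subseteq> (\<Union>c\<in>C. ball c (r c))"
  shows "flux A \<le> ennreal (\<kappa> * h) * area A \<and> ennreal h * area A \<le> ennreal \<kappa> * flux A"
  using assms(1) C A
proof (induction C arbitrary: A rule: finite_induct)
  case empty
  then have "A = {}" by simp
  then show ?case by (simp add: flux_def crossing_integral_def area_def N_def)
next
  case (insert c C)
  let ?B = "A \<inter> ball c (r c)" and ?D = "A - ball c (r c)"
  have sets: "?B \<in> sets borel" "?D \<in> sets borel" using insert.prems(2) by auto
  have B: "flux ?B \<le> ennreal (\<kappa> * h) * area ?B" "ennreal h * area ?B \<le> ennreal \<kappa> * flux ?B"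
    using insert.prems(1)[of c ?B] insert.prems(3) sets(1) by blast+
  have "flux ?D \<le> ennreal (\<kappa> * h) * area ?D \<and> ennreal h * area ?D \<le> ennreal \<kappa> * flux ?D"
  proof (rule insert.IH)
    show "flux A \<le> ennreal (\<kappa> * h) * area A \<and> ennreal h * area A \<le> ennreal \<kappa> * flux A"
      if "c \<in> C" "A \<in> sets borel" "A \<subseteq> zero_set S" "A \<subseteq> ball c (r c)" for c A
      using insert.prems(1)[of c A] that by blast
    show "?D \<in> sets borel" by (rule sets(2))
    show "?D \<subseteq> zero_set S" "?D \<subseteq> (\<Union>c\<in>C. ball c (r c))" using insert.prems(3,4) by blast+
  qed
  then have D: "flux ?D \<le> ennreal (\<kappa> * h) * area ?D" "ennreal h * area ?D \<le> ennreal \<kappa> * flux ?D" by auto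
  have A: "A = ?B \<union> ?D" and "?B \<inter> ?D = {}" by auto
  then have "flux A = flux ?B + flux ?D" "area A = area ?B + area ?D"
    using sets by (metis flux_Un, metis area_Un)
  then show ?case using add_mono[OF B(1) D(1)] add_mono[OF B(2) D(2)] by (simp add: distrib_left)
qed

text \<open>For each \<kappa> > 1 compactness leaves finitely many local balls, whose number does
  not enter the bound; then \<kappa> tends to 1.\<close>

lemma flux_eq_area_compact:
  assumes K: "compact K" "\<And>\<theta>. \<theta> \<in> K \<Longrightarrow> D_op \<omega> S \<theta> \<noteq> 0"
    and A: "A \<in> sets borel" "A \<subseteq> zero_set S" "A \<subseteq> K"
  shows "flux A = ennreal h * area A"
proof -
  have "flux A \<le> ennreal (\<kappa> * h) * area A \<and> ennreal h * area A \<le> ennreal \<kappa> * flux A" if \<kappa>: "1 < \<kappa>" for \<kappa>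
  proof -
    have "\<exists>r>0. \<forall>A. A \<in> sets borel \<longrightarrow> A \<subseteq> zero_set S \<longrightarrow> A \<subseteq> ball \<theta> r \<longrightarrow>
        flux A \<le> ennreal (\<kappa> * h) * area A \<and> ennreal h * area A \<le> ennreal \<kappa> * flux A" if \<theta>: "\<theta> \<in> K" for \<theta>
    proof -
      have "q 1 (rep_torus \<theta>) \<noteq> 0" using K(2)[OF \<theta>] by (simp only: q_1(1) abs_rep_torus) simp
      from flux_area_local[OF this \<kappa>] show ?thesis unfolding abs_rep_torus .
    qed
    then obtain r where r: "\<And>\<theta>. \<theta> \<in> K \<Longrightarrow> 0 < r \<theta>" "\<And>\<theta> A. \<theta> \<in> K \<Longrightarrow> A \<in> sets borel \<Longrightarrow> A \<subseteq> zero_set S \<Longrightarrow> A \<subseteq> ball \<theta> (r \<theta>) \<Longrightarrow>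
        flux A \<le> ennreal (\<kappa> * h) * area A \<and> ennreal h * area A \<le> ennreal \<kappa> * flux A"
      by metis
    obtain C where C: "C \<subseteq> K" "finite C" "K \<subseteq> (\<Union>\<theta>\<in>C. ball \<theta> (r \<theta>))"
      using r(1) by (rule_tac compactE_image[OF K(1), of K "\<lambda>\<theta>. ball \<theta> (r \<theta>)"]) force+
    show ?thesis
    proof (rule flux_area_cover[OF C(2)])
      show "A \<subseteq> (\<Union>\<theta>\<in>C. ball \<theta> (r \<theta>))" using A(3) C(3) by blast
    qed (use A \<kappa> r(2) C(1) in auto)
  qed
  then have 1: "flux A \<le> ennreal \<kappa> * (ennreal h * area A)" and 2: "ennreal h * area A \<le> ennreal \<kappa> * flux A" if "1 < \<kappa>" for \<kappa>
    using that h_pos by (auto simp: ennreal_mult mult.assoc)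
  show ?thesis
    by (rule antisym; rule ennreal_le_of_le_mult) (use 1 2 in auto)
qed

text \<open>Off the tangencies A is exhausted by the parts where the derivative along \<omega> is at
  least 1 / (j + 1) in absolute value, each inside a compact set. Tangencies carry no flux because
  their orbits are null, and no area because the weight vanishes there.\<close>

theorem flux_eq_area:
  assumes A: "A \<in> sets borel" "A \<subseteq> zero_set S"
  shows "flux A = ennreal h * area A"
proof -
  define B where "B j = A \<inter> {\<theta>. 1 / real (Suc j) \<le> \<bar>D_op \<omega> S \<theta>\<bar>}" for j
  have closed: "closed {\<theta>. 1 / real (Suc j) \<le> \<bar>D_op \<omega> S \<theta>\<bar>}" for j
    using D_op_continuous[of UNIV 1] by (intro closed_Collect_le continuous_intros) auto
  then have B [measurable]: "B j \<in> sets borel" for j unfolding B_def using A(1) by (intro sets.Int) auto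
  have inc: "incseq (\<lambda>j. indicator (B j) :: 'd torus \<Rightarrow> ennreal)"
  proof (rule incseq_SucI)
    fix j
    have "1 / real (Suc (Suc j)) \<le> 1 / real (Suc j)" by (simp add: frac_le)
    then have "B j \<subseteq> B (Suc j)" by (auto simp: B_def intro: order_trans)
    then show "indicator (B j) \<le> (indicator (B (Suc j)) :: 'd torus \<Rightarrow> ennreal)"
      by (auto simp: le_fun_def indicator_def)
  qed
  have Un: "(\<Union>j. B j) = A - tangency_set \<omega> S"
  proof safe
    fix \<theta> j assume "\<theta> \<in> B j" then show "\<theta> \<in> A" by (simp add: B_def)
    assume "\<theta> \<in> tangency_set \<omega> S" then show False using \<open>\<theta> \<in> B j\<close> by (simp add: B_def tangency_set_def)
  next
    fix \<theta> assume "\<theta> \<in> A" "\<theta> \<notin> tangency_set \<omega> S"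
    then have "0 < \<bar>D_op \<omega> S \<theta>\<bar>" using A(2) by (auto simp: tangency_set_def)
    then obtain j where "inverse (real (Suc j)) < \<bar>D_op \<omega> S \<theta>\<bar>" using reals_Archimedean by blast
    then show "\<theta> \<in> (\<Union>j. B j)" using \<open>\<theta> \<in> A\<close> by (auto simp: B_def inverse_eq_divide intro!: exI[of _ j])
  qed
  have SUP: "indicator (A - tangency_set \<omega> S) = (\<lambda>\<theta>. SUP j. indicator (B j) \<theta> :: ennreal)"
  proof
    fix \<theta>
    show "indicator (A - tangency_set \<omega> S) \<theta> = (SUP j. indicator (B j) \<theta> :: ennreal)"
    proof (cases "\<theta> \<in> (\<Union>j. B j)")
      case True
      then obtain j where j: "\<theta> \<in> B j" by blast
      have "(SUP j. indicator (B j) \<theta> :: ennreal) = 1"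
      proof (rule antisym)
        show "(SUP j. indicator (B j) \<theta> :: ennreal) \<le> 1" by (rule SUP_least) (simp add: indicator_def)
        show "1 \<le> (SUP j. indicator (B j) \<theta> :: ennreal)" using j by (intro SUP_upper2[of j]) auto
      qed
      then show ?thesis using True unfolding Un by simp
    next
      case False
      then show ?thesis unfolding Un[symmetric] by simp
    qed
  qed
  have T: "A \<inter> tangency_set \<omega> S \<in> sets borel" "A - tangency_set \<omega> S \<in> sets borel"
    using A(1) borel_closed[OF finite_imp_closed[OF fin]] by blast+
  have area_T: "area (A \<inter> tangency_set \<omega> S) = 0"
    unfolding area_def by (rule nn_integral_zero') (auto simp: weight_def tangency_set_def indicator_def)
  have level: "flux (B j) = ennreal h * area (B j)" for j
  proof (rule flux_eq_area_compact)
    show "compact {\<theta>. 1 / real (Suc j) \<le> \<bar>D_op \<omega> S \<theta>\<bar>}"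
      using closed_Int_compact[OF closed compact_torus] by simp
    show "D_op \<omega> S \<theta> \<noteq> 0" if "\<theta> \<in> {\<theta>. 1 / real (Suc j) \<le> \<bar>D_op \<omega> S \<theta>\<bar>}" for \<theta>
      using that by (auto simp: field_simps)
  qed (use A(2) B in \<open>auto simp: B_def\<close>)
  have "flux A = flux ((A - tangency_set \<omega> S) \<union> (A \<inter> tangency_set \<omega> S))" by (simp add: Un_Diff_Int)
  also have "\<dots> = flux (A - tangency_set \<omega> S)" using T by (subst flux_Un) (auto simp: flux_tangency)
  also have "\<dots> = (SUP j. flux (B j))"
    unfolding flux_def SUP by (rule crossing_integral_SUP[OF inc]) measurable
  also have "\<dots> = ennreal h * (SUP j. area (B j))" by (simp add: level SUP_mult_left_ennreal)
  also have "(SUP j. area (B j)) = area (A - tangency_set \<omega> S)"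
  proof -
    have "incseq (\<lambda>j \<theta>. ennreal (weight \<theta>) * indicator (B j) \<theta>)"
      using inc by (auto simp: incseq_def le_fun_def intro!: mult_left_mono)
    then show ?thesis
      unfolding area_def SUP SUP_mult_left_ennreal
      by (intro nn_integral_monotone_convergence_SUP[symmetric]) measurable
  qed
  also have "\<dots> = area ((A - tangency_set \<omega> S) \<union> (A \<inter> tangency_set \<omega> S))"
    using T by (subst area_Un) (auto simp: area_T)
  also have "\<dots> = area A" by (simp add: Un_Diff_Int)
  finally show ?thesis .
qed

theorem crossing_integral_eq:
  assumes "g \<in> borel_measurable borel"
  shows "crossing_integral g =
    ennreal h * (\<integral>\<^sup>+\<theta>\<in>zero_set S. g \<theta> * ennreal (weight \<theta>) \<partial>hausdorff_measure (CARD('d) - 1))"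
  using assms
proof (induction rule: borel_measurable_induct)
  case (cong f g)
  then show ?case by (simp add: fun_eq_iff[symmetric] flip: ext)
next
  case (set A)
  have "crossing_integral (indicator A) = flux (A \<inter> zero_set S)"
    unfolding flux_def crossing_integral_def
    by (intro nn_integral_cong) (auto simp: N_def Z_def zero_set_def q_0 indicator_def intro!: sum.cong)
  also have "\<dots> = ennreal h * area (A \<inter> zero_set S)" using set by (intro flux_eq_area) auto
  also have "area (A \<inter> zero_set S) = (\<integral>\<^sup>+\<theta>\<in>zero_set S. indicator A \<theta> * ennreal (weight \<theta>) \<partial>hausdorff_measure (CARD('d) - 1))"
    unfolding area_def by (intro nn_integral_cong) (auto simp: indicator_def)
  finally show ?case .
next
  case (mult u c)
  have [measurable]: "u \<in> borel_measurable borel" by (rule mult)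
  have "(\<integral>\<^sup>+\<theta>\<in>zero_set S. c * u \<theta> * ennreal (weight \<theta>) \<partial>hausdorff_measure (CARD('d) - 1))
      = (\<integral>\<^sup>+\<theta>. c * (u \<theta> * ennreal (weight \<theta>) * indicator (zero_set S) \<theta>) \<partial>hausdorff_measure (CARD('d) - 1))"
    by (simp add: mult_ac)
  also have "\<dots> = c * (\<integral>\<^sup>+\<theta>\<in>zero_set S. u \<theta> * ennreal (weight \<theta>) \<partial>hausdorff_measure (CARD('d) - 1))"
    by (rule nn_integral_cmult) measurable
  finally show ?case using mult by (simp add: crossing_integral_cmult mult_ac)
next
  case (add u v)
  have [measurable]: "u \<in> borel_measurable borel" "v \<in> borel_measurable borel" by (rule add)+
  have "(\<integral>\<^sup>+\<theta>\<in>zero_set S. (v \<theta> + u \<theta>) * ennreal (weight \<theta>) \<partial>hausdorff_measure (CARD('d) - 1))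
      = (\<integral>\<^sup>+\<theta>\<in>zero_set S. v \<theta> * ennreal (weight \<theta>) \<partial>hausdorff_measure (CARD('d) - 1))
       + (\<integral>\<^sup>+\<theta>\<in>zero_set S. u \<theta> * ennreal (weight \<theta>) \<partial>hausdorff_measure (CARD('d) - 1))"
    unfolding distrib_right by (rule nn_integral_add) measurable
  then show ?case using add by (simp add: crossing_integral_add distrib_left)
next
  case (seq U)
  have [measurable]: "U i \<in> borel_measurable borel" for i by (rule seq)
  have sup: "(SUP i. U i) = (\<lambda>\<theta>. SUP i. U i \<theta>)" by (auto simp: fun_eq_iff image_comp)
  have "incseq (\<lambda>i \<theta>. U i \<theta> * ennreal (weight \<theta>) * indicator (zero_set S) \<theta>)"
    using \<open>incseq U\<close> by (auto simp: incseq_def le_fun_def intro!: mult_right_mono)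
  then have "(\<integral>\<^sup>+\<theta>\<in>zero_set S. (SUP i. U i \<theta>) * ennreal (weight \<theta>) \<partial>hausdorff_measure (CARD('d) - 1))
      = (SUP i. \<integral>\<^sup>+\<theta>\<in>zero_set S. U i \<theta> * ennreal (weight \<theta>) \<partial>hausdorff_measure (CARD('d) - 1))"
    unfolding SUP_mult_right_ennreal by (intro nn_integral_monotone_convergence_SUP) measurable
  then show ?case
    unfolding \<open>g = _\<close> sup crossing_integral_SUP[OF \<open>incseq U\<close> seq(1)] by (simp add: seq.IH SUP_mult_left_ennreal)
qed

end

section \<open>Limit density and empirical measures\<close>

lemma ex_strict_enumeration:
  fixes P :: "real set"
  assumes pos: "P \<subseteq> {0<..}" and inf: "infinite P" and fin: "\<And>L. finite (P \<inter> {..L})"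
  obtains x where "strict_mono_on {1..} x" "x ` {1::nat..} = P"
proof -
  have "\<exists>t. t \<in> P \<and> a < t \<and> (\<forall>s\<in>P. a < s \<longrightarrow> t \<le> s)" for a
  proof -
    have "infinite (P - (P \<inter> {..a}))" by (rule Diff_infinite_finite[OF fin inf])
    then have "P - (P \<inter> {..a}) \<noteq> {}" by (metis finite.emptyI)
    then obtain p where "p \<in> P - (P \<inter> {..a})" by blast
    then have p: "p \<in> P" "a < p" by auto
    \<comment> \<open>The successor of a in P is sought among the finitely many elements up to
      p.\<close>
    let ?M = "P \<inter> {..p} \<inter> {a<..}"
    have M: "finite ?M" "?M \<noteq> {}" using fin[of p] p by auto
    have "Min ?M \<le> s" if "s \<in> P" "a < s" for s
    proof (cases "s \<le> p")
      case True
      then show ?thesis using that M by (intro Min_le) auto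
    next
      case False
      moreover have "Min ?M \<le> p" using p M by (intro Min_le) auto
      ultimately show ?thesis by simp
    qed
    moreover have "Min ?M \<in> ?M" by (rule Min_in[OF M])
    ultimately show ?thesis by blast
  qed
  then obtain nxt where nxt: "\<And>a. nxt a \<in> P" "\<And>a. a < nxt a" "\<And>a s. s \<in> P \<Longrightarrow> a < s \<Longrightarrow> nxt a \<le> s"
    by metis
  define x where "x m = (nxt ^^ m) 0" for m :: nat
  have x: "x 0 = 0" "x (Suc m) = nxt (x m)" for m by (simp_all add: x_def)
  have mono: "strict_mono x" using nxt(2) by (simp add: strict_mono_Suc_iff x)
  have in_P: "x m \<in> P" if "1 \<le> m" for m using that nxt(1) by (cases m) (auto simp: x)
  have "t \<in> x ` {1..}" if t: "t \<in> P" for t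
  proof (rule ccontr)
    assume no: "t \<notin> x ` {1..}"
    have lt: "x m < t" for m
    proof (induction m)
      case 0
      then show ?case using t pos by (auto simp: x)
    next
      case (Suc m)
      then have "x (Suc m) \<le> t" using nxt(3)[OF t] by (simp add: x)
      moreover have "x (Suc m) \<noteq> t" using no by force
      ultimately show ?case by simp
    qed
    have "x ` {1..} \<subseteq> P \<inter> {..t}" using in_P lt by (auto intro: less_imp_le)
    then have "finite (x ` {1..})" using fin finite_subset by blast
    then have "finite {1::nat..}" using mono by (metis finite_imageD strict_mono_imp_inj_on inj_on_subset subset_UNIV)
    then show False using infinite_Ici by blast
  qed
  then have "x ` {1..} = P" using in_P by auto
  moreover have "strict_mono_on {1..} x" using mono by (simp add: strict_mono_on_def strict_mono_def)
  ultimately show thesis by (rule that[rotated])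
qed

lemma finite_fibres_tendsto_at_top:
  fixes x :: "nat \<Rightarrow> real"
  assumes inj: "inj_on x {1..}" and fin: "\<And>L. finite (x ` {1..} \<inter> {..L})"
  shows "filterlim x at_top sequentially"
  unfolding filterlim_at_top
proof
  fix L
  have "finite (x -` (x ` {1..} \<inter> {..L}) \<inter> {1..})" by (rule finite_vimage_IntI[OF fin inj])
  then have "finite (insert 0 (x -` (x ` {1..} \<inter> {..L}) \<inter> {1..}))" by simp
  moreover have "{m. \<not> L \<le> x m} \<subseteq> insert 0 (x -` (x ` {1..} \<inter> {..L}) \<inter> {1..})"
    by (auto simp: not_le Suc_le_eq)
  ultimately have "finite {m. \<not> L \<le> x m}" by (rule finite_subset[rotated])
  then show "\<forall>\<^sub>F m in sequentially. L \<le> x m" by (simp add: eventually_cofinite flip: cofinite_eq_sequentially)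
qed

context torus_flow
begin

lemma sets_surface_measure: "sets (surface_measure (zero_set S)) = sets (restrict_space borel (zero_set S))"
  unfolding surface_measure_def by (rule sets_restrict_space_cong) simp

lemma space_surface_measure: "space (surface_measure (zero_set S)) = zero_set S"
  by (simp add: surface_measure_def space_restrict_space)

lemma nn_integral_surface_measure:
  "(\<integral>\<^sup>+\<theta>. g \<theta> \<partial>surface_measure (zero_set S)) = (\<integral>\<^sup>+\<theta>\<in>zero_set S. g \<theta> \<partial>hausdorff_measure (CARD('d) - 1))"
  unfolding surface_measure_def by (rule nn_integral_restrict_space) simp

lemma borel_measurable_surface_measure:
  "f \<in> borel_measurable borel \<Longrightarrow> f \<in> borel_measurable (surface_measure (zero_set S))"
  unfolding surface_measure_def by (rule measurable_restrict_space1) simp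

lemma weight_nonneg [simp]: "0 \<le> weight \<theta>"
  by (simp add: weight_def)

text \<open>Were every zero a tangency, the zero set would be finite and the dimension at least 2. A
  small punctured ball around a lifted zero is then connected and free of zeros, yet S takes both
  signs on it along the gradient.\<close>

lemma ex_transversal_zero:
  assumes "zero_set S \<noteq> {}"
  shows "\<exists>y. q 0 y = 0 \<and> q 1 y \<noteq> 0"
proof (rule ccontr)
  assume "\<nexists>y. q 0 y = 0 \<and> q 1 y \<noteq> 0"
  then have tang: "q 1 y = 0" if "q 0 y = 0" for y using that by blast
  have sub: "zero_set S \<subseteq> tangency_set \<omega> S"
  proof
    fix \<theta> assume "\<theta> \<in> zero_set S"
    then have "q 0 (rep_torus \<theta>) = 0" by (simp add: q_0 zero_set_def)
    then have "abs_torus (rep_torus \<theta>) \<in> tangency_set \<omega> S" using tang by (simp only: tangency_iff)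
    then show "\<theta> \<in> tangency_set \<omega> S" by simp
  qed
  then have finS: "finite (zero_set S)" using fin finite_subset by blast
  have dim: "2 \<le> CARD('d)"
  proof -
    have "CARD('d) \<noteq> 1" using tangency_empty_card_1 sub assms by blast
    moreover have "CARD('d) \<noteq> 0" by simp
    ultimately show ?thesis by linarith
  qed
  obtain \<theta>0 where \<theta>0: "\<theta>0 \<in> zero_set S" using assms by blast
  define y where "y = rep_torus \<theta>0"
  have y: "abs_torus y = \<theta>0" "q 0 y = 0" using \<theta>0 by (simp_all add: y_def q_0 zero_set_def)
  define g where "g = grad (q 0) y"
  have g: "g \<noteq> 0" using regular \<theta>0 torus_grad_q[of y] by (auto simp: g_def y(1))
  obtain r where r: "0 < r" "\<And>\<theta>. \<theta> \<in> zero_set S \<Longrightarrow> \<theta> \<noteq> \<theta>0 \<Longrightarrow> r \<le> dist \<theta>0 \<theta>"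
    using finite_set_avoid[OF finS, of \<theta>0] by blast
  define e where "e = min r 1"
  have e: "0 < e" "e \<le> r" "e \<le> 1" using r(1) by (auto simp: e_def)
  have nz: "q 0 z \<noteq> 0" if z: "z \<in> ball y e - {y}" for z
  proof
    assume "q 0 z = 0"
    then have zS: "abs_torus z \<in> zero_set S" by (simp add: q_0 zero_set_def)
    show False
    proof (cases "abs_torus z = \<theta>0")
      case True
      then have "y = z" using abs_torus_inj_ball[of y z] z e(3) y(1) pi_gt3 by auto
      then show False using z by simp
    next
      case False
      then have "r \<le> dist \<theta>0 (abs_torus z)" using r(2) zS by blast
      also have "\<dots> \<le> dist y z" unfolding y(1)[symmetric] by (rule dist_abs_torus_le)
      finally show False using z e by simp
    qed
  qed
  have der: "((\<lambda>t. q 0 (y + t *\<^sub>R g)) has_real_derivative g \<bullet> grad (q 0) (y + 0 *\<^sub>R g)) (at 0)"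
    by (rule has_derivative_along[OF q_smooth])
  have gg: "0 < g \<bullet> grad (q 0) (y + 0 *\<^sub>R g)" using g by (simp add: g_def)
  obtain d1 where d1: "0 < d1" "\<And>t. 0 < t \<Longrightarrow> t < d1 \<Longrightarrow> q 0 (y + 0 *\<^sub>R g) < q 0 (y + (0 + t) *\<^sub>R g)"
    using DERIV_pos_inc_right[OF der gg] by blast
  obtain d2 where d2: "0 < d2" "\<And>t. 0 < t \<Longrightarrow> t < d2 \<Longrightarrow> q 0 (y + (0 - t) *\<^sub>R g) < q 0 (y + 0 *\<^sub>R g)"
    using DERIV_pos_inc_left[OF der gg] by blast
  define l where "l = e / norm g"
  have "0 < l" using e(1) g by (simp add: l_def)
  then obtain t where t: "0 < t" "t < d1" "t < d2" "t < l"
    using d1(1) d2(1) that[of "min (min d1 d2) l / 2"] by (auto simp: min_def)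
  have tg: "t * norm g < e" using t(4) g by (simp add: l_def pos_less_divide_eq)
  let ?B = "ball y e - {y}"
  have in_B: "y + t *\<^sub>R g \<in> ?B" "y - t *\<^sub>R g \<in> ?B" using tg t(1) g by (auto simp: dist_norm)
  have "0 \<in> q 0 ` ?B"
  proof (rule connectedD_interval)
    show "connected (q 0 ` ?B)"
      using connected_punctured_ball[of y e] dim by (intro connected_continuous_image q_continuous) auto
    show "q 0 (y - t *\<^sub>R g) \<in> q 0 ` ?B" "q 0 (y + t *\<^sub>R g) \<in> q 0 ` ?B" using in_B by blast+
    show "q 0 (y - t *\<^sub>R g) \<le> 0" "0 \<le> q 0 (y + t *\<^sub>R g)"
      using d1(2)[OF t(1,2)] d2(2)[OF t(1,3)] y(2) by simp_all
  qed
  then show False using nz by (metis imageE)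
qed

end

context torus_flow_window
begin

text \<open>A sign change along the flow at a transversal zero persists for all nearby starting
  points. They form an open set, and each of them has a crossing in its window.\<close>

lemma crossing_integral_one_pos:
  assumes "zero_set S \<noteq> {}"
  shows "crossing_integral (\<lambda>_. 1) \<noteq> 0"
proof
  assume zero: "crossing_integral (\<lambda>_. 1) = 0"
  obtain y where y: "q 0 y = 0" "q 1 y \<noteq> 0" using ex_transversal_zero[OF assms] by blast
  obtain s where s: "s = 1 \<or> s = -1" "0 < s * q 1 y" using y(2) 
    by (cases "0 < q 1 y") (auto simp: that[of 1] intro!: that[of "-1"])
  let ?f = "\<lambda>t. s * q 0 (y + t *\<^sub>R \<omega>)"
  have der: "(?f has_real_derivative s * q (Suc 0) (y + 0 *\<^sub>R \<omega>)) (at 0)"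
    by (rule DERIV_cmult[OF q_deriv])
  have pos: "0 < s * q (Suc 0) (y + 0 *\<^sub>R \<omega>)" using s(2) by simp
  obtain d1 where d1: "0 < d1" "\<And>t. 0 < t \<Longrightarrow> t < d1 \<Longrightarrow> ?f 0 < ?f (0 + t)"
    using DERIV_pos_inc_right[OF der pos] by blast
  obtain d2 where d2: "0 < d2" "\<And>t. 0 < t \<Longrightarrow> t < d2 \<Longrightarrow> ?f (0 - t) < ?f 0"
    using DERIV_pos_inc_left[OF der pos] by blast
  obtain t where t: "0 < t" "t < d1" "t < d2" "t < h / 2"
    using d1(1) d2(1) h_pos that[of "min (min d1 d2) (h / 2) / 2"] by (auto simp: min_def)
  \<comment> \<open>c is the centre of the cell. The translation by a carries it to the point from
    which y is reached at time h / 2, so a whole neighbourhood lies in the cell and crosses well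
    inside the window.\<close>
  define c :: "real ^ 'd" where "c = (\<chi> i. pi)"
  define a where "a = y - (h / 2) *\<^sub>R \<omega> - c"
  define U where "U = {x. 0 < s * q 0 (x + a + (h / 2 + t) *\<^sub>R \<omega>)} \<inter> {x. s * q 0 (x + a + (h / 2 - t) *\<^sub>R \<omega>) < 0}
    \<inter> {x. \<forall>i. 0 < x $ i \<and> x $ i < 2 * pi}"
  have cont: "continuous_on UNIV (\<lambda>x. s * q 0 (x + a + u *\<^sub>R \<omega>))" for u
    by (intro continuous_on_mult continuous_on_const continuous_on_compose2[OF q_continuous[of UNIV]] continuous_intros) auto
  have "open {x :: real ^ 'd. \<forall>i. 0 < x $ i \<and> x $ i < 2 * pi}"
  proof -
    have "{x :: real ^ 'd. \<forall>i. 0 < x $ i \<and> x $ i < 2 * pi} = box 0 (\<chi> i. 2 * pi)"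
      by (auto simp: mem_box_cart)
    then show ?thesis by (simp only: open_box)
  qed
  then have "open U" unfolding U_def by (intro open_Int open_Collect_less cont continuous_on_const)
  moreover have "c \<in> U"
  proof -
    have "c + a + (h / 2 + t) *\<^sub>R \<omega> = y + t *\<^sub>R \<omega>" "c + a + (h / 2 - t) *\<^sub>R \<omega> = y - t *\<^sub>R \<omega>"
      by (simp_all add: a_def algebra_simps)
    then show ?thesis using d1(2)[OF t(1,2)] d2(2)[OF t(1,3)] y(1) by (simp add: U_def c_def)
  qed
  ultimately have "\<not> negligible U" using open_not_negligible by blast
  have ge: "1 \<le> N (\<lambda>_. 1 :: ennreal) (x + a)" if x: "x \<in> U" for x
  proof -
    have "0 \<in> (\<lambda>u. s * q 0 (x + a + u *\<^sub>R \<omega>)) ` {h / 2 - t..h / 2 + t}"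
    proof (rule connectedD_interval)
      show "connected ((\<lambda>u. s * q 0 (x + a + u *\<^sub>R \<omega>)) ` {h / 2 - t..h / 2 + t})"
        by (intro connected_continuous_image continuous_on_mult continuous_on_const q_line_continuous) simp
      show "s * q 0 (x + a + (h / 2 - t) *\<^sub>R \<omega>) \<in> (\<lambda>u. s * q 0 (x + a + u *\<^sub>R \<omega>)) ` {h / 2 - t..h / 2 + t}"
        "s * q 0 (x + a + (h / 2 + t) *\<^sub>R \<omega>) \<in> (\<lambda>u. s * q 0 (x + a + u *\<^sub>R \<omega>)) ` {h / 2 - t..h / 2 + t}"
        using t(1) by (auto intro!: imageI)
      show "s * q 0 (x + a + (h / 2 - t) *\<^sub>R \<omega>) \<le> 0" "0 \<le> s * q 0 (x + a + (h / 2 + t) *\<^sub>R \<omega>)"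
        using x by (auto simp: U_def)
    qed
    then obtain u where u: "u \<in> {h / 2 - t..h / 2 + t}" "s * q 0 (x + a + u *\<^sub>R \<omega>) = 0" by auto
    then have "u \<in> Z (x + a)" using s(1) t by (auto simp: Z_def)
    then have "1 \<le> card (Z (x + a))" by (auto simp: Suc_le_eq card_gt_0_iff)
    from of_nat_mono[OF this, where 'a=ennreal] show ?thesis by (simp add: N_def)
  qed
  have [measurable]: "N (\<lambda>_. 1 :: ennreal) \<in> borel_measurable borel" by (rule N_measurable) simp
  have [measurable]: "U \<in> sets borel" using \<open>open U\<close> by simp
  have "emeasure lborel U = (\<integral>\<^sup>+x. indicator U x \<partial>lborel)" by simp
  also have "\<dots> \<le> (\<integral>\<^sup>+x\<in>torus_cell. N (\<lambda>_. 1) (x + a) \<partial>lborel)"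
  proof (rule nn_integral_mono)
    fix x
    show "indicator U x \<le> N (\<lambda>_. 1 :: ennreal) (x + a) * indicator torus_cell x"
    proof (cases "x \<in> U")
      case True
      then have "x \<in> torus_cell" by (auto simp: U_def torus_cell_def intro: less_imp_le)
      then show ?thesis using ge[OF True] True by simp
    qed simp
  qed
  also have "\<dots> = (\<integral>\<^sup>+x\<in>torus_cell. N (\<lambda>_. 1) x \<partial>lborel)"
    by (rule nn_integral_torus_cell_shift[OF _ periodic_N]) measurable
  also have "\<dots> = 0" using zero by (simp add: crossing_integral_def)
  finally have "emeasure lborel U = 0" by simp
  then have "U \<in> null_sets lborel" by (simp add: null_sets_def)
  then have "negligible U" by (simp add: negligible_iff_null_sets null_sets_completionI)
  then show False using \<open>\<not> negligible U\<close> by blast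
qed

section \<open>Long time limits as surface integrals\<close>

definition weighted_mean :: "('d torus \<Rightarrow> real) \<Rightarrow> real" where
  "weighted_mean f = 1 / (2 * pi) ^ CARD('d) * (LINT \<theta>|surface_measure (zero_set S). f \<theta> * weight \<theta>)"

lemma crossing_integral_one:
  "crossing_integral (\<lambda>_. 1) = ennreal h * (\<integral>\<^sup>+\<theta>. ennreal (weight \<theta>) \<partial>surface_measure (zero_set S))"
  by (simp add: crossing_integral_eq nn_integral_surface_measure)

lemma crossing_integral_one_finite: "crossing_integral (\<lambda>_. 1) < \<top>"
proof -
  have "crossing_integral (\<lambda>_. 1) \<le> (\<integral>\<^sup>+x\<in>torus_cell. of_nat n \<partial>(lborel :: (real ^ 'd) measure))"
    unfolding crossing_integral_def N_def
    by (intro nn_integral_mono mult_right_mono) (simp_all add: card_Z)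
  also have "\<dots> = of_nat n * ennreal ((2 * pi) ^ CARD('d))"
    by (simp add: nn_integral_cmult_indicator emeasure_torus_cell)
  also have "\<dots> < \<top>" by (simp add: ennreal_mult_less_top of_nat_less_top)
  finally show ?thesis .
qed

text \<open>Finiteness comes from the bounded number of crossings, through the identity of crossing
  and surface integrals, rather than from an estimate of the area of the zero set.\<close>

lemma total_weight_finite: "(\<integral>\<^sup>+\<theta>. ennreal (weight \<theta>) \<partial>surface_measure (zero_set S)) < \<top>"
proof (rule ccontr)
  assume "\<not> ?thesis"
  then have "(\<integral>\<^sup>+\<theta>. ennreal (weight \<theta>) \<partial>surface_measure (zero_set S)) = \<top>" by (metis top.not_eq_extremum)
  then show False using crossing_integral_one crossing_integral_one_finite h_pos by (simp add: ennreal_mult_top)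
qed

lemma integrable_weight: "integrable (surface_measure (zero_set S)) weight"
  by (rule integrableI_nonneg)
    (use total_weight_finite borel_measurable_surface_measure[OF weight_measurable] in auto)

lemma integrable_mult_weight:
  assumes f: "continuous_on (zero_set S) f" "\<And>\<theta>. \<theta> \<in> zero_set S \<Longrightarrow> \<bar>f \<theta>\<bar> \<le> B"
  shows "integrable (surface_measure (zero_set S)) (\<lambda>\<theta>. f \<theta> * weight \<theta>)"
proof (rule Bochner_Integration.integrable_bound)
  show "integrable (surface_measure (zero_set S)) (\<lambda>\<theta>. B * weight \<theta>)" using integrable_weight by simp
  have "f \<in> borel_measurable (surface_measure (zero_set S))"
    using borel_measurable_continuous_on_restrict[OF f(1)] measurable_cong_sets[OF sets_surface_measure refl] by blast
  then show "(\<lambda>\<theta>. f \<theta> * weight \<theta>) \<in> borel_measurable (surface_measure (zero_set S))"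
    using borel_measurable_surface_measure[OF weight_measurable] by (rule borel_measurable_times)
  show "AE \<theta> in surface_measure (zero_set S). norm (f \<theta> * weight \<theta>) \<le> norm (B * weight \<theta>)"
  proof (rule AE_I2)
    fix \<theta> assume "\<theta> \<in> space (surface_measure (zero_set S))"
    then have "\<bar>f \<theta>\<bar> \<le> B" using f(2) by (simp add: space_surface_measure)
    then show "norm (f \<theta> * weight \<theta>) \<le> norm (B * weight \<theta>)" by (simp add: abs_mult mult_right_mono)
  qed
qed

lemma zero_sum_limit_surface:
  fixes f :: "'d torus \<Rightarrow> real"
  assumes f: "continuous_on (zero_set S) f" "\<And>\<theta>. \<theta> \<in> zero_set S \<Longrightarrow> 0 \<le> f \<theta>" "\<And>\<theta>. \<theta> \<in> zero_set S \<Longrightarrow> f \<theta> \<le> B"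
  shows "((\<lambda>L. (\<Sum>t\<in>zeros 0 L. f (abs_torus (t *\<^sub>R \<omega>))) / L) \<longlongrightarrow> weighted_mean f) at_top"
proof -
  define g where "g = (\<lambda>\<theta>. if \<theta> \<in> zero_set S then f \<theta> else 0)"
  note r = restrict_to_zero_set[OF f(1), folded g_def]
  have g: "0 \<le> g \<theta>" for \<theta> using f by (auto simp: g_def)
  have [measurable]: "N g \<in> borel_measurable borel" using r(1) g by (rule N_measurable_real)
  have Ng: "0 \<le> N g x" for x using g by (simp add: N_def sum_nonneg)
  have gw: "(\<lambda>\<theta>. g \<theta> * weight \<theta>) \<in> borel_measurable (surface_measure (zero_set S))"
    using r(1) weight_measurable by (intro borel_measurable_surface_measure borel_measurable_times)
  have "(LINT x:torus_cell|lborel. N g x) = enn2real (\<integral>\<^sup>+x. ennreal (indicator torus_cell x *\<^sub>R N g x) \<partial>lborel)"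
    unfolding set_lebesgue_integral_def by (rule integral_eq_nn_integral) (use Ng in auto)
  also have "(\<integral>\<^sup>+x. ennreal (indicator torus_cell x *\<^sub>R N g x) \<partial>lborel) = crossing_integral (\<lambda>\<theta>. ennreal (g \<theta>))"
    unfolding crossing_integral_def N_ennreal[OF g] by (intro nn_integral_cong) (auto simp: indicator_def)
  also have "\<dots> = ennreal h * (\<integral>\<^sup>+\<theta>. ennreal (g \<theta> * weight \<theta>) \<partial>surface_measure (zero_set S))"
    using r(1) g by (subst crossing_integral_eq) (simp_all add: nn_integral_surface_measure ennreal_mult)
  also have "enn2real \<dots> = h * (LINT \<theta>|surface_measure (zero_set S). g \<theta> * weight \<theta>)"
    using h_pos g by (subst integral_eq_nn_integral[OF gw]) (auto simp: enn2real_mult)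
  also have "(LINT \<theta>|surface_measure (zero_set S). g \<theta> * weight \<theta>) = (LINT \<theta>|surface_measure (zero_set S). f \<theta> * weight \<theta>)"
    by (rule Bochner_Integration.integral_cong) (auto simp: g_def space_surface_measure)
  finally have "cell_mean (N f) / h = weighted_mean f"
    using h_pos by (simp add: cell_mean_def weighted_mean_def r(3))
  then show ?thesis using zero_sum_limit[OF f] by simp
qed

end

context torus_flow_window
begin

abbreviation \<sigma> :: "'d torus measure" where
  "\<sigma> \<equiv> surface_measure (zero_set S)"

definition density_limit :: real where
  "density_limit = weighted_mean (\<lambda>_. 1)"

lemma zeros_eq: "{x \<in> {0..L}. orbit_fun \<omega> S x = 0} = zeros 0 L"
  by (simp add: zeros_def orbit_fun_def q_0)

lemma zero_count_eq: "zero_count \<omega> S L = card (zeros 0 L)"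
  by (simp only: zero_count_def zeros_eq)

lemma zero_count_limit: "((\<lambda>L. real (zero_count \<omega> S L) / L) \<longlongrightarrow> density_limit) at_top"
  using zero_sum_limit_surface[of "\<lambda>_. 1" 1] by (simp add: density_limit_def zero_count_eq)

lemma density_limit_eq: "density_limit = 1 / (2 * pi) ^ CARD('d) * (LINT \<theta>|\<sigma>. weight \<theta>)"
  by (simp add: density_limit_def weighted_mean_def)

lemma total_weight_eq: "(\<integral>\<^sup>+\<theta>. ennreal (weight \<theta>) \<partial>\<sigma>) = ennreal ((2 * pi) ^ CARD('d) * density_limit)"
proof -
  have "(\<integral>\<^sup>+\<theta>. ennreal (weight \<theta>) \<partial>\<sigma>) = ennreal (LINT \<theta>|\<sigma>. weight \<theta>)"
    by (rule nn_integral_eq_integral[OF integrable_weight]) simp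
  then show ?thesis by (simp add: density_limit_eq)
qed

lemma mollified_density_limit:
  assumes "mollifier \<phi>"
  shows "((\<lambda>\<eta>. 1 / (2 * pi) ^ CARD('d) *
    (LINT \<theta>|torus_lebesgue. 1 / \<eta> * \<phi> (S \<theta> / \<eta>) * \<bar>D_op \<omega> S \<theta>\<bar>)) \<longlongrightarrow> density_limit) (at_right 0)"
proof -
  have nonneg: "0 \<le> LINT \<theta>|\<sigma>. weight \<theta>" by (rule Bochner_Integration.integral_nonneg) simp
  have "enn2real (\<integral>\<^sup>+x\<in>torus_cell. N (\<lambda>_. 1) x \<partial>lborel) / h = (LINT \<theta>|\<sigma>. weight \<theta>)"
    using crossing_integral_one h_pos nonneg
    by (simp add: crossing_integral_def total_weight_eq density_limit_eq enn2real_mult)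
  then have "1 / (2 * pi) ^ CARD('d) * (enn2real (\<integral>\<^sup>+x\<in>torus_cell. N (\<lambda>_. 1) x \<partial>lborel) / h) = density_limit"
    by (simp add: density_limit_eq)
  then show ?thesis
    using tendsto_mult[OF tendsto_const mollified_limit[OF assms], of "1 / (2 * pi) ^ CARD('d)"] by simp
qed

lemma density_limit_pos:
  assumes "zero_set S \<noteq> {}"
  shows "0 < density_limit"
proof (rule ccontr)
  assume "\<not> 0 < density_limit"
  then have "(2 * pi) ^ CARD('d) * density_limit \<le> 0" by (simp add: mult_le_0_iff)
  then have "crossing_integral (\<lambda>_. 1) = 0"
    by (simp add: crossing_integral_one total_weight_eq ennreal_neg)
  then show False using crossing_integral_one_pos[OF assms] by contradiction
qed

definition equilibrium :: "'d torus measure" where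
  "equilibrium = density \<sigma> (\<lambda>\<theta>. ennreal (1 / ((2 * pi) ^ CARD('d) * density_limit) * weight \<theta>))"

lemma equilibrium_prob:
  assumes "zero_set S \<noteq> {}"
  shows "equilibrium \<in> prob_measures_on (zero_set S)"
proof -
  note pos = density_limit_pos[OF assms]
  have [measurable]: "weight \<in> borel_measurable \<sigma>" by (rule borel_measurable_surface_measure[OF weight_measurable])
  let ?c = "1 / ((2 * pi) ^ CARD('d) * density_limit)"
  have "emeasure equilibrium (space equilibrium) = (\<integral>\<^sup>+\<theta>. ennreal (?c * weight \<theta>) * indicator (space \<sigma>) \<theta> \<partial>\<sigma>)"
    unfolding equilibrium_def space_density by (rule emeasure_density) auto
  also have "\<dots> = (\<integral>\<^sup>+\<theta>. ennreal ?c * ennreal (weight \<theta>) \<partial>\<sigma>)"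
  proof (rule nn_integral_cong)
    fix \<theta> assume "\<theta> \<in> space \<sigma>"
    moreover have "ennreal (?c * weight \<theta>) = ennreal ?c * ennreal (weight \<theta>)"
      using pos by (intro ennreal_mult) auto
    ultimately show "ennreal (?c * weight \<theta>) * indicator (space \<sigma>) \<theta> = ennreal ?c * ennreal (weight \<theta>)"
      by (simp only: indicator_simps mult_1_right)
  qed
  also have "\<dots> = ennreal ?c * ennreal ((2 * pi) ^ CARD('d) * density_limit)"
    by (simp only: nn_integral_cmult[OF measurable_compose[OF \<open>weight \<in> borel_measurable \<sigma>\<close> measurable_ennreal]] total_weight_eq)
  also have "\<dots> = ennreal (?c * ((2 * pi) ^ CARD('d) * density_limit))" using pos by (intro ennreal_mult[symmetric]) auto
  also have "\<dots> = 1" using pos by simp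
  finally have "prob_space equilibrium" by (rule prob_spaceI)
  then show ?thesis
    by (simp add: prob_measures_on_def equilibrium_def space_surface_measure sets_surface_measure)
qed

lemma integral_equilibrium:
  assumes "zero_set S \<noteq> {}" "continuous_on (zero_set S) f"
  shows "(LINT \<theta>|equilibrium. f \<theta>) = weighted_mean f / density_limit"
proof -
  let ?c = "1 / ((2 * pi) ^ CARD('d) * density_limit)"
  have [measurable]: "weight \<in> borel_measurable \<sigma>" by (rule borel_measurable_surface_measure[OF weight_measurable])
  have [measurable]: "f \<in> borel_measurable \<sigma>"
    using borel_measurable_continuous_on_restrict[OF assms(2)] measurable_cong_sets[OF sets_surface_measure refl] by blast
  have "(LINT \<theta>|equilibrium. f \<theta>) = (LINT \<theta>|\<sigma>. (?c * weight \<theta>) *\<^sub>R f \<theta>)"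
    unfolding equilibrium_def using density_limit_pos[OF assms(1)] by (intro integral_density) auto
  also have "\<dots> = (LINT \<theta>|\<sigma>. ?c * (f \<theta> * weight \<theta>))" by (simp add: mult_ac)
  also have "\<dots> = ?c * (LINT \<theta>|\<sigma>. f \<theta> * weight \<theta>)" by (rule integral_mult_right_zero)
  finally show ?thesis by (simp add: weighted_mean_def)
qed

section \<open>Enumeration of the positive zeros and their empirical measures\<close>

abbreviation positive_zeros :: "real set" where
  "positive_zeros \<equiv> {t. 0 < t \<and> orbit_fun \<omega> S t = 0}"

lemma positive_zeros_Int: "positive_zeros \<inter> {..L} = zeros 0 L - {0}"
  by (auto simp: zeros_def orbit_fun_def q_0)

text \<open>Finitely many zeros would have density 0, against
  \<open>density_limit_pos\<close>.\<close>

lemma infinite_positive_zeros: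
  assumes "zero_set S \<noteq> {}"
  shows "infinite positive_zeros"
proof
  assume fin: "finite positive_zeros"
  have "((\<lambda>L. real (zero_count \<omega> S L) / L) \<longlongrightarrow> 0) at_top"
  proof (rule tendsto_sandwich[OF _ _ tendsto_const])
    show "((\<lambda>L. real (card (insert 0 positive_zeros)) / L) \<longlongrightarrow> 0) at_top"
      by (rule real_tendsto_divide_at_top[OF tendsto_const filterlim_ident])
    show "\<forall>\<^sub>F L in at_top. real (zero_count \<omega> S L) / L \<le> real (card (insert 0 positive_zeros)) / L"
      using eventually_gt_at_top[of 0]
    proof eventually_elim
      case (elim L)
      have "zeros 0 L \<subseteq> insert 0 positive_zeros" using positive_zeros_Int[of L] by blast
      then have "card (zeros 0 L) \<le> card (insert 0 positive_zeros)" using fin by (intro card_mono) auto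
      then show ?case unfolding zero_count_eq using elim by (intro divide_right_mono) auto
    qed
    show "\<forall>\<^sub>F L in at_top. 0 \<le> real (zero_count \<omega> S L) / L"
      using eventually_gt_at_top[of 0] by eventually_elim simp
  qed
  then have "density_limit = 0" using zero_count_limit tendsto_unique trivial_limit_at_top_linorder by blast
  then show False using density_limit_pos[OF assms] by simp
qed

lemma ex_enumeration:
  assumes "zero_set S \<noteq> {}"
  shows "\<exists>x. enumerates_pos_zeros (orbit_fun \<omega> S) x"
proof -
  obtain x where "strict_mono_on {1..} x" "x ` {1::nat..} = positive_zeros"
  proof (rule ex_strict_enumeration)
    show "positive_zeros \<subseteq> {0<..}" by auto
    show "infinite positive_zeros" by (rule infinite_positive_zeros[OF assms])
    show "finite (positive_zeros \<inter> {..L})" for L unfolding positive_zeros_Int by (simp add: finite_zeros)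
  qed
  then show ?thesis unfolding enumerates_pos_zeros_def by blast
qed

context
  fixes x :: "nat \<Rightarrow> real"
  assumes x: "enumerates_pos_zeros (orbit_fun \<omega> S) x"
begin

lemma enum_mono: "strict_mono_on {1..} x" and enum_image: "x ` {1..} = positive_zeros"
  using x by (auto simp: enumerates_pos_zeros_def)

lemma enum_inj: "inj_on x {1..}"
  using enum_mono by (rule strict_mono_on_imp_inj_on)

lemma enum_pos: "1 \<le> m \<Longrightarrow> 0 < x m"
  using enum_image by force

lemma enum_in_zero_set: "1 \<le> m \<Longrightarrow> abs_torus (x m *\<^sub>R \<omega>) \<in> zero_set S"
  using enum_image by (force simp: orbit_fun_def zero_set_def)

lemma enum_at_top: "filterlim x at_top sequentially"
proof (rule finite_fibres_tendsto_at_top[OF enum_inj])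
  show "finite (x ` {1..} \<inter> {..L})" for L
    unfolding enum_image positive_zeros_Int by (simp add: finite_zeros)
qed

lemma zeros_enum:
  assumes "1 \<le> m"
  shows "zeros 0 (x m) - {0} = x ` {1..m}"
proof -
  have "x i \<le> x m \<longleftrightarrow> i \<le> m" if "1 \<le> i" for i
    using enum_mono that assms by (simp add: strict_mono_on_less_eq)
  then have "x ` {1..} \<inter> {..x m} = x ` {1..m}" by auto
  then show ?thesis unfolding enum_image positive_zeros_Int .
qed

lemma enum_sum_limit_nonneg:
  fixes f :: "'d torus \<Rightarrow> real"
  assumes f: "continuous_on (zero_set S) f" "\<And>\<theta>. \<theta> \<in> zero_set S \<Longrightarrow> 0 \<le> f \<theta>" "\<And>\<theta>. \<theta> \<in> zero_set S \<Longrightarrow> f \<theta> \<le> B"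
  shows "(\<lambda>m. (\<Sum>i=1..m. f (abs_torus (x i *\<^sub>R \<omega>))) / x m) \<longlonglongrightarrow> weighted_mean f"
proof -
  define g where "g t = f (abs_torus (t *\<^sub>R \<omega>))" for t
  \<comment> \<open>A zero at time 0 belongs to \<open>zeros\<close> but not to the enumeration; its
    contribution e disappears after division by x m.\<close>
  define e where "e = (if q 0 0 = 0 then g 0 else 0)"
  have "(\<lambda>m. (\<Sum>t\<in>zeros 0 (x m). g t) / x m) \<longlonglongrightarrow> weighted_mean f"
    unfolding g_def by (rule filterlim_compose[OF zero_sum_limit_surface[OF f] enum_at_top])
  moreover have "(\<lambda>m. e / x m) \<longlonglongrightarrow> 0"
    by (rule real_tendsto_divide_at_top[OF tendsto_const enum_at_top])
  ultimately have lim: "(\<lambda>m. (\<Sum>t\<in>zeros 0 (x m). g t) / x m - e / x m) \<longlonglongrightarrow> weighted_mean f - 0"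
    by (rule tendsto_diff)
  have "\<forall>\<^sub>F m in sequentially. (\<Sum>t\<in>zeros 0 (x m). g t) / x m - e / x m = (\<Sum>i=1..m. g (x i)) / x m"
    using eventually_ge_at_top[of 1]
  proof eventually_elim
    case (elim m)
    have "0 < x m" using enum_pos elim by blast
    then have 0: "0 \<in> zeros 0 (x m) \<longleftrightarrow> q 0 0 = 0" by (simp add: zeros_def)
    have "(\<Sum>t\<in>zeros 0 (x m). g t) = e + (\<Sum>t\<in>zeros 0 (x m) - {0}. g t)"
      using 0 finite_zeros[of 0 "x m"] by (auto simp: e_def sum.remove)
    also have "(\<Sum>t\<in>zeros 0 (x m) - {0}. g t) = (\<Sum>i=1..m. g (x i))"
      unfolding zeros_enum[OF elim] using enum_inj by (subst sum.reindex) (auto intro: inj_on_subset)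
    finally show ?case by (simp add: add_divide_distrib)
  qed
  from Lim_transform_eventually[OF lim this] show ?thesis by (simp add: g_def)
qed

lemma enum_sum_limit:
  assumes f: "continuous_on (zero_set S) f" and B: "\<And>\<theta>. \<theta> \<in> zero_set S \<Longrightarrow> \<bar>f \<theta>\<bar> \<le> B"
  shows "(\<lambda>m. (\<Sum>i=1..m. f (abs_torus (x i *\<^sub>R \<omega>))) / x m) \<longlonglongrightarrow> weighted_mean f"
proof -
  \<comment> \<open>Adding the bound B reduces to a nonnegative function; the constant contributes B
    times the density.\<close>
  have "(\<lambda>m. (\<Sum>i=1..m. f (abs_torus (x i *\<^sub>R \<omega>)) + B) / x m) \<longlonglongrightarrow> weighted_mean (\<lambda>\<theta>. f \<theta> + B)"
  proof (rule enum_sum_limit_nonneg)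
    show "continuous_on (zero_set S) (\<lambda>\<theta>. f \<theta> + B)" using f by (intro continuous_intros)
    show "0 \<le> f \<theta> + B" "f \<theta> + B \<le> 2 * B" if "\<theta> \<in> zero_set S" for \<theta> using B[OF that] by auto
  qed
  moreover have "(\<lambda>m. B * ((\<Sum>i=1..m. 1) / x m)) \<longlonglongrightarrow> B * density_limit"
    unfolding density_limit_def by (intro tendsto_mult tendsto_const enum_sum_limit_nonneg[of "\<lambda>_. 1" 1]) auto
  ultimately have "(\<lambda>m. (\<Sum>i=1..m. f (abs_torus (x i *\<^sub>R \<omega>)) + B) / x m - B * ((\<Sum>i=1..m. 1) / x m))
      \<longlonglongrightarrow> weighted_mean (\<lambda>\<theta>. f \<theta> + B) - B * density_limit"
    by (rule tendsto_diff)
  moreover have "weighted_mean (\<lambda>\<theta>. f \<theta> + B) - B * density_limit = weighted_mean f"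
    using integrable_mult_weight[OF f B] integrable_weight
    by (simp add: weighted_mean_def density_limit_eq distrib_right algebra_simps)
  moreover have "(\<Sum>i=1..m. f (abs_torus (x i *\<^sub>R \<omega>)) + B) / x m - B * ((\<Sum>i=1..m. 1) / x m)
      = (\<Sum>i=1..m. f (abs_torus (x i *\<^sub>R \<omega>))) / x m" for m
    by (simp add: sum.distrib add_divide_distrib)
  ultimately show ?thesis by simp
qed

lemma enum_measurable:
  "(\<lambda>i. abs_torus (x i *\<^sub>R \<omega>)) \<in> uniform_count_measure {1..m} \<rightarrow>\<^sub>M restrict_space borel (zero_set S)"
  using enum_in_zero_set
  by (auto simp: measurable_def space_uniform_count_measure sets_uniform_count_measure space_restrict_space)

lemma empirical_measure_prob:
  assumes "1 \<le> m"
  shows "empirical_measure (zero_set S) (\<lambda>i. abs_torus (x i *\<^sub>R \<omega>)) m \<in> prob_measures_on (zero_set S)"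
proof -
  interpret prob_space "uniform_count_measure {1..m}"
    using assms by (intro prob_space_uniform_count_measure) auto
  show ?thesis
    unfolding prob_measures_on_def empirical_measure_def
    using prob_space_distr[OF enum_measurable] by (simp add: space_restrict_space)
qed

lemma empirical_measures_converge:
  assumes ne: "zero_set S \<noteq> {}"
  shows "weakly_converges_on (zero_set S) (empirical_measure (zero_set S) (\<lambda>i. abs_torus (x i *\<^sub>R \<omega>))) equilibrium"
  unfolding weakly_converges_on_def
proof (intro allI impI, elim conjE)
  fix f :: "'d torus \<Rightarrow> real" assume f: "continuous_on (zero_set S) f" "bounded (f ` zero_set S)"
  obtain B where B: "\<And>\<theta>. \<theta> \<in> zero_set S \<Longrightarrow> \<bar>f \<theta>\<bar> \<le> B" using f(2) by (auto simp: bounded_iff)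
  let ?F = "\<lambda>m. \<Sum>i=1..m. f (abs_torus (x i *\<^sub>R \<omega>))"
  have mean: "(LINT \<theta>|empirical_measure (zero_set S) (\<lambda>i. abs_torus (x i *\<^sub>R \<omega>)) m. f \<theta>) = ?F m / real m" for m
    unfolding empirical_measure_def
    by (subst integral_distr[OF enum_measurable borel_measurable_continuous_on_restrict[OF f(1)]])
      (simp add: integral_uniform_count_measure)
  \<comment> \<open>An average over the index is the quotient of two averages over time; this is the
    denominator, the number of zeros per unit time.\<close>
  have "(\<lambda>m. real m / x m) \<longlonglongrightarrow> density_limit"
    using enum_sum_limit_nonneg[of "\<lambda>_. 1" 1] by (simp add: density_limit_def)
  then have "(\<lambda>m. ?F m / x m / (real m / x m)) \<longlonglongrightarrow> weighted_mean f / density_limit"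
    using density_limit_pos[OF ne] by (intro tendsto_divide enum_sum_limit[OF f(1) B]) auto
  moreover have "\<forall>\<^sub>F m in sequentially. ?F m / x m / (real m / x m) = ?F m / real m"
    using eventually_ge_at_top[of 1]
  proof eventually_elim
    case (elim m)
    then show ?case using enum_pos[of m] by simp
  qed
  ultimately have "(\<lambda>m. ?F m / real m) \<longlonglongrightarrow> weighted_mean f / density_limit"
    by (rule Lim_transform_eventually)
  then show "(\<lambda>m. LINT \<theta>|empirical_measure (zero_set S) (\<lambda>i. abs_torus (x i *\<^sub>R \<omega>)) m. f \<theta>)
      \<longlonglongrightarrow> (LINT \<theta>|equilibrium. f \<theta>)"
    by (simp only: mean integral_equilibrium[OF ne f(1)])
qed

end

end

theorem theorem7p2:
  fixes \<omega> :: "real ^ 'd" and S :: "'d torus \<Rightarrow> real"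
  assumes nonres: "nonresonant \<omega>"
    and smooth: "torus_smooth S"
    and regular: "\<forall>\<theta> \<in> zero_set S. torus_grad S \<theta> \<noteq> 0"
    and fin: "finite (tangency_set \<omega> S)"
    and order: "\<forall>\<theta> \<in> tangency_set \<omega> S. \<exists>r\<ge>2.
        (\<forall>l. 1 \<le> l \<and> l < r \<longrightarrow> (D_op \<omega> ^^ l) S \<theta> = 0) \<and> (D_op \<omega> ^^ r) S \<theta> \<noteq> 0"
  shows "(\<forall>L. finite {x \<in> {0..L}. orbit_fun \<omega> S x = 0}) \<and>
    (\<exists>\<rho>. ((\<lambda>L. real (zero_count \<omega> S L) / L) \<longlongrightarrow> \<rho>) at_top
      \<and> (\<forall>\<phi>. mollifier \<phi> \<longrightarrow>
           ((\<lambda>\<eta>. 1 / (2 * pi) ^ CARD('d) *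
               (LINT \<theta>|torus_lebesgue. 1 / \<eta> * \<phi> (S \<theta> / \<eta>) * \<bar>D_op \<omega> S \<theta>\<bar>)) \<longlongrightarrow> \<rho>) (at_right 0))
      \<and> integrable (surface_measure (zero_set S)) (\<lambda>\<theta>. \<bar>D_op \<omega> S \<theta>\<bar> / norm (torus_grad S \<theta>))
      \<and> \<rho> = 1 / (2 * pi) ^ CARD('d) *
          (LINT \<theta>|surface_measure (zero_set S). \<bar>D_op \<omega> S \<theta>\<bar> / norm (torus_grad S \<theta>))
      \<and> (zero_set S \<noteq> {} \<longrightarrow>
          (let \<mu> = density (surface_measure (zero_set S))
                 (\<lambda>\<theta>. ennreal (1 / ((2 * pi) ^ CARD('d) * \<rho>) *
                    (\<bar>D_op \<omega> S \<theta>\<bar> / norm (torus_grad S \<theta>))))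
           in \<mu> \<in> prob_measures_on (zero_set S)
            \<and> (\<exists>x. enumerates_pos_zeros (orbit_fun \<omega> S) x)
            \<and> (\<forall>x. enumerates_pos_zeros (orbit_fun \<omega> S) x \<longrightarrow>
                (let \<mu>\<^sub>N = empirical_measure (zero_set S) (\<lambda>n. abs_torus (x n *\<^sub>R \<omega>))
                 in (\<forall>N\<ge>1. \<mu>\<^sub>N N \<in> prob_measures_on (zero_set S))
                  \<and> weakly_converges_on (zero_set S) \<mu>\<^sub>N \<mu>)))))"
  proof -
  interpret torus_flow \<omega> S
    using assms by unfold_locales
  obtain h n where hn: "0 < h" "h * norm \<omega> \<le> 1" "0 < n"
    "\<And>x. (\<forall>t\<in>{0..h}. 1 / real n < \<bar>q 0 (x + t *\<^sub>R \<omega>)\<bar>) \<or> (\<exists>j\<in>{1..n}. \<forall>t\<in>{0..h}. q j (x + t *\<^sub>R \<omega>) \<noteq> 0)"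
    using ex_window by blast
  interpret torus_flow_window \<omega> S h n
    using hn by unfold_locales
  show ?thesis
  proof (intro conjI exI[of _ density_limit] allI impI)
    show "finite {x \<in> {0..L}. orbit_fun \<omega> S x = 0}" for L
      unfolding zeros_eq by (rule finite_zeros)
    show "integrable \<sigma> (\<lambda>\<theta>. \<bar>D_op \<omega> S \<theta>\<bar> / norm (torus_grad S \<theta>))"
      using integrable_weight by (simp add: weight_def[abs_def])
    show "density_limit = 1 / (2 * pi) ^ CARD('d) * (LINT \<theta>|\<sigma>. \<bar>D_op \<omega> S \<theta>\<bar> / norm (torus_grad S \<theta>))"
      using density_limit_eq by (simp add: weight_def)
    assume ne: "zero_set S \<noteq> {}"
    show "let \<mu> = density \<sigma> (\<lambda>\<theta>. ennreal (1 / ((2 * pi) ^ CARD('d) * density_limit) *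
                    (\<bar>D_op \<omega> S \<theta>\<bar> / norm (torus_grad S \<theta>))))
           in \<mu> \<in> prob_measures_on (zero_set S)
            \<and> (\<exists>x. enumerates_pos_zeros (orbit_fun \<omega> S) x)
            \<and> (\<forall>x. enumerates_pos_zeros (orbit_fun \<omega> S) x \<longrightarrow>
                (let \<mu>\<^sub>N = empirical_measure (zero_set S) (\<lambda>n. abs_torus (x n *\<^sub>R \<omega>))
                 in (\<forall>N\<ge>1. \<mu>\<^sub>N N \<in> prob_measures_on (zero_set S))
                  \<and> weakly_converges_on (zero_set S) \<mu>\<^sub>N \<mu>))"
      unfolding Let_def weight_def[symmetric] equilibrium_def[symmetric]
      using equilibrium_prob[OF ne] ex_enumeration[OF ne] empirical_measure_prob
        empirical_measures_converge[OF _ ne] by blast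
  qed (fact zero_count_limit mollified_density_limit)+
qed

end
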